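(* Let $(a,b,c,d,t)\in V$. The Askey-Wilson functions $\phi_\gamma$ with $\gamma\in\widetilde S$ are elements of the Hilbert space $\mathcal{H}$. Furthermore, $$\int\phi_\gamma(x)\overline{\phi_{\gamma'}(x)}\,d\nu(x)=0,\qquad \gamma,\gamma'\in\widetilde S,\ \gamma\ne\gamma'.$$
   Context: Fix $0<q<1$. Write $(x;q)_\infty=\prod_{i\ge 0}(1-xq^i)$, $(x;q)_k=(x;q)_\infty/(xq^k;q)_\infty$, $(x_1,\dots,x_r;q)_k=\prod_i(x_i;q)_k$ (also for $k=\infty$), $\theta(x)=(x,q/x;q)_\infty$, and ${}_4\phi_3\left(\begin{smallmatrix}a_1,a_2,a_3,a_4\\ b_1,b_2,b_3\end{smallmatrix};q,z\right)=\sum_{k\ge0}\frac{(a_1,a_2,a_3,a_4;q)_k}{(q,b_1,b_2,b_3;q)_k}z^k$. $\mathbb{T}$ is the counterclockwise oriented unit circle; $\mathbb{Z}_+=\{0,1,2,\dots\}$. Parameters: $V$ is the set of $(a,b,c,d,t)\in\mathbb{R}^5$ with $t<0$, $0<b,c\le a<d/q$, $bd,cd\ge q$, $ab,ac<1$. Dual parameters: $\tilde a=\sqrt{q^{-1}abcd}$ (positive root), $\tilde b=ab/\tilde a$, $\tilde c=ac/\tilde a$, $\tilde d=ad/\tilde a$, $\tilde t=1/(qadt)$. Askey-Wilson function: for $ad\notin q^{\mathbb{Z}}$, $$\phi_\gamma(x)=\frac{1}{(bc,qa/d,q/ad;q)_\infty}{}_4\phi_3\left(\begin{matrix}ax,a/x,\tilde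 a\gamma,\tilde a/\gamma\\ ab,ac,ad\end{matrix};q,q\right)+\frac{(ax,a/x,\tilde a\gamma,\tilde a/\gamma,qb/d,qc/d;q)_\infty}{(qx/d,q/dx,q\gamma/\tilde d,q/\tilde d\gamma,ab,ac,bc,qa/d,ad/q;q)_\infty}{}_4\phi_3\left(\begin{matrix}qx/d,q/dx,q\gamma/\tilde d,q/\tilde d\gamma\\ qb/d,qc/d,q^2/ad\end{matrix};q,q\right),$$ a meromorphic function of $x,\gamma\in\mathbb{C}\setminus\{0\}$, invariant under $x\mapsto x^{-1}$ and $\gamma\mapsto\gamma^{-1}$, with possible poles only at $x^{\pm1}=q^{1+k}/d$, $\gamma^{\pm1}=q^{1+k}/\tilde d$ ($k\in\mathbb{Z}_+$). The apparent singularities at parameters with $ad\in q^{\mathbb{Z}}$ are removable and $\phi_\gamma(x)$ is defined there by continuity; equivalently, for $|q/\tilde d\gamma|<1$ and up to removable singularities, $$\phi_\gamma(x)=\frac{(qax\gamma/\tilde d,qa\gamma/\tilde dx;q)_\infty}{(\tilde a\tilde b\tilde c\gamma,q\gamma/\tilde d,q\tilde a/\tilde d,qx/d,q/dx;q)_\infty}\,{}_8W_7(\tilde a\tilde b\tilde c\gamma/q;ax,a/x,\tilde a\gamma,\tilde b\gamma,\tilde c\gamma;q,q/\tilde d\gamma),$$ where ${}_8W_7(A;B,C,D,E,F;q,z)=\sum_{k\ge0}\frac{1-Aq^{2k}}{1-A}\frac{(A,B,C,D,E,F;q)_kz^k}{(q,qA/B,qA/C,qA/D,qA/E,qA/F;q)_k}$.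 Measure $\nu$: put $$W(x)=\frac{(qx/d,q/dx,x^2,1/x^2;q)_\infty}{(ax,a/x,bx,b/x,cx,c/x;q)_\infty\theta(dtx)\theta(dt/x)},\qquad K=(ab,ac,bc,qa/d,q;q)_\infty\sqrt{\frac{\theta(qt)\theta(adt)\theta(bdt)\theta(cdt)}{qabcdt^2}},$$ $S=S_+\cup S_-$, $S_+=\{aq^k: k\in\mathbb{Z}_+,\ aq^k>1\}$, $S_-=\{dtq^k: k\in\mathbb{Z},\ dtq^k<-1\}$, $S^{-1}=\{x^{-1}:x\in S\}$. Then $\nu$ is the positive measure on $\mathbb{T}\cup S\cup S^{-1}$ given by $$\int f\,d\nu=\frac{K}{4\pi i}\int_{\mathbb{T}}f(x)W(x)\frac{dx}{x}+\sum_{x\in S}\big(f(x)+f(x^{-1})\big)\nu(\{x\}),$$ where $\nu(\{x\})=\nu(\{x^{-1}\})$ equals $\frac K2\operatorname{Res}_{y=x}(W(y)/y)$ when the pole is simple, and in general (by continuous extension in the parameters) $$\nu(\{aq^k\})=\frac{(qa/d,q/ad,1/a^2;q)_\infty}{(q,ab,b/a,ac,c/a;q)_\infty\theta(adt)\theta(dt/a)}\frac{(a^2,ab,ac,ad;q)_k}{(q,qa/b,qa/c,qa/d;q)_k}\frac{1-a^2q^{2k}}{1-a^2}\frac{K}{2\tilde a^{2k}}\quad(aq^k\in S_+),$$ $$\nu(\{dtq^k\})=\frac{(qt,q/d^2t;q)_\infty}{(q,q,a/dt,b/dt,c/dt,adt,bdt,cdt;q)_\infty}\frac{(1/t,a/dt,b/dt,c/dt;q)_{-k}}{(q/adt,q/bdt,q/cdt,q/d^2t;q)_{-k}}\Big(1-\frac1{d^2t^2q^{2k}}\Big)\frac{K\tilde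 a^{2k}}2\quad(dtq^k\in S_-).$$ $\mathcal{H}$ is the Hilbert space of functions $f\in L^2(\nu)$ with $f(x)=f(x^{-1})$ $\nu$-almost everywhere. $\widetilde S$ is the set $S$ for the dual parameters: $\widetilde S=\{\tilde aq^k:k\in\mathbb{Z}_+,\ \tilde aq^k>1\}\cup\{\tilde d\tilde tq^k:k\in\mathbb{Z},\ \tilde d\tilde tq^k<-1\}$. *)

theory Defs
  imports "HOL-Analysis.Analysis"
begin

definition qinf1 :: "'a::{real_normed_field} \<Rightarrow> 'a \<Rightarrow> 'a" where
  "qinf1 q x = (\<Prod>i. 1 - x * q ^ i)"

definition qinf :: "'a::{real_normed_field} \<Rightarrow> 'a list \<Rightarrow> 'a" where
  "qinf q xs = prod_list (map (qinf1 q) xs)"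

text \<open>
  The factorial \<open>(x;q)\<^sub>k = (x;q)\<^sub>\<infinity> / (x q\<^sup>k;q)\<^sub>\<infinity>\<close> for integer \<open>k\<close>.  It is written as a finite
  product, since the quotient is \<open>0/0\<close> for \<open>x = q\<^sup>-\<^sup>n\<close>, \<open>0 \<le> k \<le> n\<close>;
  see \<open>qfac1_eq_quotient\<close> below.
\<close>
definition qfac1 :: "'a::{real_normed_field} \<Rightarrow> int \<Rightarrow> 'a \<Rightarrow> 'a" where
  "qfac1 q k x = (if k \<ge> 0 then \<Prod>i<nat k. 1 - x * q ^ i
                  else inverse (\<Prod>i\<in>{1..nat (-k)}. 1 - x / q ^ i))"

definition qfac :: "'a::{real_normed_field} \<Rightarrow> int \<Rightarrow> 'a list \<Rightarrow> 'a" where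
  "qfac q k xs = prod_list (map (qfac1 q k) xs)"

definition qtheta :: "'a::{real_normed_field} \<Rightarrow> 'a \<Rightarrow> 'a" where
  "qtheta q x = qinf q [x, q / x]"

definition phi43 ::
  "'a \<Rightarrow> 'a \<Rightarrow> 'a \<Rightarrow> 'a \<Rightarrow> 'a \<Rightarrow> 'a \<Rightarrow> 'a \<Rightarrow> 'a \<Rightarrow> 'a::{real_normed_field} \<Rightarrow> 'a" where
  "phi43 a1 a2 a3 a4 b1 b2 b3 q z =
     (\<Sum>k. qfac q (int k) [a1, a2, a3, a4] / qfac q (int k) [q, b1, b2, b3] * z ^ k)"

lemma convergent_prod_qinf1:
  fixes q x :: "'a::{real_normed_field,banach}"
  assumes "norm q < 1"
  shows "convergent_prod (\<lambda>i. 1 - x * q ^ i)"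
proof -
  have "summable (\<lambda>i. norm (x * q ^ i))"
    using assms by (simp add: norm_mult norm_power summable_mult summable_geometric)
  then have "abs_convergent_prod (\<lambda>i. 1 - x * q ^ i)"
    by (subst abs_convergent_prod_conv_summable) simp
  then show ?thesis
    by (rule abs_convergent_prod_imp_convergent_prod)
qed

lemma qinf1_split:
  fixes q x :: "'a::{real_normed_field,banach}"
  assumes "norm q < 1"
  shows "qinf1 q x = (\<Prod>i<n. 1 - x * q ^ i) * qinf1 q (x * q ^ n)"
proof -
  have "(\<lambda>m. \<Prod>i\<le>m. 1 - y * q ^ i) \<longlonglongrightarrow> qinf1 q y" for y
    unfolding qinf1_def by (rule convergent_prod_LIMSEQ[OF convergent_prod_qinf1[OF assms]])
  note L = this
  have "(\<lambda>m. (\<Prod>i<n. 1 - x * q ^ i) * (\<Prod>i\<le>m. 1 - (x * q ^ n) * q ^ i))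
          \<longlonglongrightarrow> (\<Prod>i<n. 1 - x * q ^ i) * qinf1 q (x * q ^ n)"
    by (intro tendsto_intros L)
  moreover have "(\<Prod>i<n. 1 - x * q ^ i) * (\<Prod>i\<le>m. 1 - (x * q ^ n) * q ^ i) =
      (\<Prod>i\<le>m + n. 1 - x * q ^ i)" for m
  proof -
    have "(\<Prod>i\<le>m. 1 - (x * q ^ n) * q ^ i) = (\<Prod>i\<in>{n..m+n}. 1 - x * q ^ i)"
      by (rule prod.reindex_bij_witness[of _ "\<lambda>i. i - n" "\<lambda>i. i + n"])
         (auto simp: power_add mult_ac)
    moreover have "{..m+n} = {..<n} \<union> {n..m+n}" by auto
    ultimately show ?thesis
      by (auto simp: ivl_disj_int intro!: prod.union_disjoint[symmetric])
  qed
  ultimately have "(\<lambda>m. \<Prod>i\<le>m + n. 1 - x * q ^ i)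
          \<longlonglongrightarrow> (\<Prod>i<n. 1 - x * q ^ i) * qinf1 q (x * q ^ n)" by simp
  with LIMSEQ_ignore_initial_segment[OF L[of x], of n] show ?thesis
    using LIMSEQ_unique by blast
qed

lemma qfac1_eq_quotient:
  fixes q x :: "'a::{real_normed_field,banach}"
  assumes "norm q < 1" "q \<noteq> 0" and nz: "qinf1 q (x * q powi k) \<noteq> 0"
  shows "qfac1 q k x = qinf1 q x / qinf1 q (x * q powi k)"
proof (cases "k \<ge> 0")
  case True
  then show ?thesis
    using nz qinf1_split[OF assms(1), of x "nat k"]
    by (simp add: qfac1_def power_int_def)
next
  case False
  define n where "n = nat (-k)"
  have k: "k = - int n" "n > 0" using False by (auto simp: n_def)
  have "qinf1 q (x * q powi k) = (\<Prod>i<n. 1 - (x * q powi k) * q ^ i) * qinf1 q x"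
    using qinf1_split[OF assms(1), of "x * q powi k" n] \<open>q \<noteq> 0\<close> k
    by (simp add: power_int_minus field_simps)
  moreover have "(\<Prod>i<n. 1 - (x * q powi k) * q ^ i) = (\<Prod>i\<in>{1..n}. 1 - x / q ^ i)"
  proof (rule prod.reindex_bij_witness[of _ "\<lambda>i. n - i" "\<lambda>i. n - i"])
    fix i assume "i \<in> {..<n}"
    then have "q ^ n = q ^ (n - i) * q ^ i" by (simp flip: power_add)
    then show "1 - x / q ^ (n - i) = 1 - x * q powi k * q ^ i"
      using \<open>q \<noteq> 0\<close> k by (simp add: power_int_minus field_simps)
  qed auto
  ultimately show ?thesis
    using nz False by (simp add: qfac1_def n_def[symmetric] field_simps)
qed

definition AW_params :: "real \<Rightarrow> (real \<times> real \<times> real \<times> real \<times> real) set" where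
  "AW_params q = {(a, b, c, d, t). t < 0 \<and> 0 < b \<and> b \<le> a \<and> 0 < c \<and> c \<le> a \<and> a < d / q \<and>
                    b * d \<ge> q \<and> c * d \<ge> q \<and> a * b < 1 \<and> a * c < 1}"

definition dual_a :: "real \<Rightarrow> real \<Rightarrow> real \<Rightarrow> real \<Rightarrow> real \<Rightarrow> real" where
  "dual_a q a b c d = sqrt (a * b * c * d / q)"

definition dual_d :: "real \<Rightarrow> real \<Rightarrow> real \<Rightarrow> real \<Rightarrow> real \<Rightarrow> real" where
  "dual_d q a b c d = a * d / dual_a q a b c d"

definition dual_t :: "real \<Rightarrow> real \<Rightarrow> real \<Rightarrow> real \<Rightarrow> real" where
  "dual_t q a d t = 1 / (q * a * d * t)"

text \<open>The defining expression, meaningful for \<open>ad \<notin> q\<^sup>\<int>\<close>.\<close>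
definition AW_phi_generic ::
  "real \<Rightarrow> real \<Rightarrow> real \<Rightarrow> real \<Rightarrow> real \<Rightarrow> complex \<Rightarrow> complex \<Rightarrow> complex" where
  "AW_phi_generic q' a' b' c' d' \<gamma> x =
     (let q = complex_of_real q'; a = complex_of_real a'; b = complex_of_real b';
          c = complex_of_real c'; d = complex_of_real d';
          \<alpha> = complex_of_real (dual_a q' a' b' c' d');
          \<delta> = complex_of_real (dual_d q' a' b' c' d')
      in 1 / qinf q [b * c, q * a / d, q / (a * d)]
           * phi43 (a * x) (a / x) (\<alpha> * \<gamma>) (\<alpha> / \<gamma>) (a * b) (a * c) (a * d) q q
         + qinf q [a * x, a / x, \<alpha> * \<gamma>, \<alpha> / \<gamma>, q * b / d, q * c / d]
           / qinf q [q * x / d, q / (d * x), q * \<gamma> / \<delta>, q / (\<delta> * \<gamma>),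
                     a * b, a * c, b * c, q * a / d, a * d / q]
           * phi43 (q * x / d) (q / (d * x)) (q * \<gamma> / \<delta>) (q / (\<delta> * \<gamma>))
                   (q * b / d) (q * c / d) (q\<^sup>2 / (a * d)) q q)"

definition AW_generic :: "real \<Rightarrow> (real \<times> real \<times> real \<times> real) set" where
  "AW_generic q = {(a, b, c, d). a * d \<notin> range (\<lambda>n::int. q powi n)}"

text \<open>
  At parameters with \<open>ad \<in> q\<^sup>\<int>\<close> the value is the limit along generic parameters, with
  \<open>\<gamma>\<close> and \<open>x\<close> held fixed.
\<close>
definition AW_phi ::
  "real \<Rightarrow> real \<Rightarrow> real \<Rightarrow> real \<Rightarrow> real \<Rightarrow> complex \<Rightarrow> complex \<Rightarrow> complex" where
  "AW_phi q a b c d \<gamma> x =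
     (if (a, b, c, d) \<in> AW_generic q then AW_phi_generic q a b c d \<gamma> x
      else Lim (at (a, b, c, d) within AW_generic q)
             (\<lambda>(a', b', c', d'). AW_phi_generic q a' b' c' d' \<gamma> x))"

definition AW_weight ::
  "real \<Rightarrow> real \<Rightarrow> real \<Rightarrow> real \<Rightarrow> real \<Rightarrow> real \<Rightarrow> complex \<Rightarrow> complex" where
  "AW_weight q' a' b' c' d' t' x =
     (let q = complex_of_real q'; a = complex_of_real a'; b = complex_of_real b';
          c = complex_of_real c'; d = complex_of_real d'; t = complex_of_real t'
      in qinf q [q * x / d, q / (d * x), x\<^sup>2, 1 / x\<^sup>2]
         / (qinf q [a * x, a / x, b * x, b / x, c * x, c / x]
            * qtheta q (d * t * x) * qtheta q (d * t / x)))"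

definition AW_K :: "real \<Rightarrow> real \<Rightarrow> real \<Rightarrow> real \<Rightarrow> real \<Rightarrow> real \<Rightarrow> real" where
  "AW_K q a b c d t =
     qinf q [a * b, a * c, b * c, q * a / d, q]
     * sqrt (qtheta q (q * t) * qtheta q (a * d * t) * qtheta q (b * d * t) * qtheta q (c * d * t)
             / (q * a * b * c * d * t\<^sup>2))"

definition AW_S_plus :: "real \<Rightarrow> real \<Rightarrow> real set" where
  "AW_S_plus q a = {a * q ^ k | k::nat. a * q ^ k > 1}"

definition AW_S_minus :: "real \<Rightarrow> real \<Rightarrow> real \<Rightarrow> real set" where
  "AW_S_minus q d t = {d * t * q powi k | k::int. d * t * q powi k < -1}"

definition AW_S :: "real \<Rightarrow> real \<Rightarrow> real \<Rightarrow> real \<Rightarrow> real set" where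
  "AW_S q a d t = AW_S_plus q a \<union> AW_S_minus q d t"

definition AW_dual_S :: "real \<Rightarrow> real \<Rightarrow> real \<Rightarrow> real \<Rightarrow> real \<Rightarrow> real \<Rightarrow> real set" where
  "AW_dual_S q a b c d t = AW_S q (dual_a q a b c d) (dual_d q a b c d) (dual_t q a d t)"

text \<open>
  The masses at \<open>aq\<^sup>k\<close> and at \<open>dtq\<^sup>k\<close> are indexed by \<open>k\<close>.  For admissible parameters and
  points of \<open>S\<close> no denominator vanishes, so these formulas cover the parameters
  reached by continuity without further case distinctions.
\<close>
definition AW_mass_plus ::
  "real \<Rightarrow> real \<Rightarrow> real \<Rightarrow> real \<Rightarrow> real \<Rightarrow> real \<Rightarrow> nat \<Rightarrow> real" where
  "AW_mass_plus q a b c d t k =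
     qinf q [q * a / d, q / (a * d), 1 / a\<^sup>2]
     / (qinf q [q, a * b, b / a, a * c, c / a] * qtheta q (a * d * t) * qtheta q (d * t / a))
     * (qfac q (int k) [a\<^sup>2, a * b, a * c, a * d]
        / qfac q (int k) [q, q * a / b, q * a / c, q * a / d])
     * ((1 - a\<^sup>2 * q ^ (2 * k)) / (1 - a\<^sup>2))
     * (AW_K q a b c d t / (2 * dual_a q a b c d ^ (2 * k)))"

definition AW_mass_minus ::
  "real \<Rightarrow> real \<Rightarrow> real \<Rightarrow> real \<Rightarrow> real \<Rightarrow> real \<Rightarrow> int \<Rightarrow> real" where
  "AW_mass_minus q a b c d t k =
     qinf q [q * t, q / (d\<^sup>2 * t)]
     / qinf q [q, q, a / (d * t), b / (d * t), c / (d * t), a * d * t, b * d * t, c * d * t]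
     * (qfac q (- k) [1 / t, a / (d * t), b / (d * t), c / (d * t)]
        / qfac q (- k) [q / (a * d * t), q / (b * d * t), q / (c * d * t), q / (d\<^sup>2 * t)])
     * (1 - 1 / (d\<^sup>2 * t\<^sup>2 * q powi (2 * k)))
     * (AW_K q a b c d t * dual_a q a b c d powi (2 * k) / 2)"

definition AW_supp :: "real \<Rightarrow> real \<Rightarrow> real \<Rightarrow> real \<Rightarrow> complex set" where
  "AW_supp q a d t = sphere 0 1 \<union> complex_of_real ` AW_S q a d t
                       \<union> (\<lambda>x. inverse (complex_of_real x)) ` AW_S q a d t"

text \<open>
  The functional \<open>f \<mapsto> \<integral> f d\<nu>\<close> on nonnegative functions.  The unit circle is parametrised by
  \<open>x = e\<^sup>i\<^sup>s\<close>, so that \<open>dx / (4 \<pi> i x) = ds / (4 \<pi>)\<close>; on the circle the weight is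
  real and nonnegative (\<open>AW_weight_circle\<close> below), and the masses are positive, so \<open>ennreal\<close>
  truncates nothing.  See \<open>nn_integral_AW_measure\<close> for the relation to the measure.
\<close>
definition AW_functional ::
  "real \<Rightarrow> real \<Rightarrow> real \<Rightarrow> real \<Rightarrow> real \<Rightarrow> real \<Rightarrow> (complex \<Rightarrow> ennreal) \<Rightarrow> ennreal" where
  "AW_functional q a b c d t f =
     (\<integral>\<^sup>+ s\<in>{0..2 * pi}.
        f (cis s) * ennreal (AW_K q a b c d t / (4 * pi) * Re (AW_weight q a b c d t (cis s)))
      \<partial>lborel)
     + (\<integral>\<^sup>+ k. (f (complex_of_real (a * q ^ k)) + f (inverse (complex_of_real (a * q ^ k))))
               * ennreal (AW_mass_plus q a b c d t k)
        \<partial>count_space {k::nat. a * q ^ k > 1})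
     + (\<integral>\<^sup>+ k. (f (complex_of_real (d * t * q powi k)) + f (inverse (complex_of_real (d * t * q powi k))))
               * ennreal (AW_mass_minus q a b c d t k)
        \<partial>count_space {k::int. d * t * q powi k < -1})"

definition AW_measure ::
  "real \<Rightarrow> real \<Rightarrow> real \<Rightarrow> real \<Rightarrow> real \<Rightarrow> real \<Rightarrow> complex measure" where
  "AW_measure q a b c d t =
     measure_of (AW_supp q a d t) (sets (restrict_space borel (AW_supp q a d t)))
       (\<lambda>A. AW_functional q a b c d t (indicator A))"

lemma qinf1_measurable [measurable]:
  fixes q :: complex
  assumes "norm q < 1"
  shows "qinf1 q \<in> borel_measurable borel"
proof (rule borel_measurable_LIMSEQ_metric)
  show "(\<lambda>x. \<Prod>i\<le>n. 1 - x * q ^ i) \<in> borel_measurable borel" for n :: nat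
    by measurable
  show "(\<lambda>n. \<Prod>i\<le>n. 1 - x * q ^ i) \<longlonglongrightarrow> qinf1 q x" for x
    unfolding qinf1_def by (rule convergent_prod_LIMSEQ[OF convergent_prod_qinf1[OF assms]])
qed

lemma AW_weight_measurable:
  assumes "0 < q" "q < 1"
  shows "AW_weight q a b c d t \<in> borel_measurable borel"
proof -
  have [measurable]: "qinf1 (complex_of_real q) \<in> borel_measurable borel"
    by (rule qinf1_measurable) (use assms in auto)
  show ?thesis
    unfolding AW_weight_def Let_def qinf_def qtheta_def by simp
qed

lemma cnj_qinf1:
  assumes "0 < q" "q < 1"
  shows "cnj (qinf1 (complex_of_real q) x) = qinf1 (complex_of_real q) (cnj x)"
proof -
  have L: "(\<lambda>m. \<Prod>i\<le>m. 1 - y * complex_of_real q ^ i) \<longlonglongrightarrow> qinf1 (complex_of_real q) y" for y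
    unfolding qinf1_def
    by (rule convergent_prod_LIMSEQ[OF convergent_prod_qinf1]) (use assms in auto)
  show ?thesis
    using tendsto_cnj[OF L[of x]] L[of "cnj x"] by (simp add: LIMSEQ_unique)
qed

lemma AW_weight_circle:
  assumes "0 < q" "q < 1" "cmod x = 1"
  shows "\<exists>r\<ge>0. AW_weight q a b c d t x = complex_of_real r"
proof -
  have x: "inverse x = cnj x"
    using assms(3) by (simp add: inverse_complex_def complex_eq_iff cmod_def)
  let ?Q = "qinf1 (complex_of_real q)"
  define N where "N = ?Q (q * x / d) * ?Q (x\<^sup>2)"
  define D where "D = ?Q (a * x) * ?Q (b * x) * ?Q (c * x) * ?Q (d * t * x) * ?Q (q / (d * t * x))"
  have "AW_weight q a b c d t x = (N * cnj N) / (D * cnj D)"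
    unfolding AW_weight_def Let_def qinf_def qtheta_def N_def D_def
    by (simp add: cnj_qinf1[OF assms(1,2)] divide_inverse x mult_ac flip: x power_inverse)
  also have "\<dots> = complex_of_real ((cmod N)\<^sup>2 / (cmod D)\<^sup>2)"
    by (simp add: complex_norm_square del: of_real_power)
  finally show ?thesis by (intro exI[of _ "(cmod N)\<^sup>2 / (cmod D)\<^sup>2"]) auto
qed

lemma space_AW_measure [simp]: "space (AW_measure q a b c d t) = AW_supp q a d t"
  unfolding AW_measure_def
  using sets.space_closed[of "restrict_space borel (AW_supp q a d t)"]
  by (intro space_measure_of) (simp add: space_restrict_space)

lemma sets_AW_measure [measurable_cong]:
  "sets (AW_measure q a b c d t) = sets (restrict_space borel (AW_supp q a d t))"
  unfolding AW_measure_def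
  using sets.sets_measure_of_eq[of "restrict_space borel (AW_supp q a d t)"]
  by (simp add: space_restrict_space)

lemma AW_points_in_supp:
  "cis s \<in> AW_supp q a d t"
  "a * q ^ k > 1 \<Longrightarrow> complex_of_real (a * q ^ k) \<in> AW_supp q a d t"
  "a * q ^ k > 1 \<Longrightarrow> inverse (complex_of_real (a * q ^ k)) \<in> AW_supp q a d t"
  "d * t * q powi l < -1 \<Longrightarrow> complex_of_real (d * t * q powi l) \<in> AW_supp q a d t"
  "d * t * q powi l < -1 \<Longrightarrow> inverse (complex_of_real (d * t * q powi l)) \<in> AW_supp q a d t"
  unfolding AW_supp_def AW_S_def AW_S_plus_def AW_S_minus_def by (auto simp del: of_real_mult)

context
  fixes q a b c d t :: real
  assumes q: "0 < q" "q < 1"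
begin

lemma cis_measurable_supp:
  "cis \<in> measurable lborel (restrict_space borel (AW_supp q a d t))"
  by (rule measurable_restrict_space2) (auto simp: AW_points_in_supp intro!: borel_measurable_continuous_onI continuous_intros)

lemma AW_circle_measurable:
  fixes f :: "complex \<Rightarrow> ennreal"
  assumes "f \<in> borel_measurable (restrict_space borel (AW_supp q a d t))"
  shows "(\<lambda>s. f (cis s) * ennreal (AW_K q a b c d t / (4 * pi) * Re (AW_weight q a b c d t (cis s)))
             * indicator {0..2 * pi} s) \<in> borel_measurable lborel"
proof -
  have [measurable]: "cis \<in> borel_measurable borel"
    by (intro borel_measurable_continuous_onI continuous_intros)
  note [measurable] = AW_weight_measurable[OF q, of a b c d t]
    measurable_compose[OF cis_measurable_supp assms]
  show ?thesis by measurable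
qed

lemma AW_functional_suminf:
  fixes f :: "nat \<Rightarrow> complex \<Rightarrow> ennreal"
  assumes "\<And>i. f i \<in> borel_measurable (restrict_space borel (AW_supp q a d t))"
  shows "AW_functional q a b c d t (\<lambda>x. \<Sum>i. f i x) = (\<Sum>i. AW_functional q a b c d t (f i))"
proof -
  have c: "(\<Sum>i. g i) * w * v = (\<Sum>i. g i * w * v)" for g :: "nat \<Rightarrow> ennreal" and w v
    by (simp add: ennreal_suminf_multc mult.assoc)
  have p: "((\<Sum>i. g i) + (\<Sum>i. h i)) * w = (\<Sum>i. (g i + h i) * w)" for g h :: "nat \<Rightarrow> ennreal" and w
    by (simp add: ennreal_suminf_multc suminf_add)
  have s: "(\<Sum>i. g i) + (\<Sum>i. h i) + (\<Sum>i. k i) = (\<Sum>i. g i + h i + k i)"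
    for g h k :: "nat \<Rightarrow> ennreal"
    by (simp add: suminf_add)
  show ?thesis
    unfolding AW_functional_def c p
    by (subst (1 2 3) nn_integral_suminf) (simp_all only: s AW_circle_measurable[OF assms] borel_measurable_count_space)
qed

lemma AW_functional_add:
  fixes f g :: "complex \<Rightarrow> ennreal"
  assumes [measurable]: "f \<in> borel_measurable (restrict_space borel (AW_supp q a d t))"
    "g \<in> borel_measurable (restrict_space borel (AW_supp q a d t))"
  shows "AW_functional q a b c d t (\<lambda>x. f x + g x) = AW_functional q a b c d t f + AW_functional q a b c d t g"
proof -
  have c: "(x + y) * w * v = x * w * v + y * w * v" for x y w v :: ennreal
    by (simp add: distrib_right)
  have p: "(x + y + (x' + y')) * w = (x + x') * w + (y + y') * w" for x y x' y' w :: ennreal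
    by (simp add: algebra_simps)
  have s: "x1 + x2 + (y1 + y2) + (z1 + z2) = x1 + y1 + z1 + (x2 + y2 + z2)"
    for x1 x2 y1 y2 z1 z2 :: ennreal
    by (simp add: algebra_simps)
  show ?thesis
    unfolding AW_functional_def c p
    by (subst (1 2 3) nn_integral_add)
       (simp_all only: s AW_circle_measurable[OF assms(1)] AW_circle_measurable[OF assms(2)]
         borel_measurable_count_space)
qed

lemma AW_functional_cmult:
  fixes f :: "complex \<Rightarrow> ennreal"
  assumes "f \<in> borel_measurable (restrict_space borel (AW_supp q a d t))"
  shows "AW_functional q a b c d t (\<lambda>x. r * f x) = r * AW_functional q a b c d t f"
proof -
  have p: "(r * x + r * y) * w = r * ((x + y) * w)" for x y w :: ennreal
    by (simp add: algebra_simps)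
  have c: "r * x * w * v = r * (x * w * v)" for x w v :: ennreal
    by (simp add: mult_ac)
  show ?thesis
    unfolding AW_functional_def c p
    by (subst (1 2 3) nn_integral_cmult)
       (simp_all only: distrib_left AW_circle_measurable[OF assms] borel_measurable_count_space)
qed

lemma AW_functional_SUP:
  fixes f :: "nat \<Rightarrow> complex \<Rightarrow> ennreal"
  assumes "\<And>i. f i \<in> borel_measurable (restrict_space borel (AW_supp q a d t))" and inc: "incseq f"
  shows "AW_functional q a b c d t (\<lambda>x. SUP i. f i x) = (SUP i. AW_functional q a b c d t (f i))"
proof -
  have i: "incseq (\<lambda>i. f i x)" for x
    using inc by (auto simp: incseq_def le_fun_def)
  have c: "(SUP i. f i x) * w * v = (SUP i. f i x * w * v)" for x w v
    by (simp add: SUP_mult_right_ennreal)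
  have p: "((SUP i. f i x) + (SUP i. f i y)) * w = (SUP i. (f i x + f i y) * w)" for x y w
    by (simp only: ennreal_SUP_add[OF i i, symmetric] SUP_mult_right_ennreal)
  have m1: "incseq (\<lambda>i x. f i (g x) * w x * v x)"
    "incseq (\<lambda>i. \<integral>\<^sup>+ x. f i (g x) * w x * v x \<partial>M)"
    for g w v and M :: "real measure"
    using i by (auto simp: incseq_def le_fun_def intro!: nn_integral_mono mult_right_mono)
  have m2: "incseq (\<lambda>i x. (f i (h x) + f i (k x)) * u x)"
    "incseq (\<lambda>i. \<integral>\<^sup>+ x. (f i (h x) + f i (k x)) * u x \<partial>M)"
    for h k u and M :: "nat measure"
    using i by (auto simp: incseq_def le_fun_def intro!: nn_integral_mono mult_right_mono add_mono)
  have m3: "incseq (\<lambda>i x. (f i (h x) + f i (k x)) * u x)"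
    "incseq (\<lambda>i. \<integral>\<^sup>+ x. (f i (h x) + f i (k x)) * u x \<partial>M)"
    for h k u and M :: "int measure"
    using i by (auto simp: incseq_def le_fun_def intro!: nn_integral_mono mult_right_mono add_mono)
  have s: "(SUP i. F i) + (SUP i. G i) + (SUP i. H i) = (SUP i. F i + G i + H i)"
    if F: "incseq F" and G: "incseq G" and H: "incseq H" for F G H :: "nat \<Rightarrow> ennreal"
  proof -
    have "incseq (\<lambda>i. F i + G i)"
      using F G by (auto simp: incseq_def intro!: add_mono)
    then show ?thesis
      by (simp only: ennreal_SUP_add[OF F G, symmetric] ennreal_SUP_add[OF _ H, symmetric])
  qed
  show ?thesis
    unfolding AW_functional_def c p
      nn_integral_monotone_convergence_SUP[OF m1(1) AW_circle_measurable[OF assms(1)]]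
      nn_integral_monotone_convergence_SUP[OF m2(1) borel_measurable_count_space]
      nn_integral_monotone_convergence_SUP[OF m3(1) borel_measurable_count_space]
    by (intro s m1 m2 m3)
qed

lemma emeasure_AW_measure:
  assumes A: "A \<in> sets (AW_measure q a b c d t)"
  shows "emeasure (AW_measure q a b c d t) A = AW_functional q a b c d t (indicator A)"
proof (rule emeasure_measure_of[OF AW_measure_def])
  let ?M = "AW_measure q a b c d t"
  show "sets (restrict_space borel (AW_supp q a d t)) \<subseteq> Pow (AW_supp q a d t)"
    using sets.space_closed[of ?M] by (simp add: sets_AW_measure)
  show "A \<in> sets ?M" by fact
  show "positive (sets ?M) (\<lambda>A. AW_functional q a b c d t (indicator A))"
    by (simp add: positive_def AW_functional_def)
  show "countably_additive (sets ?M) (\<lambda>A. AW_functional q a b c d t (indicator A))"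
  proof (rule countably_additiveI)
    fix B :: "nat \<Rightarrow> complex set"
    assume B: "range B \<subseteq> sets ?M" "disjoint_family B"
    have "indicator (B i) \<in> borel_measurable (restrict_space borel (AW_supp q a d t))" for i
      using B(1) by (intro borel_measurable_indicator) (use sets_AW_measure[of q a b c d t] in blast)
    from AW_functional_suminf[of "\<lambda>i. indicator (B i)", OF this]
    show "(\<Sum>i. AW_functional q a b c d t (indicator (B i))) =
            AW_functional q a b c d t (indicator (\<Union> (range B)))"
      by (simp add: suminf_indicator[OF B(2)])
  qed
qed

lemma nn_integral_AW_measure:
  assumes "f \<in> borel_measurable (AW_measure q a b c d t)"
  shows "(\<integral>\<^sup>+ x. f x \<partial>AW_measure q a b c d t) = AW_functional q a b c d t f"
  using assms
proof (induction rule: borel_measurable_induct)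
  case (cong f g)
  have "AW_functional q a b c d t f = AW_functional q a b c d t g"
    using cong(3) unfolding AW_functional_def
    by (intro arg_cong2[of _ _ _ _ "(+)"] nn_integral_cong) (simp_all add: AW_points_in_supp del: of_real_mult)
  with cong show ?case
    by (metis nn_integral_cong)
next
  case (set A)
  then show ?case by (simp add: emeasure_AW_measure)
next
  case (mult u r)
  then show ?case
    by (simp add: nn_integral_cmult AW_functional_cmult
        measurable_cong_sets[OF sets_AW_measure refl])
next
  case (add u v)
  then show ?case
    by (simp add: nn_integral_add AW_functional_add measurable_cong_sets[OF sets_AW_measure refl])
next
  case (seq U)
  have S: "Sup (range U) = (\<lambda>x. SUP i. U i x)"
    by (auto simp: image_comp)
  from seq have "AW_functional q a b c d t (Sup (range U)) = (SUP i. AW_functional q a b c d t (U i))"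
    unfolding S by (intro AW_functional_SUP) (simp_all add: measurable_cong_sets[OF sets_AW_measure refl])
  with seq show ?case
    unfolding S by (simp only: nn_integral_monotone_convergence_SUP)
qed

end

definition AW_Hilbert ::
  "real \<Rightarrow> real \<Rightarrow> real \<Rightarrow> real \<Rightarrow> real \<Rightarrow> real \<Rightarrow> (complex \<Rightarrow> complex) set" where
  "AW_Hilbert q a b c d t =
     {f \<in> borel_measurable (AW_measure q a b c d t).
        integrable (AW_measure q a b c d t) (\<lambda>x. (cmod (f x))\<^sup>2) \<and>
        (AE x in AW_measure q a b c d t. f x = f (inverse x))}"

end

theory Submission
  imports Defs "HOL-Complex_Analysis.Complex_Analysis"
begin

text \<open>
  Write \<open>\<phi>\<^sub>\<gamma>(x) = const \<cdot> F\<^sub>\<gamma>(x) / (qx/d, q/dx; q)\<^sub>\<infinity>\<close> with the very-well-poised series \<open>F\<^sub>\<gamma>\<close>, which is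
  holomorphic on the punctured plane and invariant under inversion; that the two-term expression in balanced series
  has this form is Bailey's three-term relation, and it makes the continuation to \<open>ad \<in> q\<^sup>\<int>\<close> evident.
  The functions \<open>\<phi>\<^sub>\<gamma>\<close> are eigenfunctions of the Askey-Wilson second-order \<open>q\<close>-difference operator, with
  different eigenvalues for different \<open>\<gamma>\<close> in the dual set. Hence the product of two of them with the weight is, up to the
  nonzero difference of eigenvalues, of the form \<open>H(x) - H(x/q)\<close> with \<open>H(1/qx) = - H(x)\<close>. The circle integral therefore
  equals minus the sum of the residues of \<open>H\<close> in the annulus \<open>1 < |x| \<le> 1/q\<close>. Along the lattices \<open>aq\<^sup>k\<close> and
  \<open>dtq\<^sup>k\<close> the same relation telescopes and turns the sums over the point masses into the same
  residues; the boundary term at infinity vanishes since \<open>\<phi>\<^sub>\<gamma>(dtq\<^sup>k)\<close> decays like \<open>(|\<gamma>|/s)\<^sup>k\<close>, where \<open>s\<close> is the dual parameter of \<open>a\<close>.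
\<close>



text \<open>Denominators are the recurring obstacle. A factor 1/(x;q)_k is therefore replaced
  throughout by the infinite product \<open>Q (x * q ^ k)\<close>: the terms then depend
  holomorphically on all parameters, admit one geometric majorant and keep a meaning where the
  classical formula reads 0/0. The two forms of the eigenfunction share the work. The difference
  operator acts well only on the bases of the two balanced series, while holomorphy in x and
  continuity in the parameters are visible only on the very-well-poised series. The second obstacle
  is coincidence of poles. If y^2 lies in q^Z, the lattice y q^Z is mapped to itself by inversion;
  two poles of the weight merge, the residue is twice the mass, and correspondingly only half as
  many poles lie in the annulus. The factor \<open>eps\<close> keeps this account. Moreover poles
  may fall on the unit circle itself (a = 1, or d t q^k = -1), so the contour is first pushed to a
  radius \<open>r0\<close> slightly larger than 1.\<close>

definition qpoch :: "'a::real_normed_field \<Rightarrow> nat \<Rightarrow> 'a \<Rightarrow> 'a" where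
  "qpoch q n x = (\<Prod>i<n. 1 - x * q ^ i)"

lemma qpoch_0 [simp]: "qpoch q 0 x = 1"
  by (simp add: qpoch_def)

lemma qpoch_Suc: "qpoch q (Suc n) x = qpoch q n x * (1 - x * q ^ n)"
  by (simp add: qpoch_def)

lemma qpoch_add: "qpoch q (m + n) x = qpoch q m x * qpoch q n (x * q ^ m)"
  by (induction n) (simp_all add: qpoch_Suc power_add mult_ac)

lemma qpoch_Suc_left: "qpoch q (Suc n) x = (1 - x) * qpoch q n (x * q)"
  using qpoch_add[of q 1 n x] by (simp add: qpoch_Suc)

section \<open>Limits and interchange of series with a geometric majorant\<close>

lemma summable_geo_bound:
  fixes f :: "nat \<Rightarrow> 'a::banach"
  assumes "\<And>n. norm (f n) \<le> C * r ^ n" "0 \<le> r" "r < 1"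
  shows "summable f"
  by (rule summable_comparison_test'[of "\<lambda>n. C * r ^ n" 0])
     (use assms in \<open>auto intro!: summable_mult summable_geometric\<close>)

text \<open>Tannery's theorem. The filter is arbitrary because limits are taken along the integers,
  at points of the plane and through generic parameters; the majorant has to hold only
  eventually.\<close>

lemma tendsto_suminf_geo:
  fixes f :: "nat \<Rightarrow> 'b \<Rightarrow> 'a::{real_normed_algebra,banach}"
  assumes lim: "\<And>k. (f k \<longlongrightarrow> g k) F"
    and bound: "eventually (\<lambda>n. \<forall>k. norm (f k n) \<le> C * r ^ k) F" and r: "0 \<le> r" "r < 1"
  shows "((\<lambda>n. \<Sum>k. f k n) \<longlongrightarrow> (\<Sum>k. g k)) F"
proof (cases "F = bot")
  case False
  have "eventually (\<lambda>(k, n). norm (f k n) \<le> C * r ^ k) (at_top \<times>\<^sub>F F)"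
    unfolding eventually_prod_filter
    by (rule exI[of _ "\<lambda>_. True"], rule exI[of _ "\<lambda>n. \<forall>k. norm (f k n) \<le> C * r ^ k"])
       (use bound in auto)
  then show ?thesis
    using tannerys_theorem[of f g F "\<lambda>k. C * r ^ k"] lim r False
    by (simp add: summable_mult summable_geometric)
qed auto

text \<open>Tannery's theorem applied to the partial sums over k: finite sums commute with the outer
  series, and they are bounded by C/(1 - r) s^n uniformly in the cut-off.\<close>

lemma suminf_swap_geo:
  fixes a :: "nat \<Rightarrow> nat \<Rightarrow> 'a::{real_normed_algebra,banach}"
  assumes b: "\<And>k n. norm (a k n) \<le> C * r ^ k * s ^ n" and r: "0 \<le> r" "r < 1" "0 \<le> s" "s < 1"
  shows "(\<Sum>n. \<Sum>k. a k n) = (\<Sum>k. \<Sum>n. a k n)"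
proof -
  have C: "C \<ge> 0"
    using order_trans[OF norm_ge_zero b[of 0 0]] by simp
  have sn: "summable (\<lambda>n. a k n)" for k
    by (rule summable_geo_bound[OF b]) (use r in auto)
  have sk: "summable (\<lambda>k. a k n)" for n
    by (rule summable_geo_bound[of _ "C * s ^ n" r]) (use r b in \<open>auto simp: mult_ac\<close>)
  have "(\<lambda>K. \<Sum>n. \<Sum>k<K. a k n) \<longlonglongrightarrow> (\<Sum>n. \<Sum>k. a k n)"
  proof (rule tendsto_suminf_geo[where C = "C / (1 - r)" and r = s])
    show "(\<lambda>K. \<Sum>k<K. a k n) \<longlonglongrightarrow> (\<Sum>k. a k n)" for n
      using sk[of n] by (rule summable_LIMSEQ)
    have "norm (\<Sum>k<K. a k n) \<le> C / (1 - r) * s ^ n" for K n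
    proof -
      have "norm (\<Sum>k<K. a k n) \<le> (\<Sum>k<K. C * s ^ n * r ^ k)"
        by (rule sum_norm_le) (use b[of _ n] in \<open>simp add: mult_ac\<close>)
      also have "\<dots> = C * s ^ n * (\<Sum>k<K. r ^ k)"
        by (simp add: sum_distrib_left)
      also have "\<dots> \<le> C * s ^ n * (\<Sum>k. r ^ k)"
        by (intro mult_left_mono sum_le_suminf) (use r C in \<open>auto intro: summable_geometric\<close>)
      also have "(\<Sum>k. r ^ k) = 1 / (1 - r)"
        using suminf_geometric[of r] r by simp
      finally show ?thesis by (simp add: mult_ac)
    qed
    then show "\<forall>\<^sub>F K in sequentially. \<forall>n. norm (\<Sum>k<K. a k n) \<le> C / (1 - r) * s ^ n"
      by simp
  qed (use r in auto)
  moreover have "(\<Sum>n. \<Sum>k<K. a k n) = (\<Sum>k<K. \<Sum>n. a k n)" for K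
    by (rule suminf_sum) (rule sn)
  ultimately have "(\<lambda>k. \<Sum>n. a k n) sums (\<Sum>n. \<Sum>k. a k n)"
    by (simp add: sums_def)
  then show ?thesis by (rule sums_unique)
qed

section \<open>Finite and infinite q-shifted factorials\<close>

locale qbase =
  fixes q :: complex
  assumes q0: "q \<noteq> 0" and q1: "norm q < 1"
begin

abbreviation Q where "Q \<equiv> qinf1 q"
abbreviation P where "P \<equiv> qpoch q"

lemma Q_shift: "Q x = P n x * Q (x * q ^ n)"
  using qinf1_split[OF q1, of x n] by (simp add: qpoch_def)

lemma Q_rec: "Q x = (1 - x) * Q (x * q)"
  using Q_shift[of x 1] by (simp add: qpoch_def)

lemma P_LIMSEQ: "(\<lambda>n. P n x) \<longlonglongrightarrow> Q x"
proof -
  have "(\<lambda>m. \<Prod>i\<le>m. 1 - x * q ^ i) \<longlonglongrightarrow> Q x"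
    unfolding qinf1_def by (rule convergent_prod_LIMSEQ[OF convergent_prod_qinf1[OF q1]])
  then have "(\<lambda>m. P (Suc m) x) \<longlonglongrightarrow> Q x"
    by (simp add: qpoch_def lessThan_Suc_atMost)
  then show ?thesis by (rule LIMSEQ_imp_Suc)
qed

lemma Q_0 [simp]: "Q 0 = 1"
  by (simp add: qinf1_def)

lemma Q_1 [simp]: "Q 1 = 0"
  using Q_rec[of 1] by simp

text \<open>Each factor satisfies 1 + u \<le> exp u. The bound does not depend on n, so it serves
  inside majorants and passes to the infinite product.\<close>

lemma P_bound: "norm (P n x) \<le> exp (norm x / (1 - norm q))"
proof -
  have "norm (P n x) \<le> (\<Prod>i<n. exp (norm x * norm q ^ i))"
    unfolding qpoch_def prod_norm[symmetric]
  proof (rule prod_mono, safe)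
    fix i
    have "norm (1 - x * q ^ i) \<le> 1 + norm x * norm q ^ i"
      using norm_triangle_ineq4[of 1 "x * q ^ i"] by (simp add: norm_mult norm_power)
    also have "\<dots> \<le> exp (norm x * norm q ^ i)" by (rule exp_ge_add_one_self)
    finally show "norm (1 - x * q ^ i) \<le> exp (norm x * norm q ^ i)" .
  qed auto
  also have "\<dots> = exp (norm x * (\<Sum>i<n. norm q ^ i))"
    by (simp add: exp_sum sum_distrib_left)
  also have "(\<Sum>i<n. norm q ^ i) \<le> (\<Sum>i. norm q ^ i)"
    by (rule sum_le_suminf) (use q1 in \<open>auto intro: summable_geometric\<close>)
  also have "(\<Sum>i. norm q ^ i) = 1 / (1 - norm q)"
    using suminf_geometric[of "norm q"] q1 by simp
  finally show ?thesis by (simp add: mult_left_mono)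
qed

lemma Q_bound: "norm (Q x) \<le> exp (norm x / (1 - norm q))"
  by (rule LIMSEQ_le_const2[OF tendsto_norm[OF P_LIMSEQ]]) (use P_bound in auto)

lemma P_bound': "norm x \<le> r \<Longrightarrow> norm (P n x) \<le> exp (r / (1 - norm q))"
  by (rule order_trans[OF P_bound]) (use q1 in \<open>simp add: divide_right_mono\<close>)

lemma Q_bound': "norm x \<le> r \<Longrightarrow> norm (Q x) \<le> exp (r / (1 - norm q))"
  by (rule order_trans[OF Q_bound]) (use q1 in \<open>simp add: divide_right_mono\<close>)

lemma norm_q_pow: "norm (q ^ k) \<le> 1"
  using q1 by (simp add: norm_power power_le_one)

lemma norm_mult_q_pow: "norm (x * q ^ k) \<le> norm x"
  using mult_left_mono[OF norm_q_pow[of k], of "norm x"] by (simp add: norm_mult)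

lemma Q_bound_pow: "norm (Q (x * q ^ k)) \<le> exp (norm x / (1 - norm q))"
  by (rule Q_bound') (rule norm_mult_q_pow)

lemma P_holomorphic: "P n holomorphic_on A"
  unfolding qpoch_def by (intro holomorphic_intros)

lemma Q_holomorphic: "Q holomorphic_on A"
proof -
  have "Q holomorphic_on UNIV"
  proof (rule holomorphic_uniform_sequence[where f = "\<lambda>n x. P n x"])
    fix x :: complex
    define R where "R = norm x + 1"
    have uc: "uniformly_convergent_on (cball x 1) (\<lambda>N x. \<Prod>n<N. 1 + (- (x * q ^ n)))"
    proof (rule uniformly_convergent_on_prod)
      show "uniformly_convergent_on (cball x 1) (\<lambda>N x. \<Sum>n<N. norm (- (x * q ^ n)))"
      proof (rule Weierstrass_m_test'[where M = "\<lambda>n. R * norm q ^ n"])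
        show "norm (norm (- (y * q ^ n))) \<le> R * norm q ^ n" if "y \<in> cball x 1" for n y
        proof -
          have "norm y \<le> R"
            using that norm_triangle_ineq4[of x "x - y"] by (simp add: R_def dist_norm)
          then show ?thesis by (simp add: norm_mult norm_power mult_right_mono)
        qed
        show "summable (\<lambda>n. R * norm q ^ n)"
          using q1 by (intro summable_mult summable_geometric) auto
      qed
    qed (auto intro!: continuous_intros)
    then obtain l where l: "uniform_limit (cball x 1) (\<lambda>N x. P N x) l sequentially"
      unfolding uniformly_convergent_on_def qpoch_def by auto
    have "l y = Q y" if "y \<in> cball x 1" for y
      using tendsto_uniform_limitI[OF l that] P_LIMSEQ[of y] by (rule LIMSEQ_unique)
    then have "uniform_limit (cball x 1) (\<lambda>N x. P N x) Q sequentially"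
      using uniform_limit_cong'[THEN iffD1, OF _ _ l] by blast
    then show "\<exists>d>0. cball x d \<subseteq> UNIV \<and> uniform_limit (cball x d) (\<lambda>N x. P N x) Q sequentially"
      by (intro exI[of _ 1]) auto
  qed (auto intro: P_holomorphic)
  then show ?thesis by (rule holomorphic_on_subset) auto
qed

lemma Q_holomorphic' [holomorphic_intros]:
  "f holomorphic_on A \<Longrightarrow> (\<lambda>x. Q (f x)) holomorphic_on A"
  using holomorphic_on_compose[OF _ Q_holomorphic, of f A] by (simp add: o_def)

lemma P_holomorphic' [holomorphic_intros]:
  "f holomorphic_on A \<Longrightarrow> (\<lambda>x. P n (f x)) holomorphic_on A"
  using holomorphic_on_compose[OF _ P_holomorphic, of f A] by (simp add: o_def)

lemma Q_isCont: "isCont Q x"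
  using holomorphic_on_imp_continuous_on[OF Q_holomorphic[of UNIV]]
  by (simp add: continuous_on_eq_continuous_at)

lemma tendsto_Q [tendsto_intros]: "(f \<longlongrightarrow> l) F \<Longrightarrow> ((\<lambda>x. Q (f x)) \<longlongrightarrow> Q l) F"
  by (rule isCont_tendsto_compose[OF Q_isCont])

lemma tendsto_P [tendsto_intros]: "(f \<longlongrightarrow> l) F \<Longrightarrow> ((\<lambda>x. P n (f x)) \<longlongrightarrow> P n l) F"
  unfolding qpoch_def by (intro tendsto_intros)

lemma continuous_on_Q [continuous_intros]:
  "continuous_on A f \<Longrightarrow> continuous_on A (\<lambda>x. Q (f x))"
  unfolding continuous_on_def by (auto intro: tendsto_intros)

lemma q_pow_tendsto_0: "(\<lambda>n. x * q ^ n) \<longlonglongrightarrow> 0"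
  using tendsto_mult_left[OF LIMSEQ_power_zero[OF q1], of x] by simp

lemma Q_pow_tendsto_1: "(\<lambda>n. Q (x * q ^ n)) \<longlonglongrightarrow> 1"
  using tendsto_Q[OF q_pow_tendsto_0] by simp

lemma Q_eq_0_iff: "Q x = 0 \<longleftrightarrow> (\<exists>n. x * q ^ n = 1)"
proof
  assume "Q x = 0"
  show "\<exists>n. x * q ^ n = 1"
  proof (rule ccontr)
    assume "\<nexists>n. x * q ^ n = 1"
    then have "Q x \<noteq> 0" unfolding qinf1_def
      by (intro prodinf_nonzero convergent_prod_qinf1 q1) auto
    then show False using \<open>Q x = 0\<close> by simp
  qed
next
  assume "\<exists>n. x * q ^ n = 1"
  then obtain n where "x * q ^ n = 1" ..
  then show "Q x = 0" using Q_shift[of x n] by simp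
qed

lemma Q_nz: "norm x < 1 \<Longrightarrow> Q x \<noteq> 0"
proof
  assume "norm x < 1" "Q x = 0"
  then obtain n where "x * q ^ n = 1" by (auto simp: Q_eq_0_iff)
  then show False
    using norm_mult_q_pow[of x n] \<open>norm x < 1\<close> by simp
qed

lemma Q_nz_pow: "Q x \<noteq> 0 \<Longrightarrow> Q (x * q ^ n) \<noteq> 0"
  using Q_shift[of x n] by auto

lemma P_eq: "Q x \<noteq> 0 \<Longrightarrow> P n x = Q x / Q (x * q ^ n)"
  using Q_shift[of x n] by (auto simp: field_simps)

end



section \<open>The nonterminating very-well-poised 6phi5 sum\<close>

context qbase
begin

text \<open>With A = B/q this is the very-well-poised factor (1 - A q^(2k))/(1 - A) times (A;q)_k.
  The cancelled form is a polynomial in B and keeps its meaning at A = 1.\<close>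

definition vwp :: "complex \<Rightarrow> nat \<Rightarrow> complex" where
  "vwp B k = (case k of 0 \<Rightarrow> 1 | Suc j \<Rightarrow> (1 - B * q ^ (2 * j + 1)) * P j B)"

lemma vwp_0 [simp]: "vwp B 0 = 1" and vwp_Suc: "vwp B (Suc j) = (1 - B * q ^ (2 * j + 1)) * P j B"
  by (simp_all add: vwp_def)

lemma vwp_bound: "norm B \<le> r \<Longrightarrow> norm (vwp B k) \<le> exp (r / (1 - norm q)) * (1 + r)"
proof (cases k)
  case 0
  assume r: "norm B \<le> r"
  then have "0 \<le> r" using norm_ge_zero order_trans by blast
  then have "1 * 1 \<le> exp (r / (1 - norm q)) * (1 + r)"
    using q1 by (intro mult_mono) auto
  then show ?thesis using 0 by simp
next
  case (Suc j)
  assume r: "norm B \<le> r"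
  have "norm (1 - B * q ^ (2 * j + 1)) \<le> 1 + r"
    using norm_triangle_ineq4[of 1 "B * q ^ (2 * j + 1)"] norm_mult_q_pow[of B "2 * j + 1"] r
    by simp
  then show ?thesis
    using P_bound'[OF r, of j] unfolding Suc vwp_Suc norm_mult
    by (subst mult.commute) (intro mult_mono, auto intro: order_trans)
qed

text \<open>The part of the k-th 6phi5 term that is free of the third parameter, multiplied by (q,
  hC, hD; q)_infinity. With q A = h C D one has q A / C = h D and q A / D = h C.\<close>

definition wcoef :: "complex \<Rightarrow> complex \<Rightarrow> complex \<Rightarrow> nat \<Rightarrow> complex" where
  "wcoef h C D k = vwp (h * C * D) k * P k C * P k D *
     Q (q * q ^ k) * Q (h * C * q ^ k) * Q (h * D * q ^ k)"

lemma wcoef_bound: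
  assumes "norm h \<le> r" "norm C \<le> r" "norm D \<le> r" "1 \<le> r"
  shows "norm (wcoef h C D k) \<le> exp (6 * r ^ 3 / (1 - norm q)) * (1 + r ^ 3)"
proof -
  let ?e = "exp (r ^ 3 / (1 - norm q))"
  have r3: "r \<le> r ^ 3" "r * r \<le> r ^ 3" "1 \<le> r ^ 3"
    using assms(4) power_increasing[of 1 3 r] power_increasing[of 2 3 r] power_increasing[of 0 3 r]
    by (auto simp: power2_eq_square)
  have hC: "norm (h * C) \<le> r * r" "norm (h * D) \<le> r * r"
    unfolding norm_mult by (intro mult_mono; use assms in simp)+
  have B: "norm (h * C * D) \<le> r ^ 3"
  proof -
    have "norm (h * C * D) \<le> (r * r) * r"
      unfolding norm_mult[of "h * C"] by (intro mult_mono hC) (use assms in auto)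
    then show ?thesis by (simp add: power3_eq_cube)
  qed
  have "norm (wcoef h C D k) \<le> (?e * (1 + r ^ 3)) * ?e * ?e * ?e * ?e * ?e"
    unfolding wcoef_def norm_mult[of "_ * _ * _"] norm_mult[of "_ * _" "P k D"]
      norm_mult[of "vwp _ _" "P k C"] norm_mult[of "_ * _ " "Q _"]
    by (intro mult_mono vwp_bound P_bound' Q_bound' B mult_nonneg_nonneg order_trans[OF norm_mult_q_pow])
       (use assms r3 hC q1 in \<open>auto intro: order_trans\<close>)
  also have "\<dots> = ?e ^ 6 * (1 + r ^ 3)"
    by (simp add: power_numeral_reduce)
  also have "?e ^ 6 = exp (6 * r ^ 3 / (1 - norm q))"
    by (simp flip: exp_of_nat_mult)
  finally show ?thesis .
qed

lemma wcoef_bounded: "\<exists>K\<ge>0. \<forall>k. norm (wcoef h C D k) \<le> K"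
proof -
  define r where "r = Max {1, norm h, norm C, norm D}"
  have "norm h \<le> r" "norm C \<le> r" "norm D \<le> r" "1 \<le> r" by (auto simp: r_def)
  from wcoef_bound[OF this] show ?thesis
    by (meson norm_ge_zero order_trans)
qed

text \<open>Equals (h t)^k (1/t; q)_k. Written as a polynomial in t it survives at t = 0, the limit
  point of the recursion, and it vanishes at t = q^n as soon as k > n.\<close>

definition lat :: "complex \<Rightarrow> complex \<Rightarrow> nat \<Rightarrow> complex" where
  "lat h t k = (\<Prod>i<k. h * (t - q ^ i))"

lemma lat_0 [simp]: "lat h t 0 = 1" and lat_Suc: "lat h t (Suc k) = lat h t k * (h * (t - q ^ k))"
  by (simp_all add: lat_def)

lemma lat_shift: "lat h (t * q) (Suc k) = h * (t * q - 1) * q ^ k * lat h t k"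
proof (induction k)
  case (Suc k)
  have "lat h (t * q) (Suc (Suc k)) = h * (t * q - 1) * q ^ k * lat h t k * (h * (t * q - q ^ Suc k))"
    by (subst lat_Suc) (simp only: Suc)
  then show ?case by (simp add: lat_Suc algebra_simps)
qed (simp add: lat_def)

lemma lat_bound:
  assumes "norm (h * t) \<le> r" "0 < r"
  shows "norm (lat h t k) \<le> exp (norm h / (r * (1 - norm q))) * r ^ k"
proof -
  have "norm (lat h t k) \<le> (\<Prod>i<k. r * exp (norm h / r * norm q ^ i))"
    unfolding lat_def prod_norm[symmetric]
  proof (rule prod_mono, safe)
    fix i
    have "norm (h * (t - q ^ i)) \<le> norm (h * t) + norm h * norm q ^ i"
      using norm_triangle_ineq4[of "h * t" "h * q ^ i"] by (simp add: algebra_simps norm_mult norm_power)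
    also have "\<dots> \<le> r * (1 + norm h / r * norm q ^ i)"
      using assms by (simp add: field_simps)
    also have "\<dots> \<le> r * exp (norm h / r * norm q ^ i)"
      using assms by (intro mult_left_mono exp_ge_add_one_self) auto
    finally show "norm (h * (t - q ^ i)) \<le> r * exp (norm h / r * norm q ^ i)" .
  qed auto
  also have "\<dots> = r ^ k * exp (norm h / r * (\<Sum>i<k. norm q ^ i))"
    by (simp add: prod.distrib exp_sum sum_distrib_left)
  also have "\<dots> \<le> r ^ k * exp (norm h / r * (\<Sum>i. norm q ^ i))"
    using assms q1
    by (intro mult_left_mono) (auto intro!: divide_right_mono mult_left_mono sum_le_suminf summable_geometric)
  also have "(\<Sum>i. norm q ^ i) = 1 / (1 - norm q)"
    using suminf_geometric[of "norm q"] q1 by simp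
  finally show ?thesis by (simp add: mult.commute)
qed

lemma lat_eq_0: "n < k \<Longrightarrow> lat h (q ^ n) k = 0"
  unfolding lat_def by (intro prod_zero) auto

text \<open>The k-th term of the 6phi5 with upper parameters C, D, 1/t and argument h t, cleared of
  denominators.\<close>

definition sp :: "complex \<Rightarrow> complex \<Rightarrow> complex \<Rightarrow> complex \<Rightarrow> nat \<Rightarrow> complex" where
  "sp h C D t k = wcoef h C D k * Q (h * C * D * t * q ^ k) * lat h t k"

lemma sp_bound:
  assumes "0 < r"
  obtains K where "K \<ge> 0" "\<And>t k. norm t \<le> T \<Longrightarrow> norm (h * t) \<le> r \<Longrightarrow> norm (sp h C D t k) \<le> K * r ^ k"
proof -
  obtain K0 where K0: "K0 \<ge> 0" "\<And>k. norm (wcoef h C D k) \<le> K0" using wcoef_bounded by blast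
  let ?E = "exp (norm (h * C * D) * \<bar>T\<bar> / (1 - norm q))"
  let ?L = "exp (norm h / (r * (1 - norm q)))"
  show ?thesis
  proof (rule that[of "K0 * ?E * ?L"])
    fix t k assume t: "norm t \<le> T" "norm (h * t) \<le> r"
    have "norm (Q (h * C * D * t * q ^ k)) \<le> ?E"
      by (rule Q_bound', rule order_trans[OF norm_mult_q_pow])
         (use t in \<open>auto simp: norm_mult intro!: mult_mono\<close>)
    then have "norm (sp h C D t k) \<le> K0 * ?E * (?L * r ^ k)"
      unfolding sp_def norm_mult[of "_ * _" "lat h t k"] norm_mult[of _ "Q _"]
      using lat_bound[OF t(2) assms, of k] K0 by (intro mult_mono) auto
    then show "norm (sp h C D t k) \<le> K0 * ?E * ?L * r ^ k" by (simp add: mult_ac)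
  qed (use K0 in auto)
qed

lemma sp_summable:
  assumes "norm (h * t) < 1 \<or> (\<exists>n. t = q ^ n)"
  shows "summable (sp h C D t)"
  using assms
proof
  assume t: "norm (h * t) < 1"
  obtain r where "norm (h * t) < r" "r < 1" using dense[OF t] by blast
  then have r: "0 < r" "r < 1" "norm (h * t) \<le> r"
    using le_less_trans[OF norm_ge_zero, of "h * t" r] by auto
  obtain K where "\<And>k. norm (sp h C D t k) \<le> K * r ^ k"
    using sp_bound[OF r(1), of "norm t" h C D] r by (metis order_refl)
  then show ?thesis by (rule summable_geo_bound) (use r in auto)
next
  assume "\<exists>n. t = q ^ n"
  then obtain n where "t = q ^ n" ..
  then have "sp h C D t k = 0" if "k \<notin> {..n}" for k
    using lat_eq_0[of n k h] that by (simp add: sp_def)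
  then show ?thesis by (rule summable_finite[rotated]) auto
qed

text \<open>The certificate of the first-order recursion in \<open>t\<close> satisfied by the very-well-poised sum.\<close>
definition spG :: "complex \<Rightarrow> complex \<Rightarrow> complex \<Rightarrow> complex \<Rightarrow> nat \<Rightarrow> complex" where
  "spG h C D t k = (case k of 0 \<Rightarrow> 0 | Suc j \<Rightarrow>
     P j (h * C * D) * P k C * P k D * h * t * Q (q * q ^ j) * Q (h * C * q ^ j) * Q (h * D * q ^ j)
       * Q (h * C * D * t * q ^ k) * lat h t j)"

text \<open>The polynomial identity to which the telescoping reduces, with p = q and u =
  q^j.\<close>

lemma sp_poly:
  fixes h C D t u p :: complex
  shows "(1 - h * C * t) * (1 - h * D * t) * (1 - h * C * D * p * u * u) * (t * p - 1) * u
      - (1 - h * t) * (1 - h * C * D * p * u * u) * (1 - h * C * D * t * p * u) * (t - u)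
    = t * ((1 - h * C * D * u) * (1 - C * (p * u)) * (1 - D * (p * u)) * h * (t - u)
      - (1 - p * u) * (1 - h * C * u) * (1 - h * D * u) * (1 - h * C * D * t * p * u))"
  by (simp add: algebra_simps)

text \<open>All infinite products are pulled to their shift by q^(j+1), where k = j + 1. A common
  factor \<open>Z\<close> splits off and leaves \<open>sp_poly\<close>.\<close>

lemma sp_telescope:
  "(1 - h * C * t) * (1 - h * D * t) * sp h C D (t * q) k - (1 - h * t) * sp h C D t k =
     spG h C D t (Suc k) - spG h C D t k"
proof (cases k)
  case 0
  define X where "X = Q (h * C * D * t * q)"
  have e: "Q (h * C * D * t) = (1 - h * C * D * t) * X"
    unfolding X_def by (rule Q_rec)
  have e': "Q (h * C * D * (t * q)) = X" "Q (h * C * D * t * q ^ Suc 0) = X"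
    unfolding X_def by (simp_all add: mult.assoc)
  show ?thesis
    unfolding 0 sp_def spG_def wcoef_def nat.case e e' lat_0 vwp_0 qpoch_0 qpoch_Suc power_0 mult_1_right
    by (simp add: algebra_simps)
next
  case (Suc j)
  define X where "X = Q (h * C * D * t * q ^ Suc (Suc j))"
  define Y1 where "Y1 = Q (q * q ^ Suc j)"
  define Y2 where "Y2 = Q (h * C * q ^ Suc j)"
  define Y3 where "Y3 = Q (h * D * q ^ Suc j)"
  define u where "u = q ^ j"
  have e1: "Q (h * C * D * (t * q) * q ^ Suc j) = X"
    by (simp add: X_def mult_ac)
  have e2: "Q (h * C * D * t * q ^ Suc j) = (1 - h * C * D * t * q * u) * X"
    unfolding X_def u_def by (subst Q_rec) (simp add: mult_ac)
  have e3: "Q (q * q ^ j) = (1 - q * u) * Y1" "Q (h * C * q ^ j) = (1 - h * C * u) * Y2"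
    "Q (h * D * q ^ j) = (1 - h * D * u) * Y3"
    unfolding Y1_def Y2_def Y3_def u_def by (subst Q_rec, simp add: mult_ac)+
  have u2: "q ^ (2 * j + 1) = q * u * u" "q ^ Suc j = q * u"
    unfolding u_def by (simp_all add: power_add power_mult mult_2)
  define Z where "Z = P j (h * C * D) * P (Suc j) C * P (Suc j) D * Y1 * Y2 * Y3 * X * lat h t j * h"
  have "sp h C D (t * q) k = Z * ((1 - h * C * D * q * u * u) * (t * q - 1) * u)"
    unfolding Suc sp_def wcoef_def vwp_Suc lat_shift e1
    unfolding X_def[symmetric] Y1_def[symmetric] Y2_def[symmetric] Y3_def[symmetric]
    unfolding u2 u_def[symmetric] Z_def by (simp only: mult_ac)
  then have s1: "(1 - h * C * t) * (1 - h * D * t) * sp h C D (t * q) k =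
      Z * ((1 - h * C * t) * (1 - h * D * t) * (1 - h * C * D * q * u * u) * (t * q - 1) * u)"
    by (simp only: mult_ac)
  have "sp h C D t k = Z * ((1 - h * C * D * q * u * u) * (1 - h * C * D * t * q * u) * (t - u))"
    unfolding Suc sp_def wcoef_def vwp_Suc lat_Suc e2
    unfolding X_def[symmetric] Y1_def[symmetric] Y2_def[symmetric] Y3_def[symmetric]
    unfolding u2 u_def[symmetric] Z_def by (simp only: mult_ac)
  then have s2: "(1 - h * t) * sp h C D t k =
      Z * ((1 - h * t) * (1 - h * C * D * q * u * u) * (1 - h * C * D * t * q * u) * (t - u))"
    by (simp only: mult_ac)
  have s3: "spG h C D t (Suc k) = Z * (t * ((1 - h * C * D * u) * (1 - C * (q * u)) * (1 - D * (q * u)) * h * (t - u)))"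
    unfolding Suc spG_def nat.case lat_Suc qpoch_Suc[of _ "Suc j" C] qpoch_Suc[of _ "Suc j" D] qpoch_Suc[of _ j "h * C * D"]
    unfolding X_def[symmetric] Y1_def[symmetric] Y2_def[symmetric] Y3_def[symmetric]
    unfolding u2 u_def[symmetric] Z_def by (simp only: mult_ac)
  have s4: "spG h C D t k = Z * (t * ((1 - q * u) * (1 - h * C * u) * (1 - h * D * u) * (1 - h * C * D * t * q * u)))"
    unfolding Suc spG_def nat.case e2 e3 Z_def by (simp only: mult_ac)
  show ?thesis
    unfolding s1 s2 s3 s4 right_diff_distrib[symmetric] sp_poly ..
qed

lemma lat_tendsto_0: "(\<lambda>k. lat h t k) \<longlonglongrightarrow> 0" if "norm (h * t) < 1 \<or> (\<exists>n. t = q ^ n)"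
  using that
proof
  assume t: "norm (h * t) < 1"
  obtain r where "norm (h * t) < r" "r < 1" using dense[OF t] by blast
  then have r: "0 < r" "r < 1" "norm (h * t) \<le> r"
    using le_less_trans[OF norm_ge_zero, of "h * t" r] by auto
  have "(\<lambda>k. exp (norm h / (r * (1 - norm q))) * r ^ k) \<longlonglongrightarrow> 0"
    using tendsto_mult_left[OF LIMSEQ_power_zero[of r]] r by simp
  then show ?thesis
    by (rule Lim_null_comparison[rotated]) (use lat_bound[OF r(3,1)] in auto)
next
  assume "\<exists>n. t = q ^ n"
  then obtain n where n: "t = q ^ n" ..
  show ?thesis
    by (rule tendsto_eventually, rule eventually_sequentiallyI[of "Suc n"])
       (use n lat_eq_0[of n _ h] in auto)
qed

lemma q_pow_1: "(\<lambda>n. q ^ n) \<longlonglongrightarrow> 0"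
  using LIMSEQ_power_zero[OF q1] .

text \<open>The certificate contains \<open>lat\<close>, so it tends to 0 both in the convergent and
  in the terminating case, and the telescoping sum leaves nothing.\<close>

lemma sp_rec:
  assumes "norm (h * t) < 1 \<or> (\<exists>n. t = q ^ n)"
  shows "(1 - h * C * t) * (1 - h * D * t) * (\<Sum>k. sp h C D (t * q) k) = (1 - h * t) * (\<Sum>k. sp h C D t k)"
proof -
  have a: "norm (h * (t * q)) < 1 \<or> (\<exists>n. t * q = q ^ n)"
    using assms
  proof
    assume "norm (h * t) < 1"
    then have "norm (h * (t * q)) < 1"
      using norm_mult_q_pow[of "h * t" 1] by (simp add: mult.assoc)
    then show ?thesis ..
  next
    assume "\<exists>n. t = q ^ n"
    then show ?thesis by (metis power_Suc2)
  qed
  note s = sp_summable[OF assms, of C D] sp_summable[OF a, of C D]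
  let ?g = "\<lambda>k. (1 - h * C * t) * (1 - h * D * t) * sp h C D (t * q) k - (1 - h * t) * sp h C D t k"
  have lim: "(\<lambda>k. spG h C D t (Suc k)) \<longlonglongrightarrow> 0"
  proof -
    have "(\<lambda>k. P k (h * C * D) * P (Suc k) C * P (Suc k) D * h * t * Q (q * q ^ k) * Q (h * C * q ^ k) *
        Q (h * D * q ^ k) * Q (h * C * D * t * (q * q ^ k)) * lat h t k) \<longlonglongrightarrow>
       Q (h * C * D) * Q C * Q D * h * t * Q (q * 0) * Q (h * C * 0) * Q (h * D * 0) *
         Q (h * C * D * t * (q * 0)) * 0"
      by (intro tendsto_intros P_LIMSEQ LIMSEQ_Suc[OF P_LIMSEQ] q_pow_1 lat_tendsto_0[OF assms])
    then show ?thesis by (simp add: spG_def)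
  qed
  have "(\<lambda>n. \<Sum>k<n. ?g k) \<longlonglongrightarrow> 0"
  proof -
    have "(\<Sum>k<n. ?g k) = spG h C D t n" for n
      unfolding sp_telescope sum_lessThan_telescope by (simp add: spG_def)
    then show ?thesis using LIMSEQ_imp_Suc[OF lim] by simp
  qed
  then have "?g sums 0" by (simp add: sums_def)
  moreover have "?g sums ((1 - h * C * t) * (1 - h * D * t) * (\<Sum>k. sp h C D (t * q) k)
      - (1 - h * t) * (\<Sum>k. sp h C D t k))"
    by (intro sums_diff sums_mult summable_sums s)
  ultimately show ?thesis using sums_unique2 by fastforce
qed

text \<open>On the lattice the series terminates, so h may be large. The induction starts at t = 1,
  where only the term k = 0 survives.\<close>

lemma sp_sum_lattice:
  assumes "Q (h * C) \<noteq> 0" "Q (h * D) \<noteq> 0"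
  shows "(\<Sum>k. sp h C D (q ^ n) k) = Q q * Q (h * C * D) * P n h * Q (h * C * q ^ n) * Q (h * D * q ^ n)"
proof (induction n)
  case 0
  have "sp h C D 1 k = 0" if "k \<notin> {0}" for k
    using lat_eq_0[of 0 k h] that by (simp add: sp_def)
  then have "(\<Sum>k. sp h C D 1 k) = (\<Sum>k\<in>{0}. sp h C D 1 k)"
    by (intro suminf_finite) auto
  then show ?case by (simp add: sp_def wcoef_def)
next
  case (Suc n)
  have nz: "1 - h * C * q ^ n \<noteq> 0" "1 - h * D * q ^ n \<noteq> 0"
    using assms unfolding Q_eq_0_iff by auto
  have e: "Q (h * C * q ^ n) = (1 - h * C * q ^ n) * Q (h * C * q ^ Suc n)"
     "Q (h * D * q ^ n) = (1 - h * D * q ^ n) * Q (h * D * q ^ Suc n)"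
    by (subst Q_rec, simp add: mult_ac)+
  have "(1 - h * C * q ^ n) * (1 - h * D * q ^ n) * (\<Sum>k. sp h C D (q ^ Suc n) k) =
     (1 - h * C * q ^ n) * (1 - h * D * q ^ n) * (Q q * Q (h * C * D) * (P n h * (1 - h * q ^ n)) *
       Q (h * C * q ^ Suc n) * Q (h * D * q ^ Suc n))"
    using sp_rec[of h "q ^ n" C D] unfolding Suc e by (auto simp: mult_ac)
  then show ?case using nz by (simp add: qpoch_Suc)
qed

lemma sp_cont_0:
  assumes "s \<longlonglongrightarrow> 0"
  shows "(\<lambda>n. \<Sum>k. sp h C D (s n) k) \<longlonglongrightarrow> (\<Sum>k. sp h C D 0 k)"
proof -
  obtain K where K: "\<forall>t k. norm t \<le> 1 \<longrightarrow> norm (h * t) \<le> 1 / 2 \<longrightarrow> norm (sp h C D t k) \<le> K * (1 / 2) ^ k"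
    by (rule sp_bound[where r = "1/2" and T = 1 and h = h and C = C and D = D]) (simp, blast)
  have hs: "(\<lambda>n. h * s n) \<longlonglongrightarrow> 0" using tendsto_mult_left[OF assms, of h] by simp
  have ev: "eventually (\<lambda>n. norm (h * s n) < 1 / 2) sequentially"
    using tendstoD[OF hs, of "1/2"] by (simp add: dist_norm)
  have ev': "eventually (\<lambda>n. norm (s n) < 1) sequentially"
    using tendstoD[OF assms, of 1] by (simp add: dist_norm)
  show ?thesis
  proof (rule tendsto_suminf_geo[where C = K and r = "1/2"])
    show "(\<lambda>n. sp h C D (s n) k) \<longlonglongrightarrow> sp h C D 0 k" for k
      unfolding sp_def lat_def by (intro tendsto_intros assms)
    show "\<forall>\<^sub>F n in sequentially. \<forall>k. norm (sp h C D (s n) k) \<le> K * (1 / 2) ^ k"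
      using ev ev' by eventually_elim (use K in force)
  qed auto
qed

text \<open>The value at t = 0 is the limit of the closed form on the lattice points q^n.\<close>

lemma sp_sum_0:
  assumes "Q (h * C) \<noteq> 0" "Q (h * D) \<noteq> 0"
  shows "(\<Sum>k. sp h C D 0 k) = Q q * Q (h * C * D) * Q h"
proof -
  have "(\<lambda>n. Q q * Q (h * C * D) * P n h * Q (h * C * q ^ n) * Q (h * D * q ^ n)) \<longlonglongrightarrow>
      Q q * Q (h * C * D) * Q h * 1 * 1"
    by (intro tendsto_intros P_LIMSEQ Q_pow_tendsto_1)
  then show ?thesis
    using sp_cont_0[OF q_pow_1, of h C D] unfolding sp_sum_lattice[OF assms]
    by (simp add: LIMSEQ_unique)
qed

text \<open>Up to normalisation this is the nonterminating very-well-poised \<open>6\<phi>5\<close> sum.\<close>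
lemma sp_sum:
  assumes "Q (h * C) \<noteq> 0" "Q (h * D) \<noteq> 0" and t: "norm (h * t) < 1"
  shows "Q (h * t) * (\<Sum>k. sp h C D t k) = Q q * Q (h * C * D) * Q h * Q (h * C * t) * Q (h * D * t)"
proof -
  have tn: "norm (h * (t * q ^ n)) < 1" for n
    using norm_mult_q_pow[of "h * t" n] t by (simp add: mult.assoc)
  define S where "S n = (\<Sum>k. sp h C D (t * q ^ n) k)" for n
  have rec: "(1 - h * C * t * q ^ n) * (1 - h * D * t * q ^ n) * S (Suc n) = (1 - h * t * q ^ n) * S n" for n
    using sp_rec[OF disjI1[OF tn[of n]], of C D] unfolding S_def power_Suc2 by (simp only: mult.assoc)
  \<comment> \<open>The recursion carries t to t q^n; as n grows the unknown sum is replaced by the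
    known one at t = 0.\<close>
  have r: "P n (h * t) * S 0 = P n (h * C * t) * P n (h * D * t) * S n" for n
  proof (induction n)
    case (Suc n)
    have "P (Suc n) (h * t) * S 0 = (1 - h * t * q ^ n) * (P n (h * t) * S 0)"
      unfolding qpoch_Suc by (simp only: mult_ac)
    also have "\<dots> = P n (h * C * t) * P n (h * D * t) * ((1 - h * t * q ^ n) * S n)"
      unfolding Suc by (simp only: mult_ac)
    also have "\<dots> = P (Suc n) (h * C * t) * P (Suc n) (h * D * t) * S (Suc n)"
      unfolding rec[symmetric] qpoch_Suc by (simp only: mult_ac)
    finally show ?case .
  qed simp
  have "(\<lambda>n. P n (h * t) * S 0) \<longlonglongrightarrow> Q (h * t) * S 0"
    by (intro tendsto_intros P_LIMSEQ)
  moreover have "(\<lambda>n. P n (h * C * t) * P n (h * D * t) * S n) \<longlonglongrightarrow>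
      Q (h * C * t) * Q (h * D * t) * (\<Sum>k. sp h C D 0 k)"
    unfolding S_def by (intro tendsto_intros P_LIMSEQ sp_cont_0 q_pow_tendsto_0)
  ultimately have "Q (h * t) * S 0 = Q (h * C * t) * Q (h * D * t) * (Q q * Q (h * C * D) * Q h)"
    unfolding r sp_sum_0[OF assms(1,2)] by (rule LIMSEQ_unique)
  then show ?thesis by (simp add: S_def mult_ac)
qed

end



section \<open>The nonterminating q-Saalschuetz sum as a q-beta integral\<close>

context qbase
begin

text \<open>The integrand at t = s q^n together with the factor t of the q-integral, multiplied by
  (se, sf, sg; q)_infinity. The end points of integration are s = 1 and s = \<alpha>.\<close>

definition qb :: "complex \<Rightarrow> complex \<Rightarrow> complex \<Rightarrow> complex \<Rightarrow> complex \<Rightarrow> nat \<Rightarrow> complex" where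
  "qb \<alpha> e f g s n = s * q ^ n * Q (s * q * q ^ n) * Q (s / \<alpha> * q * q ^ n) * Q (\<alpha> * e * f * g * s * q ^ n)
     * P n (s * e) * P n (s * f) * P n (s * g)"

lemma qb_bound:
  obtains K where "K \<ge> 0"
    "\<And>(e::complex) (f::complex) (g::complex) n. norm e \<le> r \<Longrightarrow> norm f \<le> r \<Longrightarrow> norm g \<le> r \<Longrightarrow> norm (qb \<alpha> e f g s n) \<le> K * norm q ^ n"
proof (cases "r \<ge> 0")
  case r: True
  let ?x = "\<lambda>y. exp (y / (1 - norm q))"
  let ?K = "norm s * ?x (norm (s * q)) * ?x (norm (s / \<alpha> * q)) * ?x (norm \<alpha> * r * r * r * norm s)
     * ?x (norm s * r) * ?x (norm s * r) * ?x (norm s * r)"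
  show ?thesis
  proof (rule that[of ?K])
    fix e f g :: complex and n assume b: "norm e \<le> r" "norm f \<le> r" "norm g \<le> r"
    have c: "norm (\<alpha> * e * f * g * s) \<le> norm \<alpha> * r * r * r * norm s"
      unfolding norm_mult by (intro mult_mono mult_nonneg_nonneg) (use b r in auto)
    have d: "norm (s * e) \<le> norm s * r" "norm (s * f) \<le> norm s * r" "norm (s * g) \<le> norm s * r"
      unfolding norm_mult by (intro mult_left_mono; use b in simp)+
    have "norm (qb \<alpha> e f g s n) = norm s * norm q ^ n * norm (Q (s * q * q ^ n)) * norm (Q (s / \<alpha> * q * q ^ n))
      * norm (Q (\<alpha> * e * f * g * s * q ^ n)) * norm (P n (s * e)) * norm (P n (s * f)) * norm (P n (s * g))"
      unfolding qb_def norm_mult norm_power ..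
    also have "\<dots> \<le> norm s * norm q ^ n * ?x (norm (s * q)) * ?x (norm (s / \<alpha> * q)) * ?x (norm \<alpha> * r * r * r * norm s)
     * ?x (norm s * r) * ?x (norm s * r) * ?x (norm s * r)"
      by (intro mult_mono mult_nonneg_nonneg Q_bound_pow P_bound' d Q_bound' order_trans[OF norm_mult_q_pow] c) auto
    finally show "norm (qb \<alpha> e f g s n) \<le> ?K * norm q ^ n" by (simp add: mult_ac)
  qed (use r in auto)
next
  case False
  then have "\<not> norm e \<le> r" for e :: complex using norm_ge_zero order_trans by blast
  then show ?thesis by (intro that[of 0]) auto
qed

lemma qb_summable: "summable (qb \<alpha> e f g s)"
proof -
  define r where "r = Max {norm e, norm f, norm g}"
  obtain K where "\<And>n. norm (qb \<alpha> e f g s n) \<le> K * norm q ^ n"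
    using qb_bound[of r \<alpha> s] by (metis Max_ge finite.emptyI finite.insertI insertI1 insertI2 r_def)
  then show ?thesis by (rule summable_geo_bound) (use q1 in auto)
qed

lemma qb_tendsto:
  assumes "(e \<longlongrightarrow> e0) F"
  shows "((\<lambda>x. \<Sum>n. qb \<alpha> (e x) f g s n) \<longlongrightarrow> (\<Sum>n. qb \<alpha> e0 f g s n)) F"
proof -
  define r where "r = Max {norm e0 + 1, norm f, norm g}"
  have r: "norm f \<le> r" "norm g \<le> r" "norm e0 + 1 \<le> r" by (auto simp: r_def)
  obtain K where K: "\<And>e f g n. norm e \<le> r \<Longrightarrow> norm f \<le> r \<Longrightarrow> norm g \<le> r \<Longrightarrow> norm (qb \<alpha> e f g s n) \<le> K * norm q ^ n"
    using qb_bound[of r \<alpha> s] by metis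
  show ?thesis
  proof (rule tendsto_suminf_geo[where C = K and r = "norm q"])
    show "((\<lambda>x. qb \<alpha> (e x) f g s n) \<longlongrightarrow> qb \<alpha> e0 f g s n) F" for n
      unfolding qb_def by (intro tendsto_intros assms)
    have "eventually (\<lambda>x. norm (e x) < norm e0 + 1) F"
      using order_tendstoD(2)[OF tendsto_norm[OF assms]] by simp
    then show "\<forall>\<^sub>F x in F. \<forall>n. norm (qb \<alpha> (e x) f g s n) \<le> K * norm q ^ n"
      by eventually_elim (use K r in force)
  qed (use q1 in auto)
qed

text \<open>The quantity \<open>\<integral> (qt/\<alpha>, qt, \<alpha>efgt) / (et, ft, gt) d\<^sub>qt\<close> over \<open>[\<alpha>, 1]\<close>, cleared of denominators.\<close>
definition qbeta :: "complex \<Rightarrow> complex \<Rightarrow> complex \<Rightarrow> complex \<Rightarrow> complex" where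
  "qbeta \<alpha> e f g = (\<Sum>n. qb \<alpha> e f g 1 n) * Q (\<alpha> * e) * Q (\<alpha> * f) * Q (\<alpha> * g)
     - Q e * Q f * Q g * (\<Sum>n. qb \<alpha> e f g \<alpha> n)"

lemma qb_poly:
  fixes \<alpha> e f g t :: complex
  assumes "\<alpha> \<noteq> 0"
  shows "((1 - e) * (1 - \<alpha> * e) * (1 - \<alpha> * e * f * g * t) - (1 - \<alpha> * e * f) * (1 - \<alpha> * e * g) * (1 - e * t)) * t
      = \<alpha> * e * ((1 - t) * (1 - t / \<alpha>) * (1 - \<alpha> * e * f * g * t) - (1 - e * t) * (1 - f * t) * (1 - g * t))"
proof -
  obtain \<beta> where \<beta>: "\<alpha> * \<beta> = 1" "t / \<alpha> = \<beta> * t"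
    using assms by (intro that[of "1 / \<alpha>"]) auto
  show ?thesis unfolding \<beta>(2) using \<beta>(1) by algebra
qed

text \<open>A telescoping certificate \<open>G\<close>. It vanishes at n = 0 because one of its
  factors is \<open>Q 1\<close> at either end point. Its limit, the contribution of t = 0, is the
  right-hand side; it is what the two halves of \<open>qbeta\<close> have in common.\<close>

lemma qb_shift_aux:
  assumes \<alpha>: "\<alpha> \<noteq> 0" and s: "s = 1 \<or> s = \<alpha>"
  shows "(1 - e) * (1 - \<alpha> * e) * (\<Sum>n. qb \<alpha> e f g s n)
    - (1 - \<alpha> * e * f) * (1 - \<alpha> * e * g) * (1 - s * e) * (\<Sum>n. qb \<alpha> (e * q) f g s n)
    = - (\<alpha> * e * Q (s * e) * Q (s * f) * Q (s * g))"
proof -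
  define G where "G n = \<alpha> * e * Q (s * q ^ n) * Q (s / \<alpha> * q ^ n) * Q (\<alpha> * e * f * g * s * q ^ n)
     * P n (s * e) * P n (s * f) * P n (s * g)" for n
  let ?g = "\<lambda>n. (1 - e) * (1 - \<alpha> * e) * qb \<alpha> e f g s n
    - (1 - \<alpha> * e * f) * (1 - \<alpha> * e * g) * (1 - s * e) * qb \<alpha> (e * q) f g s n"
  have step: "?g n = G n - G (Suc n)" for n
  proof -
    define t where "t = s * q ^ n"
    define X1 where "X1 = Q (t * q)"
    define X2 where "X2 = Q (t / \<alpha> * q)"
    define X3 where "X3 = Q (\<alpha> * e * f * g * t * q)"
    have e1: "Q (s * q ^ n) = (1 - t) * X1" "Q (s / \<alpha> * q ^ n) = (1 - t / \<alpha>) * X2"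
       "Q (\<alpha> * e * f * g * s * q ^ n) = (1 - \<alpha> * e * f * g * t) * X3"
      unfolding X1_def X2_def X3_def t_def by (subst Q_rec, simp add: mult_ac)+
    have e2: "Q (s * q * q ^ n) = X1" "Q (s / \<alpha> * q * q ^ n) = X2" "Q (\<alpha> * (e * q) * f * g * s * q ^ n) = X3"
       "Q (s * q ^ Suc n) = X1" "Q (s / \<alpha> * q ^ Suc n) = X2" "Q (\<alpha> * e * f * g * s * q ^ Suc n) = X3"
      unfolding X1_def X2_def X3_def t_def by (simp_all add: mult_ac)
    have e3: "(1 - s * e) * P n (s * (e * q)) = P n (s * e) * (1 - e * t)"
      using qpoch_Suc_left[of q n "s * e"] qpoch_Suc[of q n "s * e"] by (simp add: t_def mult_ac)
    have e4: "P (Suc n) (s * e) = P n (s * e) * (1 - e * t)" "P (Suc n) (s * f) = P n (s * f) * (1 - f * t)"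
       "P (Suc n) (s * g) = P n (s * g) * (1 - g * t)"
      by (simp_all add: qpoch_Suc t_def mult_ac)
    have "?g n = (1 - e) * (1 - \<alpha> * e) * (t * X1 * X2 * ((1 - \<alpha> * e * f * g * t) * X3) * P n (s * e) * P n (s * f) * P n (s * g))
      - (1 - \<alpha> * e * f) * (1 - \<alpha> * e * g) * (t * X1 * X2 * X3 * ((1 - s * e) * P n (s * (e * q))) * P n (s * f) * P n (s * g))"
      unfolding qb_def e2 e1 by (simp add: t_def)
    also have "\<dots> = ((1 - e) * (1 - \<alpha> * e) * (1 - \<alpha> * e * f * g * t) - (1 - \<alpha> * e * f) * (1 - \<alpha> * e * g) * (1 - e * t)) * t *
       (X1 * X2 * X3 * P n (s * e) * P n (s * f) * P n (s * g))"
      unfolding e3 by (simp add: algebra_simps)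
    also have "((1 - e) * (1 - \<alpha> * e) * (1 - \<alpha> * e * f * g * t) - (1 - \<alpha> * e * f) * (1 - \<alpha> * e * g) * (1 - e * t)) * t
      = \<alpha> * e * ((1 - t) * (1 - t / \<alpha>) * (1 - \<alpha> * e * f * g * t) - (1 - e * t) * (1 - f * t) * (1 - g * t))"
      by (rule qb_poly[OF \<alpha>])
    finally have "?g n = \<alpha> * e * ((1 - t) * (1 - t / \<alpha>) * (1 - \<alpha> * e * f * g * t) - (1 - e * t) * (1 - f * t) * (1 - g * t))
       * (X1 * X2 * X3 * P n (s * e) * P n (s * f) * P n (s * g))" .
    moreover have "G n = \<alpha> * e * ((1 - t) * (1 - t / \<alpha>) * (1 - \<alpha> * e * f * g * t))
       * (X1 * X2 * X3 * P n (s * e) * P n (s * f) * P n (s * g))"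
      unfolding G_def e1 by (simp only: mult_ac)
    moreover have "G (Suc n) = \<alpha> * e * ((1 - e * t) * (1 - f * t) * (1 - g * t))
       * (X1 * X2 * X3 * P n (s * e) * P n (s * f) * P n (s * g))"
      unfolding G_def e2 e4 by (simp only: mult_ac)
    ultimately show ?thesis
      by (simp only: right_diff_distrib[symmetric] left_diff_distrib[symmetric])
  qed
  have G0: "G 0 = 0"
    using s \<alpha> by (auto simp: G_def)
  have lim: "G \<longlonglongrightarrow> \<alpha> * e * Q (s * e) * Q (s * f) * Q (s * g)"
  proof -
    have "G \<longlonglongrightarrow> \<alpha> * e * 1 * 1 * 1 * Q (s * e) * Q (s * f) * Q (s * g)"
      unfolding G_def by (intro tendsto_intros P_LIMSEQ Q_pow_tendsto_1)
    then show ?thesis by simp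
  qed
  have "(\<Sum>n<N. ?g n) = - G N" for N
    unfolding step using sum_lessThan_telescope'[of G N] G0 by simp
  then have "?g sums - (\<alpha> * e * Q (s * e) * Q (s * f) * Q (s * g))"
    unfolding sums_def using tendsto_minus[OF lim] by simp
  moreover have "?g sums ((1 - e) * (1 - \<alpha> * e) * (\<Sum>n. qb \<alpha> e f g s n)
    - (1 - \<alpha> * e * f) * (1 - \<alpha> * e * g) * (1 - s * e) * (\<Sum>n. qb \<alpha> (e * q) f g s n))"
    by (intro sums_diff sums_mult summable_sums qb_summable)
  ultimately show ?thesis by (rule sums_unique2[symmetric])
qed

lemma qbeta_tendsto:
  assumes "(e \<longlongrightarrow> e0) F"
  shows "((\<lambda>x. qbeta \<alpha> (e x) f g) \<longlongrightarrow> qbeta \<alpha> e0 f g) F"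
  unfolding qbeta_def
  by (intro tendsto_mult tendsto_diff tendsto_Q tendsto_const qb_tendsto assms)

text \<open>The contributions of t = 0 from the two half-integrals cancel. The computation divides
  by 1 - e and 1 - \<alpha> e; the excluded values of e follow by continuity.\<close>

lemma qbeta_shift:
  assumes \<alpha>: "\<alpha> \<noteq> 0"
  shows "qbeta \<alpha> e f g = (1 - \<alpha> * e * f) * (1 - \<alpha> * e * g) * qbeta \<alpha> (e * q) f g"
proof -
  have main: "qbeta \<alpha> e f g = (1 - \<alpha> * e * f) * (1 - \<alpha> * e * g) * qbeta \<alpha> (e * q) f g" if e: "e \<noteq> 1" and e': "1 - \<alpha> * e \<noteq> 0" for e
  proof -
    define M1 where "M1 = (\<Sum>n. qb \<alpha> e f g 1 n)"
    define M2 where "M2 = (\<Sum>n. qb \<alpha> e f g \<alpha> n)"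
    define N1 where "N1 = (\<Sum>n. qb \<alpha> (e * q) f g 1 n)"
    define N2 where "N2 = (\<Sum>n. qb \<alpha> (e * q) f g \<alpha> n)"
    define k where "k = (1 - \<alpha> * e * f) * (1 - \<alpha> * e * g)"
    define A where "A = Q (e * q)"
    define B where "B = Q (\<alpha> * (e * q))"
    have A: "Q e = (1 - e) * A" and B: "Q (\<alpha> * e) = (1 - \<alpha> * e) * B"
      unfolding A_def B_def by (subst Q_rec, simp add: mult_ac)+
    have r1: "(1 - e) * (1 - \<alpha> * e) * M1 - k * (1 - e) * N1 = - (\<alpha> * e * ((1 - e) * A) * Q f * Q g)"
      using qb_shift_aux[OF \<alpha>, of 1 e f g] unfolding M1_def N1_def k_def A[symmetric] by simp
    have r2: "(1 - e) * (1 - \<alpha> * e) * M2 - k * (1 - \<alpha> * e) * N2 = - (\<alpha> * e * ((1 - \<alpha> * e) * B) * Q (\<alpha> * f) * Q (\<alpha> * g))"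
      using qb_shift_aux[OF \<alpha>, of \<alpha> e f g] unfolding M2_def N2_def k_def B[symmetric] by simp
    have "(1 - e) * (qbeta \<alpha> e f g - k * qbeta \<alpha> (e * q) f g) =
      ((1 - e) * (1 - \<alpha> * e) * M1 - k * (1 - e) * N1) * B * Q (\<alpha> * f) * Q (\<alpha> * g)
       - (1 - e) * (A * Q f * Q g * ((1 - e) * M2 - k * N2))"
      unfolding qbeta_def A B A_def[symmetric] B_def[symmetric] M1_def[symmetric] M2_def[symmetric] N1_def[symmetric] N2_def[symmetric]
      by algebra
    also have "\<dots> = (1 - e) * (- A * Q f * Q g) * (\<alpha> * e * B * Q (\<alpha> * f) * Q (\<alpha> * g) + ((1 - e) * M2 - k * N2))"
      unfolding r1 by algebra
    finally have x: "qbeta \<alpha> e f g - k * qbeta \<alpha> (e * q) f g =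
       - A * Q f * Q g * (\<alpha> * e * B * Q (\<alpha> * f) * Q (\<alpha> * g) + ((1 - e) * M2 - k * N2))"
      using e unfolding mult.assoc by (subst (asm) mult_left_cancel) auto
    have "(1 - \<alpha> * e) * (\<alpha> * e * B * Q (\<alpha> * f) * Q (\<alpha> * g) + ((1 - e) * M2 - k * N2)) = 0"
      using r2 by algebra
    then show ?thesis using e' x by (simp add: k_def)
  qed
  have a: "((\<lambda>e. qbeta \<alpha> e f g) \<longlongrightarrow> qbeta \<alpha> e f g) (at e)"
    by (intro qbeta_tendsto tendsto_ident_at)
  have b: "((\<lambda>e. (1 - \<alpha> * e * f) * (1 - \<alpha> * e * g) * qbeta \<alpha> (e * q) f g) \<longlongrightarrow>
      (1 - \<alpha> * e * f) * (1 - \<alpha> * e * g) * qbeta \<alpha> (e * q) f g) (at e)"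
    by (intro tendsto_intros qbeta_tendsto)
  have c: "\<forall>\<^sub>F x in at e. (1 - \<alpha> * x * f) * (1 - \<alpha> * x * g) * qbeta \<alpha> (x * q) f g = qbeta \<alpha> x f g"
  proof -
    have "\<forall>\<^sub>F x in at e. x \<noteq> 1 \<and> x \<noteq> 1 / \<alpha>"
      by (intro eventually_conj eventually_neq_at_within)
    then show ?thesis
    proof eventually_elim
      case (elim x)
      then have "1 - \<alpha> * x \<noteq> 0" using \<alpha> by (auto simp: field_simps)
      then show ?case using main[of x] elim by simp
    qed
  qed
  show ?thesis
    by (rule tendsto_unique[OF at_neq_bot a Lim_transform_eventually[OF b c]])
qed

lemma qbeta_commute: "qbeta \<alpha> e f g = qbeta \<alpha> f e g" "qbeta \<alpha> e f g = qbeta \<alpha> g f e"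
proof -
  have "qb \<alpha> e f g s = qb \<alpha> f e g s" "qb \<alpha> e f g s = qb \<alpha> g f e s" for s
    unfolding qb_def by (simp_all only: mult_ac)
  then show "qbeta \<alpha> e f g = qbeta \<alpha> f e g" "qbeta \<alpha> e f g = qbeta \<alpha> g f e"
    unfolding qbeta_def by (simp_all only: mult_ac)
qed

lemma qbeta_reduce:
  assumes "\<alpha> \<noteq> 0"
  shows "qbeta \<alpha> e f g = Q (\<alpha> * e * f) * Q (\<alpha> * e * g) * qbeta \<alpha> 0 f g"
proof -
  have "qbeta \<alpha> e f g = P n (\<alpha> * e * f) * P n (\<alpha> * e * g) * qbeta \<alpha> (e * q ^ n) f g" for n
  proof (induction n)
    case (Suc n)
    show ?case
      unfolding Suc qbeta_shift[OF assms, of "e * q ^ n"] qpoch_Suc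
      by (simp add: mult_ac)
  qed simp
  moreover have "(\<lambda>n. P n (\<alpha> * e * f) * P n (\<alpha> * e * g) * qbeta \<alpha> (e * q ^ n) f g) \<longlonglongrightarrow>
     Q (\<alpha> * e * f) * Q (\<alpha> * e * g) * qbeta \<alpha> 0 f g"
    by (intro tendsto_intros P_LIMSEQ qbeta_tendsto q_pow_tendsto_0)
  ultimately show ?thesis by (simp add: LIMSEQ_const_iff)
qed

text \<open>Each of e, f, g is scaled down to 0 in turn, by the symmetry in the three; what remains
  depends on \<alpha> alone.\<close>

lemma qbeta_eq_const:
  assumes "\<alpha> \<noteq> 0"
  shows "qbeta \<alpha> e f g = Q (\<alpha> * e * f) * Q (\<alpha> * e * g) * Q (\<alpha> * f * g) * qbeta \<alpha> 0 0 0"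
proof -
  have "qbeta \<alpha> 0 f g = Q (\<alpha> * f * 0) * Q (\<alpha> * f * g) * qbeta \<alpha> 0 0 g"
    using qbeta_reduce[OF assms, of f 0 g] qbeta_commute(1)[of \<alpha> 0 f g] by simp
  moreover have "qbeta \<alpha> 0 0 g = qbeta \<alpha> 0 0 0"
    using qbeta_reduce[OF assms, of g 0 0] qbeta_commute(2)[of \<alpha> 0 0 g] by simp
  ultimately show ?thesis
    using qbeta_reduce[OF assms, of e f g] by (simp add: mult_ac)
qed

text \<open>For \<open>e = q/\<alpha>\<close>, \<open>f = q\<close>, \<open>g = 0\<close> both series are geometric, which fixes the constant.\<close>
lemma qbeta_eq:
  assumes \<alpha>: "\<alpha> \<noteq> 0"
  shows "qbeta \<alpha> e f g = Q (\<alpha> * e * f) * Q (\<alpha> * e * g) * Q (\<alpha> * f * g) * (Q q * Q (q / \<alpha>) * Q \<alpha>)"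
proof -
  have q1': "1 - q \<noteq> 0" using q1 by auto
  have geo: "(\<Sum>n. c * q ^ n) = c / (1 - q)" for c
    using suminf_geometric[OF q1] suminf_mult[OF summable_geometric[OF q1], of c] by simp
  have t1: "qb \<alpha> (q / \<alpha>) q 0 1 n = Q q * Q (q / \<alpha>) * q ^ n" for n
    using Q_shift[of q n] Q_shift[of "q / \<alpha>" n] by (simp add: qb_def qpoch_def)
  have t2: "qb \<alpha> (q / \<alpha>) q 0 \<alpha> n = \<alpha> * Q q * Q (\<alpha> * q) * q ^ n" for n
    using Q_shift[of q n] Q_shift[of "\<alpha> * q" n] \<alpha> by (simp add: qb_def qpoch_def)
  have Qa: "Q \<alpha> = (1 - \<alpha>) * Q (\<alpha> * q)" and Qq: "Q q = (1 - q) * Q (q * q)"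
    by (rule Q_rec)+
  have nz: "Q (q * q) \<noteq> 0"
    by (rule Q_nz) (metis norm_mult mult_strict_mono' norm_ge_zero q1 mult_1_right)
  have "qbeta \<alpha> (q / \<alpha>) q 0 = Q q * Q (q / \<alpha>) / (1 - q) * Q q * Q (\<alpha> * q)
     - Q (q / \<alpha>) * Q q * (\<alpha> * Q q * Q (\<alpha> * q) / (1 - q))"
    unfolding qbeta_def t1 t2 geo using \<alpha> by simp
  also have "\<dots> = Q q / (1 - q) * (Q q * Q (q / \<alpha>) * ((1 - \<alpha>) * Q (\<alpha> * q)))"
    using q1' by (simp add: divide_simps) (simp add: algebra_simps)
  also have "Q q / (1 - q) = Q (q * q)" using Qq q1' by simp
  also have "(1 - \<alpha>) * Q (\<alpha> * q) = Q \<alpha>" by (rule Qa[symmetric])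
  finally have "qbeta \<alpha> 0 0 0 = Q q * Q (q / \<alpha>) * Q \<alpha>"
    using qbeta_eq_const[OF \<alpha>, of "q / \<alpha>" q 0] \<alpha> nz by simp
  then show ?thesis using qbeta_eq_const[OF \<alpha>, of e f g] by (simp only:)
qed

end



section \<open>Bailey's relation: the 6phi5 sum integrated against the q-beta weight\<close>

context qbase
begin

text \<open>The number (-1)^k q^(k(k-1)/2).\<close>

definition altq :: "nat \<Rightarrow> complex" where "altq k = (\<Prod>i<k. - (q ^ i))"

text \<open>Turns \<open>lat\<close> into a shift of the factor (qt; q)_infinity of the q-beta
  weight. After this shift the k-th term is again a q-beta integrand.\<close>

lemma lat_Q: "lat h t k * Q (t * q) = h ^ k * altq k * Q (t * q / q ^ k)"
proof (induction k)
  case (Suc k)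
  have e: "Q (t * q / q ^ Suc k) = (1 - t / q ^ k) * Q (t * q / q ^ k)"
    using Q_rec[of "t / q ^ k"] q0 by simp
  have "lat h t (Suc k) * Q (t * q) = h * (t - q ^ k) * (lat h t k * Q (t * q))"
    by (simp add: lat_Suc mult_ac)
  also have "\<dots> = h ^ Suc k * altq (Suc k) * Q (t * q / q ^ Suc k)"
    unfolding Suc e using q0 by (simp add: altq_def field_simps)
  finally show ?case .
qed (simp add: altq_def)

text \<open>Quasi-periodicity of the theta function between \<alpha> / q^k and \<alpha>; it undoes
  the shift of \<alpha> caused by the substitution in the k-th term.\<close>

lemma theta_shift:
  assumes "\<alpha> \<noteq> 0"
  shows "altq k * q ^ k * (Q (q * q ^ k / \<alpha>) * Q (\<alpha> / q ^ k)) = \<alpha> ^ k * (Q (q / \<alpha>) * Q \<alpha>)"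
proof (induction k)
  case (Suc k)
  have e1: "Q (\<alpha> / q ^ Suc k) = (1 - \<alpha> / q ^ Suc k) * Q (\<alpha> / q ^ k)"
    using Q_rec[of "\<alpha> / q ^ Suc k"] q0 by simp
  have e2: "Q (q * q ^ k / \<alpha>) = (1 - q * q ^ k / \<alpha>) * Q (q * q ^ Suc k / \<alpha>)"
    using Q_rec[of "q * q ^ k / \<alpha>"] by (simp add: mult_ac)
  have "altq (Suc k) * q ^ Suc k * (Q (q * q ^ Suc k / \<alpha>) * Q (\<alpha> / q ^ Suc k)) =
     \<alpha> * (altq k * q ^ k * ((1 - q * q ^ k / \<alpha>) * Q (q * q ^ Suc k / \<alpha>) * Q (\<alpha> / q ^ k)))"
    unfolding e1 using q0 assms by (simp add: altq_def field_simps)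
  then show ?case unfolding e2[symmetric] Suc by simp
qed (simp add: altq_def)

text \<open>The majorant is uniform on the whole lattice although |h| may exceed r: for large n the
  number h q^n is small, and for the finitely many other n the series terminates, so that finitely
  many terms are absorbed by the constant.\<close>

lemma sp_lattice_bound:
  assumes "0 < r"
  obtains K where "K \<ge> 0" "\<And>n k. norm (sp h C D (q ^ n) k) \<le> K * r ^ k"
proof -
  obtain K where K: "K \<ge> 0" "\<And>t k. norm t \<le> 1 \<Longrightarrow> norm (h * t) \<le> r \<Longrightarrow> norm (sp h C D t k) \<le> K * r ^ k"
    using sp_bound[OF assms, of 1 h C D] by metis
  have "\<forall>\<^sub>F n in sequentially. norm (h * q ^ n) < r"
    using tendstoD[OF q_pow_tendsto_0[of h] assms] by (simp add: dist_norm)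
  then obtain n0 where n0: "\<And>n. n \<ge> n0 \<Longrightarrow> norm (h * q ^ n) < r"
    by (auto simp: eventually_sequentially)
  define K' where "K' = K + (\<Sum>n<n0. \<Sum>k\<le>n. norm (sp h C D (q ^ n) k) / r ^ k)"
  have nn: "0 \<le> (\<Sum>n<n0. \<Sum>k\<le>n. norm (sp h C D (q ^ n) k) / r ^ k)"
    using assms by (intro sum_nonneg) auto
  show ?thesis
  proof (rule that[of K'])
    show "K' \<ge> 0" using K nn by (simp add: K'_def)
    fix n k
    show "norm (sp h C D (q ^ n) k) \<le> K' * r ^ k"
    proof (cases "n \<ge> n0")
      case True
      have "norm (sp h C D (q ^ n) k) \<le> K * r ^ k"
        using K(2)[OF norm_q_pow less_imp_le[OF n0[OF True]]] .
      also have "\<dots> \<le> K' * r ^ k"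
        using nn assms by (intro mult_right_mono) (auto simp: K'_def)
      finally show ?thesis .
    next
      case False
      show ?thesis
      proof (cases "k \<le> n")
        case True
        have "norm (sp h C D (q ^ n) k) / r ^ k \<le> (\<Sum>k\<le>n. norm (sp h C D (q ^ n) k) / r ^ k)"
          using True assms by (intro member_le_sum) auto
        also have "\<dots> \<le> (\<Sum>n<n0. \<Sum>k\<le>n. norm (sp h C D (q ^ n) k) / r ^ k)"
          using False assms by (intro member_le_sum[of n]) (auto intro!: sum_nonneg)
        also have "\<dots> \<le> K'" using K by (simp add: K'_def)
        finally show ?thesis using assms by (simp add: field_simps)
      next
        case False
        then have "sp h C D (q ^ n) k = 0" using lat_eq_0[of n k h] by (simp add: sp_def)
        then show ?thesis using K nn assms by (simp add: K'_def)
      qed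
    qed
  qed
qed

text \<open>The q-beta integrand without the factor (\<alpha> e f g t; q)_infinity. That factor is
  supplied by \<open>sp\<close>, through h C D = \<alpha> e f g and shifted by q^k.\<close>

definition bw :: "complex \<Rightarrow> complex \<Rightarrow> complex \<Rightarrow> complex \<Rightarrow> complex \<Rightarrow> nat \<Rightarrow> complex" where
  "bw \<alpha> e f g s n = s * q ^ n * Q (s * q * q ^ n) * Q (s / \<alpha> * q * q ^ n) * P n (s * e) * P n (s * f) * P n (s * g)"

lemma bw_bound: "norm (bw \<alpha> e f g s n) \<le> norm s * exp (norm (s * q) / (1 - norm q)) * exp (norm (s / \<alpha> * q) / (1 - norm q))
    * exp (norm (s * e) / (1 - norm q)) * exp (norm (s * f) / (1 - norm q)) * exp (norm (s * g) / (1 - norm q)) * norm q ^ n"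
proof -
  have "norm (bw \<alpha> e f g s n) = norm s * norm (Q (s * q * q ^ n)) * norm (Q (s / \<alpha> * q * q ^ n))
    * norm (P n (s * e)) * norm (P n (s * f)) * norm (P n (s * g)) * norm q ^ n"
    by (simp only: bw_def norm_mult norm_power mult_ac)
  also have "\<dots> \<le> norm s * exp (norm (s * q) / (1 - norm q)) * exp (norm (s / \<alpha> * q) / (1 - norm q))
    * exp (norm (s * e) / (1 - norm q)) * exp (norm (s * f) / (1 - norm q)) * exp (norm (s * g) / (1 - norm q)) * norm q ^ n"
    by (intro mult_mono mult_nonneg_nonneg Q_bound_pow P_bound) auto
  finally show ?thesis .
qed

text \<open>The majorant that permits the interchange has two sources: termination at the end point
  1, and |\<alpha> h| < 1 at the end point \<alpha>.\<close>

lemma bw_swap: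
  assumes s: "s = 1 \<or> s = \<alpha>" and h: "norm (\<alpha> * h) < 1"
  shows "(\<Sum>n. bw \<alpha> e f g s n * (\<Sum>k. sp h C D (s * q ^ n) k)) = (\<Sum>k. \<Sum>n. bw \<alpha> e f g s n * sp h C D (s * q ^ n) k)"
    and "\<exists>K r. r < 1 \<and> 0 \<le> r \<and> (\<forall>k n. norm (bw \<alpha> e f g s n * sp h C D (s * q ^ n) k) \<le> K * r ^ k * norm q ^ n)"
proof -
  obtain r where "norm (\<alpha> * h) < r" "r < 1" using dense[OF h] by blast
  then have r: "0 < r" "r < 1" "norm (\<alpha> * h) \<le> r"
    using le_less_trans[OF norm_ge_zero, of "\<alpha> * h" r] by auto
  obtain K1 where K1: "K1 \<ge> 0" "\<And>n k. norm (sp h C D (s * q ^ n) k) \<le> K1 * r ^ k"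
    using s
  proof
    assume s: "s = 1"
    show ?thesis using sp_lattice_bound[OF r(1), of h C D] s by (metis mult_1 that)
  next
    assume s: "s = \<alpha>"
    obtain K where K: "K \<ge> 0" "\<And>t k. norm t \<le> norm \<alpha> \<Longrightarrow> norm (h * t) \<le> r \<Longrightarrow> norm (sp h C D t k) \<le> K * r ^ k"
      using sp_bound[OF r(1), of "norm \<alpha>" h C D] by metis
    have "norm (h * (\<alpha> * q ^ n)) \<le> r" for n
      using order_trans[OF norm_mult_q_pow[of "\<alpha> * h" n] r(3)] by (simp add: mult_ac)
    then show ?thesis using K norm_mult_q_pow[of \<alpha>] s by (intro that[of K]) auto
  qed
  define K0 where "K0 = norm s * exp (norm (s * q) / (1 - norm q)) * exp (norm (s / \<alpha> * q) / (1 - norm q))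
    * exp (norm (s * e) / (1 - norm q)) * exp (norm (s * f) / (1 - norm q)) * exp (norm (s * g) / (1 - norm q))"
  have "K0 \<ge> 0" by (simp add: K0_def)
  have bd: "norm (bw \<alpha> e f g s n * sp h C D (s * q ^ n) k) \<le> K0 * K1 * r ^ k * norm q ^ n" for k n
  proof -
    have "norm (bw \<alpha> e f g s n * sp h C D (s * q ^ n) k) \<le> (K0 * norm q ^ n) * (K1 * r ^ k)"
      unfolding norm_mult using bw_bound[of \<alpha> e f g s n] K1 \<open>K0 \<ge> 0\<close> unfolding K0_def[symmetric]
      by (intro mult_mono) auto
    then show ?thesis by (simp add: mult_ac)
  qed
  then show "\<exists>K r. r < 1 \<and> 0 \<le> r \<and> (\<forall>k n. norm (bw \<alpha> e f g s n * sp h C D (s * q ^ n) k) \<le> K * r ^ k * norm q ^ n)"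
    using r by (intro exI[of _ "K0 * K1"] exI[of _ r]) auto
  have sm: "summable (sp h C D (s * q ^ n))" for n
    by (rule summable_geo_bound[OF K1(2)]) (use r in auto)
  have "(\<Sum>n. bw \<alpha> e f g s n * (\<Sum>k. sp h C D (s * q ^ n) k)) = (\<Sum>n. \<Sum>k. bw \<alpha> e f g s n * sp h C D (s * q ^ n) k)"
    by (intro suminf_cong suminf_mult[symmetric] sm)
  also have "\<dots> = (\<Sum>k. \<Sum>n. bw \<alpha> e f g s n * sp h C D (s * q ^ n) k)"
    by (rule suminf_swap_geo[OF bd]) (use r q1 in auto)
  finally show "(\<Sum>n. bw \<alpha> e f g s n * (\<Sum>k. sp h C D (s * q ^ n) k)) = (\<Sum>k. \<Sum>n. bw \<alpha> e f g s n * sp h C D (s * q ^ n) k)" .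
qed

text \<open>The result of summing \<open>sp\<close> in closed form under \<open>bw\<close>: the term
  of a balanced 4phi3 with upper parameters se, sf, sg, sh, cleared of denominators.\<close>

definition blat :: "complex \<Rightarrow> complex \<Rightarrow> complex \<Rightarrow> complex \<Rightarrow> complex \<Rightarrow> complex \<Rightarrow> complex \<Rightarrow> complex \<Rightarrow> nat \<Rightarrow> complex" where
  "blat \<alpha> e f g h C D s n = bw \<alpha> e f g s n * Q (h * C * s * q ^ n) * Q (h * D * s * q ^ n) * P n (s * h)"

text \<open>The term of the 8W7 with base A = h C D / q, parameters C, D, e, f, g and argument
  \<alpha> h, cleared of denominators. Under h C D = \<alpha> e f g one has q A / e = \<alpha> f g,
  and likewise for f and g.\<close>

definition w8 :: "complex \<Rightarrow> complex \<Rightarrow> complex \<Rightarrow> complex \<Rightarrow> complex \<Rightarrow> complex \<Rightarrow> complex \<Rightarrow> nat \<Rightarrow> complex" where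
  "w8 \<alpha> e f g h C D k = wcoef h C D k * (\<alpha> * h) ^ k * (P k e * P k f * P k g) *
     (Q (\<alpha> * e * f * q ^ k) * Q (\<alpha> * e * g * q ^ k) * Q (\<alpha> * f * g * q ^ k))"

text \<open>The substitution t = q^k t' makes the k-th summand a q-beta sum with \<alpha> / q^k for
  \<alpha> and with e, f, g multiplied by q^k. At the end point 1 the terms with n < k vanish, so
  the summation begins at n = k, that is at t' = 1; this produces the finite products in e, f,
  g.\<close>

lemma bw_sp_inner:
  assumes \<alpha>: "\<alpha> \<noteq> 0" and h: "norm (\<alpha> * h) < 1" and B: "h * C * D = \<alpha> * e * f * g"
  shows "(\<Sum>n. bw \<alpha> e f g 1 n * sp h C D (1 * q ^ n) k) =
       wcoef h C D k * h ^ k * altq k * q ^ k * (P k e * P k f * P k g) *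
          (\<Sum>n. qb (\<alpha> / q ^ k) (e * q ^ k) (f * q ^ k) (g * q ^ k) 1 n)"
    and "(\<Sum>n. bw \<alpha> e f g \<alpha> n * sp h C D (\<alpha> * q ^ n) k) =
       wcoef h C D k * h ^ k * altq k * q ^ k *
          (\<Sum>n. qb (\<alpha> / q ^ k) (e * q ^ k) (f * q ^ k) (g * q ^ k) (\<alpha> / q ^ k) n)"
proof -
  have gen: "bw \<alpha> e f g s n * sp h C D (s * q ^ n) k = wcoef h C D k * h ^ k * altq k *
      (s * q ^ n * Q (s * q * q ^ n / q ^ k) * Q (s / \<alpha> * q * q ^ n) * P n (s * e) * P n (s * f) * P n (s * g)
        * Q (\<alpha> * e * f * g * s * q ^ n * q ^ k))" for s n
  proof -
    have e: "s * q * q ^ n = s * q ^ n * q" by simp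
    have "bw \<alpha> e f g s n * sp h C D (s * q ^ n) k = wcoef h C D k * (lat h (s * q ^ n) k * Q (s * q ^ n * q)) *
      (s * q ^ n * Q (s / \<alpha> * q * q ^ n) * P n (s * e) * P n (s * f) * P n (s * g)
        * Q (\<alpha> * e * f * g * (s * q ^ n) * q ^ k))"
      unfolding bw_def sp_def B e by (simp only: mult_ac)
    then show ?thesis unfolding lat_Q e by (simp only: mult_ac)
  qed
  note qk = q0
  have qk': "q ^ k \<noteq> 0" using q0 by simp
  have "(\<Sum>n. bw \<alpha> e f g \<alpha> n * sp h C D (\<alpha> * q ^ n) k) =
     (\<Sum>n. wcoef h C D k * h ^ k * altq k * q ^ k * qb (\<alpha> / q ^ k) (e * q ^ k) (f * q ^ k) (g * q ^ k) (\<alpha> / q ^ k) n)"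
  proof (rule suminf_cong)
    fix n
    have "q ^ k * qb (\<alpha> / q ^ k) (e * q ^ k) (f * q ^ k) (g * q ^ k) (\<alpha> / q ^ k) n =
       \<alpha> * q ^ n * Q (\<alpha> * q * q ^ n / q ^ k) * Q (\<alpha> / \<alpha> * q * q ^ n) * P n (\<alpha> * e) * P n (\<alpha> * f) * P n (\<alpha> * g)
        * Q (\<alpha> * e * f * g * \<alpha> * q ^ n * q ^ k)"
    proof -
      have a: "\<alpha> / q ^ k * q * q ^ n = \<alpha> * q * q ^ n / q ^ k" "\<alpha> / q ^ k / (\<alpha> / q ^ k) = \<alpha> / \<alpha>"
        "\<alpha> / q ^ k * (e * q ^ k) * (f * q ^ k) * (g * q ^ k) * (\<alpha> / q ^ k) * q ^ n = \<alpha> * e * f * g * \<alpha> * q ^ n * q ^ k"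
        "\<alpha> / q ^ k * (x * q ^ k) = \<alpha> * x" "q ^ k * (\<alpha> / q ^ k * q ^ n) = \<alpha> * q ^ n" for x
        using q0 \<alpha> by simp_all
      show ?thesis unfolding qb_def a(3) unfolding a(1,2,4) by (simp add: q0)
    qed
    then show "bw \<alpha> e f g \<alpha> n * sp h C D (\<alpha> * q ^ n) k =
       wcoef h C D k * h ^ k * altq k * q ^ k * qb (\<alpha> / q ^ k) (e * q ^ k) (f * q ^ k) (g * q ^ k) (\<alpha> / q ^ k) n"
      unfolding gen by (simp only: mult.assoc)
  qed
  also have "\<dots> = wcoef h C D k * h ^ k * altq k * q ^ k *
          (\<Sum>n. qb (\<alpha> / q ^ k) (e * q ^ k) (f * q ^ k) (g * q ^ k) (\<alpha> / q ^ k) n)"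
    by (intro suminf_mult qb_summable)
  finally show "(\<Sum>n. bw \<alpha> e f g \<alpha> n * sp h C D (\<alpha> * q ^ n) k) = \<dots>" .
  have sm: "summable (\<lambda>n. bw \<alpha> e f g 1 n * sp h C D (1 * q ^ n) k)"
  proof -
    obtain K r where "\<forall>k n. norm (bw \<alpha> e f g 1 n * sp h C D (1 * q ^ n) k) \<le> K * r ^ k * norm q ^ n"
      using bw_swap(2)[OF disjI1[OF refl] h, of e f g C D] by blast
    then show ?thesis
      by (intro summable_geo_bound[of _ "K * r ^ k" "norm q"]) (use q1 in auto)
  qed
  have z: "bw \<alpha> e f g 1 n * sp h C D (1 * q ^ n) k = 0" if "n < k" for n
    using lat_eq_0[OF that, of h] by (simp add: sp_def)
  have "(\<Sum>n. bw \<alpha> e f g 1 n * sp h C D (1 * q ^ n) k) = (\<Sum>n. bw \<alpha> e f g 1 (n + k) * sp h C D (1 * q ^ (n + k)) k)"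
  proof -
    have "(\<Sum>i<k. bw \<alpha> e f g 1 i * sp h C D (1 * q ^ i) k) = 0"
      by (rule sum.neutral) (use z in blast)
    then show ?thesis using suminf_split_initial_segment[OF sm, of k] by simp
  qed
  also have "\<dots> = (\<Sum>n. wcoef h C D k * h ^ k * altq k * q ^ k * (P k e * P k f * P k g)
         * qb (\<alpha> / q ^ k) (e * q ^ k) (f * q ^ k) (g * q ^ k) 1 n)"
  proof (rule suminf_cong)
    fix n
    have "q ^ k * (P k e * P k f * P k g) * qb (\<alpha> / q ^ k) (e * q ^ k) (f * q ^ k) (g * q ^ k) 1 n =
       1 * q ^ (n + k) * Q (1 * q * q ^ (n + k) / q ^ k) * Q (1 / \<alpha> * q * q ^ (n + k)) *
        P (n + k) (1 * e) * P (n + k) (1 * f) * P (n + k) (1 * g)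
        * Q (\<alpha> * e * f * g * 1 * q ^ (n + k) * q ^ k)"
    proof -
      have p: "P (n + k) x = P k x * P n (x * q ^ k)" for x
        using qpoch_add[of q k n x] by (simp add: add.commute)
      have a: "1 * q * q ^ (n + k) / q ^ k = 1 * q * q ^ n"
        "1 / \<alpha> * q * q ^ (n + k) = 1 / (\<alpha> / q ^ k) * q * q ^ n"
        "\<alpha> * e * f * g * 1 * q ^ (n + k) * q ^ k = \<alpha> / q ^ k * (e * q ^ k) * (f * q ^ k) * (g * q ^ k) * 1 * q ^ n"
        using q0 by (simp_all add: power_add)
      show ?thesis unfolding qb_def a unfolding p mult_1_left by (simp only: power_add mult_ac)
    qed
    then show "bw \<alpha> e f g 1 (n + k) * sp h C D (1 * q ^ (n + k)) k =
       wcoef h C D k * h ^ k * altq k * q ^ k * (P k e * P k f * P k g)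
         * qb (\<alpha> / q ^ k) (e * q ^ k) (f * q ^ k) (g * q ^ k) 1 n"
      unfolding gen by (simp only: mult.assoc)
  qed
  also have "\<dots> = wcoef h C D k * h ^ k * altq k * q ^ k * (P k e * P k f * P k g) *
          (\<Sum>n. qb (\<alpha> / q ^ k) (e * q ^ k) (f * q ^ k) (g * q ^ k) 1 n)"
    by (intro suminf_mult qb_summable)
  finally show "(\<Sum>n. bw \<alpha> e f g 1 n * sp h C D (1 * q ^ n) k) = \<dots>" .
qed

text \<open>Evaluates the k-th q-beta sum by \<open>qbeta_eq\<close>. The theta factor returns to
  \<alpha> by \<open>theta_shift\<close> and leaves \<alpha>^k, which completes the argument
  \<alpha> h of the 8W7.\<close>

lemma w8_summable_aux:
  assumes \<alpha>: "\<alpha> \<noteq> 0" and h: "norm (\<alpha> * h) < 1" and B: "h * C * D = \<alpha> * e * f * g"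
  shows "Q (\<alpha> * e) * Q (\<alpha> * f) * Q (\<alpha> * g) * (\<Sum>n. bw \<alpha> e f g 1 n * sp h C D (1 * q ^ n) k)
     - Q e * Q f * Q g * (\<Sum>n. bw \<alpha> e f g \<alpha> n * sp h C D (\<alpha> * q ^ n) k) = Q q * Q (q / \<alpha>) * Q \<alpha> * w8 \<alpha> e f g h C D k"
proof -
  have qk: "q ^ k \<noteq> 0" using q0 by simp
  have a: "\<alpha> / q ^ k * (x * q ^ k) = \<alpha> * x" "\<alpha> / q ^ k * (x * q ^ k) * (y * q ^ k) = \<alpha> * x * y * q ^ k" for x y
    using q0 by simp_all
  have b: "q / (\<alpha> / q ^ k) = q * q ^ k / \<alpha>" using q0 by simp
  have ak: "\<alpha> / q ^ k \<noteq> 0" using \<alpha> q0 by simp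
  note qe = qbeta_eq[OF ak, of "e * q ^ k" "f * q ^ k" "g * q ^ k", unfolded qbeta_def a b]
  define M1 where "M1 = (\<Sum>n. qb (\<alpha> / q ^ k) (e * q ^ k) (f * q ^ k) (g * q ^ k) 1 n)"
  define M2 where "M2 = (\<Sum>n. qb (\<alpha> / q ^ k) (e * q ^ k) (f * q ^ k) (g * q ^ k) (\<alpha> / q ^ k) n)"
  define c where "c = wcoef h C D k * h ^ k * altq k * q ^ k"
  define R where "R = Q (\<alpha> * e * f * q ^ k) * Q (\<alpha> * e * g * q ^ k) * Q (\<alpha> * f * g * q ^ k)"
  have "Q (\<alpha> * e) * Q (\<alpha> * f) * Q (\<alpha> * g) * (c * (P k e * P k f * P k g) * M1) - Q e * Q f * Q g * (c * M2)
     = c * (P k e * P k f * P k g) * (M1 * Q (\<alpha> * e) * Q (\<alpha> * f) * Q (\<alpha> * g)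
         - Q (e * q ^ k) * Q (f * q ^ k) * Q (g * q ^ k) * M2)"
    unfolding Q_shift[of e k] Q_shift[of f k] Q_shift[of g k] right_diff_distrib by (simp only: mult_ac)
  also have "\<dots> = c * (P k e * P k f * P k g) * (R * (Q q * Q (q * q ^ k / \<alpha>) * Q (\<alpha> / q ^ k)))"
    unfolding M1_def M2_def R_def qe by (simp only: mult.assoc)
  also have "\<dots> = wcoef h C D k * h ^ k * (P k e * P k f * P k g) * R * Q q * (altq k * q ^ k * (Q (q * q ^ k / \<alpha>) * Q (\<alpha> / q ^ k)))"
    unfolding c_def by (simp only: mult_ac)
  also have "\<dots> = Q q * Q (q / \<alpha>) * Q \<alpha> * w8 \<alpha> e f g h C D k"
    unfolding theta_shift[OF \<alpha>] w8_def R_def[symmetric] power_mult_distrib by (simp only: mult_ac)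
  finally show ?thesis
    unfolding bw_sp_inner[OF assms] M1_def[symmetric] M2_def[symmetric] c_def[symmetric] .
qed

text \<open>Bailey's three-term relation between two balanced \<open>4\<phi>3\<close> series and a very-well-poised \<open>8\<phi>7\<close> series.\<close>
theorem bailey:
  assumes \<alpha>: "\<alpha> \<noteq> 0" and h: "norm (\<alpha> * h) < 1" and B: "h * C * D = \<alpha> * e * f * g"
    and nz: "Q (h * C) \<noteq> 0" "Q (h * D) \<noteq> 0"
  shows "Q (h * C * D) * (Q (\<alpha> * e) * Q (\<alpha> * f) * Q (\<alpha> * g) * Q (\<alpha> * h) * (\<Sum>n. blat \<alpha> e f g h C D 1 n)
       - Q e * Q f * Q g * Q h * (\<Sum>n. blat \<alpha> e f g h C D \<alpha> n))
     = Q (\<alpha> * h) * Q (q / \<alpha>) * Q \<alpha> * (\<Sum>k. w8 \<alpha> e f g h C D k)"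
    and "summable (blat \<alpha> e f g h C D 1)" "summable (blat \<alpha> e f g h C D \<alpha>)"
proof -
  note sw = bw_swap(1)[OF _ h, of _ e f g C D]
  define c where "c = Q q * Q (h * C * D)"
  have qq: "Q q \<noteq> 0" using Q_nz[OF q1] .
  have blat_bound: "\<exists>K. \<forall>n. norm (blat \<alpha> e f g h C D s n) \<le> K * norm q ^ n" for s
  proof -
    define K0 where "K0 = norm s * exp (norm (s * q) / (1 - norm q)) * exp (norm (s / \<alpha> * q) / (1 - norm q))
      * exp (norm (s * e) / (1 - norm q)) * exp (norm (s * f) / (1 - norm q)) * exp (norm (s * g) / (1 - norm q))"
    have "K0 \<ge> 0" by (simp add: K0_def)
    have "norm (blat \<alpha> e f g h C D s n) \<le> K0 * norm q ^ n * exp (norm (h * C * s) / (1 - norm q))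
       * exp (norm (h * D * s) / (1 - norm q)) * exp (norm (s * h) / (1 - norm q))" for n
      unfolding blat_def norm_mult[of "_ * _ * _" "P n (s * h)"] norm_mult[of "_ * _" "Q (h * D * s * q ^ n)"]
        norm_mult[of _ "Q (h * C * s * q ^ n)"]
      by (intro mult_mono mult_nonneg_nonneg bw_bound[of \<alpha> e f g s n, folded K0_def] Q_bound_pow P_bound)
         (use \<open>K0 \<ge> 0\<close> in auto)
    then show ?thesis
      by (intro exI[of _ "K0 * exp (norm (h * C * s) / (1 - norm q))
       * exp (norm (h * D * s) / (1 - norm q)) * exp (norm (s * h) / (1 - norm q))"]) (simp add: mult_ac)
  qed
  have sb: "summable (blat \<alpha> e f g h C D s)" for s
    using blat_bound[of s] summable_geo_bound[OF _ norm_ge_zero q1] by blast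
  then show "summable (blat \<alpha> e f g h C D 1)" "summable (blat \<alpha> e f g h C D \<alpha>)" by auto
  have t1: "c * (\<Sum>n. blat \<alpha> e f g h C D 1 n) = (\<Sum>k. \<Sum>n. bw \<alpha> e f g 1 n * sp h C D (1 * q ^ n) k)"
  proof -
    have "c * blat \<alpha> e f g h C D 1 n = bw \<alpha> e f g 1 n * (\<Sum>k. sp h C D (1 * q ^ n) k)" for n
      unfolding mult_1 sp_sum_lattice[OF nz] c_def blat_def by (simp add: mult_ac)
    then show ?thesis using sw[of 1] suminf_mult[OF sb[of 1], of c] by simp
  qed
  have t2: "Q h * c * (\<Sum>n. blat \<alpha> e f g h C D \<alpha> n) = Q (\<alpha> * h) * (\<Sum>k. \<Sum>n. bw \<alpha> e f g \<alpha> n * sp h C D (\<alpha> * q ^ n) k)"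
  proof -
    have "Q h * c * blat \<alpha> e f g h C D \<alpha> n = Q (\<alpha> * h) * (bw \<alpha> e f g \<alpha> n * (\<Sum>k. sp h C D (\<alpha> * q ^ n) k))" for n
    proof -
      have hn: "norm (h * (\<alpha> * q ^ n)) < 1"
        using le_less_trans[OF norm_mult_q_pow[of "\<alpha> * h" n] h] by (simp add: mult_ac)
      have "Q h * c * blat \<alpha> e f g h C D \<alpha> n = bw \<alpha> e f g \<alpha> n * P n (\<alpha> * h) *
         (Q q * Q (h * C * D) * Q h * Q (h * C * (\<alpha> * q ^ n)) * Q (h * D * (\<alpha> * q ^ n)))"
        unfolding c_def blat_def by (simp add: mult_ac)
      also have "\<dots> = bw \<alpha> e f g \<alpha> n * (P n (\<alpha> * h) * Q (\<alpha> * h * q ^ n)) * (\<Sum>k. sp h C D (\<alpha> * q ^ n) k)"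
        unfolding sp_sum[OF nz hn, symmetric] by (simp add: mult_ac)
      also have "P n (\<alpha> * h) * Q (\<alpha> * h * q ^ n) = Q (\<alpha> * h)"
        using Q_shift[of "\<alpha> * h" n] by simp
      finally show ?thesis by (simp only: mult_ac)
    qed
    moreover have "summable (\<lambda>n. bw \<alpha> e f g \<alpha> n * (\<Sum>k. sp h C D (\<alpha> * q ^ n) k))"
    proof -
      have "summable (\<lambda>n. Q (\<alpha> * h) * (bw \<alpha> e f g \<alpha> n * (\<Sum>k. sp h C D (\<alpha> * q ^ n) k)))"
        using summable_mult[OF sb[of \<alpha>], of "Q h * c"] calculation by simp
      then show ?thesis using Q_nz[OF h] by (simp add: summable_cmult_iff)
    qed
    ultimately show ?thesis
      using sw[of \<alpha>] suminf_mult[OF sb[of \<alpha>], of "Q h * c"] by (simp add: suminf_mult)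
  qed
  have sums: "summable (\<lambda>k. \<Sum>n. bw \<alpha> e f g s n * sp h C D (s * q ^ n) k)" if s: "s = 1 \<or> s = \<alpha>" for s
  proof -
    obtain K r where K: "r < 1" "0 \<le> r" "\<forall>k n. norm (bw \<alpha> e f g s n * sp h C D (s * q ^ n) k) \<le> K * r ^ k * norm q ^ n"
      using bw_swap(2)[OF s h, of e f g C D] by blast
    have "norm (\<Sum>n. bw \<alpha> e f g s n * sp h C D (s * q ^ n) k) \<le> K / (1 - norm q) * r ^ k" for k
    proof -
      have "norm (\<Sum>n. bw \<alpha> e f g s n * sp h C D (s * q ^ n) k) \<le> (\<Sum>n. K * r ^ k * norm q ^ n)"
        by (intro norm_suminf_le summable_mult summable_geometric) (use K q1 in auto)
      also have "\<dots> = K / (1 - norm q) * r ^ k"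
        using suminf_mult[OF summable_geometric[of "norm q"], of "K * r ^ k"] suminf_geometric[of "norm q"] q1 by simp
      finally show ?thesis .
    qed
    then show ?thesis by (rule summable_geo_bound) (use K in auto)
  qed
  define L where "L = Q (\<alpha> * e) * Q (\<alpha> * f) * Q (\<alpha> * g)"
  define L' where "L' = Q e * Q f * Q g"
  define A1 where "A1 k = (\<Sum>n. bw \<alpha> e f g 1 n * sp h C D (1 * q ^ n) k)" for k
  define A2 where "A2 k = (\<Sum>n. bw \<alpha> e f g \<alpha> n * sp h C D (\<alpha> * q ^ n) k)" for k
  have s1: "summable A1" "summable A2" using sums[of 1] sums[of \<alpha>] by (simp_all add: A1_def[abs_def] A2_def[abs_def])
  have "L * (\<Sum>k. A1 k) - L' * (\<Sum>k. A2 k) = (\<Sum>k. L * A1 k - L' * A2 k)"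
    using suminf_diff[OF summable_mult[OF s1(1)] summable_mult[OF s1(2)], of L L'] s1
    by (simp only: suminf_mult)
  also have "\<dots> = (\<Sum>k. Q q * Q (q / \<alpha>) * Q \<alpha> * w8 \<alpha> e f g h C D k)"
    unfolding L_def L'_def A1_def A2_def w8_summable_aux[OF \<alpha> h B] ..
  finally have m: "L * (\<Sum>k. A1 k) - L' * (\<Sum>k. A2 k) = (\<Sum>k. Q q * Q (q / \<alpha>) * Q \<alpha> * w8 \<alpha> e f g h C D k)" .
  \<comment> \<open>If the theta factor vanishes, that is if \<alpha> is an integer power of q, both
    sides are 0. Otherwise summability of \<open>w8\<close> is inherited from the left-hand
    side.\<close>
  have w: "(\<Sum>k. Q q * Q (q / \<alpha>) * Q \<alpha> * w8 \<alpha> e f g h C D k) = Q q * Q (q / \<alpha>) * Q \<alpha> * (\<Sum>k. w8 \<alpha> e f g h C D k)"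
  proof (cases "Q q * Q (q / \<alpha>) * Q \<alpha> = 0")
    case False
    have "summable (\<lambda>k. L * A1 k - L' * A2 k)"
      using s1 by (intro summable_diff summable_mult)
    then have "summable (\<lambda>k. Q q * Q (q / \<alpha>) * Q \<alpha> * w8 \<alpha> e f g h C D k)"
      unfolding L_def L'_def A1_def A2_def w8_summable_aux[OF \<alpha> h B] .
    then have "summable (w8 \<alpha> e f g h C D)" using False by (simp only: summable_cmult_iff) auto
    then show ?thesis by (rule suminf_mult)
  next
    case True
    show ?thesis unfolding True by simp
  qed
  define S1 where "S1 = (\<Sum>n. blat \<alpha> e f g h C D 1 n)"
  define S2 where "S2 = (\<Sum>n. blat \<alpha> e f g h C D \<alpha> n)"
  have "Q q * (Q (h * C * D) * (L * Q (\<alpha> * h) * S1 - L' * Q h * S2)) = Q (\<alpha> * h) * (L * (c * S1)) - L' * (Q h * c * S2)"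
    unfolding c_def by (simp add: algebra_simps)
  also have "\<dots> = Q (\<alpha> * h) * (L * (\<Sum>k. A1 k) - L' * (\<Sum>k. A2 k))"
    unfolding S1_def S2_def t1 t2 A1_def A2_def by (simp add: algebra_simps)
  also have "\<dots> = Q q * (Q (\<alpha> * h) * Q (q / \<alpha>) * Q \<alpha> * (\<Sum>k. w8 \<alpha> e f g h C D k))"
    unfolding m w by (simp only: mult_ac)
  finally show "Q (h * C * D) * (Q (\<alpha> * e) * Q (\<alpha> * f) * Q (\<alpha> * g) * Q (\<alpha> * h) * (\<Sum>n. blat \<alpha> e f g h C D 1 n)
       - Q e * Q f * Q g * Q h * (\<Sum>n. blat \<alpha> e f g h C D \<alpha> n))
     = Q (\<alpha> * h) * Q (q / \<alpha>) * Q \<alpha> * (\<Sum>k. w8 \<alpha> e f g h C D k)"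
    using qq unfolding L_def L'_def S1_def S2_def by simp
qed

end



section \<open>The very-well-poised form of the Askey-Wilson function\<close>

context qbase
begin

text \<open>One constant serves the whole polydisc of radius R, and the argument enters only through
  r^k. Joint continuity in the parameters and locally uniform convergence in x both rest on
  this.\<close>

lemma w8_bound:
  assumes R: "1 \<le> R"
  obtains K where "K \<ge> 0" "\<And>\<alpha> e f g h C D r k. norm \<alpha> \<le> R \<Longrightarrow> norm e \<le> R \<Longrightarrow> norm f \<le> R \<Longrightarrow>
    norm g \<le> R \<Longrightarrow> norm h \<le> R \<Longrightarrow> norm C \<le> R \<Longrightarrow> norm D \<le> R \<Longrightarrow> norm (\<alpha> * h) \<le> r \<Longrightarrow>
    norm (w8 \<alpha> e f g h C D k) \<le> K * r ^ k"
proof -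
  let ?x = "\<lambda>y. exp (y / (1 - norm q))"
  let ?W = "exp (6 * R ^ 3 / (1 - norm q)) * (1 + R ^ 3)"
  have R0: "0 \<le> R" using R by simp
  show ?thesis
  proof (rule that[of "?W * (?x R * ?x R * ?x R) * (?x (R * R * R) * ?x (R * R * R) * ?x (R * R * R))"])
    show "0 \<le> ?W * (?x R * ?x R * ?x R) * (?x (R * R * R) * ?x (R * R * R) * ?x (R * R * R))"
      using R by (intro mult_nonneg_nonneg) auto
    fix \<alpha> e f g h C D :: complex and r k
    assume b: "norm \<alpha> \<le> R" "norm e \<le> R" "norm f \<le> R" "norm g \<le> R" "norm h \<le> R" "norm C \<le> R" "norm D \<le> R"
      "norm (\<alpha> * h) \<le> r"
    have m: "norm (u * v * w) \<le> R * R * R" if "norm u \<le> R" "norm v \<le> R" "norm w \<le> R" for u v w :: complex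
      unfolding norm_mult using that R0 by (intro mult_mono mult_nonneg_nonneg) auto
    have "norm (w8 \<alpha> e f g h C D k) = norm (wcoef h C D k) * norm (\<alpha> * h) ^ k * (norm (P k e) * norm (P k f) * norm (P k g)) *
       (norm (Q (\<alpha> * e * f * q ^ k)) * norm (Q (\<alpha> * e * g * q ^ k)) * norm (Q (\<alpha> * f * g * q ^ k)))"
      unfolding w8_def by (simp only: norm_mult norm_power)
    also have "\<dots> \<le> ?W * r ^ k * (?x R * ?x R * ?x R) * (?x (R * R * R) * ?x (R * R * R) * ?x (R * R * R))"
      by (intro mult_mono mult_nonneg_nonneg wcoef_bound power_mono P_bound' Q_bound'
          order_trans[OF norm_mult_q_pow] m b R norm_ge_zero exp_ge_zero zero_le_power order_trans[OF norm_ge_zero b(8)])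
         (use R in auto)
    finally show "norm (w8 \<alpha> e f g h C D k) \<le> ?W * (?x R * ?x R * ?x R) * (?x (R * R * R) * ?x (R * R * R) * ?x (R * R * R)) * r ^ k"
      by (simp only: mult_ac)
  qed
qed

lemma w8_tendsto:
  fixes F :: "'a filter"
  assumes t: "(\<alpha> \<longlongrightarrow> \<alpha>0) F" "(e \<longlongrightarrow> e0) F" "(f \<longlongrightarrow> f0) F" "(g \<longlongrightarrow> g0) F" "(h \<longlongrightarrow> h0) F" "(C \<longlongrightarrow> C0) F" "(D \<longlongrightarrow> D0) F"
    and z: "norm (\<alpha>0 * h0) < 1"
  shows "((\<lambda>x. \<Sum>k. w8 (\<alpha> x) (e x) (f x) (g x) (h x) (C x) (D x) k) \<longlongrightarrow> (\<Sum>k. w8 \<alpha>0 e0 f0 g0 h0 C0 D0 k)) F"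
proof -
  define R where "R = Max (insert 1 ((\<lambda>y. norm y + 1) ` {\<alpha>0, e0, f0, g0, h0, C0, D0}))"
  have "1 \<le> R" unfolding R_def by (rule Max_ge) auto
  then obtain K where K: "\<And>\<alpha> e f g h C D r k. norm \<alpha> \<le> R \<Longrightarrow> norm e \<le> R \<Longrightarrow> norm f \<le> R \<Longrightarrow>
    norm g \<le> R \<Longrightarrow> norm h \<le> R \<Longrightarrow> norm C \<le> R \<Longrightarrow> norm D \<le> R \<Longrightarrow> norm (\<alpha> * h) \<le> r \<Longrightarrow>
    norm (w8 \<alpha> e f g h C D k) \<le> K * r ^ k"
    by (rule w8_bound) blast
  obtain r where r: "norm (\<alpha>0 * h0) < r" "r < 1" using dense[OF z] by blast
  then have r0: "0 \<le> r" using le_less_trans[OF norm_ge_zero] by (metis less_imp_le)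
  have Rb: "norm \<alpha>0 + 1 \<le> R" "norm e0 + 1 \<le> R" "norm f0 + 1 \<le> R" "norm g0 + 1 \<le> R" "norm h0 + 1 \<le> R"
      "norm C0 + 1 \<le> R" "norm D0 + 1 \<le> R"
    unfolding R_def by (rule Max_ge; simp)+
  have ev: "\<forall>\<^sub>F x in F. norm (u x) \<le> R" if u: "(u \<longlongrightarrow> u0) F" "norm u0 + 1 \<le> R" for u :: "'a \<Rightarrow> complex" and u0
  proof -
    have "\<forall>\<^sub>F x in F. norm (u x) < norm u0 + 1"
      using order_tendstoD(2)[OF tendsto_norm[OF u(1)], of "norm u0 + 1"] by simp
    then show ?thesis using u(2) by (auto elim!: eventually_mono)
  qed
  have evr: "\<forall>\<^sub>F x in F. norm (\<alpha> x * h x) < r"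
    by (rule order_tendstoD(2)[OF tendsto_norm[OF tendsto_mult[OF t(1,5)]] r(1)])
  show ?thesis
  proof (rule tendsto_suminf_geo[where C = K and r = r])
    show "((\<lambda>x. w8 (\<alpha> x) (e x) (f x) (g x) (h x) (C x) (D x) k) \<longlongrightarrow> w8 \<alpha>0 e0 f0 g0 h0 C0 D0 k) F" for k
      unfolding w8_def wcoef_def vwp_def
      by (cases k) (auto intro!: tendsto_mult tendsto_power tendsto_P tendsto_Q tendsto_diff tendsto_const t)
    show "\<forall>\<^sub>F x in F. \<forall>k. norm (w8 (\<alpha> x) (e x) (f x) (g x) (h x) (C x) (D x) k) \<le> K * r ^ k"
      using ev[OF t(1) Rb(1)] ev[OF t(2) Rb(2)] ev[OF t(3) Rb(3)] ev[OF t(4) Rb(4)] ev[OF t(5) Rb(5)]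
        ev[OF t(6) Rb(6)] ev[OF t(7) Rb(7)] evr
    proof eventually_elim
      case (elim x)
      then show ?case by (intro allI K) auto
    qed
  qed (use r r0 in auto)
qed

text \<open>Here s is the dual parameter of a, the last two entries are the dual b and c times
  \<gamma>, and the argument \<alpha> h is q s / (a d \<gamma>).\<close>

definition aw8 :: "complex \<Rightarrow> complex \<Rightarrow> complex \<Rightarrow> complex \<Rightarrow> complex \<Rightarrow> complex \<Rightarrow> complex \<Rightarrow> complex" where
  "aw8 a b c d s \<gamma> x = (\<Sum>k. w8 (q / (a * d)) (a * x) (a / x) (s * \<gamma>) (s / \<gamma>) (a * b * \<gamma> / s) (a * c * \<gamma> / s) k)"

lemma aw8_inverse: "aw8 a b c d s \<gamma> (1 / x) = aw8 a b c d s \<gamma> x"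
  unfolding aw8_def w8_def by (rule suminf_cong) (simp add: mult_ac)

lemma aw8_tendsto:
  assumes "(a \<longlongrightarrow> a0) F" "(b \<longlongrightarrow> b0) F" "(c \<longlongrightarrow> c0) F" "(d \<longlongrightarrow> d0) F" "(s \<longlongrightarrow> s0) F" "(\<gamma> \<longlongrightarrow> \<gamma>0) F" "(x \<longlongrightarrow> x0) F"
    and "a0 \<noteq> 0" "d0 \<noteq> 0" "s0 \<noteq> 0" "\<gamma>0 \<noteq> 0" "x0 \<noteq> 0" and z: "norm (q * s0 / (a0 * d0 * \<gamma>0)) < 1"
  shows "((\<lambda>i. aw8 (a i) (b i) (c i) (d i) (s i) (\<gamma> i) (x i)) \<longlongrightarrow> aw8 a0 b0 c0 d0 s0 \<gamma>0 x0) F"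
  unfolding aw8_def
  by (rule w8_tendsto) (use assms in \<open>auto intro!: tendsto_intros\<close>)

lemma aw8_holomorphic:
  assumes "a \<noteq> 0" "norm (q * s / (a * d * \<gamma>)) < 1"
  shows "aw8 a b c d s \<gamma> holomorphic_on (- {0})"
proof (rule holomorphic_uniform_sequence[where f = "\<lambda>n x. \<Sum>k<n. w8 (q / (a * d)) (a * x) (a / x) (s * \<gamma>) (s / \<gamma>) (a * b * \<gamma> / s) (a * c * \<gamma> / s) k"])
  show "(\<lambda>x. \<Sum>k<n. w8 (q / (a * d)) (a * x) (a / x) (s * \<gamma>) (s / \<gamma>) (a * b * \<gamma> / s) (a * c * \<gamma> / s) k) holomorphic_on - {0}" for n
    unfolding w8_def by (intro holomorphic_intros) auto
next
  fix x :: complex assume x: "x \<in> - {0}"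
  define \<delta> where "\<delta> = norm x / 2"
  have \<delta>: "\<delta> > 0" using x by (simp add: \<delta>_def)
  have low: "norm y \<ge> \<delta>" and up: "norm y \<le> 3 * \<delta>" if "y \<in> cball x \<delta>" for y
    using that norm_triangle_ineq2[of x y] norm_triangle_ineq2[of y x] by (auto simp: dist_norm \<delta>_def norm_minus_commute)
  define R where "R = Max {1, norm (q / (a * d)), norm (s * \<gamma>), norm (s / \<gamma>), norm (a * b * \<gamma> / s), norm (a * c * \<gamma> / s), norm a * (3 * \<delta>), norm a / \<delta>}"
  have Rb: "1 \<le> R" "norm (q / (a * d)) \<le> R" "norm (s * \<gamma>) \<le> R" "norm (s / \<gamma>) \<le> R" "norm (a * b * \<gamma> / s) \<le> R" "norm (a * c * \<gamma> / s) \<le> R"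
     "norm a * (3 * \<delta>) \<le> R" "norm a / \<delta> \<le> R"
    unfolding R_def by (rule Max_ge; simp)+
  obtain K where K: "\<And>\<alpha> e f g h C D r k. norm \<alpha> \<le> R \<Longrightarrow> norm e \<le> R \<Longrightarrow> norm f \<le> R \<Longrightarrow>
    norm g \<le> R \<Longrightarrow> norm h \<le> R \<Longrightarrow> norm C \<le> R \<Longrightarrow> norm D \<le> R \<Longrightarrow> norm (\<alpha> * h) \<le> r \<Longrightarrow>
    norm (w8 \<alpha> e f g h C D k) \<le> K * r ^ k"
    by (rule w8_bound[OF Rb(1)]) blast
  have cb: "cball x \<delta> \<subseteq> - {0}" using low[of 0] \<delta> by auto
  have "uniform_limit (cball x \<delta>) (\<lambda>n x. \<Sum>k<n. w8 (q / (a * d)) (a * x) (a / x) (s * \<gamma>) (s / \<gamma>) (a * b * \<gamma> / s) (a * c * \<gamma> / s) k)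
     (aw8 a b c d s \<gamma>) sequentially"
    unfolding aw8_def
  proof (rule Weierstrass_m_test[where M = "\<lambda>k. K * norm (q * s / (a * d * \<gamma>)) ^ k"])
    fix k y assume y: "y \<in> cball x \<delta>"
    have "norm (a * y) \<le> R"
      using order_trans[OF mult_left_mono[OF up[OF y], of "norm a"] Rb(7)] by (simp add: norm_mult)
    moreover have py: "norm y > 0" using low[OF y] \<delta> by linarith
    have "norm (a / y) \<le> R"
      using order_trans[OF divide_left_mono[OF low[OF y] norm_ge_zero mult_pos_pos[OF py \<delta>]] Rb(8)]
      by (simp add: norm_divide)
    ultimately show "norm (w8 (q / (a * d)) (a * y) (a / y) (s * \<gamma>) (s / \<gamma>) (a * b * \<gamma> / s) (a * c * \<gamma> / s) k)
       \<le> K * norm (q * s / (a * d * \<gamma>)) ^ k"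
      by (intro K Rb) simp_all
  qed (use assms in \<open>auto intro!: summable_mult summable_geometric\<close>)
  then show "\<exists>\<delta>>0. cball x \<delta> \<subseteq> - {0} \<and> uniform_limit (cball x \<delta>) (\<lambda>n x. \<Sum>k<n. w8 (q / (a * d)) (a * x) (a / x) (s * \<gamma>) (s / \<gamma>) (a * b * \<gamma> / s) (a * c * \<gamma> / s) k)
     (aw8 a b c d s \<gamma>) sequentially"
    using \<delta> cb by blast
qed auto

section \<open>The Askey-Wilson operator and the eigenvalue equation at generic parameters\<close>

definition AA :: "complex \<Rightarrow> complex \<Rightarrow> complex \<Rightarrow> complex \<Rightarrow> complex \<Rightarrow> complex" where
  "AA a b c d x = (1 - a * x) * (1 - b * x) * (1 - c * x) * (1 - d * x) / ((1 - x ^ 2) * (1 - q * x ^ 2))"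

definition Lop :: "complex \<Rightarrow> complex \<Rightarrow> complex \<Rightarrow> complex \<Rightarrow> (complex \<Rightarrow> complex) \<Rightarrow> complex \<Rightarrow> complex" where
  "Lop a b c d f x = AA a b c d x * (f (q * x) - f x) + AA a b c d (1 / x) * (f (x / q) - f x)"

text \<open>The left-hand side vanishes at x = 1 and x = -1. The extracted factor 1 - x^2 removes
  the common pole of the two coefficients of the operator; r stands for a t.\<close>

lemma aw_poly:
  fixes r b c d x :: complex
  shows "r * ((x - r) * (x - b) * (x - c) * (x - d) - (1 - r * x) * (1 - b * x) * (1 - c * x) * (1 - d * x)) =
    (1 - x ^ 2) * ((1 - b * c * d * r) * (1 - r * x) * (x - r) - x * (1 - b * r) * (1 - c * r) * (1 - d * r))"
  by (simp add: algebra_simps power2_eq_square)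

text \<open>The operator is bidiagonal on the functions (ax, a/x; q)_n. Here t is in the place of
  q^(n-1), y is the function of degree n - 1, and v, vp, vm are the one of degree n at x, q x and x
  / q. A free t covers the shifted lattice of the second balanced series as well. The conditions on
  vp and vm are multiplied out so that a x = 1 and x = a remain admissible.\<close>

lemma Lop_step:
  assumes nz: "x \<noteq> 0" "t \<noteq> 0" "x ^ 2 \<noteq> 1" "q * x ^ 2 \<noteq> 1" "x ^ 2 \<noteq> q"
    and v: "v = y * (1 - a * x * t) * (1 - a * t / x)"
    and vp: "(1 - a * x) * vp = y * (1 - a / (q * x)) * (1 - a * x * t) * (1 - a * x * (q * t))"
    and vm: "(1 - a / x) * vm = y * (1 - a * x / q) * (1 - a * t / x) * (1 - a * (q * t) / x)"
  shows "AA a b c d x * (vp - v) + AA a b c d (1 / x) * (vm - v) =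
    (1 - q * t) * (1 - a * b * c * d * t) / (q * t) * v
     - (1 - q * t) * (1 - a * b * t) * (1 - a * c * t) * (1 - a * d * t) / (q * t) * y"
proof -
  define k where "k = (1 - q * t) * a / q * y / (1 - x ^ 2)"
  have n1: "1 - x ^ 2 \<noteq> 0" "1 - q * x ^ 2 \<noteq> 0" "x ^ 2 - q \<noteq> 0" using nz by auto
  have "(1 - a * x) * (vp - v) = (1 - a * x) * vp - (1 - a * x) * v" by (rule right_diff_distrib)
  also have "\<dots> = y * (1 - a * x * t) * ((1 - a / (q * x)) * (1 - a * x * (q * t))) - y * (1 - a * x * t) * ((1 - a * x) * (1 - a * t / x))"
    unfolding vp v by (simp only: mult_ac)
  also have "\<dots> = y * (1 - a * x * t) * ((1 - a / (q * x)) * (1 - a * x * (q * t)) - (1 - a * x) * (1 - a * t / x))"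
    by (rule right_diff_distrib[symmetric])
  also have "(1 - a / (q * x)) * (1 - a * x * (q * t)) - (1 - a * x) * (1 - a * t / x) = - ((1 - q * t) * a * (1 - q * x ^ 2) / (q * x))"
    using nz q0 by (simp add: divide_simps) (simp add: algebra_simps power2_eq_square)
  finally have 1: "(1 - a * x) * (vp - v) = y * (1 - a * x * t) * - ((1 - q * t) * a * (1 - q * x ^ 2) / (q * x))" .
  have "AA a b c d x * (vp - v) = ((1 - a * x) * (vp - v)) * ((1 - b * x) * (1 - c * x) * (1 - d * x)) / ((1 - x ^ 2) * (1 - q * x ^ 2))"
    unfolding AA_def by simp
  also have "\<dots> = - k * ((1 - a * x * t) * ((1 - b * x) * (1 - c * x) * (1 - d * x)) / x)"
    unfolding 1 k_def using n1 by (simp add: mult_ac)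
  finally have A: "AA a b c d x * (vp - v) = - k * ((1 - a * x * t) * ((1 - b * x) * (1 - c * x) * (1 - d * x)) / x)" .
  have "(1 - a / x) * (vm - v) = (1 - a / x) * vm - (1 - a / x) * v" by (rule right_diff_distrib)
  also have "\<dots> = y * (1 - a * t / x) * ((1 - a * x / q) * (1 - a * (q * t) / x)) - y * (1 - a * t / x) * ((1 - a / x) * (1 - a * x * t))"
    unfolding vm v by (simp only: mult_ac)
  also have "\<dots> = y * (1 - a * t / x) * ((1 - a * x / q) * (1 - a * (q * t) / x) - (1 - a / x) * (1 - a * x * t))"
    by (rule right_diff_distrib[symmetric])
  also have "(1 - a * x / q) * (1 - a * (q * t) / x) - (1 - a / x) * (1 - a * x * t) = (1 - q * t) * a * (q - x ^ 2) / (q * x)"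
    using nz q0 by (simp add: divide_simps) (simp add: algebra_simps power2_eq_square)
  finally have 2: "(1 - a / x) * (vm - v) = y * (1 - a * t / x) * ((1 - q * t) * a * (q - x ^ 2) / (q * x))" .
  have den: "(1 - (1 / x) ^ 2) * (1 - q * (1 / x) ^ 2) = (1 - x ^ 2) * (q - x ^ 2) / x ^ 4"
    using nz by (simp add: divide_simps) (simp add: algebra_simps power_numeral_reduce)
  have num: "(1 - b * (1 / x)) * (1 - c * (1 / x)) * (1 - d * (1 / x)) = (x - b) * (x - c) * (x - d) / x ^ 3"
    using nz by (simp add: divide_simps) (simp add: algebra_simps power_numeral_reduce)
  have "AA a b c d (1 / x) * (vm - v) = ((1 - a / x) * (vm - v)) * ((x - b) * (x - c) * (x - d) / x ^ 3) / ((1 - x ^ 2) * (q - x ^ 2) / x ^ 4)"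
    unfolding num[symmetric] den[symmetric] AA_def by simp
  also have "\<dots> = k * ((1 - a * t / x) * ((x - b) * (x - c) * (x - d)))"
    unfolding 2 k_def using n1 nz by (simp add: divide_simps) (simp add: algebra_simps power_numeral_reduce)
  finally have B: "AA a b c d (1 / x) * (vm - v) = k * ((1 - a * t / x) * ((x - b) * (x - c) * (x - d)))" .
  have "AA a b c d x * (vp - v) + AA a b c d (1 / x) * (vm - v) = (1 - q * t) * y / (q * t * x * (1 - x ^ 2)) *
     ((a * t) * ((x - a * t) * (x - b) * (x - c) * (x - d) - (1 - (a * t) * x) * (1 - b * x) * (1 - c * x) * (1 - d * x)))"
    unfolding A B k_def using nz n1 q0 by (simp add: divide_simps) (simp add: algebra_simps power2_eq_square)
  also have "\<dots> = (1 - q * t) * y / (q * t * x) *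
     ((1 - b * c * d * (a * t)) * (1 - (a * t) * x) * (x - a * t) - x * (1 - b * (a * t)) * (1 - c * (a * t)) * (1 - d * (a * t)))"
    unfolding aw_poly using n1 by (simp add: mult_ac)
  also have "\<dots> = (1 - q * t) * (1 - a * b * c * d * t) / (q * t) * v
     - (1 - q * t) * (1 - a * b * t) * (1 - a * c * t) * (1 - a * d * t) / (q * t) * y"
  proof -
    have vv: "v = y * (1 - (a * t) * x) * (x - a * t) / x"
      unfolding v using nz by (simp add: field_simps)
    show ?thesis unfolding vv using nz q0 by (simp add: divide_simps) (simp add: algebra_simps)
  qed
  finally show ?thesis .
qed

text \<open>Coefficients common to the two balanced series, with \<sigma> = 1 for the first and
  \<sigma> = q/(ad) for the second.\<close>

definition lmu :: "complex \<Rightarrow> complex \<Rightarrow> complex \<Rightarrow> complex \<Rightarrow> complex \<Rightarrow> complex \<Rightarrow> complex \<Rightarrow> nat \<Rightarrow> complex" where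
  "lmu a b c d g h \<sigma> n = (Q (\<sigma> * q * q ^ n) * Q (a * d * \<sigma> * q ^ n) * Q (a * b * \<sigma> * q ^ n) * Q (a * c * \<sigma> * q ^ n)) * (P n (\<sigma> * g) * P n (\<sigma> * h))"

text \<open>Because of the bidiagonal action, operator minus eigenvalue turns the series into a
  telescoping one. The condition \<open>r0\<close> says that no term of index -1 is produced. What
  remains is the limit of the partial sums, where the infinite products in \<open>lmu\<close> have
  tended to 1.\<close>

lemma lmu_telescope:
  assumes nz: "x \<noteq> 0" "\<sigma> \<noteq> 0" "x ^ 2 \<noteq> 1" "q * x ^ 2 \<noteq> 1" "x ^ 2 \<noteq> q" and gh: "q * (g * h) = a * b * c * d"
    and r1: "\<And>n. v (Suc n) = v n * (1 - a * x * (\<sigma> * q ^ n)) * (1 - a * (\<sigma> * q ^ n) / x)"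
    and r2: "\<And>n. (1 - a * x) * vp (Suc n) = v n * (1 - a / (q * x)) * (1 - a * x * (\<sigma> * q ^ n)) * (1 - a * x * (q * (\<sigma> * q ^ n)))"
    and r3: "\<And>n. (1 - a / x) * vm (Suc n) = v n * (1 - a * x / q) * (1 - a * (\<sigma> * q ^ n) / x) * (1 - a * (q * (\<sigma> * q ^ n)) / x)"
    and r0: "\<sigma> * (AA a b c d x * (vp 0 - v 0) + AA a b c d (1 / x) * (vm 0 - v 0)) = (1 - \<sigma>) * (1 - g * h * \<sigma>) * v 0"
    and lim: "v \<longlonglongrightarrow> V"
  shows "(\<lambda>n. \<sigma> * q ^ n * lmu a b c d g h \<sigma> n * (AA a b c d x * (vp n - v n) + AA a b c d (1 / x) * (vm n - v n)
     - (g + h - 1 - g * h) * v n)) sums (Q (\<sigma> * g) * Q (\<sigma> * h) * V)"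
proof -
  define G where "G n = (Q (\<sigma> * q * q ^ n) * Q (a * d * \<sigma> * q ^ n) * Q (a * b * \<sigma> * q ^ n) * Q (a * c * \<sigma> * q ^ n)) *
     (P (Suc n) (\<sigma> * g) * P (Suc n) (\<sigma> * h)) * v n" for n
  let ?L = "\<lambda>n. AA a b c d x * (vp n - v n) + AA a b c d (1 / x) * (vm n - v n)"
  let ?T = "\<lambda>n. \<sigma> * q ^ n * lmu a b c d g h \<sigma> n * (?L n - (g + h - 1 - g * h) * v n)"
  have P1: "P (Suc n) (\<sigma> * y) = P n (\<sigma> * y) * (1 - y * (\<sigma> * q ^ n))" for n y
    by (simp add: qpoch_Suc mult_ac)
  have T0: "?T 0 = G 0"
  proof -
    have "?T 0 = lmu a b c d g h \<sigma> 0 * (\<sigma> * ?L 0 - \<sigma> * (g + h - 1 - g * h) * v 0)"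
      by (simp only: power_0 mult_1_right) (simp add: algebra_simps)
    also have "\<dots> = lmu a b c d g h \<sigma> 0 * (1 - g * \<sigma>) * (1 - h * \<sigma>) * v 0"
      unfolding r0 by (simp add: algebra_simps)
    finally show ?thesis by (simp add: G_def lmu_def qpoch_Suc mult_ac)
  qed
  have TS: "?T (Suc n) = G (Suc n) - G n" for n
  proof -
    define t where "t = \<sigma> * q ^ n"
    define X where "X = Q (\<sigma> * q * q ^ Suc n) * Q (a * d * \<sigma> * q ^ Suc n) * Q (a * b * \<sigma> * q ^ Suc n) * Q (a * c * \<sigma> * q ^ Suc n)"
    define Y where "Y = P (Suc n) (\<sigma> * g) * P (Suc n) (\<sigma> * h)"
    have t: "t \<noteq> 0" "\<sigma> * q ^ Suc n = q * t" using nz q0 by (auto simp: t_def)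
    have L: "?L (Suc n) = (1 - q * t) * (1 - a * b * c * d * t) / (q * t) * v (Suc n)
        - (1 - q * t) * (1 - a * b * t) * (1 - a * c * t) * (1 - a * d * t) / (q * t) * v n"
      by (rule Lop_step) (use nz t(1) r1[of n] r2[of n] r3[of n] in \<open>simp_all add: t_def\<close>)
    have sh: "Q (\<sigma> * q * q ^ n) = (1 - q * t) * Q (\<sigma> * q * q ^ Suc n)"
       "Q (a * d * \<sigma> * q ^ n) = (1 - a * d * t) * Q (a * d * \<sigma> * q ^ Suc n)"
       "Q (a * b * \<sigma> * q ^ n) = (1 - a * b * t) * Q (a * b * \<sigma> * q ^ Suc n)"
       "Q (a * c * \<sigma> * q ^ n) = (1 - a * c * t) * Q (a * c * \<sigma> * q ^ Suc n)"
      unfolding t_def by (subst Q_rec, simp add: mult_ac)+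
    have Gn: "G n = X * Y * ((1 - q * t) * (1 - a * b * t) * (1 - a * c * t) * (1 - a * d * t) * v n)"
      unfolding G_def X_def Y_def sh by (simp only: mult_ac)
    have GS: "G (Suc n) = X * Y * ((1 - g * (q * t)) * (1 - h * (q * t)) * v (Suc n))"
      unfolding G_def X_def Y_def P1[of "Suc n"] t(2) by (simp only: mult_ac)
    have "?T (Suc n) = X * Y * ((q * t) * ?L (Suc n) - (q * t) * (g + h - 1 - g * h) * v (Suc n))"
      unfolding lmu_def X_def[symmetric] Y_def[symmetric] t(2) by (simp add: algebra_simps)
    also have "(q * t) * ?L (Suc n) = (1 - q * t) * (1 - a * b * c * d * t) * v (Suc n)
        - (1 - q * t) * (1 - a * b * t) * (1 - a * c * t) * (1 - a * d * t) * v n"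
      unfolding L using t(1) q0 by (simp add: divide_simps)
    also have "X * Y * ((1 - q * t) * (1 - a * b * c * d * t) * v (Suc n)
        - (1 - q * t) * (1 - a * b * t) * (1 - a * c * t) * (1 - a * d * t) * v n - (q * t) * (g + h - 1 - g * h) * v (Suc n))
       = G (Suc n) - G n"
      unfolding Gn GS gh[symmetric] by (simp add: algebra_simps)
    finally show ?thesis .
  qed
  have "(\<Sum>n<Suc N. ?T n) = G N" for N
  proof (induction N)
    case 0
    then show ?case using T0 by simp
  next
    case (Suc N)
    then show ?case using TS[of N] by (simp only: sum.lessThan_Suc[of _ "Suc N"]) simp
  qed
  moreover have "G \<longlonglongrightarrow> (1 * 1 * 1 * 1) * (Q (\<sigma> * g) * Q (\<sigma> * h)) * V"
    unfolding G_def by (intro tendsto_mult Q_pow_tendsto_1 LIMSEQ_Suc[OF P_LIMSEQ] lim)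
  ultimately have "(\<lambda>N. \<Sum>n<Suc N. ?T n) \<longlonglongrightarrow> Q (\<sigma> * g) * Q (\<sigma> * h) * V" by simp
  then show ?thesis unfolding sums_def by (rule LIMSEQ_imp_Suc)
qed

definition awf :: "complex \<Rightarrow> complex \<Rightarrow> complex \<Rightarrow> complex \<Rightarrow> complex \<Rightarrow> complex \<Rightarrow> complex \<Rightarrow> complex" where
  "awf a b c d s \<gamma> x = aw8 a b c d s \<gamma> x / (Q (q * x / d) * Q (q / (d * x)))"

text \<open>Bailey's relation at \<alpha> = q/(ad), divided by the products depending on x. The
  prefactor of the second series stays inside its terms: together with the finite products it forms
  the functions on which the operator acts.\<close>

lemma awf_bailey:
  assumes nz: "a \<noteq> 0" "d \<noteq> 0" "s \<noteq> 0" "\<gamma> \<noteq> 0" and s: "q * s ^ 2 = a * b * c * d"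
    and z: "norm (q * s / (a * d * \<gamma>)) < 1" and Qn: "Q (a * b) \<noteq> 0" "Q (a * c) \<noteq> 0" "Q (a * d) \<noteq> 0" "Q (q / (a * d)) \<noteq> 0"
      "Q (q * (s * \<gamma>) / (a * d)) \<noteq> 0"
    and x: "x \<noteq> 0" "Q (q * x / d) \<noteq> 0" "Q (q / (d * x)) \<noteq> 0"
  defines "\<alpha> \<equiv> q / (a * d)"
  shows "awf a b c d s \<gamma> x = Q (a * a * b * c * \<gamma> / s) * Q (q * (s * \<gamma>) / (a * d)) / (Q (a * d) * Q (q / (a * d))) *
     ((\<Sum>n. 1 * q ^ n * lmu a b c d (s * \<gamma>) (s / \<gamma>) 1 n * (P n (a * x) * P n (a / x)))
      - Q (s * \<gamma>) * Q (s / \<gamma>) / (Q (\<alpha> * (s * \<gamma>)) * Q (\<alpha> * (s / \<gamma>))) *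
      (\<Sum>n. \<alpha> * q ^ n * lmu a b c d (s * \<gamma>) (s / \<gamma>) \<alpha> n * (Q (a * x) * Q (a / x) / (Q (\<alpha> * (a * x)) * Q (\<alpha> * (a / x))) * (P n (\<alpha> * (a * x)) * P n (\<alpha> * (a / x))))))"
    (is "_ = ?K * ((\<Sum>n. ?M1 n) - ?rho * (\<Sum>n. ?M2 n))")
    and "summable (\<lambda>n. 1 * q ^ n * lmu a b c d (s * \<gamma>) (s / \<gamma>) 1 n * (P n (a * x) * P n (a / x)))"
    and "summable (\<lambda>n. \<alpha> * q ^ n * lmu a b c d (s * \<gamma>) (s / \<gamma>) \<alpha> n * (Q (a * x) * Q (a / x) / (Q (\<alpha> * (a * x)) * Q (\<alpha> * (a / x))) * (P n (\<alpha> * (a * x)) * P n (\<alpha> * (a / x)))))"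
proof -
  let ?C = "a * b * \<gamma> / s" and ?D = "a * c * \<gamma> / s" and ?h = "s / \<gamma>" and ?g = "s * \<gamma>"
  have \<alpha>0: "\<alpha> \<noteq> 0" using nz q0 by (simp add: \<alpha>_def)
  have hC: "?h * ?C = a * b" "?h * ?D = a * c" using nz by simp_all
  have hCD: "?h * ?C * ?D = a * a * b * c * \<gamma> / s" using nz by simp
  have B: "?h * ?C * ?D = \<alpha> * (a * x) * (a / x) * ?g"
  proof -
    have "a * a * b * c * \<gamma> / s = a * (a * b * c * d) * \<gamma> / (s * d)" using nz by simp
    also have "\<dots> = \<alpha> * (a * x) * (a / x) * ?g"
      unfolding s[symmetric] \<alpha>_def using nz x by (simp add: field_simps power2_eq_square)
    finally show ?thesis unfolding hCD .
  qed
  have ah: "norm (\<alpha> * ?h) < 1" using z by (simp add: \<alpha>_def mult_ac)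
  have al: "\<alpha> * (a * x) = q * x / d" "\<alpha> * (a / x) = q / (d * x)" "\<alpha> * ?g = q * (s * \<gamma>) / (a * d)" "q / \<alpha> = a * d"
    using nz x q0 by (simp_all add: \<alpha>_def)
  have bl: "blat \<alpha> (a * x) (a / x) ?g ?h ?C ?D \<sigma> n = \<sigma> * q ^ n * lmu a b c d ?g ?h \<sigma> n * (P n (\<sigma> * (a * x)) * P n (\<sigma> * (a / x)))" for \<sigma> n
  proof -
    have "\<sigma> / \<alpha> * q * q ^ n = a * d * \<sigma> * q ^ n" using q0 by (simp add: \<alpha>_def)
    then show ?thesis unfolding blat_def bw_def lmu_def hC by (simp only: mult_ac)
  qed
  have hh: "Q (?h * ?C) \<noteq> 0" "Q (?h * ?D) \<noteq> 0" using Qn by (simp_all only: hC) auto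
  note ba = bailey[OF \<alpha>0 ah B hh]
  have sm: "summable (blat \<alpha> (a * x) (a / x) ?g ?h ?C ?D 1)" "summable (blat \<alpha> (a * x) (a / x) ?g ?h ?C ?D \<alpha>)"
    using ba(2,3) .
  define w where "w = Q (a * x) * Q (a / x) / (Q (\<alpha> * (a * x)) * Q (\<alpha> * (a / x)))"
  have M2: "?M2 n = w * blat \<alpha> (a * x) (a / x) ?g ?h ?C ?D \<alpha> n" for n
    unfolding bl w_def by (simp only: mult_ac)
  have M1: "?M1 n = blat \<alpha> (a * x) (a / x) ?g ?h ?C ?D 1 n" for n
    unfolding bl by simp
  show "summable ?M1" unfolding M1 using sm(1) by simp
  show "summable ?M2" unfolding M2 using summable_mult[OF sm(2), of w] by simp
  have sM2: "(\<Sum>n. ?M2 n) = w * (\<Sum>n. blat \<alpha> (a * x) (a / x) ?g ?h ?C ?D \<alpha> n)"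
    unfolding M2 by (rule suminf_mult[OF sm(2)])
  have nzs: "Q (\<alpha> * (a * x)) \<noteq> 0" "Q (\<alpha> * (a / x)) \<noteq> 0" "Q (\<alpha> * ?g) \<noteq> 0" "Q (\<alpha> * ?h) \<noteq> 0" "Q (q / \<alpha>) \<noteq> 0" "Q \<alpha> \<noteq> 0"
    using x Qn Q_nz[OF ah] by (simp_all only: al) (auto simp: \<alpha>_def)
  have alg: "W / (e * f) = B * g / (u * v) * (A1 - ga * h' / (g * h) * (ee * ff / (e * f) * A2))"
    if "B * (e * f * g * h * A1 - ee * ff * ga * h' * A2) = h * u * v * W" "e \<noteq> 0" "f \<noteq> 0" "g \<noteq> 0" "h \<noteq> 0" "u \<noteq> 0" "v \<noteq> 0"
    for W e f B g u v A1 ga h' h ee ff A2 :: complex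
  proof -
    have "W = B * (e * f * g * h * A1 - ee * ff * ga * h' * A2) / (h * u * v)" unfolding that(1) using that by simp
    then show ?thesis using that(2-7) by (simp add: divide_simps) (simp add: algebra_simps)
  qed
  have "awf a b c d s \<gamma> x = (\<Sum>k. w8 \<alpha> (a * x) (a / x) ?g ?h ?C ?D k) / (Q (\<alpha> * (a * x)) * Q (\<alpha> * (a / x)))"
    unfolding awf_def aw8_def al \<alpha>_def[symmetric] ..
  also have "\<dots> = Q (?h * ?C * ?D) * Q (\<alpha> * ?g) / (Q (q / \<alpha>) * Q \<alpha>) *
     ((\<Sum>n. blat \<alpha> (a * x) (a / x) ?g ?h ?C ?D 1 n) - Q ?g * Q ?h / (Q (\<alpha> * ?g) * Q (\<alpha> * ?h)) *
       (Q (a * x) * Q (a / x) / (Q (\<alpha> * (a * x)) * Q (\<alpha> * (a / x))) * (\<Sum>n. blat \<alpha> (a * x) (a / x) ?g ?h ?C ?D \<alpha> n)))"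
    by (rule alg[OF ba(1) nzs])
  finally show "awf a b c d s \<gamma> x = ?K * ((\<Sum>n. ?M1 n) - ?rho * (\<Sum>n. ?M2 n))"
    unfolding sM2 M1 unfolding w_def[symmetric] hCD al(4) by (simp only: al(3) \<alpha>_def[symmetric])
qed

text \<open>The analogue of (e, f; q)_(\<nu>+n) with q^\<nu> = \<alpha>, namely Q e Q f over the
  infinite products at \<alpha> e q^n and \<alpha> f q^n. It has the same limit as the basis (e, f;
  q)_n of the first series.\<close>

definition lw :: "complex \<Rightarrow> complex \<Rightarrow> complex \<Rightarrow> nat \<Rightarrow> complex" where
  "lw \<alpha> e f n = Q e * Q f / (Q (\<alpha> * e) * Q (\<alpha> * f)) * (P n (\<alpha> * e) * P n (\<alpha> * f))"

text \<open>The effect of x -> q x on the basis, with e = a x and f = a / x, in the multiplied form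
  that \<open>Lop_step\<close> asks for.\<close>

lemma P_swap_shift:
  "(1 - e) * (P (Suc n) (e * q) * P (Suc n) (f / q)) = P n e * P n f * (1 - f / q) * (1 - e * q ^ n) * (1 - e * q * q ^ n)"
proof -
  have 1: "(1 - e) * P (Suc n) (e * q) = P n e * (1 - e * q ^ n) * (1 - e * q * q ^ n)"
    unfolding qpoch_Suc_left[symmetric] by (simp add: qpoch_Suc mult_ac)
  have 2: "P (Suc n) (f / q) = (1 - f / q) * P n f"
    unfolding qpoch_Suc_left using q0 by simp
  have "(1 - e) * (P (Suc n) (e * q) * P (Suc n) (f / q)) = ((1 - e) * P (Suc n) (e * q)) * P (Suc n) (f / q)"
    by (simp only: mult.assoc)
  then show ?thesis unfolding 1 2 by (simp only: mult_ac)
qed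

lemma lw_0_shift:
  assumes "Q (\<alpha> * e) \<noteq> 0" "1 - \<alpha> * f / q \<noteq> 0"
  shows "(1 - e) * (Q (e * q) * Q (f / q) / (Q (\<alpha> * (e * q)) * Q (\<alpha> * (f / q)))) =
     Q e * Q f / (Q (\<alpha> * e) * Q (\<alpha> * f)) * ((1 - f / q) * (1 - \<alpha> * e) / (1 - \<alpha> * f / q))"
proof -
  have 1: "Q e = (1 - e) * Q (e * q)" "Q (\<alpha> * e) = (1 - \<alpha> * e) * Q (\<alpha> * (e * q))"
    by (subst Q_rec, simp add: mult_ac)+
  have 2: "Q (f / q) = (1 - f / q) * Q f" "Q (\<alpha> * (f / q)) = (1 - \<alpha> * f / q) * Q (\<alpha> * f)"
    using q0 by (subst Q_rec, simp)+
  have "1 - \<alpha> * e \<noteq> 0" using assms(1) 1(2) by auto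
  then show ?thesis unfolding 1 2 using assms by (simp add: mult_ac)
qed

lemma lw_shift:
  assumes "Q (\<alpha> * e) \<noteq> 0" "1 - \<alpha> * f / q \<noteq> 0"
  shows "(1 - e) * lw \<alpha> (e * q) (f / q) (Suc n) = lw \<alpha> e f n * (1 - f / q) * (1 - \<alpha> * e * q ^ n) * (1 - \<alpha> * e * q * q ^ n)"
proof -
  define u where "u = 1 - \<alpha> * f / q"
  have u: "u \<noteq> 0" using assms(2) by (simp add: u_def)
  have "(1 - e) * lw \<alpha> (e * q) (f / q) (Suc n) = ((1 - e) * (Q (e * q) * Q (f / q) / (Q (\<alpha> * (e * q)) * Q (\<alpha> * (f / q))))) *
     (P (Suc n) (\<alpha> * e * q) * P (Suc n) (\<alpha> * f / q))"
  proof -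
    have ar: "P (Suc n) (\<alpha> * (e * q)) = P (Suc n) (\<alpha> * e * q)" "P (Suc n) (\<alpha> * (f / q)) = P (Suc n) (\<alpha> * f / q)"
      by (simp_all add: mult.assoc)
    show ?thesis unfolding lw_def ar by (rule mult.assoc[symmetric])
  qed
  also have "\<dots> = Q e * Q f / (Q (\<alpha> * e) * Q (\<alpha> * f)) * (1 - f / q) / (1 - \<alpha> * f / q) *
     ((1 - \<alpha> * e) * (P (Suc n) (\<alpha> * e * q) * P (Suc n) (\<alpha> * f / q)))"
    unfolding lw_0_shift[OF assms] by (simp only: times_divide_eq_right times_divide_eq_left mult_ac)
  also have "\<dots> = lw \<alpha> e f n * (1 - f / q) * (1 - \<alpha> * e * q ^ n) * (1 - \<alpha> * e * q * q ^ n)"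
    unfolding P_swap_shift lw_def u_def[symmetric] using u by (simp add: mult_ac)
  finally show ?thesis .
qed

lemma lw_LIMSEQ:
  assumes "Q (\<alpha> * e) \<noteq> 0" "Q (\<alpha> * f) \<noteq> 0"
  shows "lw \<alpha> e f \<longlonglongrightarrow> Q e * Q f"
proof -
  have "lw \<alpha> e f \<longlonglongrightarrow> Q e * Q f / (Q (\<alpha> * e) * Q (\<alpha> * f)) * (Q (\<alpha> * e) * Q (\<alpha> * f))"
    unfolding lw_def[abs_def] by (intro tendsto_mult tendsto_const P_LIMSEQ)
  then show ?thesis using assms by simp
qed

text \<open>Neither balanced series is an eigenfunction by itself. Each leaves an inhomogeneous term
  proportional to (ax, a/x; q)_infinity, and the coefficient \<rho> in Bailey's combination is
  precisely the one that cancels the two.\<close>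

lemma awf_eigen_generic:
  assumes nz: "a \<noteq> 0" "d \<noteq> 0" "s \<noteq> 0" "\<gamma> \<noteq> 0" and s: "q * s ^ 2 = a * b * c * d"
    and z: "norm (q * s / (a * d * \<gamma>)) < 1" and Qn: "Q (a * b) \<noteq> 0" "Q (a * c) \<noteq> 0" "Q (a * d) \<noteq> 0" "Q (q / (a * d)) \<noteq> 0"
      "Q (q * (s * \<gamma>) / (a * d)) \<noteq> 0"
    and x: "x \<noteq> 0" "Q (x / d) \<noteq> 0" "Q (1 / (d * x)) \<noteq> 0" "x ^ 2 \<noteq> 1" "q * x ^ 2 \<noteq> 1" "x ^ 2 \<noteq> q"
  shows "Lop a b c d (awf a b c d s \<gamma>) x = (s * \<gamma> + s / \<gamma> - 1 - s ^ 2) * awf a b c d s \<gamma> x"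
proof -
  define \<alpha> where "\<alpha> = q / (a * d)"
  define g where "g = s * \<gamma>"
  define h where "h = s / \<gamma>"
  have gh: "q * (g * h) = a * b * c * d" "g * h = s ^ 2"
    using s nz by (simp_all add: g_def h_def power2_eq_square)
  have \<alpha>0: "\<alpha> \<noteq> 0" using nz q0 by (simp add: \<alpha>_def)
  have al: "\<alpha> * (a * y) = q * y / d" "\<alpha> * (a / y) = q / (d * y)" for y
    using nz by (simp_all add: \<alpha>_def)
  have x1: "1 - x / d \<noteq> 0" "Q (q * x / d) \<noteq> 0" "Q (q * (q * x) / d) \<noteq> 0"
    using x(2) Q_rec[of "x / d"] Q_rec[of "q * x / d"] by (auto simp: mult_ac)
  have x2: "1 - 1 / (d * x) \<noteq> 0" "Q (q / (d * x)) \<noteq> 0" "Q (q * q / (d * x)) \<noteq> 0"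
    using x(3) Q_rec[of "1 / (d * x)"] Q_rec[of "q / (d * x)"] by (auto simp: mult_ac)
  have x3: "q * x \<noteq> 0" "Q (q / (d * (q * x))) \<noteq> 0" "x / q \<noteq> 0" "Q (q * (x / q) / d) \<noteq> 0" "Q (q / (d * (x / q))) \<noteq> 0"
    using x q0 x2 by (simp_all add: mult_ac)
  define A where "A = AA a b c d x"
  define A' where "A' = AA a b c d (1 / x)"
  define K where "K = Q (a * a * b * c * \<gamma> / s) * Q (q * (s * \<gamma>) / (a * d)) / (Q (a * d) * Q (q / (a * d)))"
  define \<rho> where "\<rho> = Q g * Q h / (Q (\<alpha> * g) * Q (\<alpha> * h))"
  define m1 where "m1 y n = 1 * q ^ n * lmu a b c d g h 1 n * (P n (a * y) * P n (a / y))" for y n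
  define m2 where "m2 y n = \<alpha> * q ^ n * lmu a b c d g h \<alpha> n * lw \<alpha> (a * y) (a / y) n" for y n
  have F: "awf a b c d s \<gamma> y = K * ((\<Sum>n. m1 y n) - \<rho> * (\<Sum>n. m2 y n))" "summable (m1 y)" "summable (m2 y)"
    if y: "y \<noteq> 0" "Q (q * y / d) \<noteq> 0" "Q (q / (d * y)) \<noteq> 0" for y
  proof -
    note * = awf_bailey[OF nz s z Qn y, folded \<alpha>_def g_def h_def]
    show "awf a b c d s \<gamma> y = K * ((\<Sum>n. m1 y n) - \<rho> * (\<Sum>n. m2 y n))"
      using *(1) unfolding K_def \<rho>_def m1_def m2_def lw_def g_def h_def \<alpha>_def .
    show "summable (m1 y)" "summable (m2 y)"
      using *(2,3) unfolding m1_def[abs_def] m2_def[abs_def] lw_def .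
  qed
  note F0 = F[OF x(1) x1(2) x2(2)] and F1 = F[OF x3(1) x1(3) x3(2)] and F2 = F[OF x3(3,4,5)]
  let ?\<Lambda> = "g + h - 1 - g * h"
  have S1: "(\<lambda>n. 1 * q ^ n * lmu a b c d g h 1 n * (A * (P n (a * (q * x)) * P n (a / (q * x)) - P n (a * x) * P n (a / x))
      + A' * (P n (a * (x / q)) * P n (a / (x / q)) - P n (a * x) * P n (a / x)) - ?\<Lambda> * (P n (a * x) * P n (a / x)))) sums
     (Q (1 * g) * Q (1 * h) * (Q (a * x) * Q (a / x)))"
    unfolding A_def A'_def
  proof (rule lmu_telescope)
    fix n
    show "P (Suc n) (a * x) * P (Suc n) (a / x) = P n (a * x) * P n (a / x) * (1 - a * x * (1 * q ^ n)) * (1 - a * (1 * q ^ n) / x)"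
      by (simp add: qpoch_Suc mult_ac)
    have e: "a * (q * x) = a * x * q" "a / (q * x) = a / x / q" "a * (x / q) = a * x / q" "a / (x / q) = a / x * q"
      by (simp_all add: mult_ac)
    show "(1 - a * x) * (P (Suc n) (a * (q * x)) * P (Suc n) (a / (q * x))) = P n (a * x) * P n (a / x) * (1 - a / (q * x)) *
        (1 - a * x * (1 * q ^ n)) * (1 - a * x * (q * (1 * q ^ n)))"
      unfolding e P_swap_shift by (simp add: mult_ac)
    have "(1 - a / x) * (P (Suc n) (a * (x / q)) * P (Suc n) (a / (x / q))) = (1 - a / x) * (P (Suc n) (a / x * q) * P (Suc n) (a * x / q))"
      unfolding e by (simp only: mult_ac)
    then show "(1 - a / x) * (P (Suc n) (a * (x / q)) * P (Suc n) (a / (x / q))) = P n (a * x) * P n (a / x) * (1 - a * x / q) *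
        (1 - a * (1 * q ^ n) / x) * (1 - a * (q * (1 * q ^ n)) / x)"
      unfolding P_swap_shift by (simp add: mult_ac)
    show "(\<lambda>n. P n (a * x) * P n (a / x)) \<longlonglongrightarrow> Q (a * x) * Q (a / x)"
      by (intro tendsto_mult P_LIMSEQ)
  qed (use x gh in auto)
  have nz2: "Q (\<alpha> * (a * x)) \<noteq> 0" "Q (\<alpha> * (a / x)) \<noteq> 0" "1 - \<alpha> * (a * x) / q \<noteq> 0" "1 - \<alpha> * (a / x) / q \<noteq> 0"
    unfolding al using x1 x2 q0 by simp_all
  have e: "a * (q * x) = a * x * q" "a / (q * x) = a / x / q" "a * (x / q) = a * x / q" "a / (x / q) = a / x * q"
    by (simp_all add: mult_ac)
  have comm: "lw \<alpha> e f n = lw \<alpha> f e n" for e f n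
    unfolding lw_def by (simp only: mult_ac)
  have S2: "(\<lambda>n. \<alpha> * q ^ n * lmu a b c d g h \<alpha> n * (A * (lw \<alpha> (a * (q * x)) (a / (q * x)) n - lw \<alpha> (a * x) (a / x) n)
      + A' * (lw \<alpha> (a * (x / q)) (a / (x / q)) n - lw \<alpha> (a * x) (a / x) n) - ?\<Lambda> * lw \<alpha> (a * x) (a / x) n)) sums
     (Q (\<alpha> * g) * Q (\<alpha> * h) * (Q (a * x) * Q (a / x)))"
    unfolding A_def A'_def
  proof (rule lmu_telescope)
    fix n
    show "lw \<alpha> (a * x) (a / x) (Suc n) = lw \<alpha> (a * x) (a / x) n * (1 - a * x * (\<alpha> * q ^ n)) * (1 - a * (\<alpha> * q ^ n) / x)"
      by (simp add: lw_def qpoch_Suc mult_ac)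
    show "(1 - a * x) * lw \<alpha> (a * (q * x)) (a / (q * x)) (Suc n) = lw \<alpha> (a * x) (a / x) n * (1 - a / (q * x)) *
        (1 - a * x * (\<alpha> * q ^ n)) * (1 - a * x * (q * (\<alpha> * q ^ n)))"
      unfolding e lw_shift[OF nz2(1,4)] by (simp add: mult_ac)
    have "(1 - a / x) * lw \<alpha> (a * (x / q)) (a / (x / q)) (Suc n) = (1 - a / x) * lw \<alpha> (a / x * q) (a * x / q) (Suc n)"
      unfolding e comm[of "a * x / q"] ..
    then show "(1 - a / x) * lw \<alpha> (a * (x / q)) (a / (x / q)) (Suc n) = lw \<alpha> (a * x) (a / x) n * (1 - a * x / q) *
        (1 - a * (\<alpha> * q ^ n) / x) * (1 - a * (q * (\<alpha> * q ^ n)) / x)"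
      unfolding lw_shift[OF nz2(2,3)] comm[of "a / x"] by (simp add: mult_ac)
    show "lw \<alpha> (a * x) (a / x) \<longlonglongrightarrow> Q (a * x) * Q (a / x)"
      by (rule lw_LIMSEQ[OF nz2(1,2)])
    define u1 where "u1 = 1 - \<alpha> * (a * x) / q"
    define u2 where "u2 = 1 - \<alpha> * (a / x) / q"
    have u: "u1 \<noteq> 0" "u2 \<noteq> 0" using nz2(3,4) by (simp_all only: u1_def u2_def) auto
    \<comment> \<open>The basis function of index -1 on the shifted lattice. Its coefficient
      contains 1 - a d \<alpha> / q = 0, so the second series has a clean start.\<close>
    define y where "y = lw \<alpha> (a * x) (a / x) 0 / ((1 - \<alpha> * (a * x) / q) * (1 - \<alpha> * (a / x) / q))"
    have l0: "lw \<alpha> e f 0 = Q e * Q f / (Q (\<alpha> * e) * Q (\<alpha> * f))" for e f by (simp add: lw_def)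
    have "AA a b c d x * (lw \<alpha> (a * (q * x)) (a / (q * x)) 0 - lw \<alpha> (a * x) (a / x) 0)
      + AA a b c d (1 / x) * (lw \<alpha> (a * (x / q)) (a / (x / q)) 0 - lw \<alpha> (a * x) (a / x) 0) =
      (1 - q * (\<alpha> / q)) * (1 - a * b * c * d * (\<alpha> / q)) / (q * (\<alpha> / q)) * lw \<alpha> (a * x) (a / x) 0
     - (1 - q * (\<alpha> / q)) * (1 - a * b * (\<alpha> / q)) * (1 - a * c * (\<alpha> / q)) * (1 - a * d * (\<alpha> / q)) / (q * (\<alpha> / q)) * y"
    proof (rule Lop_step)
      show "lw \<alpha> (a * x) (a / x) 0 = y * (1 - a * x * (\<alpha> / q)) * (1 - a * (\<alpha> / q) / x)"
      proof -
        have *: "1 - a * x * (\<alpha> / q) = 1 - \<alpha> * (a * x) / q" "1 - a * (\<alpha> / q) / x = 1 - \<alpha> * (a / x) / q"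
          by (simp_all add: mult_ac)
        show ?thesis unfolding y_def * u1_def[symmetric] u2_def[symmetric] using u by simp
      qed
      show "(1 - a * x) * lw \<alpha> (a * (q * x)) (a / (q * x)) 0 = y * (1 - a / (q * x)) * (1 - a * x * (\<alpha> / q)) * (1 - a * x * (q * (\<alpha> / q)))"
      proof -
        have *: "1 - a * x * (\<alpha> / q) = 1 - \<alpha> * (a * x) / q" "1 - a * x * (q * (\<alpha> / q)) = 1 - \<alpha> * (a * x)"
          using q0 by (simp_all add: mult_ac)
        show ?thesis unfolding e l0 lw_0_shift[OF nz2(1,4)] y_def * u1_def[symmetric] u2_def[symmetric] using u by (simp add: mult_ac)
      qed
      show "(1 - a / x) * lw \<alpha> (a * (x / q)) (a / (x / q)) 0 = y * (1 - a * x / q) * (1 - a * (\<alpha> / q) / x) * (1 - a * (q * (\<alpha> / q)) / x)"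
      proof -
        have *: "1 - a * (\<alpha> / q) / x = 1 - \<alpha> * (a / x) / q" "1 - a * (q * (\<alpha> / q)) / x = 1 - \<alpha> * (a / x)"
          using q0 by (simp_all add: mult_ac)
        show ?thesis unfolding e comm[of "a * x / q"] unfolding l0 lw_0_shift[OF nz2(2,3)] y_def * u1_def[symmetric] u2_def[symmetric] using u by (simp add: mult_ac)
      qed
    qed (use x \<alpha>0 q0 in auto)
    also have "1 - a * d * (\<alpha> / q) = 0" using nz q0 by (simp add: \<alpha>_def)
    finally show "\<alpha> * (AA a b c d x * (lw \<alpha> (a * (q * x)) (a / (q * x)) 0 - lw \<alpha> (a * x) (a / x) 0)
      + AA a b c d (1 / x) * (lw \<alpha> (a * (x / q)) (a / (x / q)) 0 - lw \<alpha> (a * x) (a / x) 0)) =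
       (1 - \<alpha>) * (1 - g * h * \<alpha>) * lw \<alpha> (a * x) (a / x) 0"
      unfolding gh(1)[symmetric] using \<alpha>0 q0 by (simp add: mult_ac)
  qed (use x gh \<alpha>0 in auto)
  have gen: "A * (c * p - c * z) + A' * (c * n - c * z) - l * (c * z) = c * (A * (p - z) + A' * (n - z) - l * z)" for c p z n l
    by (simp add: algebra_simps)
  have T1: "A * ((\<Sum>n. m1 (q * x) n) - (\<Sum>n. m1 x n)) + A' * ((\<Sum>n. m1 (x / q) n) - (\<Sum>n. m1 x n)) - ?\<Lambda> * (\<Sum>n. m1 x n)
     = Q g * Q h * (Q (a * x) * Q (a / x))"
  proof (rule sums_unique2)
    show "(\<lambda>n. A * (m1 (q * x) n - m1 x n) + A' * (m1 (x / q) n - m1 x n) - ?\<Lambda> * m1 x n) sums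
      (A * ((\<Sum>n. m1 (q * x) n) - (\<Sum>n. m1 x n)) + A' * ((\<Sum>n. m1 (x / q) n) - (\<Sum>n. m1 x n)) - ?\<Lambda> * (\<Sum>n. m1 x n))"
      by (intro sums_diff sums_add sums_mult summable_sums F0 F1 F2)
    have "(\<lambda>n. A * (m1 (q * x) n - m1 x n) + A' * (m1 (x / q) n - m1 x n) - ?\<Lambda> * m1 x n) =
       (\<lambda>n. 1 * q ^ n * lmu a b c d g h 1 n * (A * (P n (a * (q * x)) * P n (a / (q * x)) - P n (a * x) * P n (a / x))
      + A' * (P n (a * (x / q)) * P n (a / (x / q)) - P n (a * x) * P n (a / x)) - ?\<Lambda> * (P n (a * x) * P n (a / x))))"
      unfolding m1_def by (rule ext) (rule gen)
    then show "(\<lambda>n. A * (m1 (q * x) n - m1 x n) + A' * (m1 (x / q) n - m1 x n) - ?\<Lambda> * m1 x n) sums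
        (Q g * Q h * (Q (a * x) * Q (a / x)))"
      using S1 by simp
  qed
  have T2: "A * ((\<Sum>n. m2 (q * x) n) - (\<Sum>n. m2 x n)) + A' * ((\<Sum>n. m2 (x / q) n) - (\<Sum>n. m2 x n)) - ?\<Lambda> * (\<Sum>n. m2 x n)
     = Q (\<alpha> * g) * Q (\<alpha> * h) * (Q (a * x) * Q (a / x))"
  proof (rule sums_unique2)
    show "(\<lambda>n. A * (m2 (q * x) n - m2 x n) + A' * (m2 (x / q) n - m2 x n) - ?\<Lambda> * m2 x n) sums
      (A * ((\<Sum>n. m2 (q * x) n) - (\<Sum>n. m2 x n)) + A' * ((\<Sum>n. m2 (x / q) n) - (\<Sum>n. m2 x n)) - ?\<Lambda> * (\<Sum>n. m2 x n))"
      by (intro sums_diff sums_add sums_mult summable_sums F0 F1 F2)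
    have "(\<lambda>n. A * (m2 (q * x) n - m2 x n) + A' * (m2 (x / q) n - m2 x n) - ?\<Lambda> * m2 x n) =
       (\<lambda>n. \<alpha> * q ^ n * lmu a b c d g h \<alpha> n * (A * (lw \<alpha> (a * (q * x)) (a / (q * x)) n - lw \<alpha> (a * x) (a / x) n)
      + A' * (lw \<alpha> (a * (x / q)) (a / (x / q)) n - lw \<alpha> (a * x) (a / x) n) - ?\<Lambda> * lw \<alpha> (a * x) (a / x) n))"
      unfolding m2_def by (rule ext) (rule gen)
    then show "(\<lambda>n. A * (m2 (q * x) n - m2 x n) + A' * (m2 (x / q) n - m2 x n) - ?\<Lambda> * m2 x n) sums
        (Q (\<alpha> * g) * Q (\<alpha> * h) * (Q (a * x) * Q (a / x)))"
      using S2 by simp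
  qed
  have nzr: "Q (\<alpha> * g) \<noteq> 0" "Q (\<alpha> * h) \<noteq> 0"
  proof -
    have "\<alpha> * g = q * (s * \<gamma>) / (a * d)" "\<alpha> * h = q * s / (a * d * \<gamma>)" by (simp_all add: \<alpha>_def g_def h_def)
    then show "Q (\<alpha> * g) \<noteq> 0" "Q (\<alpha> * h) \<noteq> 0" using Qn(5) Q_nz[OF z] by simp_all
  qed
  have fin: "A * (K * (p1 - \<rho> * p2) - K * (z1 - \<rho> * z2)) + A' * (K * (n1 - \<rho> * n2) - K * (z1 - \<rho> * z2)) - l * (K * (z1 - \<rho> * z2))
     = K * ((A * (p1 - z1) + A' * (n1 - z1) - l * z1) - \<rho> * (A * (p2 - z2) + A' * (n2 - z2) - l * z2))" for p1 p2 z1 z2 n1 n2 l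
    by (simp add: algebra_simps)
  have "Lop a b c d (awf a b c d s \<gamma>) x - ?\<Lambda> * awf a b c d s \<gamma> x =
     K * (Q g * Q h * (Q (a * x) * Q (a / x)) - \<rho> * (Q (\<alpha> * g) * Q (\<alpha> * h) * (Q (a * x) * Q (a / x))))"
    unfolding Lop_def A_def[symmetric] A'_def[symmetric] F0(1) F1(1) F2(1) fin T1 T2 ..
  also have "\<dots> = 0" unfolding \<rho>_def using nzr by simp
  finally show ?thesis unfolding gh(2) by (simp add: g_def h_def)
qed

end



section \<open>Normalisation of the defining two-term expression\<close>

context qbase
begin

lemma qfac_eq: "qfac q (int k) xs = prod_list (map (P k) xs)"
proof -
  have "qfac1 q (int k) = P k" by (rule ext) (simp add: qfac1_def qpoch_def)
  then show ?thesis by (simp add: qfac_def)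
qed

text \<open>No factor (ad; q)_infinity or (q/(ad); q)_infinity is left: the singularities of the two
  terms at a d in q^Z have cancelled.\<close>

definition aw_const :: "complex \<Rightarrow> complex \<Rightarrow> complex \<Rightarrow> complex \<Rightarrow> complex \<Rightarrow> complex \<Rightarrow> complex" where
  "aw_const a b c d s \<gamma> = 1 / (Q (b * c) * Q (q * a / d) * Q q * Q (a * b) * Q (a * c) * Q (a * a * b * c * \<gamma> / s)
      * Q (q * (s * \<gamma>) / (a * d)))"

definition aw_gen :: "complex \<Rightarrow> complex \<Rightarrow> complex \<Rightarrow> complex \<Rightarrow> complex \<Rightarrow> complex \<Rightarrow> complex \<Rightarrow> complex" where
  "aw_gen a b c d s \<gamma> x =
      1 / qinf q [b * c, q * a / d, q / (a * d)]
           * phi43 (a * x) (a / x) (s * \<gamma>) (s / \<gamma>) (a * b) (a * c) (a * d) q q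
         + qinf q [a * x, a / x, s * \<gamma>, s / \<gamma>, q * b / d, q * c / d]
           / qinf q [q * x / d, q / (d * x), q * \<gamma> / (a * d / s), q / (a * d / s * \<gamma>),
                     a * b, a * c, b * c, q * a / d, a * d / q]
           * phi43 (q * x / d) (q / (d * x)) (q * \<gamma> / (a * d / s)) (q / (a * d / s * \<gamma>))
                   (q * b / d) (q * c / d) (q\<^sup>2 / (a * d)) q q"

text \<open>The two 4phi3 series are the sums in \<open>awf_bailey\<close> up to constants. Matching
  the constants uses (ad/q;q)_infinity = (1 - ad/q)(ad;q)_infinity and the same step for q/(ad),
  which is where a d = q has to be excluded.\<close>

lemma aw_gen_eq:
  assumes nz: "a \<noteq> 0" "d \<noteq> 0" "s \<noteq> 0" "\<gamma> \<noteq> 0" and s: "q * s ^ 2 = a * b * c * d"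
    and z: "norm (q * s / (a * d * \<gamma>)) < 1" and Qn: "Q (a * b) \<noteq> 0" "Q (a * c) \<noteq> 0" "Q (a * d) \<noteq> 0" "Q (q / (a * d)) \<noteq> 0"
      "Q (q * (s * \<gamma>) / (a * d)) \<noteq> 0"
    and x: "x \<noteq> 0" "Q (q * x / d) \<noteq> 0" "Q (q / (d * x)) \<noteq> 0"
    and Qn': "Q (q * b / d) \<noteq> 0" "Q (q * c / d) \<noteq> 0" "Q (a * a * b * c * \<gamma> / s) \<noteq> 0" and adq: "a * d \<noteq> q"
  shows "aw_gen a b c d s \<gamma> x = aw_const a b c d s \<gamma> * awf a b c d s \<gamma> x"
proof -
  define \<alpha> where "\<alpha> = q / (a * d)"
  define g where "g = s * \<gamma>"
  define h where "h = s / \<gamma>"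
  have qq: "Q q \<noteq> 0" by (rule Q_nz[OF q1])
  have al: "\<alpha> * (a * x) = q * x / d" "\<alpha> * (a / x) = q / (d * x)" "\<alpha> * g = q * (s * \<gamma>) / (a * d)" "\<alpha> * q = q\<^sup>2 / (a * d)"
     "\<alpha> * g = q * \<gamma> / (a * d / s)" "\<alpha> * h = q / (a * d / s * \<gamma>)"
    "a * d * \<alpha> = q" "a * b * \<alpha> = q * b / d" "a * c * \<alpha> = q * c / d"
    using nz q0 by (simp_all add: \<alpha>_def g_def h_def power2_eq_square mult_ac)
  have r1: "Q (a * d / q) = (1 - a * d / q) * Q (a * d)" "Q (q / (a * d)) = (1 - q / (a * d)) * Q (q\<^sup>2 / (a * d))"
    using q0 by (subst Q_rec, simp add: power2_eq_square mult_ac)+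
  have nz2: "Q (q\<^sup>2 / (a * d)) \<noteq> 0" using Qn(4) r1(2) by auto
  define L1 where "L1 n = 1 * q ^ n * lmu a b c d g h 1 n * (P n (a * x) * P n (a / x))" for n
  define L2 where "L2 n = \<alpha> * q ^ n * lmu a b c d g h \<alpha> n * (Q (a * x) * Q (a / x) / (Q (\<alpha> * (a * x)) * Q (\<alpha> * (a / x))) * (P n (\<alpha> * (a * x)) * P n (\<alpha> * (a / x))))" for n
  note ab = awf_bailey[OF nz s z Qn x, folded \<alpha>_def g_def h_def, folded L1_def L2_def]
  have sm: "summable L1" "summable L2"
    using ab(2,3) unfolding L1_def[abs_def] L2_def[abs_def] by simp_all
  have p1: "phi43 (a * x) (a / x) g h (a * b) (a * c) (a * d) q q = (\<Sum>n. L1 n) / (Q q * Q (a * d) * Q (a * b) * Q (a * c))"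
  proof -
    have "qfac q (int k) [a * x, a / x, g, h] / qfac q (int k) [q, a * b, a * c, a * d] * q ^ k
        = L1 k / (Q q * Q (a * d) * Q (a * b) * Q (a * c))" for k
    proof -
      have "Q (q * q ^ k) \<noteq> 0" "Q (a * b * q ^ k) \<noteq> 0" "Q (a * c * q ^ k) \<noteq> 0" "Q (a * d * q ^ k) \<noteq> 0"
        by (intro Q_nz_pow qq Qn)+
      then show ?thesis
        unfolding qfac_eq L1_def lmu_def using qq Qn
        by (simp add: P_eq[OF qq] P_eq[OF Qn(1)] P_eq[OF Qn(2)] P_eq[OF Qn(3)] mult_ac)
    qed
    then show ?thesis unfolding phi43_def using suminf_divide[OF sm(1)] by simp
  qed
  define w where "w = Q (a * x) * Q (a / x) / (Q (q * x / d) * Q (q / (d * x)))"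
  define S2 where "S2 = phi43 (q * x / d) (q / (d * x)) (q * \<gamma> / (a * d / s)) (q / (a * d / s * \<gamma>)) (q * b / d) (q * c / d) (q\<^sup>2 / (a * d)) q q"
  have p2: "(\<Sum>n. L2 n) = \<alpha> * w * (Q q * Q (q * b / d) * Q (q * c / d) * Q (q\<^sup>2 / (a * d))) * S2"
  proof -
    have t: "L2 k = \<alpha> * w * (Q q * Q (q * b / d) * Q (q * c / d) * Q (q\<^sup>2 / (a * d))) *
       (qfac q (int k) [q * x / d, q / (d * x), q * \<gamma> / (a * d / s), q / (a * d / s * \<gamma>)] /
        qfac q (int k) [q, q * b / d, q * c / d, q\<^sup>2 / (a * d)] * q ^ k)" for k
    proof -
      have "Q (q * q ^ k) \<noteq> 0" "Q (q * b / d * q ^ k) \<noteq> 0" "Q (q * c / d * q ^ k) \<noteq> 0" "Q (q\<^sup>2 / (a * d) * q ^ k) \<noteq> 0"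
        by (intro Q_nz_pow qq Qn' nz2)+
      then show ?thesis
        unfolding qfac_eq L2_def lmu_def al(7-9) al(1,2,4) al(5,6)[symmetric] w_def[symmetric] list.map prod_list.Cons prod_list.Nil
          P_eq[OF qq] P_eq[OF Qn'(1)] P_eq[OF Qn'(2)] P_eq[OF nz2] using qq Qn' nz2
        by (simp add: mult_ac)
    qed
    define k0 where "k0 = \<alpha> * w * (Q q * Q (q * b / d) * Q (q * c / d) * Q (q\<^sup>2 / (a * d)))"
    show ?thesis
    proof (cases "k0 = 0")
      case True
      then have "L2 k = 0" for k unfolding t k0_def[symmetric] by simp
      then have "(\<Sum>n. L2 n) = 0" by simp
      then show ?thesis using True unfolding k0_def by simp
    next
      case False
      define X where "X k = qfac q (int k) [q * x / d, q / (d * x), q * \<gamma> / (a * d / s), q / (a * d / s * \<gamma>)] /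
        qfac q (int k) [q, q * b / d, q * c / d, q\<^sup>2 / (a * d)] * q ^ k" for k
      have "summable (\<lambda>k. k0 * X k)"
        using sm(2) unfolding t[abs_def] k0_def[symmetric] X_def[symmetric] .
      then have "summable X" using False by (simp only: summable_cmult_iff) simp
      then show ?thesis unfolding t k0_def[symmetric] S2_def phi43_def X_def[symmetric] by (rule suminf_mult)
    qed
  qed
  define S1 where "S1 = (\<Sum>n. L1 n)"
  have alg: "1 / (bc * qa * qad) * (S1 / (qq * ad * ab * ac)) + ax * ax' * gg * hh * qb * qc / (x1 * x2 * ag * ah * ab * ac * bc * qa * ((1 - 1 / A) * ad)) * S2
     = 1 / (bc * qa * qq * ab * ac * B * ag) * (B * ag / (ad * qad) * (S1 - gg * hh / (ag * ah) * (A * (ax * ax' / (x1 * x2)) * (qq * qb * qc * q2) * S2)))"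
    if "qad = (1 - A) * q2" "A \<noteq> 0" "A \<noteq> 1" "q2 \<noteq> 0" "B \<noteq> 0" "ag \<noteq> 0" "ah \<noteq> 0" "x1 \<noteq> 0" "x2 \<noteq> 0" "qq \<noteq> 0" "ab \<noteq> 0" "ac \<noteq> 0" "ad \<noteq> 0"
    for bc qa qad S1 qq ad ab ac ax ax' gg hh qb qc x1 x2 ag ah A B q2 :: complex
  proof (cases "bc = 0 \<or> qa = 0")
    case True
    then show ?thesis by auto
  next
    case F: False
    have u: "1 - A \<noteq> 0" "A - 1 \<noteq> 0" using that(3) by auto
    have v: "1 / ((1 - 1 / A) * ad) = - A / ((1 - A) * ad)" using that u by (simp add: divide_simps) (simp add: algebra_simps)
    show ?thesis unfolding that(1) using that(2-) F u by (simp add: divide_simps v) (simp add: algebra_simps)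
  qed
  have r1': "Q (a * d / q) = (1 - 1 / \<alpha>) * Q (a * d)" "Q \<alpha> = (1 - \<alpha>) * Q (q\<^sup>2 / (a * d))"
    using r1 unfolding \<alpha>_def by simp_all
  have \<alpha>1: "\<alpha> \<noteq> 0" "\<alpha> \<noteq> 1" using nz q0 adq by (auto simp: \<alpha>_def)
  have ah: "Q (\<alpha> * h) \<noteq> 0"
  proof -
    have "\<alpha> * h = q * s / (a * d * \<gamma>)" by (simp add: \<alpha>_def h_def)
    then show ?thesis using Q_nz[OF z] by simp
  qed
  have "aw_gen a b c d s \<gamma> x = 1 / (Q (b * c) * Q (q * a / d) * Q \<alpha>) * (S1 / (Q q * Q (a * d) * Q (a * b) * Q (a * c))) +
     Q (a * x) * Q (a / x) * Q g * Q h * Q (q * b / d) * Q (q * c / d) /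
     (Q (q * x / d) * Q (q / (d * x)) * Q (\<alpha> * g) * Q (\<alpha> * h) * Q (a * b) * Q (a * c) * Q (b * c) * Q (q * a / d) * ((1 - 1 / \<alpha>) * Q (a * d))) * S2"
    unfolding aw_gen_def S2_def[symmetric]
    unfolding g_def[symmetric] h_def[symmetric] p1 S1_def[symmetric] al(5,6)[symmetric] \<alpha>_def[symmetric] qinf_def
      list.map prod_list.Cons prod_list.Nil r1'(1) by (simp only: mult_1_right mult.assoc)
  also have "\<dots> = 1 / (Q (b * c) * Q (q * a / d) * Q q * Q (a * b) * Q (a * c) * Q (a * a * b * c * \<gamma> / s) * Q (\<alpha> * g)) *
     (Q (a * a * b * c * \<gamma> / s) * Q (\<alpha> * g) / (Q (a * d) * Q \<alpha>) * (S1 - Q g * Q h / (Q (\<alpha> * g) * Q (\<alpha> * h)) *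
       (\<alpha> * (Q (a * x) * Q (a / x) / (Q (q * x / d) * Q (q / (d * x)))) * (Q q * Q (q * b / d) * Q (q * c / d) * Q (q\<^sup>2 / (a * d))) * S2)))"
    by (rule alg[OF r1'(2) \<alpha>1 nz2 Qn'(3) _ ah x(2,3) qq Qn(1,2,3)]) (use Qn(5) al(3) in simp)
  also have "\<dots> = aw_const a b c d s \<gamma> * awf a b c d s \<gamma> x"
  proof -
    have al3: "q * g / (a * d) = \<alpha> * g" by (simp add: \<alpha>_def)
    show ?thesis unfolding ab(1) p2 w_def S1_def[symmetric] aw_const_def g_def[symmetric] unfolding al3 ..
  qed
  finally show ?thesis .
qed

end

section \<open>Real base and genericity of the product a d\<close>

locale awq =
  fixes q :: real
  assumes q_pos: "0 < q" and q_less_1: "q < 1"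

sublocale awq \<subseteq> qbase "complex_of_real q"
  by unfold_locales (use q_pos q_less_1 in auto)

context awq
begin

abbreviation qc where "qc \<equiv> complex_of_real q"

lemma Q_nz_real:
  assumes "r < 1"
  shows "Q (complex_of_real r) \<noteq> 0"
proof
  assume "Q (complex_of_real r) = 0"
  then obtain n where "complex_of_real r * qc ^ n = 1" by (auto simp: Q_eq_0_iff)
  then have "complex_of_real (r * q ^ n) = complex_of_real 1" by simp
  then have e: "r * q ^ n = 1" by (simp only: of_real_eq_iff)
  have qn: "0 < q ^ n" "q ^ n \<le> 1" using q_pos q_less_1 by (auto simp: power_le_one)
  show False
  proof (cases "r \<le> 0")
    case True
    then show False using e qn mult_nonpos_nonneg[of r "q ^ n"] by auto
  next
    case False
    then have "r * q ^ n \<le> r * 1" using qn by (intro mult_left_mono) auto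
    then show False using e assms by simp
  qed
qed

lemma powi_range_nat: "q ^ n \<in> range (\<lambda>n::int. q powi n)" "1 / q ^ n \<in> range (\<lambda>n::int. q powi n)"
proof -
  show "q ^ n \<in> range (\<lambda>n::int. q powi n)"
    by (rule range_eqI[of _ _ "int n"]) simp
  show "1 / q ^ n \<in> range (\<lambda>n::int. q powi n)"
    by (rule range_eqI[of _ _ "- int n"]) (simp add: power_int_minus divide_inverse)
qed

lemma generic_nz:
  assumes r: "r \<notin> range (\<lambda>n::int. q powi n)" and r0: "r \<noteq> 0"
  shows "Q (complex_of_real r) \<noteq> 0" "Q (qc / complex_of_real r) \<noteq> 0" "complex_of_real r \<noteq> qc"
proof -
  show "Q (complex_of_real r) \<noteq> 0"
  proof
    assume "Q (complex_of_real r) = 0"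
    then obtain n where "complex_of_real r * qc ^ n = 1" by (auto simp: Q_eq_0_iff)
    then have "complex_of_real (r * q ^ n) = complex_of_real 1" by simp
    then have "r * q ^ n = 1" by (simp only: of_real_eq_iff)
    then have "r = 1 / q ^ n" using q_pos by (simp add: field_simps)
    then show False using r powi_range_nat(2)[of n] by simp
  qed
  show "Q (qc / complex_of_real r) \<noteq> 0"
  proof
    assume "Q (qc / complex_of_real r) = 0"
    then obtain n where "qc / complex_of_real r * qc ^ n = 1" by (auto simp: Q_eq_0_iff)
    then have "complex_of_real (q ^ Suc n) = complex_of_real r" using r0 by (simp add: field_simps)
    then have "r = q ^ Suc n" by (simp only: of_real_eq_iff)
    then show False using r powi_range_nat(1)[of "Suc n"] by simp
  qed
  show "complex_of_real r \<noteq> qc"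
    using r powi_range_nat(1)[of 1] by (auto simp: of_real_eq_iff)
qed

lemma AW_phi_generic_eq:
  "AW_phi_generic q a b c d \<gamma> x = aw_gen (complex_of_real a) (complex_of_real b) (complex_of_real c) (complex_of_real d)
     (complex_of_real (dual_a q a b c d)) \<gamma> x"
  unfolding AW_phi_generic_def Let_def aw_gen_def dual_d_def by (simp only: of_real_divide of_real_mult)

end

section \<open>Admissible parameters and the continuation to a d in q^Z\<close>

locale awp = awq +
  fixes a b c d t :: real
  assumes par: "(a, b, c, d, t) \<in> AW_params q"
begin

abbreviation s where "s \<equiv> dual_a q a b c d"
abbreviation ac where "ac \<equiv> complex_of_real a"
abbreviation bc where "bc \<equiv> complex_of_real b"
abbreviation cc where "cc \<equiv> complex_of_real c"
abbreviation dc where "dc \<equiv> complex_of_real d"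
abbreviation tc where "tc \<equiv> complex_of_real t"
abbreviation sc where "sc \<equiv> complex_of_real s"

lemma par': "t < 0" "0 < b" "b \<le> a" "0 < c" "c \<le> a" "a < d / q" "b * d \<ge> q" "c * d \<ge> q" "a * b < 1" "a * c < 1"
  using par by (auto simp: AW_params_def)

lemma a_pos: "0 < a" using par' by linarith

lemma qa_less_d: "q * a < d" using par'(6) q_pos by (simp add: field_simps)

text \<open>Places the unit circle in q/d < |x| < d/q, where (qx/d, q/(dx); q)_infinity has no
  zeros.\<close>

lemma d_gt_q: "q < d"
proof (rule ccontr)
  assume "\<not> q < d"
  moreover have "0 < d" using qa_less_d a_pos q_pos by (meson less_trans mult_pos_pos)
  ultimately have "q * a < q" using qa_less_d by linarith
  then have "a < 1" using q_pos by simp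
  then have "b * d < 1 * d" using par' \<open>0 < d\<close> by (intro mult_strict_right_mono) auto
  then show False using par'(7) \<open>\<not> q < d\<close> by simp
qed

lemma d_pos: "0 < d" using d_gt_q q_pos by linarith

lemma ad_ge_q: "q \<le> a * d"
  using par'(7) mult_right_mono[OF par'(3), of d] d_pos by linarith

lemma bc_less_1: "b * c < 1" "b < 1" "c < 1"
proof -
  show "b * c < 1"
    using par'(10) mult_right_mono[OF par'(3), of c] par'(4) by linarith
  have "b * b \<le> a * b" "c * c \<le> a * c" using par' by (auto intro: mult_right_mono)
  then have "b * b < 1" "c * c < 1" using par' by linarith+
  then show "b < 1" "c < 1"
    using mult_mono[of 1 b 1 b] mult_mono[of 1 c 1 c] by fastforce+
qed

lemma s_pos: "0 < s"
  unfolding dual_a_def using a_pos par' d_pos q_pos by simp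

lemma s_sq: "q * (s * s) = a * b * c * d"
  unfolding dual_a_def using a_pos par' d_pos q_pos by simp

lemma s_sq_c: "qc * sc ^ 2 = ac * bc * cc * dc"
  using arg_cong[OF s_sq, of complex_of_real] by (simp add: power2_eq_square)

lemma qs_less: "q * s < a * d"
proof -
  have "q * (b * c) < a * d"
    using bc_less_1 q_pos ad_ge_q mult_strict_left_mono[of "b * c" 1 q] by linarith
  then have "(a * d) * (q * (b * c)) < (a * d) * (a * d)"
    using a_pos d_pos by (intro mult_strict_left_mono) auto
  moreover have "(q * s) * (q * s) = (a * d) * (q * (b * c))"
  proof -
    have "(q * s) * (q * s) = q * (q * (s * s))" by (simp only: mult_ac)
    then show ?thesis unfolding s_sq by (simp only: mult_ac)
  qed
  ultimately have "(q * s) * (q * s) < (a * d) * (a * d)" by (simp only:)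
  then have "(q * s) ^ 2 < (a * d) ^ 2" by (simp only: power2_eq_square)
  then show ?thesis
    by (rule power_less_imp_less_base) (use a_pos d_pos in simp)
qed

text \<open>The product of the dual d and the dual t simplifies to 1/(q s t), so the dual parameters
  other than s disappear from here on.\<close>

lemma dual_S_cases:
  assumes "\<gamma> \<in> AW_dual_S q a b c d t"
  obtains (plus) n where "\<gamma> = s * q ^ n" "\<gamma> > 1" | (minus) m where "\<gamma> = q powi m / (q * s * t)" "\<gamma> < - 1"
proof -
  have e: "dual_d q a b c d * dual_t q a d t * y = y / (q * s * t)" for y
    using a_pos d_pos by (simp add: dual_d_def dual_t_def)
  show ?thesis
    using assms that unfolding AW_dual_S_def AW_S_def AW_S_plus_def AW_S_minus_def e by auto
qed

lemma dual_S_abs: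
  assumes "\<gamma> \<in> AW_dual_S q a b c d t"
  shows "\<bar>\<gamma>\<bar> > 1"
  using assms by (cases rule: dual_S_cases) linarith+

lemma dual_S_z:
  assumes "\<gamma> \<in> AW_dual_S q a b c d t"
  shows "norm (qc * sc / (ac * dc * complex_of_real \<gamma>)) < 1"
proof -
  have "norm (qc * sc / (ac * dc * complex_of_real \<gamma>)) = q * s / (a * d * \<bar>\<gamma>\<bar>)"
    using q_pos s_pos a_pos d_pos by (simp add: norm_mult norm_divide)
  moreover have "q * s < a * d * \<bar>\<gamma>\<bar>"
  proof -
    have "a * d * 1 < a * d * \<bar>\<gamma>\<bar>"
      by (rule mult_strict_left_mono[OF dual_S_abs[OF assms]]) (use a_pos d_pos in simp)
    then show ?thesis using qs_less by linarith
  qed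
  moreover have "0 < a * d * \<bar>\<gamma>\<bar>" using a_pos d_pos dual_S_abs[OF assms] by auto
  ultimately show ?thesis by simp
qed

text \<open>These are the arguments of the two products in \<open>aw_const\<close> that depend on
  \<gamma>. On the positive part of the dual set they equal b c q^n and (ab)(ac) q^n, on the
  negative part they are not positive.\<close>

lemma dual_S_bounds:
  assumes "\<gamma> \<in> AW_dual_S q a b c d t"
  shows "q * (s * \<gamma>) / (a * d) < 1" "a * a * b * c * \<gamma> / s < 1"
  using assms
proof (induction rule: dual_S_cases)
  case (plus n)
  have qn: "0 < q ^ n" "q ^ n \<le> 1" using q_pos q_less_1 by (auto simp: power_le_one)
  have "q * (s * \<gamma>) / (a * d) = b * c * q ^ n"
  proof -
    have "q * (s * \<gamma>) = (q * (s * s)) * q ^ n" using plus by (simp add: mult_ac)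
    then show ?thesis unfolding s_sq using a_pos d_pos by simp
  qed
  moreover have "b * c * q ^ n \<le> b * c * 1" using qn par' by (intro mult_left_mono) auto
  ultimately show "q * (s * \<gamma>) / (a * d) < 1" using bc_less_1 by simp
  have "a * a * b * c * \<gamma> / s = (a * b) * (a * c) * q ^ n" using plus s_pos by simp
  moreover have "(a * b) * (a * c) * q ^ n \<le> (a * b) * (a * c) * 1"
    using qn par' a_pos by (intro mult_left_mono mult_nonneg_nonneg) auto
  moreover have "(a * b) * (a * c) < 1"
    using par'(9,10) a_pos par'(2,4) mult_strict_mono[of "a * b" 1 "a * c" 1] by simp
  ultimately show "a * a * b * c * \<gamma> / s < 1" by simp
next
  case (minus m)
  then have g: "\<gamma> < 0" by simp
  have "q * (s * \<gamma>) / (a * d) \<le> 0" "a * a * b * c * \<gamma> / s \<le> 0"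
    using g q_pos s_pos a_pos d_pos par' by (auto intro!: divide_nonpos_pos mult_nonneg_nonpos mult_pos_pos)
  then show "q * (s * \<gamma>) / (a * d) < 1" "a * a * b * c * \<gamma> / s < 1" by auto
qed

text \<open>Gathers the conditions of \<open>aw_gen_eq\<close> that persist near an admissible
  point; those on a d alone come from genericity. It is applied to constant families, to generic
  quadruples and to families in which d alone moves. Also \<gamma>' may move, because a terminating
  series keeps terminating only if \<gamma>' follows the moving s.\<close>

lemma ev_good:
  fixes F :: "'i filter"
  assumes t: "(a' \<longlongrightarrow> a) F" "(b' \<longlongrightarrow> b) F" "(c' \<longlongrightarrow> c) F" "(d' \<longlongrightarrow> d) F"
    and \<gamma>: "\<gamma> \<in> AW_dual_S q a b c d t"
    and g: "(\<gamma>' \<longlongrightarrow> complex_of_real \<gamma>) F"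
    and x: "x \<noteq> 0" "Q (qc * x / dc) \<noteq> 0" "Q (qc / (dc * x)) \<noteq> 0"
  defines "A \<equiv> \<lambda>i. complex_of_real (a' i)" and "B \<equiv> \<lambda>i. complex_of_real (b' i)" and "C \<equiv> \<lambda>i. complex_of_real (c' i)"
    and "D \<equiv> \<lambda>i. complex_of_real (d' i)" and "S \<equiv> \<lambda>i. complex_of_real (dual_a q (a' i) (b' i) (c' i) (d' i))"
  shows "\<forall>\<^sub>F i in F. A i \<noteq> 0 \<and> D i \<noteq> 0 \<and> S i \<noteq> 0 \<and> \<gamma>' i \<noteq> 0 \<and> qc * S i ^ 2 = A i * B i * C i * D i \<and>
      norm (qc * S i / (A i * D i * \<gamma>' i)) < 1 \<and> Q (A i * B i) \<noteq> 0 \<and> Q (A i * C i) \<noteq> 0 \<and>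
      Q (qc * (S i * \<gamma>' i) / (A i * D i)) \<noteq> 0 \<and> Q (qc * x / D i) \<noteq> 0 \<and> Q (qc / (D i * x)) \<noteq> 0 \<and>
      Q (qc * B i / D i) \<noteq> 0 \<and> Q (qc * C i / D i) \<noteq> 0 \<and> Q (A i * A i * B i * C i * \<gamma>' i / S i) \<noteq> 0"
      (is "?ev")
    and "(S \<longlongrightarrow> sc) F" "(A \<longlongrightarrow> ac) F" "(B \<longlongrightarrow> bc) F" "(C \<longlongrightarrow> cc) F" "(D \<longlongrightarrow> dc) F"
    and "((\<lambda>i. aw_const (A i) (B i) (C i) (D i) (S i) (\<gamma>' i) * awf (A i) (B i) (C i) (D i) (S i) (\<gamma>' i) x)
       \<longlongrightarrow> aw_const ac bc cc dc sc \<gamma> * awf ac bc cc dc sc \<gamma> x) F"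
    and "((\<lambda>i. awf (A i) (B i) (C i) (D i) (S i) (\<gamma>' i) x) \<longlongrightarrow> awf ac bc cc dc sc \<gamma> x) F"
proof -
  show T: "(A \<longlongrightarrow> ac) F" "(B \<longlongrightarrow> bc) F" "(C \<longlongrightarrow> cc) F" "(D \<longlongrightarrow> dc) F"
    unfolding A_def B_def C_def D_def by (intro tendsto_of_real t)+
  show TS: "(S \<longlongrightarrow> sc) F"
    unfolding S_def dual_a_def
    by (intro tendsto_of_real tendsto_real_sqrt tendsto_divide tendsto_mult t tendsto_const) (use q_pos in auto)
  have g0: "complex_of_real \<gamma> \<noteq> 0" using dual_S_abs[OF \<gamma>] by auto
  have nz: "ac \<noteq> 0" "dc \<noteq> 0" "sc \<noteq> 0" using a_pos d_pos s_pos by auto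
  have Qs: "Q (ac * bc) \<noteq> 0" "Q (ac * cc) \<noteq> 0" "Q (qc * (sc * \<gamma>) / (ac * dc)) \<noteq> 0" "Q (qc * bc / dc) \<noteq> 0" "Q (qc * cc / dc) \<noteq> 0"
     "Q (ac * ac * bc * cc * \<gamma> / sc) \<noteq> 0" "Q (bc * cc) \<noteq> 0" "Q (qc * ac / dc) \<noteq> 0" "Q qc \<noteq> 0"
  proof -
    have "q * b \<le> q * a" "q * c \<le> q * a"
      using par'(3,5) q_pos by (simp_all add: mult_left_mono)
    then have "q * b < d" "q * c < d" "q * a < d" using qa_less_d by linarith+
    then have "q * b / d < 1" "q * c / d < 1" "q * a / d < 1" using d_pos by simp_all
    then show "Q (ac * bc) \<noteq> 0" "Q (ac * cc) \<noteq> 0" "Q (qc * (sc * \<gamma>) / (ac * dc)) \<noteq> 0" "Q (qc * bc / dc) \<noteq> 0" "Q (qc * cc / dc) \<noteq> 0"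
     "Q (ac * ac * bc * cc * \<gamma> / sc) \<noteq> 0" "Q (bc * cc) \<noteq> 0" "Q (qc * ac / dc) \<noteq> 0" "Q qc \<noteq> 0"
      using Q_nz_real[OF par'(9)] Q_nz_real[OF par'(10)] Q_nz_real[OF dual_S_bounds(1)[OF \<gamma>]] Q_nz_real[of "q * b / d"]
        Q_nz_real[of "q * c / d"] Q_nz_real[OF dual_S_bounds(2)[OF \<gamma>]] Q_nz_real[OF bc_less_1(1)] Q_nz_real[of "q * a / d"]
        Q_nz_real[OF q_less_1] by simp_all
  qed
  have pos: "\<forall>\<^sub>F i in F. 0 < a' i" "\<forall>\<^sub>F i in F. 0 < b' i" "\<forall>\<^sub>F i in F. 0 < c' i" "\<forall>\<^sub>F i in F. 0 < d' i"
    using order_tendstoD(1)[OF t(1) a_pos] order_tendstoD(1)[OF t(2) par'(2)] order_tendstoD(1)[OF t(3) par'(4)]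
      order_tendstoD(1)[OF t(4) d_pos] .
  then have sq: "\<forall>\<^sub>F i in F. qc * S i ^ 2 = A i * B i * C i * D i"
  proof eventually_elim
    case (elim i)
    then have "q * (dual_a q (a' i) (b' i) (c' i) (d' i)) ^ 2 = a' i * b' i * c' i * d' i"
      unfolding dual_a_def using q_pos by simp
    then show ?case unfolding A_def B_def C_def D_def S_def
      by (metis of_real_mult of_real_power)
  qed
  note I = T TS g tendsto_const
  have n1: "\<forall>\<^sub>F i in F. A i \<noteq> 0" "\<forall>\<^sub>F i in F. D i \<noteq> 0" "\<forall>\<^sub>F i in F. S i \<noteq> 0" "\<forall>\<^sub>F i in F. \<gamma>' i \<noteq> 0"
    by (rule tendsto_imp_eventually_ne, rule T TS g, rule nz g0)+
  have n2: "\<forall>\<^sub>F i in F. norm (qc * S i / (A i * D i * \<gamma>' i)) < 1"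
    by (rule order_tendstoD(2)[OF _ dual_S_z[OF \<gamma>]], intro tendsto_norm tendsto_divide tendsto_mult I)
      (use nz g0 in auto)
  have n3: "\<forall>\<^sub>F i in F. Q (A i * B i) \<noteq> 0" "\<forall>\<^sub>F i in F. Q (A i * C i) \<noteq> 0"
    "\<forall>\<^sub>F i in F. Q (qc * (S i * \<gamma>' i) / (A i * D i)) \<noteq> 0" "\<forall>\<^sub>F i in F. Q (qc * B i / D i) \<noteq> 0" "\<forall>\<^sub>F i in F. Q (qc * C i / D i) \<noteq> 0"
    "\<forall>\<^sub>F i in F. Q (A i * A i * B i * C i * \<gamma>' i / S i) \<noteq> 0"
    by (rule tendsto_imp_eventually_ne[OF _ Qs(1)] tendsto_imp_eventually_ne[OF _ Qs(2)] tendsto_imp_eventually_ne[OF _ Qs(3)]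
         tendsto_imp_eventually_ne[OF _ Qs(4)] tendsto_imp_eventually_ne[OF _ Qs(5)] tendsto_imp_eventually_ne[OF _ Qs(6)];
       intro tendsto_Q tendsto_divide tendsto_mult I; use nz in auto)+
  have n4: "\<forall>\<^sub>F i in F. Q (qc * x / D i) \<noteq> 0" "\<forall>\<^sub>F i in F. Q (qc / (D i * x)) \<noteq> 0"
    by (rule tendsto_imp_eventually_ne[OF _ x(2)] tendsto_imp_eventually_ne[OF _ x(3)];
       intro tendsto_Q tendsto_divide tendsto_mult I; use nz x in auto)+
  show ?ev
    using n1 n2 n3 n4 sq by eventually_elim auto
  show W: "((\<lambda>i. awf (A i) (B i) (C i) (D i) (S i) (\<gamma>' i) x) \<longlongrightarrow> awf ac bc cc dc sc \<gamma> x) F"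
    unfolding awf_def
    by (intro tendsto_divide tendsto_mult tendsto_Q aw8_tendsto I nz g0 x(1) dual_S_z[OF \<gamma>]) (use nz x in auto)
  show "((\<lambda>i. aw_const (A i) (B i) (C i) (D i) (S i) (\<gamma>' i) * awf (A i) (B i) (C i) (D i) (S i) (\<gamma>' i) x)
       \<longlongrightarrow> aw_const ac bc cc dc sc \<gamma> * awf ac bc cc dc sc \<gamma> x) F"
    unfolding aw_const_def
    by (intro tendsto_mult tendsto_divide tendsto_Q I W) (use nz Qs in auto)
qed

text \<open>At generic parameters this is \<open>aw_gen_eq\<close>. Otherwise the function is
  defined as a limit and the right-hand side is continuous. For the limit to be determined, generic
  parameters must accumulate at the given ones; they do, since for fixed a the excluded values of d
  form a countable set.\<close>

lemma AW_phi_eq: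
  assumes \<gamma>: "\<gamma> \<in> AW_dual_S q a b c d t"
    and x: "x \<noteq> 0" "Q (qc * x / dc) \<noteq> 0" "Q (qc / (dc * x)) \<noteq> 0"
  shows "AW_phi q a b c d (complex_of_real \<gamma>) x = aw_const ac bc cc dc sc \<gamma> * awf ac bc cc dc sc \<gamma> x"
proof (cases "(a, b, c, d) \<in> AW_generic q")
  case True
  have ad: "a * d \<notin> range (\<lambda>n::int. q powi n)" using True by (simp add: AW_generic_def)
  note g = generic_nz[OF ad] 
  have ad0: "a * d \<noteq> 0" using a_pos d_pos by simp
  have "\<forall>\<^sub>F i::nat in sequentially. ac \<noteq> 0 \<and> dc \<noteq> 0 \<and> sc \<noteq> 0 \<and> complex_of_real \<gamma> \<noteq> 0 \<and> qc * sc ^ 2 = ac * bc * cc * dc \<and>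
      norm (qc * sc / (ac * dc * complex_of_real \<gamma>)) < 1 \<and> Q (ac * bc) \<noteq> 0 \<and> Q (ac * cc) \<noteq> 0 \<and>
      Q (qc * (sc * complex_of_real \<gamma>) / (ac * dc)) \<noteq> 0 \<and> Q (qc * x / dc) \<noteq> 0 \<and> Q (qc / (dc * x)) \<noteq> 0 \<and>
      Q (qc * bc / dc) \<noteq> 0 \<and> Q (qc * cc / dc) \<noteq> 0 \<and> Q (ac * ac * bc * cc * complex_of_real \<gamma> / sc) \<noteq> 0"
    by (rule ev_good(1)[OF tendsto_const tendsto_const tendsto_const tendsto_const \<gamma> tendsto_const x])
  then have e: "ac \<noteq> 0 \<and> dc \<noteq> 0 \<and> sc \<noteq> 0 \<and> complex_of_real \<gamma> \<noteq> 0 \<and> qc * sc ^ 2 = ac * bc * cc * dc \<and>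
      norm (qc * sc / (ac * dc * complex_of_real \<gamma>)) < 1 \<and> Q (ac * bc) \<noteq> 0 \<and> Q (ac * cc) \<noteq> 0 \<and>
      Q (qc * (sc * complex_of_real \<gamma>) / (ac * dc)) \<noteq> 0 \<and> Q (qc * x / dc) \<noteq> 0 \<and> Q (qc / (dc * x)) \<noteq> 0 \<and>
      Q (qc * bc / dc) \<noteq> 0 \<and> Q (qc * cc / dc) \<noteq> 0 \<and> Q (ac * ac * bc * cc * complex_of_real \<gamma> / sc) \<noteq> 0"
    by (rule eventually_const[OF sequentially_bot, THEN iffD1])
  have "AW_phi q a b c d (complex_of_real \<gamma>) x = aw_gen ac bc cc dc sc \<gamma> x"
    using True by (simp add: AW_phi_def AW_phi_generic_eq)
  also have "\<dots> = aw_const ac bc cc dc sc \<gamma> * awf ac bc cc dc sc \<gamma> x"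
    by (rule aw_gen_eq) (use e x(1) g[OF ad0] in \<open>simp_all only: of_real_mult\<close>, auto)
  finally show ?thesis .
next
  case False
  define p where "p = (a, b, c, d)"
  define F where "F = at p within AW_generic q"
  have id: "((\<lambda>p. p) \<longlongrightarrow> p) F" unfolding F_def by (rule tendsto_ident_at)
  have f1: "(fst \<longlongrightarrow> a) F" and f2: "((\<lambda>p. fst (snd p)) \<longlongrightarrow> b) F" and f3: "((\<lambda>p. fst (snd (snd p))) \<longlongrightarrow> c) F"
    and f4: "((\<lambda>p. snd (snd (snd p))) \<longlongrightarrow> d) F"
    using tendsto_fst[OF id] tendsto_fst[OF tendsto_snd[OF id]] tendsto_fst[OF tendsto_snd[OF tendsto_snd[OF id]]]
      tendsto_snd[OF tendsto_snd[OF tendsto_snd[OF id]]] by (simp_all add: p_def)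
  note eg = ev_good[OF f1 f2 f3 f4 \<gamma> tendsto_const x]
  have nb: "F \<noteq> bot"
  proof -
    have "p islimpt AW_generic q"
      unfolding islimpt_approachable
    proof (intro allI impI)
      fix e :: real assume e: "0 < e"
      have "countable ((\<lambda>n::int. q powi n / a) ` UNIV)" by simp
      moreover have "uncountable {d<..<d + e}" using e by (simp add: uncountable_open_interval)
      ultimately have "\<not> {d<..<d + e} \<subseteq> (\<lambda>n::int. q powi n / a) ` UNIV"
        using countable_subset by blast
      then obtain d' where "d' \<in> {d<..<d + e}" and d'3: "d' \<notin> (\<lambda>n::int. q powi n / a) ` UNIV"
        by (meson subsetI)
      then have d': "d < d'" "d' < d + e" by auto
      have "(a, b, c, d') \<in> AW_generic q"
        using d'3 a_pos by (auto simp: AW_generic_def field_simps)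
      moreover have "dist (a, b, c, d') p < e"
        using d' by (simp add: p_def dist_Pair_Pair dist_real_def)
      ultimately show "\<exists>x'\<in>AW_generic q. x' \<noteq> p \<and> dist x' p < e"
        using d' by (intro bexI[of _ "(a, b, c, d')"]) (auto simp: p_def)
    qed
    then show ?thesis unfolding F_def by (simp add: trivial_limit_within)
  qed
  have "\<forall>\<^sub>F p in F. p \<in> AW_generic q" unfolding F_def by (simp add: eventually_at_filter)
  with eg(1) have ev: "\<forall>\<^sub>F p in F. aw_const (complex_of_real (fst p)) (complex_of_real (fst (snd p))) (complex_of_real (fst (snd (snd p))))
      (complex_of_real (snd (snd (snd p)))) (complex_of_real (dual_a q (fst p) (fst (snd p)) (fst (snd (snd p))) (snd (snd (snd p))))) \<gamma>
     * awf (complex_of_real (fst p)) (complex_of_real (fst (snd p))) (complex_of_real (fst (snd (snd p))))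
      (complex_of_real (snd (snd (snd p)))) (complex_of_real (dual_a q (fst p) (fst (snd p)) (fst (snd (snd p))) (snd (snd (snd p))))) \<gamma> x
     = (case p of (a', b', c', d') \<Rightarrow> AW_phi_generic q a' b' c' d' (complex_of_real \<gamma>) x)"
  proof eventually_elim
    case (elim p)
    obtain a' b' c' d' where p: "p = (a', b', c', d')" by (cases p) auto
    note el = elim(1)[unfolded p fst_conv snd_conv]
    have ad: "a' * d' \<notin> range (\<lambda>n::int. q powi n)" using elim(2) by (simp add: p AW_generic_def)
    have ad0: "a' * d' \<noteq> 0" using el by auto
    show ?case unfolding p fst_conv snd_conv prod.case AW_phi_generic_eq
      by (rule aw_gen_eq[symmetric]) (use el x(1) generic_nz[OF ad ad0] in \<open>simp_all only: of_real_mult\<close>, auto)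
  qed
  have "((\<lambda>(a', b', c', d'). AW_phi_generic q a' b' c' d' (complex_of_real \<gamma>) x) \<longlongrightarrow> aw_const ac bc cc dc sc \<gamma> * awf ac bc cc dc sc \<gamma> x) F"
    by (rule Lim_transform_eventually[OF eg(7)]) (use ev in \<open>simp add: case_prod_beta\<close>)
  then have "Lim F (\<lambda>(a', b', c', d'). AW_phi_generic q a' b' c' d' (complex_of_real \<gamma>) x) = aw_const ac bc cc dc sc \<gamma> * awf ac bc cc dc sc \<gamma> x"
    by (rule tendsto_Lim[OF nb])
  then show ?thesis using False unfolding AW_phi_def F_def p_def by simp
qed

text \<open>Perturbing \<open>d\<close> alone reaches generic parameters, from which identities pass to the limit.\<close>
definition dgen :: "real filter" where
  "dgen = at d within {d'. a * d' \<notin> range (\<lambda>n::int. q powi n)}"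

lemma dgen_nontrivial: "dgen \<noteq> bot"
proof -
  have "d islimpt {d'. a * d' \<notin> range (\<lambda>n::int. q powi n)}"
    unfolding islimpt_approachable
  proof (intro allI impI)
    fix e :: real assume e: "0 < e"
    have "countable ((\<lambda>n::int. q powi n / a) ` UNIV)" by simp
    moreover have "uncountable {d<..<d + e}" using e by (simp add: uncountable_open_interval)
    ultimately have "\<not> {d<..<d + e} \<subseteq> (\<lambda>n::int. q powi n / a) ` UNIV"
      using countable_subset by blast
    then obtain d' where "d' \<in> {d<..<d + e}" and d'3: "d' \<notin> (\<lambda>n::int. q powi n / a) ` UNIV"
        by (meson subsetI)
      then have d': "d < d'" "d' < d + e" by auto
    with d'3 show "\<exists>x'\<in>{d'. a * d' \<notin> range (\<lambda>n::int. q powi n)}. x' \<noteq> d \<and> dist x' d < e"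
      using a_pos by (intro bexI[of _ d']) (auto simp: dist_real_def field_simps)
  qed
  then show ?thesis unfolding dgen_def by (simp add: trivial_limit_within)
qed

lemma dgen_tendsto: "((\<lambda>d'. d') \<longlongrightarrow> d) dgen"
  unfolding dgen_def by (rule tendsto_ident_at)

lemma dgen_generic: "\<forall>\<^sub>F d' in dgen. a * d' \<notin> range (\<lambda>n::int. q powi n)"
  unfolding dgen_def by (simp add: eventually_at_filter)

text \<open>The limit of the generic equation as d' tends to d. The function is evaluated at x, q x
  and x / q, so all three points must avoid its poles; the conditions on x / d and 1/(dx) ensure
  this.\<close>

lemma awf_eigen:
  assumes \<gamma>: "\<gamma> \<in> AW_dual_S q a b c d t"
    and x: "x \<noteq> 0" "Q (x / dc) \<noteq> 0" "Q (1 / (dc * x)) \<noteq> 0" "x ^ 2 \<noteq> 1" "qc * x ^ 2 \<noteq> 1" "x ^ 2 \<noteq> qc"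
  shows "Lop ac bc cc dc (awf ac bc cc dc sc \<gamma>) x = (sc * \<gamma> + sc / \<gamma> - 1 - sc ^ 2) * awf ac bc cc dc sc \<gamma> x"
proof -
  have dc: "dc \<noteq> 0" using d_pos by simp
  have x1: "Q (qc * x / dc) \<noteq> 0" "Q (qc * (qc * x) / dc) \<noteq> 0"
    using x(2) Q_rec[of "x / dc"] Q_rec[of "qc * x / dc"] by (auto simp: mult_ac)
  have x2: "Q (qc / (dc * x)) \<noteq> 0" "Q (qc * qc / (dc * x)) \<noteq> 0"
    using x(3) Q_rec[of "1 / (dc * x)"] Q_rec[of "qc / (dc * x)"] by (auto simp: mult_ac)
  have x3: "qc * x \<noteq> 0" "Q (qc / (dc * (qc * x))) \<noteq> 0" "x / qc \<noteq> 0" "Q (qc * (x / qc) / dc) \<noteq> 0" "Q (qc / (dc * (x / qc))) \<noteq> 0"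
    using x q0 x2 by (simp_all add: mult_ac)
  note g = ev_good[OF tendsto_const tendsto_const tendsto_const dgen_tendsto \<gamma> tendsto_const]
  note g0 = g[OF x(1) x1(1) x2(1)] and g1 = g[OF x3(1) x1(2) x3(2)] and g2 = g[OF x3(3,4,5)]
  define S where "S d' = complex_of_real (dual_a q a b c d')" for d'
  have n4: "\<forall>\<^sub>F d' in dgen. Q (x / complex_of_real d') \<noteq> 0" "\<forall>\<^sub>F d' in dgen. Q (1 / (complex_of_real d' * x)) \<noteq> 0"
    by (rule tendsto_imp_eventually_ne[OF _ x(2)] tendsto_imp_eventually_ne[OF _ x(3)];
       intro tendsto_Q tendsto_divide tendsto_mult g0(6) tendsto_const; use dc x in auto)+
  have ev: "\<forall>\<^sub>F d' in dgen. Lop ac bc cc (complex_of_real d') (awf ac bc cc (complex_of_real d') (S d') \<gamma>) x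
      = (S d' * \<gamma> + S d' / \<gamma> - 1 - S d' ^ 2) * awf ac bc cc (complex_of_real d') (S d') \<gamma> x"
    using g0(1) n4 dgen_generic
  proof eventually_elim
    case (elim d')
    have ad0: "a * d' \<noteq> 0" using elim(1) by auto
    show ?case unfolding S_def
      by (rule awf_eigen_generic) (use elim x generic_nz[OF elim(4) ad0] in \<open>simp_all only: of_real_mult\<close>, auto)
  qed
  have g00: "complex_of_real \<gamma> \<noteq> 0" using dual_S_abs[OF \<gamma>] by auto
  have A: "((\<lambda>d'. AA ac bc cc (complex_of_real d') y) \<longlongrightarrow> AA ac bc cc dc y) dgen" if "y ^ 2 \<noteq> 1" "qc * y ^ 2 \<noteq> 1" for y
    unfolding AA_def by (intro tendsto_divide tendsto_mult tendsto_diff tendsto_const g0(6)) (use that in auto)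
  have y: "(1 / x) ^ 2 \<noteq> 1" "qc * (1 / x) ^ 2 \<noteq> 1"
    using x by (auto simp: power_divide field_simps)
  have L: "((\<lambda>d'. Lop ac bc cc (complex_of_real d') (awf ac bc cc (complex_of_real d') (S d') \<gamma>) x) \<longlongrightarrow>
      Lop ac bc cc dc (awf ac bc cc dc sc \<gamma>) x) dgen"
    unfolding Lop_def S_def
    by (intro tendsto_add tendsto_mult tendsto_diff A g0(8) g1(8) g2(8) x y)
  have R: "((\<lambda>d'. (S d' * \<gamma> + S d' / \<gamma> - 1 - S d' ^ 2) * awf ac bc cc (complex_of_real d') (S d') \<gamma> x) \<longlongrightarrow>
      (sc * \<gamma> + sc / \<gamma> - 1 - sc ^ 2) * awf ac bc cc dc sc \<gamma> x) dgen"
    unfolding S_def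
    by (intro tendsto_add tendsto_mult tendsto_diff tendsto_divide tendsto_power tendsto_const g0(8) g0(2) g00)
  show ?thesis
    by (rule tendsto_unique[OF dgen_nontrivial Lim_transform_eventually[OF L ev] R])
qed

end



section \<open>Decay of the eigenfunctions along the negative lattice\<close>

context awq
begin

lemma P_neg: "r \<le> 0 \<Longrightarrow> norm (P n (complex_of_real r)) = (\<Prod>i<n. 1 - r * q ^ i)"
proof -
  assume r: "r \<le> 0"
  have "norm (1 - complex_of_real r * qc ^ i) = 1 - r * q ^ i" for i
  proof -
    have "1 - complex_of_real r * qc ^ i = complex_of_real (1 - r * q ^ i)" by simp
    moreover have "r * q ^ i \<le> 0" using r q_pos by (simp add: mult_nonpos_nonneg)
    ultimately show ?thesis by (simp only: norm_of_real)
  qed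
  then show ?thesis unfolding qpoch_def prod_norm[symmetric] by simp
qed

lemma P_neg_ge_1: "r \<le> 0 \<Longrightarrow> 1 \<le> norm (P n (complex_of_real r))"
  unfolding P_neg using q_pos by (intro prod_ge_1) (auto simp: mult_nonpos_nonneg)

lemma Q_neg_ge_1: "r \<le> 0 \<Longrightarrow> 1 \<le> norm (Q (complex_of_real r))"
  by (rule LIMSEQ_le_const[OF tendsto_norm[OF P_LIMSEQ]]) (use P_neg_ge_1 in auto)

lemma Q_neg_ge_P: "r \<le> 0 \<Longrightarrow> norm (P n (complex_of_real r)) \<le> norm (Q (complex_of_real r))"
proof -
  assume r: "r \<le> 0"
  have "1 \<le> norm (Q (complex_of_real (r * q ^ n)))"
    by (rule Q_neg_ge_1) (use r q_pos in \<open>simp add: mult_nonpos_nonneg\<close>)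
  then show ?thesis
    unfolding Q_shift[of "complex_of_real r" n] norm_mult
    using mult_left_mono[of 1 "norm (Q (complex_of_real (r * q ^ n)))" "norm (P n (complex_of_real r))"] by simp
qed

end

context awp
begin

abbreviation phi0 where "phi0 \<gamma> \<equiv> awf ac bc cc dc sc (complex_of_real \<gamma>)"

text \<open>At x = d t q^k the product \<alpha> (a x) g equals q^(m+k), so one infinite product in
  \<open>w8\<close> annihilates all terms of index below N = 1 - m - k. The tail supplies z^N with z
  = q s / (a d |\<gamma>|). The factor (ax; q)_N measured against (qx/d; q)_infinity costs at most
  (ad/q)^N, and (ad/q) z = s/|\<gamma>|.\<close>

lemma decay_minus:
  assumes \<gamma>: "\<gamma> \<in> AW_dual_S q a b c d t" and m: "\<gamma> = q powi m / (q * s * t)"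
  shows "\<exists>C. \<forall>k\<le>1 - m. norm (phi0 \<gamma> (complex_of_real (d * t * q powi k))) \<le> C * (\<bar>\<gamma>\<bar> / s) powi k"
proof -
  define z where "z = q * s / (a * d * \<bar>\<gamma>\<bar>)"
  have g1: "1 < \<bar>\<gamma>\<bar>" using dual_S_abs[OF \<gamma>] .
  have z01: "0 < z" "z < 1"
  proof -
    show "0 < z" using q_pos s_pos a_pos d_pos g1 by (simp add: z_def)
    show "z < 1" using dual_S_z[OF \<gamma>] q_pos s_pos a_pos d_pos by (simp add: z_def norm_mult norm_divide)
  qed
  define g where "g = sc * complex_of_real \<gamma>"
  define h where "h = sc / complex_of_real \<gamma>"
  define CC where "CC = ac * bc * complex_of_real \<gamma> / sc"
  define DD where "DD = ac * cc * complex_of_real \<gamma> / sc"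
  define \<alpha> where "\<alpha> = qc / (ac * dc)"
  have zn: "norm (\<alpha> * h) = z"
    unfolding \<alpha>_def h_def z_def using q_pos s_pos a_pos d_pos by (simp add: norm_mult norm_divide)
  obtain K0 where K0: "K0 \<ge> 0" "\<And>k. norm (wcoef h CC DD k) \<le> K0" using wcoef_bounded by blast
  define L where "L = \<bar>d * t\<bar> * q powi (1 - m)"
  have L: "0 < L" using d_pos par'(1) q_pos by (simp add: L_def)
  let ?x = "\<lambda>y. exp (y / (1 - q))"
  have nq: "norm qc = q" using q_pos by simp
  define K1 where "K1 = K0 * (?x (a * L) * ?x (a / L) * ?x (norm g)) * (?x (norm (\<alpha> * ac * ac)) * ?x 1 * ?x (norm (\<alpha> * ac * g) / L))"
  have K1: "0 \<le> K1" unfolding K1_def using K0 by (intro mult_nonneg_nonneg) auto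
  define R where "R = a * d / q"
  have R: "1 \<le> R" using ad_ge_q q_pos by (simp add: R_def)
  have main: "norm (phi0 \<gamma> (complex_of_real (d * t * q powi k))) \<le> (K1 / (1 - z) * (s / \<bar>\<gamma>\<bar>) powi (1 - m)) * (\<bar>\<gamma>\<bar> / s) powi k" if k: "k \<le> 1 - m" for k
  proof -
    \<comment> \<open>\<open>Q\<close> vanishes at q^i exactly for i \<le> 0, so the last vanishing
      term has index - m - k and the first survivor is one further.\<close>
    define N where "N = nat (1 - m - k)"
    have N: "int N = 1 - m - k" using k by (simp add: N_def)
    define r where "r = d * t * q powi k"
    define x where "x = complex_of_real r"
    have r0: "r < 0" using d_pos par'(1) q_pos by (simp add: r_def mult_pos_neg mult_neg_pos)
    have absr: "\<bar>r\<bar> = \<bar>d * t\<bar> * q powi k" using q_pos by (simp add: r_def abs_mult)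
    have rN: "\<bar>r\<bar> * q ^ N = L"
    proof -
      have "q powi k * q ^ N = q powi (k + int N)" using q_pos by (simp add: power_int_add)
      also have "k + int N = 1 - m" using N by simp
      finally show ?thesis unfolding absr L_def by simp
    qed
    have rL: "L \<le> \<bar>r\<bar>"
      using rN mult_left_mono[of "q ^ N" 1 "\<bar>r\<bar>"] q_pos q_less_1 by (simp add: power_le_one)
    have nx: "norm x = \<bar>r\<bar>" by (simp add: x_def)
    have x0: "x \<noteq> 0" using r0 by (simp add: x_def)
    have eg: "\<alpha> * (ac * x) * g * qc ^ j = complex_of_real (q powi (m + k + int j))" for j
    proof -
      have "q / (a * d) * (a * r) * (s * \<gamma>) * q ^ j = q powi m * q powi k * q ^ j"
        unfolding r_def m using q_pos s_pos a_pos d_pos par'(1) by (simp add: field_simps)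
      also have "\<dots> = q powi (m + k + int j)" using q_pos by (simp add: power_int_add)
      finally have "complex_of_real (q / (a * d) * (a * r) * (s * \<gamma>) * q ^ j) = complex_of_real (q powi (m + k + int j))"
        by (simp only:)
      then show ?thesis unfolding \<alpha>_def g_def x_def
        by (simp only: of_real_mult of_real_divide of_real_power)
    qed
    have zero: "w8 \<alpha> (ac * x) (ac / x) g h CC DD j = 0" if "j < N" for j
    proof -
      define i where "i = nat (- (m + k + int j))"
      have i: "m + k + int j = - int i" using that N by (simp add: i_def)
      have "complex_of_real (q powi (m + k + int j)) * qc ^ i = 1"
        unfolding i using q_pos by (simp add: power_int_minus)
      then have "Q (\<alpha> * (ac * x) * g * qc ^ j) = 0" unfolding eg Q_eq_0_iff by blast
      then show ?thesis by (simp add: w8_def)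
    qed
    have bnd: "norm (w8 \<alpha> (ac * x) (ac / x) g h CC DD j) \<le> K1 * norm (P N (ac * x)) * z ^ j" if j: "N \<le> j" for j
    proof -
      have "P j (ac * x) = P N (ac * x) * P (j - N) (ac * x * qc ^ N)"
        using qpoch_add[of qc N "j - N" "ac * x"] j by simp
      moreover have "norm (P (j - N) (ac * x * qc ^ N)) \<le> ?x (a * L)"
        using P_bound[of "j - N" "ac * x * qc ^ N"] a_pos q_pos rN[symmetric] by (simp add: norm_mult norm_power nx mult_ac)
      ultimately have b1: "norm (P j (ac * x)) \<le> norm (P N (ac * x)) * ?x (a * L)"
        by (simp add: norm_mult mult_left_mono)
      have "a / \<bar>r\<bar> \<le> a / L" using rL L a_pos by (intro divide_left_mono) auto
      then have b2: "norm (P j (ac / x)) \<le> ?x (a / L)"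
        using P_bound'[of "ac / x" "a / L" j] a_pos nq by (simp add: norm_divide nx)
      have b3: "norm (P j g) \<le> ?x (norm g)" using P_bound[of j g] nq by simp
      have b4: "norm (Q (\<alpha> * (ac * x) * (ac / x) * qc ^ j)) \<le> ?x (norm (\<alpha> * ac * ac))"
      proof -
        have e: "\<alpha> * (ac * x) * (ac / x) = \<alpha> * ac * ac" using x0 by simp
        show ?thesis using Q_bound_pow[of "\<alpha> * ac * ac" j] unfolding e nq .
      qed
      have b5: "norm (Q (\<alpha> * (ac * x) * g * qc ^ j)) \<le> ?x 1"
      proof -
        have "0 \<le> m + k + int j" using j N by linarith
        then have "norm (complex_of_real (q powi (m + k + int j))) \<le> 1"
          unfolding norm_of_real using q_pos q_less_1 by (simp add: power_int_def power_le_one)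
        then show ?thesis unfolding eg using Q_bound' nq by metis
      qed
      have b6: "norm (Q (\<alpha> * (ac / x) * g * qc ^ j)) \<le> ?x (norm (\<alpha> * ac * g) / L)"
      proof -
        have "norm (\<alpha> * (ac / x) * g) = norm (\<alpha> * ac * g) / \<bar>r\<bar>" by (simp add: norm_mult norm_divide nx)
        also have "\<dots> \<le> norm (\<alpha> * ac * g) / L" using rL L by (intro divide_left_mono) auto
        finally show ?thesis using Q_bound'[OF order_trans[OF norm_mult_q_pow]] nq by metis
      qed
      have "norm (w8 \<alpha> (ac * x) (ac / x) g h CC DD j) = norm (wcoef h CC DD j) * z ^ j *
         (norm (P j (ac * x)) * norm (P j (ac / x)) * norm (P j g)) *
         (norm (Q (\<alpha> * (ac * x) * (ac / x) * qc ^ j)) * norm (Q (\<alpha> * (ac * x) * g * qc ^ j)) * norm (Q (\<alpha> * (ac / x) * g * qc ^ j)))"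
        unfolding w8_def by (simp only: norm_mult[of "_ * _"] norm_mult[of "wcoef _ _ _ _"] norm_mult[of "P _ _"] norm_mult[of "Q _"] norm_power zn)
      also have "\<dots> \<le> K0 * z ^ j * (norm (P N (ac * x)) * ?x (a * L) * ?x (a / L) * ?x (norm g)) *
          (?x (norm (\<alpha> * ac * ac)) * ?x 1 * ?x (norm (\<alpha> * ac * g) / L))"
        by (intro mult_mono mult_nonneg_nonneg K0 b1 b2 b3 b4 b5 b6 norm_ge_zero zero_le_power order_refl) (use z01 in auto)
      finally show ?thesis unfolding K1_def by (simp only: mult_ac)
    qed
    have sm: "summable (w8 \<alpha> (ac * x) (ac / x) g h CC DD)"
    proof -
      have "norm (w8 \<alpha> (ac * x) (ac / x) g h CC DD j) \<le> K1 * norm (P N (ac * x)) * z ^ j" for j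
        using bnd[of j] zero[of j] K1 z01 by (cases "j < N") (auto intro!: mult_nonneg_nonneg)
      then show ?thesis by (rule summable_geo_bound) (use z01 in auto)
    qed
    have "aw8 ac bc cc dc sc (complex_of_real \<gamma>) x = (\<Sum>j. w8 \<alpha> (ac * x) (ac / x) g h CC DD (j + N))"
      using suminf_split_initial_segment[OF sm, of N] zero
      by (simp add: aw8_def g_def h_def \<alpha>_def CC_def DD_def)
    also have "norm \<dots> \<le> (\<Sum>j. K1 * norm (P N (ac * x)) * z ^ N * z ^ j)"
    proof (rule norm_suminf_le)
      show "norm (w8 \<alpha> (ac * x) (ac / x) g h CC DD (n + N)) \<le> K1 * norm (P N (ac * x)) * z ^ N * z ^ n" for n
        using bnd[of "n + N"] unfolding power_add by (simp only: mult_ac le_add2 simp_thms)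
      show "summable (\<lambda>n. K1 * norm (P N (ac * x)) * z ^ N * z ^ n)"
        using z01 by (intro summable_mult summable_geometric) auto
    qed
    also have "\<dots> = K1 * norm (P N (ac * x)) * z ^ N * (1 / (1 - z))"
      using suminf_mult[OF summable_geometric[of z], of "K1 * norm (P N (ac * x)) * z ^ N"] suminf_geometric[of z] z01 by simp
    finally have A: "norm (aw8 ac bc cc dc sc (complex_of_real \<gamma>) x) \<le> K1 * norm (P N (ac * x)) * z ^ N * (1 / (1 - z))" .
    have PR: "norm (P N (ac * x)) \<le> R ^ N * norm (P N (qc * x / dc))"
    proof -
      have e: "ac * x = complex_of_real (a * r)" "qc * x / dc = complex_of_real (q * r / d)" by (simp_all add: x_def)
      have ar: "a * r \<le> 0" "q * r / d \<le> 0" using r0 a_pos d_pos q_pos by (auto simp: mult_pos_neg divide_neg_pos less_imp_le)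
      have "(\<Prod>i<N. 1 - a * r * q ^ i) \<le> (\<Prod>i<N. R * (1 - q * r / d * q ^ i))"
      proof (rule prod_mono, safe)
        fix i
        have "a * r * q ^ i \<le> 0" using ar(1) q_pos by (simp add: mult_nonpos_nonneg)
        then show "0 \<le> 1 - a * r * q ^ i" by simp
        have "R * (q * r / d * q ^ i) = a * r * q ^ i" using q_pos d_pos by (simp add: R_def)
        then show "1 - a * r * q ^ i \<le> R * (1 - q * r / d * q ^ i)" using R by (simp add: right_diff_distrib)
      qed
      then show ?thesis unfolding e P_neg[OF ar(1)] P_neg[OF ar(2)] by (simp add: prod.distrib)
    qed
    have Qd: "norm (P N (qc * x / dc)) \<le> norm (Q (qc * x / dc))" "1 \<le> norm (Q (qc / (dc * x)))" "0 < norm (P N (qc * x / dc))"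
    proof -
      have e: "qc * x / dc = complex_of_real (q * r / d)" "qc / (dc * x) = complex_of_real (q / (d * r))" by (simp_all add: x_def)
      have "q * r / d \<le> 0" "q / (d * r) \<le> 0" using r0 d_pos q_pos by (auto simp: mult_pos_neg divide_neg_pos divide_pos_neg less_imp_le)
      from Q_neg_ge_P[OF this(1), of N] Q_neg_ge_1[OF this(2)] P_neg_ge_1[OF this(1), of N]
      show "norm (P N (qc * x / dc)) \<le> norm (Q (qc * x / dc))" "1 \<le> norm (Q (qc / (dc * x)))" "0 < norm (P N (qc * x / dc))"
        unfolding e by auto
    qed
    have "norm (phi0 \<gamma> x) = norm (aw8 ac bc cc dc sc (complex_of_real \<gamma>) x) / (norm (Q (qc * x / dc)) * norm (Q (qc / (dc * x))))"
      by (simp add: awf_def norm_divide norm_mult)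
    also have "\<dots> \<le> (K1 * (R ^ N * norm (P N (qc * x / dc))) * z ^ N * (1 / (1 - z))) / (norm (P N (qc * x / dc)) * 1)"
    proof (rule frac_le)
      show "norm (aw8 ac bc cc dc sc (complex_of_real \<gamma>) x) \<le> K1 * (R ^ N * norm (P N (qc * x / dc))) * z ^ N * (1 / (1 - z))"
        by (rule order_trans[OF A], intro mult_right_mono mult_left_mono PR) (use K1 z01 in auto)
      show "norm (P N (qc * x / dc)) * 1 \<le> norm (Q (qc * x / dc)) * norm (Q (qc / (dc * x)))"
        by (rule mult_mono) (use Qd in auto)
    qed (use Qd K1 z01 R in auto)
    also have "\<dots> = K1 / (1 - z) * (R * z) ^ N"
      using Qd(3) by (simp add: power_mult_distrib)
    also have "R * z = s / \<bar>\<gamma>\<bar>"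
      using q_pos a_pos d_pos by (simp add: R_def z_def)
    also have "(s / \<bar>\<gamma>\<bar>) ^ N = (s / \<bar>\<gamma>\<bar>) powi (1 - m) * (\<bar>\<gamma>\<bar> / s) powi k"
    proof -
      have sg: "s / \<bar>\<gamma>\<bar> \<noteq> 0" using s_pos g1 by auto
      have "(s / \<bar>\<gamma>\<bar>) ^ N = (s / \<bar>\<gamma>\<bar>) powi (1 - m - k)" unfolding N[symmetric] by simp
      also have "\<dots> = (s / \<bar>\<gamma>\<bar>) powi (1 - m) * (s / \<bar>\<gamma>\<bar>) powi (- k)"
        using power_int_add[of "s / \<bar>\<gamma>\<bar>" "1 - m" "- k"] sg by simp
      also have "(s / \<bar>\<gamma>\<bar>) powi (- k) = (\<bar>\<gamma>\<bar> / s) powi k"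
        unfolding power_int_minus power_int_inverse[symmetric] by simp
      finally show ?thesis .
    qed
    finally show ?thesis unfolding x_def r_def by (simp only: mult.assoc)
  qed
  then show ?thesis by blast
qed

text \<open>For \<gamma> = s q^n the factor \<open>Q (s / \<gamma>)\<close> removes the second
  balanced series and the first one terminates: an Askey-Wilson polynomial in x + 1/x. At generic d'
  the quotient of \<open>Q (a * d' * q ^ j)\<close> by \<open>Q (a * d')\<close> is written as
  1/(ad';q)_j, which has a limit also when a d lies in q^Z.\<close>

lemma awf_poly:
  assumes \<gamma>: "\<gamma> \<in> AW_dual_S q a b c d t" and n: "\<gamma> = s * q ^ n" "1 < \<gamma>"
  obtains cf where "\<And>x. x \<noteq> 0 \<Longrightarrow> Q (qc * x / dc) \<noteq> 0 \<Longrightarrow> Q (qc / (dc * x)) \<noteq> 0 \<Longrightarrow>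
     phi0 \<gamma> x = (\<Sum>j\<le>n. cf j * (P j (ac * x) * P j (ac / x)))"
proof -
  define S where "S d' = complex_of_real (dual_a q a b c d')" for d'
  define g where "g d' = S d' * qc ^ n" for d'
  define cf' where "cf' d' j = Q (ac * ac * bc * cc * g d' / S d') * Q (qc * (S d' * g d') / (ac * complex_of_real d')) / Q (qc / (ac * complex_of_real d')) *
      (qc ^ j * Q (qc * qc ^ j) * Q (ac * bc * qc ^ j) * Q (ac * cc * qc ^ j) * P j (S d' * g d') * P j (1 / qc ^ n)) / P j (ac * complex_of_real d')" for d' j
  define cf where "cf j = Q (ac * ac * bc * cc * \<gamma> / sc) * Q (qc * (sc * \<gamma>) / (ac * dc)) / Q (qc / (ac * dc)) *
      (qc ^ j * Q (qc * qc ^ j) * Q (ac * bc * qc ^ j) * Q (ac * cc * qc ^ j) * P j (sc * \<gamma>) * P j (1 / qc ^ n)) / P j (ac * dc)" for j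
  have s2: "q < s * s * q ^ (2 * n) * q"
  proof -
    have "1 * 1 < \<gamma> * \<gamma>" using n(2) by (intro mult_strict_mono) auto
    moreover have "\<gamma> * \<gamma> = s * s * q ^ (2 * n)"
      unfolding n(1) mult_2 power_add by (simp only: mult_ac)
    ultimately have "1 < s * s * q ^ (2 * n)" by (simp only: mult_1_left)
    then show ?thesis using q_pos by simp
  qed
  have e2: "s * s * q ^ (2 * n) * q = a * d * (b * c) * q ^ (2 * n)"
  proof -
    have "s * s * q ^ (2 * n) * q = q * (s * s) * q ^ (2 * n)" by (simp only: mult_ac)
    then show ?thesis unfolding s_sq by (simp only: mult_ac)
  qed
  have bcp: "0 < b * c" using par' by simp
  have adq: "q < a * d"
  proof -
    have "b * c * q ^ (2 * n) \<le> 1 * 1" using bc_less_1 bcp q_pos q_less_1 by (intro mult_mono) (auto simp: power_le_one)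
    then have "a * d * (b * c * q ^ (2 * n)) \<le> a * d * 1" using a_pos d_pos by (intro mult_left_mono) auto
    moreover have "q < a * d * (b * c * q ^ (2 * n))" using s2 unfolding e2 by (simp only: mult.assoc)
    ultimately show ?thesis by linarith
  qed
  have Qad: "Q (qc / (ac * dc)) \<noteq> 0"
    using Q_nz_real[of "q / (a * d)"] adq a_pos d_pos by simp
  \<comment> \<open>The condition \<gamma> > 1 amounts to q < a d b c q^(2n). A zero a d q^i = 1
    with i < n would bound the right-hand side by b c q < q.\<close>
  have Pad: "P j (ac * dc) \<noteq> 0" if "j \<le> n" for j
  proof
    assume "P j (ac * dc) = 0"
    then obtain i where i: "i < j" "ac * dc * qc ^ i = 1" by (auto simp: qpoch_def)
    then have "complex_of_real (a * d * q ^ i) = complex_of_real 1" by simp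
    then have "a * d * q ^ i = 1" by (simp only: of_real_eq_iff)
    moreover have "q ^ (2 * n) \<le> q ^ (i + 1)" using i that q_pos q_less_1 by (intro power_decreasing) auto
    moreover have "0 < a * d * (b * c)" using a_pos d_pos bcp by simp
    ultimately have "a * d * (b * c) * q ^ (2 * n) \<le> b * c * q"
      using mult_left_mono[of "q ^ (2 * n)" "q ^ (i + 1)" "a * d * (b * c)"] by (simp add: mult_ac) (metis mult.assoc mult.commute mult.left_neutral)
    also have "b * c * q < 1 * q" using bc_less_1 q_pos by (intro mult_strict_right_mono) auto
    finally show False using s2 e2 by simp
  qed
  have gt: "((\<lambda>d'. g d') \<longlongrightarrow> complex_of_real \<gamma>) dgen"
  proof -
    have "((\<lambda>d'. S d' * qc ^ n) \<longlongrightarrow> sc * qc ^ n) dgen"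
      unfolding S_def dual_a_def
      by (intro tendsto_mult tendsto_of_real tendsto_real_sqrt tendsto_divide tendsto_const dgen_tendsto) (use q_pos in auto)
    then show ?thesis unfolding g_def n(1) by simp
  qed
  note eg = ev_good[OF tendsto_const tendsto_const tendsto_const dgen_tendsto \<gamma> gt]
  have main: "phi0 \<gamma> x = (\<Sum>j\<le>n. cf j * (P j (ac * x) * P j (ac / x)))"
    if x: "x \<noteq> 0" "Q (qc * x / dc) \<noteq> 0" "Q (qc / (dc * x)) \<noteq> 0" for x
  proof -
    note e = eg[OF x]
    have nz: "ac \<noteq> 0" "dc \<noteq> 0" "sc \<noteq> 0" using a_pos d_pos s_pos by auto
    have Sl: "(S \<longlongrightarrow> sc) dgen" using e(2) by (simp add: S_def[abs_def])
    have lim: "((\<lambda>d'. \<Sum>j\<le>n. cf' d' j * (P j (ac * x) * P j (ac / x))) \<longlongrightarrow> (\<Sum>j\<le>n. cf j * (P j (ac * x) * P j (ac / x)))) dgen"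
      unfolding cf'_def cf_def
    proof (intro tendsto_sum tendsto_mult[OF _ tendsto_const])
      fix j assume j: "j \<in> {..n}"
      have u: "((\<lambda>d'. Q (ac * ac * bc * cc * g d' / S d')) \<longlongrightarrow> Q (ac * ac * bc * cc * \<gamma> / sc)) dgen"
        by (rule tendsto_Q[OF tendsto_divide[OF tendsto_mult[OF tendsto_const gt] Sl nz(3)]])
      have v: "((\<lambda>d'. Q (qc * (S d' * g d') / (ac * complex_of_real d'))) \<longlongrightarrow> Q (qc * (sc * \<gamma>) / (ac * dc))) dgen"
        by (rule tendsto_Q[OF tendsto_divide[OF tendsto_mult[OF tendsto_const tendsto_mult[OF Sl gt]] tendsto_mult[OF tendsto_const e(6)]]])
          (use nz in simp)
      have w: "((\<lambda>d'. Q (qc / (ac * complex_of_real d'))) \<longlongrightarrow> Q (qc / (ac * dc))) dgen"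
        by (rule tendsto_Q[OF tendsto_divide[OF tendsto_const tendsto_mult[OF tendsto_const e(6)]]]) (use nz in simp)
      have y: "((\<lambda>d'. P j (S d' * g d')) \<longlongrightarrow> P j (sc * \<gamma>)) dgen"
        by (rule tendsto_P[OF tendsto_mult[OF Sl gt]])
      have p: "((\<lambda>d'. P j (ac * complex_of_real d')) \<longlongrightarrow> P j (ac * dc)) dgen"
        by (rule tendsto_P[OF tendsto_mult[OF tendsto_const e(6)]])
      have "P j (ac * dc) \<noteq> 0" using Pad j by simp
      then show "((\<lambda>d'. Q (ac * ac * bc * cc * g d' / S d') * Q (qc * (S d' * g d') / (ac * complex_of_real d')) / Q (qc / (ac * complex_of_real d')) *
        (qc ^ j * Q (qc * qc ^ j) * Q (ac * bc * qc ^ j) * Q (ac * cc * qc ^ j) * P j (S d' * g d') * P j (1 / qc ^ n)) / P j (ac * complex_of_real d'))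
        \<longlongrightarrow> Q (ac * ac * bc * cc * \<gamma> / sc) * Q (qc * (sc * \<gamma>) / (ac * dc)) / Q (qc / (ac * dc)) *
        (qc ^ j * Q (qc * qc ^ j) * Q (ac * bc * qc ^ j) * Q (ac * cc * qc ^ j) * P j (sc * \<gamma>) * P j (1 / qc ^ n)) / P j (ac * dc)) dgen"
        by (intro tendsto_divide[OF tendsto_mult[OF tendsto_divide[OF tendsto_mult[OF u v] w Qad] tendsto_mult[OF tendsto_mult[OF tendsto_const y] tendsto_const]] p])
    qed
    have ev: "\<forall>\<^sub>F d' in dgen. awf ac bc cc (complex_of_real d') (S d') (g d') x = (\<Sum>j\<le>n. cf' d' j * (P j (ac * x) * P j (ac / x)))"
      using e(1) dgen_generic
    proof eventually_elim
      case (elim d')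
      note el = elim(1)[folded S_def]
      have ad0: "a * d' \<noteq> 0" using elim(1) by auto
      note gn = generic_nz[OF elim(2) ad0, unfolded of_real_mult]
      have h: "S d' / g d' = 1 / qc ^ n" using el by (simp add: g_def)
      have Qh: "Q (1 / qc ^ n) = 0" unfolding Q_eq_0_iff by (rule exI[of _ n]) (use q0 in simp)
      have Ph: "P j (1 / qc ^ n) = 0" if "j > n" for j
        unfolding qpoch_def using that q0 by (intro prod_zero) (auto intro!: bexI[of _ n])
      have "awf ac bc cc (complex_of_real d') (S d') (g d') x = Q (ac * ac * bc * cc * g d' / S d') * Q (qc * (S d' * g d') / (ac * complex_of_real d')) / (Q (ac * complex_of_real d') * Q (qc / (ac * complex_of_real d'))) *
          (\<Sum>j. 1 * qc ^ j * lmu ac bc cc (complex_of_real d') (S d' * g d') (1 / qc ^ n) 1 j * (P j (ac * x) * P j (ac / x)))"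
        using awf_bailey(1)[of ac "complex_of_real d'" "S d'" "g d'" bc cc x] el gn x(1) unfolding h Qh by simp
      also have "(\<Sum>j. 1 * qc ^ j * lmu ac bc cc (complex_of_real d') (S d' * g d') (1 / qc ^ n) 1 j * (P j (ac * x) * P j (ac / x)))
          = (\<Sum>j\<le>n. 1 * qc ^ j * lmu ac bc cc (complex_of_real d') (S d' * g d') (1 / qc ^ n) 1 j * (P j (ac * x) * P j (ac / x)))"
        by (rule suminf_finite) (use Ph in \<open>auto simp: lmu_def\<close>)
      also have "Q (ac * ac * bc * cc * g d' / S d') * Q (qc * (S d' * g d') / (ac * complex_of_real d')) / (Q (ac * complex_of_real d') * Q (qc / (ac * complex_of_real d'))) * \<dots>
          = (\<Sum>j\<le>n. cf' d' j * (P j (ac * x) * P j (ac / x)))"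
        unfolding sum_distrib_left
      proof (rule sum.cong[OF refl])
        fix j
        have "Q (ac * complex_of_real d' * qc ^ j) \<noteq> 0" by (rule Q_nz_pow[OF gn(1)])
        then show "Q (ac * ac * bc * cc * g d' / S d') * Q (qc * (S d' * g d') / (ac * complex_of_real d')) / (Q (ac * complex_of_real d') * Q (qc / (ac * complex_of_real d'))) *
            (1 * qc ^ j * lmu ac bc cc (complex_of_real d') (S d' * g d') (1 / qc ^ n) 1 j * (P j (ac * x) * P j (ac / x))) = cf' d' j * (P j (ac * x) * P j (ac / x))"
          unfolding cf'_def lmu_def P_eq[OF gn(1)] using gn(1,2) by (simp add: mult_ac)
      qed
      finally show ?case .
    qed
    show ?thesis
    proof (rule tendsto_unique[OF dgen_nontrivial _ Lim_transform_eventually[OF lim]])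
      show "((\<lambda>d'. awf ac bc cc (complex_of_real d') (S d') (g d') x) \<longlongrightarrow> phi0 \<gamma> x) dgen"
        using e(8) by (simp add: S_def)
      show "\<forall>\<^sub>F d' in dgen. (\<Sum>j\<le>n. cf' d' j * (P j (ac * x) * P j (ac / x))) = awf ac bc cc (complex_of_real d') (S d') (g d') x"
        using ev by eventually_elim simp
    qed
  qed
  then show ?thesis by (rule that)
qed

lemma Q_d_neg:
  assumes "r < 0"
  shows "Q (qc * complex_of_real r / dc) \<noteq> 0" "Q (qc / (dc * complex_of_real r)) \<noteq> 0"
proof -
  have "q * r / d < 1" "q / (d * r) < 1"
  proof -
    have "q * r / d < 0" "q / (d * r) < 0" using assms d_pos q_pos by (auto simp: mult_pos_neg divide_neg_pos divide_pos_neg)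
    then show "q * r / d < 1" "q / (d * r) < 1" by linarith+
  qed
  then show "Q (qc * complex_of_real r / dc) \<noteq> 0" "Q (qc / (dc * complex_of_real r)) \<noteq> 0"
    using Q_nz_real[of "q * r / d"] Q_nz_real[of "q / (d * r)"] by simp_all
qed

text \<open>The polynomial is O(|x|^n) for large |x|, and at x = d t q^k this is a constant times
  q^(k n) = (\<gamma>/s)^k.\<close>

lemma decay_plus:
  assumes \<gamma>: "\<gamma> \<in> AW_dual_S q a b c d t" and n: "\<gamma> = s * q ^ n" "1 < \<gamma>"
  shows "\<exists>C k0. \<forall>k\<le>k0. norm (phi0 \<gamma> (complex_of_real (d * t * q powi k))) \<le> C * (\<bar>\<gamma>\<bar> / s) powi k"
proof -
  obtain cf where cf: "\<And>x. x \<noteq> 0 \<Longrightarrow> Q (qc * x / dc) \<noteq> 0 \<Longrightarrow> Q (qc / (dc * x)) \<noteq> 0 \<Longrightarrow>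
     phi0 \<gamma> x = (\<Sum>j\<le>n. cf j * (P j (ac * x) * P j (ac / x)))"
    using awf_poly[OF assms] by blast
  have dt: "0 < \<bar>d * t\<bar>" "d * t < 0" using d_pos par'(1) by (auto simp: mult_pos_neg)
  obtain M where M: "q ^ M < \<bar>d * t\<bar>" using real_arch_pow_inv[OF dt(1) q_less_1] by blast
  define C where "C = (\<Sum>j\<le>n. norm (cf j) * ((1 + a) ^ j * (1 + a) ^ j)) * \<bar>d * t\<bar> ^ n"
  have "norm (phi0 \<gamma> (complex_of_real (d * t * q powi k))) \<le> C * (\<bar>\<gamma>\<bar> / s) powi k" if k: "k \<le> - int M" for k
  proof -
    define r where "r = d * t * q powi k"
    define y where "y = \<bar>r\<bar>"
    have yk: "y = \<bar>d * t\<bar> * q powi k" using q_pos by (simp add: y_def r_def abs_mult)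
    have "1 = q ^ M * q powi (- int M)" using q_pos by (simp add: power_int_minus)
    also have "\<dots> \<le> \<bar>d * t\<bar> * q powi (- int M)" using M q_pos by (intro mult_right_mono) auto
    also have "\<dots> \<le> \<bar>d * t\<bar> * q powi k"
      using k q_pos q_less_1 by (intro mult_left_mono power_int_decreasing) auto
    finally have y1: "1 \<le> y" unfolding yk .
    have r0: "r < 0" using dt q_pos by (simp add: r_def mult_neg_pos)
    have Pb: "norm (P j u) \<le> (1 + norm u) ^ j" for j u
    proof -
      have "norm (P j u) \<le> (\<Prod>i<j. 1 + norm u)"
        unfolding qpoch_def prod_norm[symmetric]
      proof (rule prod_mono, safe)
        fix i show "norm (1 - u * qc ^ i) \<le> 1 + norm u"
          using norm_triangle_ineq4[of 1 "u * qc ^ i"] norm_mult_q_pow[of u i] by simp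
      qed auto
      then show ?thesis by simp
    qed
    have "norm (phi0 \<gamma> (complex_of_real r)) \<le> (\<Sum>j\<le>n. norm (cf j) * ((1 + a) ^ j * (1 + a) ^ j) * y ^ n)"
      unfolding cf[OF _ Q_d_neg[OF r0], simplified] using r0
    proof (subst cf[OF _ Q_d_neg[OF r0]], simp, intro sum_norm_le)
      fix j assume j: "j \<in> {..n}"
      have "norm (P j (ac * complex_of_real r)) \<le> ((1 + a) * y) ^ j"
        by (rule order_trans[OF Pb]) (use a_pos y1 in \<open>auto simp: norm_mult y_def algebra_simps intro!: power_mono\<close>)
      also have "\<dots> \<le> (1 + a) ^ j * y ^ n"
        unfolding power_mult_distrib using j y1 a_pos by (intro mult_left_mono power_increasing) auto
      finally have b1: "norm (P j (ac * complex_of_real r)) \<le> (1 + a) ^ j * y ^ n" .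
      have "a / y \<le> a / 1" using y1 a_pos by (intro divide_left_mono) auto
      then have b2: "norm (P j (ac / complex_of_real r)) \<le> (1 + a) ^ j"
        by (intro order_trans[OF Pb] power_mono) (use a_pos y1 in \<open>auto simp: norm_divide y_def\<close>)
      have "norm (cf j * (P j (ac * complex_of_real r) * P j (ac / complex_of_real r))) \<le> norm (cf j) * (((1 + a) ^ j * y ^ n) * (1 + a) ^ j)"
        unfolding norm_mult by (intro mult_left_mono mult_mono b1 b2) (use a_pos y1 in auto)
      then show "norm (cf j * (P j (ac * complex_of_real r) * P j (ac / complex_of_real r))) \<le> norm (cf j) * ((1 + a) ^ j * (1 + a) ^ j) * y ^ n"
        by (simp only: mult_ac)
    qed
    also have "\<dots> = C * (q powi k) ^ n"
      unfolding C_def sum_distrib_right[symmetric] yk power_mult_distrib by (simp only: mult.assoc)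
    also have "(q powi k) ^ n = (\<bar>\<gamma>\<bar> / s) powi k"
    proof -
      have "\<bar>\<gamma>\<bar> / s = q ^ n" using n s_pos by simp
      then show ?thesis by (simp add: power_int_mult[symmetric] mult.commute flip: power_int_of_nat)
    qed
    finally show ?thesis unfolding r_def .
  qed
  then show ?thesis by blast
qed

lemma decay:
  assumes \<gamma>: "\<gamma> \<in> AW_dual_S q a b c d t"
  obtains C k0 where "\<And>k. k \<le> k0 \<Longrightarrow> norm (phi0 \<gamma> (complex_of_real (d * t * q powi k))) \<le> C * (\<bar>\<gamma>\<bar> / s) powi k"
  using \<gamma>
proof (cases rule: dual_S_cases)
  case (plus n)
  then show ?thesis using decay_plus[OF \<gamma> plus] that by blast
next
  case (minus m)
  then show ?thesis using decay_minus[OF \<gamma> minus(1)] that by blast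
qed

end



section \<open>Theta functions and merging poles\<close>

context qbase
begin

definition theta :: "complex \<Rightarrow> complex" where
  "theta y = Q y * Q (q / y)"

lemma theta_q: "y \<noteq> 0 \<Longrightarrow> theta (y * q) * y = - theta y"
proof -
  assume y: "y \<noteq> 0"
  have e: "q / (y * q) = 1 / y" "1 / y * q = q / y" using q0 y by simp_all
  have "(1 - 1 / y) * y = - (1 - y)" using y by (simp add: field_simps)
  then have "Q (y * q) * ((1 - 1 / y) * Q (q / y)) * y = - ((1 - y) * Q (y * q) * Q (q / y))" by algebra
  then show ?thesis
    unfolding theta_def e using Q_rec[of y] Q_rec[of "1 / y"] by (simp only: e)
qed

text \<open>The factor E depends on k alone. Its explicit value is left open because it cancels from
  the residues.\<close>

lemma theta_quasi_period:
  "\<exists>E. E \<noteq> 0 \<and> (\<forall>y. y \<noteq> 0 \<longrightarrow> theta (y * q powi k) * y powi k = E * theta y)"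
proof (induction k rule: int_induct[where k = 0])
  case base
  show ?case by (intro exI[of _ 1]) simp
next
  case (step1 i)
  then obtain E where E: "E \<noteq> 0" "\<And>y. y \<noteq> 0 \<Longrightarrow> theta (y * q powi i) * y powi i = E * theta y" by blast
  show ?case
  proof (intro exI[of _ "- E / q powi i"] conjI allI impI)
    show "- E / q powi i \<noteq> 0" using E q0 by simp
    fix y :: complex assume y: "y \<noteq> 0"
    have "theta (y * q powi i * q) * (y * q powi i) = - theta (y * q powi i)"
      by (rule theta_q) (use y q0 in simp)
    moreover have "y * q powi (i + 1) = y * q powi i * q" "y powi (i + 1) = y powi i * y"
      using q0 y by (simp_all add: power_int_add)
    moreover have "A * (u * y) = - E / p * th" if "A * (y * p) = - B" "B * u = E * th" "p \<noteq> 0" for A B u p th :: complex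
    proof -
      have "A * (u * y) * p = - E * th" using that(1,2) by algebra
      then show ?thesis using nonzero_eq_divide_eq[OF that(3), of "A * (u * y)" "- E * th"] by simp
    qed
    ultimately show "theta (y * q powi (i + 1)) * y powi (i + 1) = - E / q powi i * theta y"
      using E(2)[OF y] q0 by (simp only: power_int_eq_0_iff simp_thms)
  qed
next
  case (step2 i)
  then obtain E where E: "E \<noteq> 0" "\<And>y. y \<noteq> 0 \<Longrightarrow> theta (y * q powi i) * y powi i = E * theta y" by blast
  show ?case
  proof (intro exI[of _ "- E * q powi (i - 1)"] conjI allI impI)
    show "- E * q powi (i - 1) \<noteq> 0" using E q0 by simp
    fix y :: complex assume y: "y \<noteq> 0"
    have "theta (y * q powi (i - 1) * q) * (y * q powi (i - 1)) = - theta (y * q powi (i - 1))"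
      by (rule theta_q) (use y q0 in simp)
    moreover have "y * q powi i = y * q powi (i - 1) * q" "y powi i = y powi (i - 1) * y"
      using q0 y by (simp_all add: power_int_diff)
    moreover have "B * u = - E * p * th" if "A * (y * p) = - B" "A * (u * y) = E * th" for A B u p th :: complex
      using that by algebra
    ultimately show "theta (y * q powi (i - 1)) * y powi (i - 1) = - E * q powi (i - 1) * theta y"
      using E(2)[OF y] by metis
  qed
qed

text \<open>If a^2 q^n = 1, then 1 - x^2 q^n and 1 - a x q^n both vanish at x = a, the former twice
  as fast; all other factors have the same limit in numerator and denominator. Otherwise the
  quotient is continuous with value 1.\<close>

lemma double_zero_ratio:
  assumes a: "a \<noteq> 0"
  shows "((\<lambda>x. Q (x\<^sup>2) / Q (a * x)) \<longlongrightarrow> (if Q (a\<^sup>2) = 0 then 2 else 1)) (at a)"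
proof (cases "Q (a\<^sup>2) = 0")
  case False
  have "((\<lambda>x. Q (x\<^sup>2) / Q (a * x)) \<longlongrightarrow> Q (a\<^sup>2) / Q (a * a)) (at a)"
    by (intro tendsto_intros) (use False in \<open>simp add: power2_eq_square\<close>)
  then show ?thesis using False by (simp add: power2_eq_square)
next
  case True
  then obtain n where n: "a\<^sup>2 * q ^ n = 1" by (auto simp: Q_eq_0_iff)
  have Pn: "P n (a * a) \<noteq> 0"
  proof
    assume "P n (a * a) = 0"
    then obtain j where j: "j < n" "a\<^sup>2 * q ^ j = 1" by (auto simp: qpoch_def power2_eq_square)
    have "q ^ n = q ^ j * q ^ (n - j)" using j by (simp flip: power_add)
    then have "a\<^sup>2 * q ^ j * q ^ (n - j) = 1" using n by (simp add: mult.assoc)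
    then have "q ^ (n - j) = 1" using j(2) by simp
    moreover have "norm (q ^ (n - j)) < 1" using q1 j by (simp add: norm_power power_less_one_iff)
    ultimately show False by simp
  qed
  have aq: "a * a * q ^ n * q = q" using n by (simp add: power2_eq_square)
  have Qn: "Q (a * a * q ^ n * q) \<noteq> 0" unfolding aq by (rule Q_nz[OF q1])
  have "((\<lambda>x. P n (x\<^sup>2) / P n (a * x) * ((a + x) / a) * (Q (x\<^sup>2 * q ^ n * q) / Q (a * x * q ^ n * q)))
      \<longlongrightarrow> P n (a\<^sup>2) / P n (a * a) * ((a + a) / a) * (Q (a\<^sup>2 * q ^ n * q) / Q (a * a * q ^ n * q))) (at a)"
    by (intro tendsto_intros) (use a Pn Qn in auto)
  moreover have "P n (a\<^sup>2) / P n (a * a) * ((a + a) / a) * (Q (a\<^sup>2 * q ^ n * q) / Q (a * a * q ^ n * q)) = 2"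
    using Pn Qn a by (simp add: power2_eq_square)
  moreover have "eventually (\<lambda>x. P n (x\<^sup>2) / P n (a * x) * ((a + x) / a) * (Q (x\<^sup>2 * q ^ n * q) / Q (a * x * q ^ n * q)) = Q (x\<^sup>2) / Q (a * x)) (at a)"
    unfolding eventually_at_filter
  proof (intro always_eventually allI impI)
    fix x assume x: "x \<noteq> a"
    have s: "Q y = P n y * (1 - y * q ^ n) * Q (y * q ^ n * q)" for y
      using Q_shift[of y n] Q_rec[of "y * q ^ n"] by simp
    have qn: "q ^ n = 1 / a\<^sup>2" using n a by (simp add: field_simps)
    have e: "(1 - x\<^sup>2 * q ^ n) = (a - x) * (a + x) / a\<^sup>2" "1 - a * x * q ^ n = (a - x) * a / a\<^sup>2"
      unfolding qn using a by (simp_all add: field_simps power2_eq_square)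
    have "(1 - x\<^sup>2 * q ^ n) / (1 - a * x * q ^ n) = (a + x) / a"
      unfolding e using x a by (simp add: field_simps)
    then show "P n (x\<^sup>2) / P n (a * x) * ((a + x) / a) * (Q (x\<^sup>2 * q ^ n * q) / Q (a * x * q ^ n * q)) = Q (x\<^sup>2) / Q (a * x)"
      unfolding s[of "x\<^sup>2"] s[of "a * x"] by (metis times_divide_times_eq)
  qed
  ultimately show ?thesis using True by (auto intro: Lim_transform_eventually)
qed

end

context awq
begin

lemma of_real_qinf1: "complex_of_real (qinf1 q y) = Q (complex_of_real y)"
proof -
  have "(\<lambda>m. \<Prod>i\<le>m. 1 - y * q ^ i) \<longlonglongrightarrow> qinf1 q y"
    unfolding qinf1_def by (rule convergent_prod_LIMSEQ[OF convergent_prod_qinf1]) (use q_pos q_less_1 in simp)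
  then have "(\<lambda>m. complex_of_real (\<Prod>i\<le>m. 1 - y * q ^ i)) \<longlonglongrightarrow> complex_of_real (qinf1 q y)"
    by (rule tendsto_of_real)
  moreover have "(\<lambda>m. complex_of_real (\<Prod>i\<le>m. 1 - y * q ^ i)) \<longlonglongrightarrow> Q (complex_of_real y)"
    unfolding qinf1_def using convergent_prod_LIMSEQ[OF convergent_prod_qinf1[OF q1], of "complex_of_real y"] by simp
  ultimately show ?thesis by (rule LIMSEQ_unique)
qed

lemma qinf1_pos: "y < 1 \<Longrightarrow> 0 < qinf1 q y"
proof -
  assume y: "y < 1"
  have "(\<lambda>m. \<Prod>i\<le>m. 1 - y * q ^ i) \<longlonglongrightarrow> qinf1 q y"
    unfolding qinf1_def by (rule convergent_prod_LIMSEQ[OF convergent_prod_qinf1]) (use q_pos q_less_1 in simp)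
  moreover have "0 \<le> (\<Prod>i\<le>m. 1 - y * q ^ i)" for m
  proof (rule prod_nonneg, safe)
    fix i
    have "y * q ^ i \<le> 1"
    proof (cases "y \<le> 0")
      case True
      then have "y * q ^ i \<le> 0" using q_pos by (simp add: mult_nonpos_nonneg)
      then show ?thesis by linarith
    next
      case False
      have "q ^ i \<le> 1" using q_pos q_less_1 by (simp add: power_le_one)
      then show ?thesis using False y mult_mono[of y 1 "q ^ i" 1] q_pos by simp
    qed
    then show "0 \<le> 1 - y * q ^ i" by simp
  qed
  ultimately have "0 \<le> qinf1 q y" by (intro LIMSEQ_le_const) auto
  moreover have "qinf1 q y \<noteq> 0"
    using Q_nz_real[OF y] of_real_qinf1[of y] by auto
  ultimately show ?thesis by simp
qed

lemma of_real_qfac1: "complex_of_real (qfac1 q k y) = qfac1 qc k (complex_of_real y)"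
  unfolding qfac1_def by (simp add: of_real_prod)

text \<open>Equal to 2 exactly if the lattice y q^Z is invariant under inversion. Then a pole of the
  weight from the lattice meets one from the inverse lattice, and the residue becomes twice the
  mass, which is defined by continuity in the parameters.\<close>

definition eps :: "real \<Rightarrow> real" where
  "eps y = (if \<exists>j::int. y\<^sup>2 = q powi j then 2 else 1)"

lemma eps_shift: "eps (y * q powi k) = eps y"
proof -
  have e: "(y * q powi k)\<^sup>2 = y\<^sup>2 * q powi (2 * k)"
  proof -
    have "q \<noteq> 0 \<or> k + k \<noteq> 0" using q_pos by simp
    then have "q powi (2 * k) = q powi k * q powi k" unfolding mult_2 by (rule power_int_add)
    then show ?thesis by (simp only: power2_eq_square mult_ac)
  qed
  have "(\<exists>j::int. y\<^sup>2 * q powi (2 * k) = q powi j) \<longleftrightarrow> (\<exists>j::int. y\<^sup>2 = q powi j)"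
  proof
    assume "\<exists>j::int. y\<^sup>2 * q powi (2 * k) = q powi j"
    then obtain j where "y\<^sup>2 * q powi (2 * k) = q powi j" by blast
    then have "y\<^sup>2 = q powi (j - 2 * k)" using q_pos by (simp add: power_int_diff nonzero_eq_divide_eq)
    then show "\<exists>j::int. y\<^sup>2 = q powi j" by blast
  next
    assume "\<exists>j::int. y\<^sup>2 = q powi j"
    then obtain j where "y\<^sup>2 = q powi j" by blast
    then have "y\<^sup>2 * q powi (2 * k) = q powi (j + 2 * k)" using q_pos by (simp add: power_int_add)
    then show "\<exists>j::int. y\<^sup>2 * q powi (2 * k) = q powi j" by blast
  qed
  then show ?thesis unfolding eps_def e by simp
qed

lemma eps_eq:
  assumes "\<bar>y\<bar> > 1"
  shows "(if Q ((complex_of_real y)\<^sup>2) = 0 then 2 else 1) = complex_of_real (eps y)"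
proof -
  have "Q ((complex_of_real y)\<^sup>2) = 0 \<longleftrightarrow> (\<exists>j::int. y\<^sup>2 = q powi j)"
  proof
    assume "Q ((complex_of_real y)\<^sup>2) = 0"
    then obtain n where "(complex_of_real y)\<^sup>2 * qc ^ n = 1" by (auto simp: Q_eq_0_iff)
    then have "complex_of_real (y\<^sup>2 * q ^ n) = complex_of_real 1" by simp
    then have "y\<^sup>2 * q ^ n = 1" by (simp only: of_real_eq_iff)
    then have "y\<^sup>2 = q powi (- int n)" using q_pos by (simp add: power_int_minus field_simps)
    then show "\<exists>j::int. y\<^sup>2 = q powi j" by blast
  next
    assume "\<exists>j::int. y\<^sup>2 = q powi j"
    then obtain j where j: "y\<^sup>2 = q powi j" by blast
    have "y\<^sup>2 > 1" using one_less_power[OF assms, of 2] by simp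
    have "j < 0"
    proof (rule ccontr)
      assume "\<not> j < 0"
      then have "y\<^sup>2 = q ^ nat j" using j by (simp add: power_int_def)
      moreover have "q ^ nat j \<le> 1" using q_pos q_less_1 by (simp add: power_le_one)
      ultimately show False using \<open>y\<^sup>2 > 1\<close> by simp
    qed
    then have "y\<^sup>2 * q ^ nat (- j) = 1" using j q_pos by (simp add: power_int_def field_simps)
    then have "(complex_of_real y)\<^sup>2 * qc ^ nat (- j) = 1"
      by (metis of_real_1 of_real_mult of_real_power)
    then show "Q ((complex_of_real y)\<^sup>2) = 0" unfolding Q_eq_0_iff by blast
  qed
  then show ?thesis by (simp add: eps_def)
qed

end

section \<open>Point masses as residues: the negative lattice\<close>

context awp
begin

definition Qd :: "complex \<Rightarrow> complex" where
  "Qd x = Q (qc * x / dc) * Q (qc / (dc * x))"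

definition Dn :: "complex \<Rightarrow> complex" where
  "Dn x = Q (ac * x) * Q (ac / x) * Q (bc * x) * Q (bc / x) * Q (cc * x) * Q (cc / x)"

definition Th :: "complex \<Rightarrow> complex" where
  "Th x = theta (dc * tc * x) * theta (dc * tc / x)"

text \<open>The weight divided by \<open>Qd\<close> squared. Each eigenfunction is a function
  holomorphic off 0 divided by \<open>Qd\<close>, so the weight times two eigenfunctions is
  \<open>Om\<close> times two such holomorphic functions.\<close>

definition Om :: "complex \<Rightarrow> complex" where
  "Om x = Q (x\<^sup>2) * Q (1 / x\<^sup>2) / (Qd x * Dn x * Th x)"

lemma AW_weight_eq: "AW_weight q a b c d t x = Om x * (Qd x)\<^sup>2"
  unfolding AW_weight_def Let_def Om_def Qd_def Dn_def Th_def theta_def qinf_def qtheta_def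
  by (cases "Qd x = 0") (auto simp: Qd_def power2_eq_square mult_ac)

definition Kc where "Kc = AW_K q a b c d t"

lemma d_neg: "d * t < 0" "a * d * t < 0" "b * d * t < 0" "c * d * t < 0" "q * t < 0"
  using par' d_pos a_pos q_pos by (auto simp: mult_pos_neg)

lemma qtheta_neg: "y < 0 \<Longrightarrow> 0 < qtheta q y"
  unfolding qtheta_def qinf_def using q_pos
  by (auto intro!: mult_pos_pos qinf1_pos simp: field_simps intro: order.strict_trans[of _ 0])

lemma K_pos: "0 < Kc"
proof -
  have "q * a / d < 1" using qa_less_d d_pos by (simp add: field_simps)
  then have "0 < qinf q [a * b, a * c, b * c, q * a / d, q]"
    unfolding qinf_def using par' bc_less_1 q_less_1 by (auto intro!: mult_pos_pos qinf1_pos)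
  moreover have "0 < qtheta q (q * t) * qtheta q (a * d * t) * qtheta q (b * d * t) * qtheta q (c * d * t)
             / (q * a * b * c * d * t\<^sup>2)"
    using d_neg qtheta_neg par' a_pos d_pos q_pos by (intro divide_pos_pos mult_pos_pos) auto
  ultimately show ?thesis unfolding Kc_def AW_K_def by simp
qed

lemma Q_nz_c:
  "y < 1 \<Longrightarrow> z = complex_of_real y \<Longrightarrow> Q z \<noteq> 0" using Q_nz_real by simp

lemma theta_neg: "y < 0 \<Longrightarrow> theta (complex_of_real y) \<noteq> 0"
  unfolding theta_def using Q_nz_real[of y] Q_nz_real[of "q / y"] q_pos
  by (auto simp: divide_pos_neg order.strict_trans[of _ 0])

text \<open>The identity between the residue and the mass formula with all products as free
  variables. The theta values at the shifted points are traded for those at the unshifted ones; the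
  accumulated powers leave S, which is s^(2k) in the application.\<close>

lemma alg_minus:
  fixes A1 Aq A' B1 Bq B' C1 Cq C' :: complex
  assumes "A1 * Aq * pa = E * Ta" "B1 * Bq * pb = E * Tb" "C1 * Cq * pc = E * Tc" "D1 * Dd * pq = E * Tq"
    and "pa * pb * pc = pd2 * pq * S"
    and "A1 \<noteq> 0" "Aq \<noteq> 0" "A' \<noteq> 0" "B1 \<noteq> 0" "Bq \<noteq> 0" "B' \<noteq> 0" "C1 \<noteq> 0" "Cq \<noteq> 0" "C' \<noteq> 0" "D1 \<noteq> 0" "Dd \<noteq> 0" "D2 \<noteq> 0"
    and "pa \<noteq> 0" "pb \<noteq> 0" "pc \<noteq> 0" "pq \<noteq> 0" "pd2 \<noteq> 0" "E \<noteq> 0" "q2 \<noteq> 0"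
  shows "E\<^sup>2 * w / (q2 * pd2 * (D1 * D2) * (A1 * A' * B1 * B' * C1 * C')) * (D1 * D2)\<^sup>2
      = Tq / (q2 * (Ta * Tb * Tc)) * (Aq * Bq * Cq * D2) / (Dd * A' * B' * C') * w * S"
proof -
  define V U W T where "V = A1 * B1 * C1" and "U = A' * B' * C'" and "W = Aq * Bq * Cq" and "T = Ta * Tb * Tc"
  have nz: "V \<noteq> 0" "U \<noteq> 0" "W \<noteq> 0" using assms by (simp_all add: V_def U_def W_def)
  have "T * E ^ 3 = (E * Ta) * (E * Tb) * (E * Tc)" by (simp add: T_def power3_eq_cube mult_ac)
  also have "\<dots> = V * W * (pa * pb * pc)" unfolding assms(1-3)[symmetric] by (simp add: V_def W_def mult_ac)
  finally have T: "T = V * W * (pd2 * pq * S) / E ^ 3" using assms(5,23) by (simp add: nonzero_eq_divide_eq)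
  have Tq: "Tq = D1 * Dd * pq / E" using assms(4,23) by (simp add: nonzero_eq_divide_eq mult.commute)
  have S: "S \<noteq> 0" using assms(5,18-20) by auto
  have "E\<^sup>2 * w / (q2 * pd2 * (D1 * D2) * (V * U)) * (D1 * D2)\<^sup>2 = Tq / (q2 * T) * (W * D2) / (Dd * U) * w * S"
    unfolding T Tq using nz S assms(15-17,21-) by (simp add: field_simps power2_eq_square power3_eq_cube)
  then show ?thesis by (simp only: V_def U_def W_def T_def mult_ac)
qed

lemma alg_K: "K \<noteq> 0 \<Longrightarrow> 2 * (X * W * (K * S / 2)) / K = X * W * (S :: complex)"
  by simp

lemma alg_mass:
  fixes n2 :: complex
  assumes "n2 \<noteq> 0" "n3 \<noteq> 0" "n4 \<noteq> 0" "x5 \<noteq> 0" "x6 \<noteq> 0" "x7 \<noteq> 0" "x8 \<noteq> 0"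
    "m1 \<noteq> 0" "m2 \<noteq> 0" "m3 \<noteq> 0" "m4 \<noteq> 0" "y5 \<noteq> 0" "y6 \<noteq> 0" "y7 \<noteq> 0" "y8 \<noteq> 0"
  shows "(T1 * x8) / (q1 * (q1 * (n2 * (n3 * (n4 * (w5 * (w6 * w7)))))))
     * ((n1 / m1) * ((n2 / m2) * ((n3 / m3) * (n4 / m4))) / ((x5 / y5) * ((x6 / y6) * ((x7 / y7) * (x8 / y8))))) * W * S
   = (T1 * n1) / (q1\<^sup>2 * ((w5 * x5) * (w6 * x6) * (w7 * x7))) * (y5 * y6 * y7 * y8) / (m1 * m2 * m3 * m4) * W * S"
proof -
  define N M X Y where "N = n2 * n3 * n4" and "M = m1 * m2 * m3 * m4" and "X = x5 * x6 * x7" and "Y = y5 * y6 * y7 * y8"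
  define w where "w = w5 * w6 * w7"
  have nz: "N \<noteq> 0" "X \<noteq> 0" using assms by (simp_all add: N_def X_def)
  have e: "(n1 / m1) * ((n2 / m2) * ((n3 / m3) * (n4 / m4))) = n1 * N / M"
    "(x5 / y5) * ((x6 / y6) * ((x7 / y7) * (x8 / y8))) = X * x8 / Y"
    "q1 * (q1 * (n2 * (n3 * (n4 * (w5 * (w6 * w7)))))) = q1\<^sup>2 * N * w"
    "q1\<^sup>2 * ((w5 * x5) * (w6 * x6) * (w7 * x7)) = q1\<^sup>2 * (w * X)"
    by (simp_all add: N_def M_def X_def Y_def w_def power2_eq_square mult_ac)
  have "(T1 * x8) / (q1\<^sup>2 * N * w) * (n1 * N / M / (X * x8 / Y)) = (T1 * n1) / (q1\<^sup>2 * (w * X)) * Y / M"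
    using nz assms(7) by (simp add: mult_ac)
  then show ?thesis unfolding e by (simp only: M_def Y_def)
qed

text \<open>The factorials of index -k become infinite products in 1/z, so k enters only through z
  and s^(2k). This form serves the residue at z as well as the growth of the masses as k tends to
  minus infinity.\<close>

lemma mass_minus_eq:
  assumes z: "z = d * t * q powi k"
  defines "zc \<equiv> complex_of_real z"
  shows "complex_of_real (2 * AW_mass_minus q a b c d t k / Kc) =
     theta (qc * tc) / ((Q qc)\<^sup>2 * (theta (ac * dc * tc) * theta (bc * dc * tc) * theta (cc * dc * tc)))
      * (Q (qc / (ac * zc)) * Q (qc / (bc * zc)) * Q (qc / (cc * zc)) * Q (qc / (dc * zc))) / (Q (dc / zc) * Q (ac / zc) * Q (bc / zc) * Q (cc / zc))
      * (1 - 1 / zc\<^sup>2) * sc powi (2 * k)"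
proof -
  have zn: "z < 0" unfolding z using d_neg q_pos by (simp add: mult_neg_pos)
  have zc: "zc = dc * tc * qc powi k" unfolding zc_def z by simp
  have nz: "dc \<noteq> 0" "tc \<noteq> 0" "ac \<noteq> 0" "bc \<noteq> 0" "cc \<noteq> 0" "qc powi k \<noteq> 0" "zc \<noteq> 0"
    using par' d_pos a_pos q_pos zn by (auto simp: zc_def)
  have neg: "Q (complex_of_real (u / (v * z))) \<noteq> 0" "Q (complex_of_real (u / z)) \<noteq> 0" if "u > 0" "v > 0" for u v
    using divide_pos_neg[OF that(1) mult_pos_neg[OF that(2) zn]] divide_pos_neg[OF that(1) zn]
    by (intro Q_nz_real; linarith)+
  have sh: "1 / tc * qc powi (- k) = dc / zc" "ac / (dc * tc) * qc powi (- k) = ac / zc" "bc / (dc * tc) * qc powi (- k) = bc / zc"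
     "cc / (dc * tc) * qc powi (- k) = cc / zc" "qc / (ac * dc * tc) * qc powi (- k) = qc / (ac * zc)"
     "qc / (bc * dc * tc) * qc powi (- k) = qc / (bc * zc)" "qc / (cc * dc * tc) * qc powi (- k) = qc / (cc * zc)"
     "qc / (dc\<^sup>2 * tc) * qc powi (- k) = qc / (dc * zc)"
    unfolding zc using nz by (simp_all add: power_int_minus field_simps power2_eq_square)
  have Qz: "Q (dc / zc) \<noteq> 0" "Q (ac / zc) \<noteq> 0" "Q (bc / zc) \<noteq> 0" "Q (cc / zc) \<noteq> 0" 
     "Q (qc / (ac * zc)) \<noteq> 0" "Q (qc / (bc * zc)) \<noteq> 0" "Q (qc / (cc * zc)) \<noteq> 0" "Q (qc / (dc * zc)) \<noteq> 0"
    using neg par' d_pos a_pos q_pos by (simp_all add: zc_def flip: of_real_mult of_real_divide)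
  have neg2: "Q (complex_of_real (u / (v * (d * t)))) \<noteq> 0" "Q (complex_of_real (u / (d * t))) \<noteq> 0" "Q (complex_of_real (u / t)) \<noteq> 0" 
    if "u > 0" "v > 0" for u v
    using divide_pos_neg[OF that(1) mult_pos_neg[OF that(2) d_neg(1)]] divide_pos_neg[OF that(1) d_neg(1)] divide_pos_neg[OF that(1) par'(1)]
    by (intro Q_nz_real; linarith)+
  have Q0: "Q (1 / tc) \<noteq> 0" "Q (ac / (dc * tc)) \<noteq> 0" "Q (bc / (dc * tc)) \<noteq> 0" "Q (cc / (dc * tc)) \<noteq> 0"
     "Q (qc / (ac * dc * tc)) \<noteq> 0" "Q (qc / (bc * dc * tc)) \<noteq> 0" "Q (qc / (cc * dc * tc)) \<noteq> 0" "Q (qc / (dc\<^sup>2 * tc)) \<noteq> 0"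
    using neg2[of 1 1] neg2[of a 1] neg2[of b 1] neg2[of c 1] neg2[of q a] neg2[of q b] neg2[of q c] neg2[of q d] par' d_pos a_pos q_pos 
    by (simp_all add: power2_eq_square mult.assoc)
  have f0: "qfac1 qc (- k) y = Q y / Q (y * qc powi (- k))" if "Q (y * qc powi (- k)) \<noteq> 0" for y
    using qfac1_eq_quotient[of qc y "- k"] q0 q1 that by blast
  have f: "qfac1 qc (- k) (1 / tc) = Q (1 / tc) / Q (dc / zc)" "qfac1 qc (- k) (ac / (dc * tc)) = Q (ac / (dc * tc)) / Q (ac / zc)"
     "qfac1 qc (- k) (bc / (dc * tc)) = Q (bc / (dc * tc)) / Q (bc / zc)" "qfac1 qc (- k) (cc / (dc * tc)) = Q (cc / (dc * tc)) / Q (cc / zc)"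
     "qfac1 qc (- k) (qc / (ac * dc * tc)) = Q (qc / (ac * dc * tc)) / Q (qc / (ac * zc))"
     "qfac1 qc (- k) (qc / (bc * dc * tc)) = Q (qc / (bc * dc * tc)) / Q (qc / (bc * zc))"
     "qfac1 qc (- k) (qc / (cc * dc * tc)) = Q (qc / (cc * dc * tc)) / Q (qc / (cc * zc))"
     "qfac1 qc (- k) (qc / (dc\<^sup>2 * tc)) = Q (qc / (dc\<^sup>2 * tc)) / Q (qc / (dc * zc))"
    using f0[of "1 / tc", unfolded sh, OF Qz(1)] f0[of "ac / (dc * tc)", unfolded sh, OF Qz(2)]
      f0[of "bc / (dc * tc)", unfolded sh, OF Qz(3)] f0[of "cc / (dc * tc)", unfolded sh, OF Qz(4)]
      f0[of "qc / (ac * dc * tc)", unfolded sh, OF Qz(5)] f0[of "qc / (bc * dc * tc)", unfolded sh, OF Qz(6)]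
      f0[of "qc / (cc * dc * tc)", unfolded sh, OF Qz(7)] f0[of "qc / (dc\<^sup>2 * tc)", unfolded sh, OF Qz(8)]
    by blast+
  have z2: "dc\<^sup>2 * tc\<^sup>2 * qc powi (2 * k) = zc\<^sup>2"
    unfolding zc power_mult_distrib by (simp add: power_int_mult mult.commute[of 2])
  have K: "complex_of_real Kc \<noteq> 0" using K_pos by simp
  have eq: "complex_of_real (2 * AW_mass_minus q a b c d t k / Kc) =
     (Q (qc * tc) * Q (qc / (dc\<^sup>2 * tc)))
     / (Q qc * (Q qc * (Q (ac / (dc * tc)) * (Q (bc / (dc * tc)) * (Q (cc / (dc * tc)) * (Q (ac * dc * tc) * (Q (bc * dc * tc) * Q (cc * dc * tc))))))))
     * ((Q (1 / tc) / Q (dc / zc)) * ((Q (ac / (dc * tc)) / Q (ac / zc)) * ((Q (bc / (dc * tc)) / Q (bc / zc)) * (Q (cc / (dc * tc)) / Q (cc / zc))))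
        / ((Q (qc / (ac * dc * tc)) / Q (qc / (ac * zc))) * ((Q (qc / (bc * dc * tc)) / Q (qc / (bc * zc))) * ((Q (qc / (cc * dc * tc)) / Q (qc / (cc * zc)))
           * (Q (qc / (dc\<^sup>2 * tc)) / Q (qc / (dc * zc)))))))
     * (1 - 1 / zc\<^sup>2) * sc powi (2 * k)"
    unfolding AW_mass_minus_def qinf_def qfac_def Kc_def[symmetric] f[symmetric] z2[symmetric] list.map prod_list.Cons prod_list.Nil mult_1_right
    by (simp only: of_real_qinf1 of_real_qfac1 of_real_mult of_real_divide of_real_diff of_real_1 of_real_power of_real_power_int of_real_numeral alg_K[OF K])
  have qt: "qc / (qc * tc) = 1 / tc" using q0 by simp
  show ?thesis
    unfolding theta_def qt by (rule trans[OF eq alg_mass[OF Q0(2-) Qz]])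
qed

lemma alg_Th:
  fixes u :: complex
  assumes "u \<noteq> 0" "E \<noteq> 0"
  shows "N1 / z1 * (E\<^sup>2 * N2 / (z2 * m1 * m2 * p * X * D)) = u * (N1 * N2 / (X * D * (z1 * z2 * (u * (m1 * m2)) * p / E\<^sup>2)))"
proof -
  define R where "R = z1 * z2 * m1 * m2 * p * X * D"
  have "X * D * (z1 * z2 * (u * (m1 * m2)) * p / E\<^sup>2) = u * R / E\<^sup>2" by (simp add: R_def mult_ac)
  moreover have "N1 / z1 * (E\<^sup>2 * N2 / (z2 * m1 * m2 * p * X * D)) = N1 * N2 * E\<^sup>2 / R" by (simp add: R_def mult_ac)
  ultimately show ?thesis using assms by simp
qed

text \<open>Both theta factors are shifted by q^k. This exposes the zero of the second one as (x -
  z)/x, and the quotient of \<open>Q (x^2)\<close> by the factor \<open>Q (z * x)\<close> of the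
  first one gives \<open>eps\<close> by \<open>double_zero_ratio\<close>.\<close>

lemma rho_minus:
  assumes z: "z = d * t * q powi k" "z < -1"
  defines "zc \<equiv> complex_of_real z"
  shows "((\<lambda>x. (x - zc) / x * Om x) \<longlongrightarrow> complex_of_real (eps (d * t) * (2 * AW_mass_minus q a b c d t k / Kc)) / (Qd zc)\<^sup>2) (at zc)"
proof -
  have zn: "z < 0" using z(2) by linarith
  have zc: "zc = dc * tc * qc powi k" unfolding zc_def z by simp
  have nz: "dc \<noteq> 0" "tc \<noteq> 0" "ac \<noteq> 0" "bc \<noteq> 0" "cc \<noteq> 0" "qc powi k \<noteq> 0" "zc \<noteq> 0" "qc \<noteq> 0"
    using par' d_pos a_pos q_pos z by (auto simp: zc_def)
  obtain E where E: "E \<noteq> 0" "\<And>y. y \<noteq> 0 \<Longrightarrow> theta (y * qc powi k) * y powi k = E * theta y"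
    using theta_quasi_period[of k] by blast
  have neg: "Q (complex_of_real (u / (v * z))) \<noteq> 0" "Q (complex_of_real (u / z)) \<noteq> 0" "Q (complex_of_real (u * z)) \<noteq> 0" "Q (complex_of_real (u * z / v)) \<noteq> 0" if "u > 0" "v > 0" for u v
    using divide_pos_neg[OF that(1) mult_pos_neg[OF that(2) zn]] divide_pos_neg[OF that(1) zn] mult_pos_neg[OF that(1) zn]
      divide_neg_pos[OF mult_pos_neg[OF that(1) zn] that(2)]
    by (intro Q_nz_real; linarith)+
  have Qz: "Q (dc / zc) \<noteq> 0" "Q (ac / zc) \<noteq> 0" "Q (bc / zc) \<noteq> 0" "Q (cc / zc) \<noteq> 0" 
     "Q (qc / (ac * zc)) \<noteq> 0" "Q (qc / (bc * zc)) \<noteq> 0" "Q (qc / (cc * zc)) \<noteq> 0" "Q (qc / (dc * zc)) \<noteq> 0"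
     "Q (ac * zc) \<noteq> 0" "Q (bc * zc) \<noteq> 0" "Q (cc * zc) \<noteq> 0" "Q (qc * zc / dc) \<noteq> 0"
    using neg par' d_pos a_pos q_pos by (simp_all add: zc_def flip: of_real_mult of_real_divide)
  have Qq: "Q qc \<noteq> 0" by (rule Q_nz[OF q1])
  have z2: "1 < z\<^sup>2" using one_less_power[of "\<bar>z\<bar>" 2] z(2) by simp
  have Qz2: "Q (qc / zc\<^sup>2) \<noteq> 0"
  proof (rule Q_nz_c)
    show "q / z\<^sup>2 < 1" using z2 q_less_1 divide_less_eq_1_pos[of "z\<^sup>2" q] by linarith
  qed (simp add: zc_def)
  define pd where "pd = (dc * tc) powi (2 * k)"
  have pd: "pd \<noteq> 0" unfolding pd_def using nz by simp
  define L where "L = (\<lambda>x. Q (x\<^sup>2) / Q (zc * x) * (E\<^sup>2 * Q (1 / x\<^sup>2) / (Q (qc / (zc * x)) * Q (qc * zc / x) * Q (qc * x / zc) * pd * Qd x * Dn x)))"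
  have ev: "eventually (\<lambda>x. L x = (x - zc) / x * Om x) (at zc)"
  proof -
    have "eventually (\<lambda>x. x \<noteq> 0) (at zc)" using tendsto_imp_eventually_ne[OF tendsto_ident_at nz(7)] .
    moreover have "eventually (\<lambda>x. x \<noteq> zc) (at zc)" by (simp add: eventually_at_filter)
    ultimately show ?thesis
    proof eventually_elim
      case (elim x)
      have 1: "theta (zc * x) * (dc * tc * x) powi k = E * theta (dc * tc * x)"
        using E(2)[of "dc * tc * x"] nz elim by (simp add: zc mult_ac)
      have 2: "theta (zc / x) * (dc * tc / x) powi k = E * theta (dc * tc / x)"
        using E(2)[of "dc * tc / x"] nz elim by (simp add: zc mult_ac)
      have "(dc * tc * x) powi k * (dc * tc / x) powi k = ((dc * tc) * (dc * tc)) powi k"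
      proof -
        have "(dc * tc * x) * (dc * tc / x) = (dc * tc) * (dc * tc)" using elim by (simp add: field_simps)
        then show ?thesis by (simp only: power_int_mult_distrib[symmetric])
      qed
      also have "\<dots> = pd" unfolding pd_def power_int_mult by (simp only: power2_eq_square power_int_numeral)
      finally have 3: "(dc * tc * x) powi k * (dc * tc / x) powi k = pd" .
      have "E\<^sup>2 * Th x = (theta (zc * x) * theta (zc / x)) * pd"
        unfolding Th_def 3[symmetric] using 1 2 by algebra
      then have "Th x = theta (zc * x) * theta (zc / x) * pd / E\<^sup>2" using E(1) by (simp add: field_simps)
      moreover have "theta (zc / x) = (x - zc) / x * (Q (qc * zc / x) * Q (qc * x / zc))"
      proof -
        have "qc / (zc / x) = qc * x / zc" "zc / x * qc = qc * zc / x" "1 - zc / x = (x - zc) / x"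
          using nz elim by (simp_all add: field_simps)
        then show ?thesis unfolding theta_def using Q_rec[of "zc / x"] by (simp only: mult.assoc)
      qed
      moreover have "(x - zc) / x \<noteq> 0" using elim by simp
      ultimately show ?case
        unfolding Om_def L_def theta_def[of "zc * x"] using alg_Th[OF _ E(1)] by metis
    qed
  qed
  have Dz: "Dn zc \<noteq> 0" "Qd zc \<noteq> 0" unfolding Dn_def Qd_def using Qz by auto
  have L: "(L \<longlongrightarrow> complex_of_real (eps z) * (E\<^sup>2 * Q (1 / zc\<^sup>2) / (Q (qc / (zc * zc)) * Q (qc * zc / zc) * Q (qc * zc / zc) * pd * Qd zc * Dn zc))) (at zc)"
    unfolding L_def
    apply (rule tendsto_mult)
    subgoal using double_zero_ratio[OF nz(7)] eps_eq[of z] z(2) unfolding zc_def by simp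
    subgoal unfolding Qd_def Dn_def using nz Qz Qz2 Qq pd
      by (intro tendsto_intros) (simp_all add: power2_eq_square) 
    done
  have eq: "complex_of_real (eps z) * (E\<^sup>2 * Q (1 / zc\<^sup>2) / (Q (qc / (zc * zc)) * Q (qc * zc / zc) * Q (qc * zc / zc) * pd * Qd zc * Dn zc))
    = complex_of_real (eps (d * t) * (2 * AW_mass_minus q a b c d t k / Kc)) / (Qd zc)\<^sup>2" (is "?A = ?B")
  proof -
    have ez: "eps z = eps (d * t)" unfolding z using eps_shift by simp
    have Q1: "Q (1 / zc\<^sup>2) = (1 - 1 / zc\<^sup>2) * Q (qc / zc\<^sup>2)" using Q_rec[of "1 / zc\<^sup>2"] by simp
    have e1: "?A = complex_of_real (eps z) * (E\<^sup>2 * (1 - 1 / zc\<^sup>2) / ((Q qc)\<^sup>2 * pd * Qd zc * Dn zc))"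
      unfolding Q1 using Qz2 nz by (simp add: power2_eq_square mult_ac)
    have th: "theta (u * zc) * (u * dc * tc) powi k = E * theta (u * dc * tc)" if "u \<noteq> 0" for u
      using E(2)[of "u * dc * tc"] nz that by (simp add: zc mult_ac)
    have tq: "theta (qc * zc / dc) * (qc * tc) powi k = E * theta (qc * tc)"
      using E(2)[of "qc * tc"] nz by (simp add: zc mult_ac)
    have pw: "(ac * dc * tc) powi k * (bc * dc * tc) powi k * (cc * dc * tc) powi k = pd * (qc * tc) powi k * sc powi (2 * k)"
    proof -
      have "pd = ((dc * tc) * (dc * tc)) powi k" "sc powi (2 * k) = (sc * sc) powi k" unfolding pd_def using nz s_pos by (simp_all add: power_int_mult power2_eq_square)
      moreover have "(ac * dc * tc) * (bc * dc * tc) * (cc * dc * tc) = (dc * tc) * (dc * tc) * (qc * tc) * (sc * sc)"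
        using s_sq_c by (simp add: power2_eq_square algebra_simps)
      ultimately show ?thesis by (simp only: power_int_mult_distrib[symmetric])
    qed
    have dd: "qc / (qc * zc / dc) = dc / zc" using nz by simp
    have "E\<^sup>2 * (1 - 1 / zc\<^sup>2) / ((Q qc)\<^sup>2 * pd * (Q (qc * zc / dc) * Q (qc / (dc * zc))) * (Q (ac * zc) * Q (ac / zc) * Q (bc * zc) * Q (bc / zc) * Q (cc * zc) * Q (cc / zc))) * (Q (qc * zc / dc) * Q (qc / (dc * zc)))\<^sup>2
      = theta (qc * tc) / ((Q qc)\<^sup>2 * (theta (ac * dc * tc) * theta (bc * dc * tc) * theta (cc * dc * tc)))
      * (Q (qc / (ac * zc)) * Q (qc / (bc * zc)) * Q (qc / (cc * zc)) * Q (qc / (dc * zc))) / (Q (dc / zc) * Q (ac / zc) * Q (bc / zc) * Q (cc / zc))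
      * (1 - 1 / zc\<^sup>2) * sc powi (2 * k)"
      by (rule alg_minus[OF th[OF nz(3), unfolded theta_def[of "ac * zc"]] th[OF nz(4), unfolded theta_def[of "bc * zc"]]
            th[OF nz(5), unfolded theta_def[of "cc * zc"]] tq[unfolded theta_def[of "qc * zc / dc"] dd] pw]; use Qz Qq pd E(1) nz in simp)
    then have "E\<^sup>2 * (1 - 1 / zc\<^sup>2) / ((Q qc)\<^sup>2 * pd * Qd zc * Dn zc) * (Qd zc)\<^sup>2 = complex_of_real (2 * AW_mass_minus q a b c d t k / Kc)"
      unfolding mass_minus_eq[OF z(1)] zc_def[symmetric] Qd_def Dn_def by simp
    then have e2: "E\<^sup>2 * (1 - 1 / zc\<^sup>2) / ((Q qc)\<^sup>2 * pd * Qd zc * Dn zc) = complex_of_real (2 * AW_mass_minus q a b c d t k / Kc) / (Qd zc)\<^sup>2"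
      by (rule iffD2[OF nonzero_eq_divide_eq[OF power_not_zero[OF Dz(2)]]])
    show ?thesis unfolding e1 unfolding ez e2 of_real_mult[of "eps (d * t)"] by (rule times_divide_eq_right)
  qed
  show ?thesis
    by (rule Lim_transform_eventually[OF subst[where P = "\<lambda>l. (L \<longlongrightarrow> l) (at zc)", OF eq L] ev])
qed

end



section \<open>The conjugated operator and the residues on the positive lattice\<close>

context awp
begin

text \<open>The coefficient \<open>AA\<close> conjugated by \<open>Qd\<close>, that is A(x) Qd(x) /
  Qd(qx): the coefficient with which the operator acts on the numerators of the
  eigenfunctions.\<close>

definition a1 :: "complex \<Rightarrow> complex" where
  "a1 x = - x * (1 - ac * x) * (1 - bc * x) * (1 - cc * x) * (dc - qc * x) / ((1 - x\<^sup>2) * (1 - qc * x\<^sup>2))"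

text \<open>The product of \<open>Om\<close> and \<open>a1\<close> with common factors cancelled,
  defined also at points where these two are not. Its invariance under x -> 1/(qx), together with
  Om(x) a1(1/x) = Bf(x/q), is the formal symmetry of the operator with respect to the
  weight.\<close>

definition Bf :: "complex \<Rightarrow> complex" where
  "Bf x = - (dc * x) * (Q (qc\<^sup>2 * x\<^sup>2) * Q (1 / x\<^sup>2))
     / (Q (qc\<^sup>2 * x / dc) * Q (qc / (dc * x)) * (Q (qc * ac * x) * Q (ac / x) * Q (qc * bc * x) * Q (bc / x) * Q (qc * cc * x) * Q (cc / x)) * Th x)"

lemma nz: "ac \<noteq> 0" "bc \<noteq> 0" "cc \<noteq> 0" "dc \<noteq> 0" "tc \<noteq> 0" "qc \<noteq> 0" "sc \<noteq> 0"
  using par' a_pos d_pos s_pos q_pos by auto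

lemma Om_inverse: "Om (1 / x) = Om x"
  unfolding Om_def Qd_def Dn_def Th_def by (simp add: power_divide mult_ac)

lemma Bf_inverse:
  assumes "x \<noteq> 0"
  shows "Bf (1 / (qc * x)) = Bf x"
proof -
  have e: "qc\<^sup>2 * (1 / (qc * x))\<^sup>2 = 1 / x\<^sup>2" "1 / (1 / (qc * x))\<^sup>2 = qc\<^sup>2 * x\<^sup>2" "qc\<^sup>2 * (1 / (qc * x)) / dc = qc / (dc * x)"
    "qc / (dc * (1 / (qc * x))) = qc\<^sup>2 * x / dc" "qc * u * (1 / (qc * x)) = u / x" "u / (1 / (qc * x)) = qc * u * x" for u
    using assms nz by (simp_all add: power_divide power_mult_distrib power2_eq_square)
  have "theta (dc * tc * x * qc) * (dc * tc * x) = - theta (dc * tc * x)" by (rule theta_q) (use assms nz in simp)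
  moreover have "theta (dc * tc * (1 / (qc * x)) * qc) * (dc * tc * (1 / (qc * x))) = - theta (dc * tc * (1 / (qc * x)))"
    by (rule theta_q) (use assms nz in simp)
  moreover have "dc * tc * (1 / (qc * x)) * qc = dc * tc / x" "dc * tc / (1 / (qc * x)) = dc * tc * x * qc" using assms nz by simp_all
  ultimately have 1: "Th (1 / (qc * x)) * (dc * tc * x) = Th x * (dc * tc * (1 / (qc * x)))"
    unfolding Th_def by algebra
  have "Th (1 / (qc * x)) = Th x / (qc * x\<^sup>2)"
  proof -
    have "dc * tc * x \<noteq> 0" using assms nz by simp
    then have "Th (1 / (qc * x)) = Th x * (dc * tc * (1 / (qc * x))) / (dc * tc * x)" using 1 by (metis nonzero_eq_divide_eq)
    then show ?thesis using assms nz by (simp add: power2_eq_square)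
  qed
  then show ?thesis unfolding Bf_def e using assms nz by (simp add: power2_eq_square mult_ac)
qed

lemma Om_a1:
  assumes "x \<noteq> 0" "x\<^sup>2 \<noteq> 1" "qc * x\<^sup>2 \<noteq> 1" "ac * x \<noteq> 1" "bc * x \<noteq> 1" "cc * x \<noteq> 1" "qc * x \<noteq> dc"
  shows "Om x * a1 x = Bf x"
proof -
  have r: "Q (x\<^sup>2) = (1 - x\<^sup>2) * (1 - qc * x\<^sup>2) * Q (qc\<^sup>2 * x\<^sup>2)"
    using Q_rec[of "x\<^sup>2"] Q_rec[of "x\<^sup>2 * qc"] by (simp add: power2_eq_square mult_ac)
  have u: "Q (u * x) = (1 - u * x) * Q (qc * u * x)" for u using Q_rec[of "u * x"] by (simp add: mult_ac)
  have d: "Q (qc * x / dc) = (dc - qc * x) / dc * Q (qc\<^sup>2 * x / dc)"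
    using Q_rec[of "qc * x / dc"] nz by (simp add: power2_eq_square field_simps)
  have n: "1 - x\<^sup>2 \<noteq> 0" "1 - qc * x\<^sup>2 \<noteq> 0" "1 - ac * x \<noteq> 0" "1 - bc * x \<noteq> 0" "1 - cc * x \<noteq> 0" "dc - qc * x \<noteq> 0" using assms by auto
  have alg: "z1 * z2 * N1 * N2 / (w4 / dc * v1 * v2 * (w1 * v3 * v4 * (w2 * v5) * v6 * (w3 * v7) * v8) * T) * (- x * w1 * w2 * w3 * w4 / (z1 * z2))
      = - (dc * x) * (N1 * N2) / (v1 * v2 * (v3 * v4 * v5 * v6 * v7 * v8) * T)"
    if "z1 \<noteq> 0" "z2 \<noteq> 0" "w1 \<noteq> 0" "w2 \<noteq> 0" "w3 \<noteq> 0" "w4 \<noteq> 0" for z1 z2 w1 w2 w3 w4 N1 N2 v1 v2 v3 v4 v5 v6 v7 v8 T :: complex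
  proof -
    define R where "R = v1 * v2 * (v3 * v4 * v5 * v6 * v7 * v8) * T"
    have "w4 / dc * v1 * v2 * (w1 * v3 * v4 * (w2 * v5) * v6 * (w3 * v7) * v8) * T = (w1 * w2 * w3 * w4) * R / dc"
      by (simp add: R_def mult_ac)
    then show ?thesis unfolding R_def[symmetric] using that nz by (simp add: mult_ac)
  qed
  show ?thesis unfolding Om_def a1_def Bf_def Qd_def Dn_def r u[of ac] u[of bc] u[of cc] d by (rule alg[OF n])
qed

lemma Om_a1':
  assumes "x \<noteq> 0" "x\<^sup>2 \<noteq> 1" "x\<^sup>2 \<noteq> qc" "ac \<noteq> x" "bc \<noteq> x" "cc \<noteq> x" "dc * x \<noteq> qc"
  shows "Om x * a1 (1 / x) = Bf (x / qc)"
proof -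
  have "Om (1 / x) * a1 (1 / x) = Bf (1 / x)"
    by (rule Om_a1) (use assms nz in \<open>auto simp: field_simps\<close>)
  also have "Bf (1 / x) = Bf (x / qc)" using Bf_inverse[of "x / qc"] assms nz by simp
  finally show ?thesis unfolding Om_inverse .
qed

text \<open>Every excluded set is the zero set of a nonzero polynomial, hence finite. Identities
  valid at generic x may thus be used in a punctured neighbourhood of any p.\<close>

lemma ev_generic:
  assumes p: "p \<noteq> 0"
  shows "eventually (\<lambda>x. x \<noteq> 0 \<and> x\<^sup>2 \<noteq> 1 \<and> qc * x\<^sup>2 \<noteq> 1 \<and> ac * x \<noteq> 1 \<and> bc * x \<noteq> 1 \<and> cc * x \<noteq> 1 \<and> qc * x \<noteq> dc
    \<and> x\<^sup>2 \<noteq> qc \<and> ac \<noteq> x \<and> bc \<noteq> x \<and> cc \<noteq> x \<and> dc * x \<noteq> qc \<and> x \<noteq> p) (at p)"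
proof -
  have fin: "eventually (\<lambda>x. poly h x \<noteq> 0) (at p)" if "h \<noteq> 0" for h :: "complex poly"
  proof -
    have "finite {x. poly h x = 0}" using that by (rule poly_roots_finite)
    then have "eventually (\<lambda>x. x \<notin> {x. poly h x = 0}) (at p)"
      using eventually_at_filter islimpt_finite islimpt_iff_eventually by blast
    then show ?thesis by simp
  qed
  have "[:0, 1:] \<noteq> (0 :: complex poly)" "[:-1, 0, 1:] \<noteq> (0 :: complex poly)" "[:-1, 0, qc:] \<noteq> (0 :: complex poly)" "[:-1, ac:] \<noteq> (0 :: complex poly)" "[:-1, bc:] \<noteq> (0 :: complex poly)" "[:-1, cc:] \<noteq> (0 :: complex poly)" "[:-dc, qc:] \<noteq> (0 :: complex poly)" "[:-qc, 0, 1:] \<noteq> (0 :: complex poly)" "[:-ac, 1:] \<noteq> (0 :: complex poly)" "[:-bc, 1:] \<noteq> (0 :: complex poly)" "[:-cc, 1:] \<noteq> (0 :: complex poly)" "[:-qc, dc:] \<noteq> (0 :: complex poly)" "[:-p, 1:] \<noteq> (0 :: complex poly)"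
    using nz by simp_all
  note this[THEN fin]
  then show ?thesis
    by eventually_elim (auto simp: power2_eq_square mult_ac)
qed

lemma a1_isCont: "p\<^sup>2 \<noteq> 1 \<Longrightarrow> qc * p\<^sup>2 \<noteq> 1 \<Longrightarrow> (a1 \<longlongrightarrow> a1 p) (at p)"
  unfolding a1_def by (intro tendsto_intros) auto

lemma rho_Bf:
  assumes L: "((\<lambda>x. (x - p) / x * Om x) \<longlongrightarrow> R) (at p)" and p: "p \<noteq> 0" "p\<^sup>2 \<noteq> 1" "qc * p\<^sup>2 \<noteq> 1"
  shows "((\<lambda>x. (x - p) / x * Bf x) \<longlongrightarrow> R * a1 p) (at p)"
proof (rule Lim_transform_eventually[OF tendsto_mult[OF L a1_isCont[OF p(2,3)]]])
  show "eventually (\<lambda>x. (x - p) / x * Om x * a1 x = (x - p) / x * Bf x) (at p)"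
    using ev_generic[OF p(1)] by eventually_elim (use Om_a1 in \<open>simp add: mult.assoc\<close>)
qed

text \<open>Since Om(x) a1(1/x) = Bf(x/q), the residue of the left-hand side at q p is that of Bf =
  Om a1 at p.\<close>

lemma rho_step:
  assumes L: "((\<lambda>x. (x - p) / x * Om x) \<longlongrightarrow> R) (at p)" and p: "p \<noteq> 0" "p\<^sup>2 \<noteq> 1" "qc * p\<^sup>2 \<noteq> 1" "qc\<^sup>2 * p\<^sup>2 \<noteq> 1"
    and a: "a1 (1 / (qc * p)) \<noteq> 0"
  shows "((\<lambda>x. (x - qc * p) / x * Om x) \<longlongrightarrow> R * a1 p / a1 (1 / (qc * p))) (at (qc * p))"
proof -
  have "filterlim (\<lambda>x. x / qc) (at p) (at (qc * p))"
    by (rule filterlim_atI) (use nz in \<open>auto intro!: tendsto_eq_intros simp: eventually_at_filter field_simps\<close>)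
  from filterlim_compose[OF rho_Bf[OF L p(1-3)] this]
  have 1: "((\<lambda>x. (x / qc - p) / (x / qc) * Bf (x / qc)) \<longlongrightarrow> R * a1 p) (at (qc * p))" .
  have "(a1 \<longlongrightarrow> a1 (1 / (qc * p))) (at (1 / (qc * p)))"
    by (rule a1_isCont) (use p nz in \<open>auto simp: power_divide power_mult_distrib field_simps power2_eq_square\<close>)
  then have "isCont a1 (1 / (qc * p))" unfolding isCont_def .
  then have 2: "((\<lambda>x. a1 (1 / x)) \<longlongrightarrow> a1 (1 / (qc * p))) (at (qc * p))"
    by (rule isCont_tendsto_compose) (intro tendsto_intros, use p nz in simp)
  have qp: "qc * p \<noteq> 0" using p nz by simp
  have "eventually (\<lambda>x. a1 (1 / x) \<noteq> 0) (at (qc * p))" by (rule tendsto_imp_eventually_ne[OF 2 a])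
  with ev_generic[OF qp] have "eventually (\<lambda>x. (x / qc - p) / (x / qc) * Bf (x / qc) / a1 (1 / x) = (x - qc * p) / x * Om x) (at (qc * p))"
  proof (eventually_elim)
    case (elim x)
    have "x / qc - p = (x - qc * p) / qc" using nz by (simp add: diff_divide_distrib)
    then have "(x / qc - p) / (x / qc) = (x - qc * p) / x" using nz by simp
    then show ?case using Om_a1'[of x] elim by (metis nonzero_mult_div_cancel_right mult.assoc)
  qed
  from Lim_transform_eventually[OF tendsto_divide[OF 1 2 a] this] show ?thesis .
qed

lemma mass_plus_Suc:
  assumes "1 - a\<^sup>2 * q ^ (2 * k) \<noteq> 0"
  shows "AW_mass_plus q a b c d t (Suc k) = AW_mass_plus q a b c d t k
     * (((1 - a\<^sup>2 * q ^ k) * ((1 - a * b * q ^ k) * ((1 - a * c * q ^ k) * (1 - a * d * q ^ k))))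
      / ((1 - q * q ^ k) * ((1 - q * a / b * q ^ k) * ((1 - q * a / c * q ^ k) * (1 - q * a / d * q ^ k)))))
     * ((1 - a\<^sup>2 * q ^ (2 * Suc k)) / (1 - a\<^sup>2 * q ^ (2 * k))) / s ^ 2"
proof -
  have f: "qfac1 q (int (Suc k)) y = qfac1 q (int k) y * (1 - y * q ^ k)" for y :: real
    unfolding qfac1_def by (simp only: of_nat_0_le_iff if_True nat_int prod.lessThan_Suc)
  have alg: "C0 * (n1 * v1 * (n2 * v2 * (n3 * v3 * (n4 * v4))) / (m1 * w1 * (m2 * w2 * (m3 * w3 * (m4 * w4))))) * (Y / Z) * (K / (2 * (S * s2)))
    = C0 * (n1 * (n2 * (n3 * n4)) / (m1 * (m2 * (m3 * m4)))) * (X / Z) * (K / (2 * S)) * ((v1 * (v2 * (v3 * v4))) / (w1 * (w2 * (w3 * w4)))) * (Y / X) / s2"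
    if "X \<noteq> 0" for C0 n1 n2 n3 n4 m1 m2 m3 m4 v1 v2 v3 v4 w1 w2 w3 w4 X Y Z K S s2 :: real
  proof -
    have "Y / Z = X / Z * (Y / X)" using that by simp
    then show ?thesis by (simp only: divide_inverse inverse_mult_distrib mult_ac)
  qed
  have s2: "s ^ (2 * Suc k) = s ^ (2 * k) * s ^ 2" by (simp flip: power_add)
  show ?thesis
    unfolding AW_mass_plus_def qfac_def list.map prod_list.Cons prod_list.Nil mult_1_right f s2
    by (rule alg[OF assms])
qed

lemma rho_plus_0:
  assumes a: "a > 1"
  shows "((\<lambda>x. (x - ac) / x * Om x) \<longlongrightarrow> complex_of_real (eps a * (2 * AW_mass_plus q a b c d t 0 / Kc)) / (Qd ac)\<^sup>2) (at ac)"
proof -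
  define L where "L = (\<lambda>x. Q (x\<^sup>2) / Q (ac * x) * (Q (1 / x\<^sup>2) / (Qd x * Q (qc * ac / x) * (Q (bc * x) * Q (bc / x) * Q (cc * x) * Q (cc / x)) * Th x)))"
  have lt: "b / a < 1" "c / a < 1" "q * a / d < 1" "q / (d * a) < 1"
    using a par' bc_less_1 qa_less_d d_pos d_gt_q mult_strict_mono[of 1 a q d] q_pos by (simp_all add: field_simps)
  have lt2: "d * t * a < 0" "d * t / a < 0" using d_neg(1) a by (simp_all add: mult_neg_pos divide_neg_pos)
  have Qn: "Q qc \<noteq> 0" "Q (bc * ac) \<noteq> 0" "Q (cc * ac) \<noteq> 0" "Q (bc / ac) \<noteq> 0" "Q (cc / ac) \<noteq> 0" "Q (qc * ac / dc) \<noteq> 0" "Q (qc / (dc * ac)) \<noteq> 0"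
    using Q_nz_real[OF q_less_1] Q_nz_real[OF par'(9)] Q_nz_real[OF par'(10)] lt[THEN Q_nz_real] by (simp_all add: mult_ac)
  have th: "theta (dc * tc * ac) \<noteq> 0" "theta (dc * tc / ac) \<noteq> 0" using lt2[THEN theta_neg] by simp_all
  have Qd: "Qd ac \<noteq> 0" using Qn by (simp add: Qd_def)
  have ev: "eventually (\<lambda>x. L x = (x - ac) / x * Om x) (at ac)"
    using ev_generic[OF nz(1)]
  proof eventually_elim
    case (elim x)
    have Qa: "Q (ac / x) = (x - ac) / x * Q (qc * ac / x)" using Q_rec[of "ac / x"] elim by (simp add: field_simps)
    have "N1 / A * (N2 / (X * A' * (B1 * B2 * C1 * C2) * T)) = u * (N1 * N2 / (X * (A * (u * A') * B1 * B2 * C1 * C2) * T))" if "u \<noteq> 0" for N1 N2 A A' B1 B2 C1 C2 X T u :: complex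
    proof -
      have "X * (A * (u * A') * B1 * B2 * C1 * C2) * T = u * (A * (X * A' * (B1 * B2 * C1 * C2) * T))" by (simp add: mult_ac)
      then show ?thesis using that by simp
    qed
    then show ?case unfolding L_def Om_def Dn_def Qa using elim by simp
  qed
  have L: "(L \<longlongrightarrow> complex_of_real (eps a) * (Q (1 / ac\<^sup>2) / (Qd ac * Q (qc * ac / ac) * (Q (bc * ac) * Q (bc / ac) * Q (cc * ac) * Q (cc / ac)) * Th ac))) (at ac)"
    unfolding L_def
    apply (rule tendsto_mult)
    subgoal using double_zero_ratio[OF nz(1)] eps_eq[of a] a by simp
    subgoal unfolding Qd_def Th_def theta_def using nz Qn th[unfolded theta_def]
      by (intro tendsto_intros) simp_all
    done
  have eq: "Q (1 / ac\<^sup>2) / (Qd ac * Q (qc * ac / ac) * (Q (bc * ac) * Q (bc / ac) * Q (cc * ac) * Q (cc / ac)) * Th ac)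
     = complex_of_real (2 * AW_mass_plus q a b c d t 0 / Kc) / (Qd ac)\<^sup>2"
  proof -
    have K: "complex_of_real Kc \<noteq> 0" using K_pos by simp
    have a2: "1 - a\<^sup>2 \<noteq> 0" using a by (simp add: power2_eq_square) (metis less_1_mult less_irrefl)
    have "complex_of_real (2 * AW_mass_plus q a b c d t 0 / Kc) = Qd ac * Q (1 / ac\<^sup>2) / (Q qc * (Q (bc * ac) * Q (bc / ac) * Q (cc * ac) * Q (cc / ac)) * Th ac)"
      unfolding AW_mass_plus_def Kc_def[symmetric] Qd_def Th_def theta_def qinf_def qtheta_def qfac_def qfac1_def
      using K a2 by (simp add: of_real_qinf1 mult_ac)
    then show ?thesis using Qd nz by (simp add: power2_eq_square)
  qed
  show ?thesis
    using Lim_transform_eventually[OF L ev] by (simp only: eq times_divide_eq_right of_real_mult of_real_divide)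
qed

lemma a1_inv:
  fixes x :: complex
  assumes "x \<noteq> 0"
  shows "a1 (1 / (qc * x)) = - ac * bc * cc * (1 - qc * x / ac) * (1 - qc * x / bc) * (1 - qc * x / cc) * (1 - dc * x)
      / (qc * x * ((1 - (qc * x)\<^sup>2) * (1 - qc * x\<^sup>2)))"
proof -
  define y where "y = qc * x"
  have y: "y \<noteq> 0" using assms nz by (simp add: y_def)
  have e: "1 - u * (1 / y) = - u * (1 - y / u) / y" if "u \<noteq> 0" for u using y that by (simp add: field_simps)
  have e2: "dc - qc * (1 / y) = - (1 - dc * x) / x" using assms nz by (simp add: y_def field_simps)
  have e3: "1 - (1 / y)\<^sup>2 = - (1 - y\<^sup>2) / y\<^sup>2" using y by (simp add: field_simps)
  have e4: "1 - qc * (1 / y)\<^sup>2 = - (1 - qc * x\<^sup>2) / (qc * x\<^sup>2)" using assms nz by (simp add: y_def field_simps power2_eq_square)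
  have "- (1 / y) * (- ac * A / y) * (- bc * B / y) * (- cc * C / y) * (- e / x) / (- Y / y\<^sup>2 * (- Z / (qc * x\<^sup>2)))
    = - ac * bc * cc * A * B * C * e / (y * (Y * Z))" for A B C e Y Z
    using assms nz by (cases "Y = 0 \<or> Z = 0") (auto simp: y_def field_simps power2_eq_square)
  then show ?thesis unfolding a1_def y_def[symmetric] e[OF nz(1)] e[OF nz(2)] e[OF nz(3)] e2 e3 e4 .
qed

text \<open>Induction along the lattice: the ratio of consecutive residues from
  \<open>rho_step\<close> agrees with the ratio of consecutive masses, up to the change of
  \<open>Qd\<close>. Ratios avoid writing (a^2; q)_k as a quotient of infinite products, which can
  be 0/0 when a^2 is a negative power of q.\<close>

lemma rho_plus:
  assumes "a * q ^ k > 1"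
  defines "zc \<equiv> complex_of_real (a * q ^ k)"
  shows "((\<lambda>x. (x - zc) / x * Om x) \<longlongrightarrow> complex_of_real (eps a * (2 * AW_mass_plus q a b c d t k / Kc)) / (Qd zc)\<^sup>2) (at zc)"
  using assms(1) unfolding zc_def
proof (induction k)
  case 0
  then show ?case using rho_plus_0 by simp
next
  case (Suc k)
  define x where "x = a * q ^ k"
  define y where "y = q * x"
  have yS: "a * q ^ Suc k = y" by (simp add: y_def x_def mult_ac)
  have y1: "y > 1" using Suc.prems yS by simp
  have x1: "x > 1 / q" using y1 q_pos by (simp add: y_def field_simps)
  have q1': "1 / q > 1" using q_pos q_less_1 by simp
  have x2: "x > 1" using x1 q1' by linarith
  have xa: "q ^ k = x / a" using a_pos by (simp add: x_def)
  have IH: "((\<lambda>z. (z - complex_of_real x) / z * Om z) \<longlongrightarrow> complex_of_real (eps a * (2 * AW_mass_plus q a b c d t k / Kc)) / (Qd (complex_of_real x))\<^sup>2) (at (complex_of_real x))"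
    using Suc.IH x2 unfolding x_def by blast
  have ylt: "y \<le> q * a" unfolding y_def x_def using q_pos q_less_1 a_pos by (simp add: power_le_one)
  have x22: "1 < x\<^sup>2" "1 < q * x\<^sup>2" "1 < y\<^sup>2"
  proof -
    show "1 < x\<^sup>2" using x2 by (simp add: power2_eq_square less_1_mult)
    show "1 < q * x\<^sup>2" using less_1_mult[OF y1 x2] by (simp add: y_def power2_eq_square mult_ac)
    show "1 < y\<^sup>2" using y1 by (simp add: power2_eq_square less_1_mult)
  qed
  define A B C D e X Y Z where "A = 1 - y / a" and "B = 1 - y / b" and "C = 1 - y / c" and "D = 1 - y / d" and "e = 1 - d * x"
     and "X = 1 - x\<^sup>2" and "Y = 1 - y\<^sup>2" and "Z = 1 - q * x\<^sup>2"
  have dx: "d * x > 1" using mult_strict_mono[of q d "1 / q" x] d_gt_q x1 q_pos d_pos by simp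
  have "y < a" using ylt mult_strict_right_mono[OF q_less_1 a_pos] by simp
  moreover have "y < d" using ylt qa_less_d by linarith
  ultimately have ne: "A \<noteq> 0" "B \<noteq> 0" "C \<noteq> 0" "D \<noteq> 0" "e \<noteq> 0" "X \<noteq> 0" "Y \<noteq> 0" "Z \<noteq> 0"
    unfolding A_def B_def C_def D_def e_def X_def Y_def Z_def using dx y1 bc_less_1 par' a_pos d_pos x22(3)[THEN less_imp_neq] x22(1)[THEN less_imp_neq] x22(2)[THEN less_imp_neq] by (auto simp: field_simps)
  have ms: "AW_mass_plus q a b c d t (Suc k) = AW_mass_plus q a b c d t k * (((1 - a * x) * ((1 - b * x) * ((1 - c * x) * e))) / (A * (B * (C * D)))) * (Y / X) / s ^ 2"
  proof -
    have e1: "a\<^sup>2 * q ^ (2 * k) = x\<^sup>2" "a\<^sup>2 * q ^ (2 * Suc k) = y\<^sup>2"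
    proof -
      have "q ^ (2 * k) = q ^ k * q ^ k" "q ^ (2 * Suc k) = (q * q ^ k) * (q * q ^ k)" by (simp_all only: mult_2 power_add power_Suc)
      then show "a\<^sup>2 * q ^ (2 * k) = x\<^sup>2" "a\<^sup>2 * q ^ (2 * Suc k) = y\<^sup>2" by (simp_all only: x_def y_def power2_eq_square mult_ac)
    qed
    have e2: "a\<^sup>2 * q ^ k = a * x" "a * b * q ^ k = b * x" "a * c * q ^ k = c * x" "a * d * q ^ k = d * x" "q * q ^ k = y / a" "q * a / b * q ^ k = y / b"
      "q * a / c * q ^ k = y / c" "q * a / d * q ^ k = y / d"
      unfolding y_def x_def using a_pos by (simp_all add: power2_eq_square)
    show ?thesis using mass_plus_Suc[of k] ne(6) unfolding e1 e2 A_def B_def C_def D_def e_def X_def Y_def by simp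
  qed
  have ai: "a1 (1 / (qc * complex_of_real x)) = complex_of_real (- a * b * c * A * B * C * e / (y * (Y * Z)))"
    by (subst a1_inv) (use x2 in \<open>simp_all add: A_def B_def C_def e_def Y_def Z_def y_def\<close>)
  have ax: "a1 (complex_of_real x) = complex_of_real (- x * (1 - a * x) * (1 - b * x) * (1 - c * x) * (d * D) / (X * Z))"
    unfolding a1_def D_def X_def Z_def y_def using d_pos by (simp add: right_diff_distrib)
  have "a1 (1 / (qc * complex_of_real x)) \<noteq> 0" unfolding ai of_real_eq_0_iff using ne y1 a_pos par' by simp
  note st = rho_step[OF IH _ _ _ _ this]
  have yc: "qc * complex_of_real x = complex_of_real y" by (simp add: y_def)
  have Qdy: "Qd (complex_of_real y) = Qd (complex_of_real x) * complex_of_real (- e / (d * x * D))"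
  proof -
    have 1: "Q (qc * complex_of_real x / dc) = complex_of_real D * Q (qc * complex_of_real y / dc)"
      using Q_rec[of "qc * complex_of_real x / dc"] by (simp add: D_def y_def mult_ac)
    have 2: "Q (qc / (dc * complex_of_real y)) = complex_of_real (- e / (d * x)) * Q (qc / (dc * complex_of_real x))"
      using Q_rec[of "qc / (dc * complex_of_real y)"] nz x2 d_pos by (simp add: e_def y_def field_simps)
    show ?thesis unfolding Qd_def 1 2 using ne by simp
  qed
  have s2: "s ^ 2 = a * b * c * d / q" using s_sq q_pos by (simp add: field_simps power2_eq_square)
  have fin: "E0 * (2 * m / Kc) * (- x * (1 - a * x) * (1 - b * x) * (1 - c * x) * (d * D) / (X * Z)) / (- a * b * c * A * B * C * e / (y * (Y * Z)))
    = E0 * (2 * (m * (((1 - a * x) * ((1 - b * x) * ((1 - c * x) * e))) / (A * (B * (C * D)))) * (Y / X) / s ^ 2) / Kc) / (- e / (d * x * D))\<^sup>2" for E0 m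
  proof -
    have "M * (- x * v1 * v2 * v3 * (d * D) / (X * Z)) / (- a * b * c * A * B * C * e / (y * (Y * Z)))
      = M * (v1 * (v2 * (v3 * e)) / (A * (B * (C * D))) * (Y / X) / (a * b * c * d / q)) / (- e / (d * x * D))\<^sup>2" for M v1 v2 v3
      using ne x2 a_pos par' d_pos q_pos by (simp add: y_def field_simps power2_eq_square)
    from this[of "E0 * (2 * m / Kc)" "1 - a * x" "1 - b * x" "1 - c * x"] show ?thesis unfolding s2 by (simp add: mult_ac)
  qed
  have "complex_of_real (eps a * (2 * AW_mass_plus q a b c d t k / Kc)) / (Qd (complex_of_real x))\<^sup>2 * a1 (complex_of_real x) / a1 (1 / (qc * complex_of_real x))
    = complex_of_real (eps a * (2 * AW_mass_plus q a b c d t (Suc k) / Kc)) / (Qd (complex_of_real y))\<^sup>2"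
  proof -
    have "complex_of_real U / X2\<^sup>2 * complex_of_real V / complex_of_real W = complex_of_real T / (X2 * complex_of_real G)\<^sup>2" if "U * V / W = T / G\<^sup>2" for U V W T G X2
    proof -
      have "complex_of_real (U * V / W) = complex_of_real (T / G\<^sup>2)" using that by simp
      then show ?thesis by (simp add: power_mult_distrib) (metis (no_types, lifting) divide_divide_eq_left mult.commute times_divide_eq_right)
    qed
    then show ?thesis unfolding ax ai Qdy ms using fin[of "eps a" "AW_mass_plus q a b c d t k"] by blast
  qed
  moreover have "complex_of_real x \<noteq> 0" "(complex_of_real x)\<^sup>2 \<noteq> 1" "qc * (complex_of_real x)\<^sup>2 \<noteq> 1" "qc\<^sup>2 * (complex_of_real x)\<^sup>2 \<noteq> 1"
  proof -
    show "complex_of_real x \<noteq> 0" using x2 by simp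
    have "complex_of_real (x\<^sup>2) \<noteq> complex_of_real 1" "complex_of_real (q * x\<^sup>2) \<noteq> complex_of_real 1" "complex_of_real (y\<^sup>2) \<noteq> complex_of_real 1"
      unfolding of_real_eq_iff using x22 by linarith+
    then show "(complex_of_real x)\<^sup>2 \<noteq> 1" "qc * (complex_of_real x)\<^sup>2 \<noteq> 1" "qc\<^sup>2 * (complex_of_real x)\<^sup>2 \<noteq> 1"
      by (simp_all add: y_def power_mult_distrib)
  qed
  note st[OF this]
  ultimately show ?case unfolding yS yc by simp
qed

end



section \<open>Residues in an annulus and removable singularities\<close>

lemma removable_finite:
  fixes f :: "complex \<Rightarrow> complex"
  assumes "finite K" "open S" "f holomorphic_on S - K"
    and "\<And>p. p \<in> K \<Longrightarrow> p \<in> S \<Longrightarrow> ((\<lambda>z. (z - p) * f z) \<longlongrightarrow> 0) (at p)"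
  shows "\<exists>g. g holomorphic_on S \<and> (\<forall>z\<in>S - K. g z = f z)"
  using assms
proof (induction K arbitrary: S rule: finite_induct)
  case empty
  then show ?case by auto
next
  case (insert p K)
  have "\<exists>g. g holomorphic_on (S - {p}) \<and> (\<forall>z\<in>S - {p} - K. g z = f z)"
  proof (rule insert.IH)
    show "open (S - {p})" using insert.prems(1) by (simp add: open_Diff)
    have "S - {p} - K = S - insert p K" by auto
    then show "f holomorphic_on S - {p} - K" using insert.prems(2) by simp
  qed (use insert.prems(3) in auto)
  then obtain g where g: "g holomorphic_on (S - {p})" "\<And>z. z \<in> S - {p} - K \<Longrightarrow> g z = f z" by blast
  show ?case
  proof (cases "p \<in> S")
    case False
    then show ?thesis using g by auto
  next
    case True
    have "open (S - K)" using insert by (simp add: open_Diff finite_imp_closed)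
    then have "eventually (\<lambda>z. z \<in> S - K) (at p)"
      using True insert.hyps by (intro eventually_at_in_open') auto
    moreover have "eventually (\<lambda>z. z \<noteq> p) (at p)" by (simp add: eventually_at_filter)
    ultimately have ev: "eventually (\<lambda>z. (z - p) * f z = (z - p) * g z) (at p)"
      by eventually_elim (use g(2) in auto)
    have "((\<lambda>z. (z - p) * f z) \<longlongrightarrow> 0) (at p)" using insert.prems(3) True by blast
    then have "((\<lambda>z. (z - p) * g z) \<longlongrightarrow> 0) (at p)" by (rule Lim_transform_eventually[OF _ ev])
    then obtain h where "h holomorphic_on S" "\<forall>z\<in>S - {p}. h z = g z"
      using holomorphic_on_extend_lim[OF g(1)] True insert.prems(1) by (metis interior_open)
    then show ?thesis using g(2) by (intro exI[of _ h]) auto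
  qed
qed

text \<open>The integral of f(x)/x over the circle of radius r, divided by the imaginary unit. In
  this normalisation a dilation of the argument merely changes the radius.\<close>

definition circle_int :: "(complex \<Rightarrow> complex) \<Rightarrow> real \<Rightarrow> complex" where
  "circle_int f r = integral {0..2 * pi} (\<lambda>s. f (complex_of_real r * cis s))"

lemma circle_int_contour:
  assumes "r \<noteq> 0"
  shows "contour_integral (circlepath 0 r) (\<lambda>x. f x / x) = \<i> * circle_int f r"
proof -
  have "contour_integral (circlepath 0 r) (\<lambda>x. f x / x)
      = integral {0..2 * pi} (\<lambda>s. f (0 + complex_of_real r * cis s) / (0 + complex_of_real r * cis s) * complex_of_real r * \<i> * cis s)"
    unfolding circlepath_def by (rule contour_integral_part_circlepath_eq) simp
  also have "\<dots> = integral {0..2 * pi} (\<lambda>s. \<i> * f (complex_of_real r * cis s))"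
    by (rule integral_cong) (use assms in simp)
  also have "\<dots> = \<i> * circle_int f r" unfolding circle_int_def by (rule integral_mult_right)
  finally show ?thesis .
qed

lemma circle_int_cong:
  "0 \<le> r \<Longrightarrow> (\<And>z. norm z = r \<Longrightarrow> f z = g z) \<Longrightarrow> circle_int f r = circle_int g r"
  unfolding circle_int_def by (rule integral_cong) (simp add: norm_mult)

lemma circle_int_scale:
  "circle_int (\<lambda>x. f (x / complex_of_real q)) r = circle_int f (r / q)"
  unfolding circle_int_def by simp

lemma circle_int_diff:
  assumes "0 \<le> r" "continuous_on (sphere 0 r) f" "continuous_on (sphere 0 r) g"
  shows "circle_int (\<lambda>x. f x - g x) r = circle_int f r - circle_int g r"
  unfolding circle_int_def
proof (rule integral_diff)
  have "continuous_on {0..2 * pi} (\<lambda>s. h (complex_of_real r * cis s))" if "continuous_on (sphere 0 r) h" for h :: "complex \<Rightarrow> complex"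
    by (rule continuous_on_compose2[OF that]) (use assms(1) in \<open>auto intro!: continuous_intros simp: norm_mult\<close>)
  then show "(\<lambda>s. f (complex_of_real r * cis s)) integrable_on {0..2 * pi}" "(\<lambda>s. g (complex_of_real r * cis s)) integrable_on {0..2 * pi}"
    using assms by (auto intro: integrable_continuous_interval)
qed

lemma circle_int_cmult: "circle_int (\<lambda>x. c * f x) r = c * circle_int f r"
  unfolding circle_int_def by (rule integral_mult_right)

lemma annulus_contour:
  assumes f: "f holomorphic_on {z. r1 < norm z \<and> norm z < r2}" and r: "0 \<le> r1" "r1 < r" "r \<le> r'" "r' < r2"
  shows "contour_integral (circlepath 0 r) f = contour_integral (circlepath 0 r') f"
proof (rule Cauchy_theorem_homotopic_loops[OF _ _ f])
  have "{z :: complex. r1 < norm z \<and> norm z < r2} = ball 0 r2 - cball 0 r1" by auto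
  then show "open {z :: complex. r1 < norm z \<and> norm z < r2}" by (simp add: open_Diff)
  show "homotopic_loops {z. r1 < norm z \<and> norm z < r2} (circlepath 0 r) (circlepath 0 r')"
  proof (rule homotopic_loops_linear)
    fix t :: real and x :: complex
    show "closed_segment (circlepath 0 r t) (circlepath 0 r' t) \<subseteq> {z. r1 < norm z \<and> norm z < r2}"
    proof
      fix z assume "z \<in> closed_segment (circlepath 0 r t) (circlepath 0 r' t)"
      then obtain u where u: "0 \<le> u" "u \<le> 1" "z = (1 - u) *\<^sub>R circlepath 0 r t + u *\<^sub>R circlepath 0 r' t"
        by (auto simp: closed_segment_def)
      define e where "e = exp (2 * complex_of_real pi * \<i> * complex_of_real t)"
      have ne: "norm e = 1" unfolding e_def by simp
      have "z = complex_of_real ((1 - u) * r + u * r') * e"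
        unfolding u(3) circlepath e_def by (simp add: scaleR_conv_of_real algebra_simps)
      then have nz: "norm z = \<bar>(1 - u) * r + u * r'\<bar>" using ne by (simp only: norm_mult norm_of_real mult_1_right)
      have "r \<le> (1 - u) * r + u * r'" "(1 - u) * r + u * r' \<le> r'"
        using mult_left_mono[OF r(3) u(1)] mult_left_mono[OF r(3), of "1 - u"] u(2) by (simp_all add: algebra_simps)
      then show "z \<in> {z. r1 < norm z \<and> norm z < r2}" unfolding mem_Collect_eq nz using r by linarith
    qed
  qed auto
qed auto

lemma annulus_residues:
  assumes f: "f holomorphic_on {z. r1 < norm z \<and> norm z < r2} - K" and K: "finite K" "\<And>p. p \<in> K \<Longrightarrow> r < norm p \<and> norm p < r'"
    and r: "0 \<le> r1" "r1 < r" "r \<le> r'" "r' < r2"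
    and lim: "\<And>p. p \<in> K \<Longrightarrow> ((\<lambda>z. (z - p) / z * f z) \<longlongrightarrow> R p) (at p)"
  shows "circle_int f r' = circle_int f r + 2 * complex_of_real pi * (\<Sum>p\<in>K. R p)"
proof -
  let ?S = "{z :: complex. r1 < norm z \<and> norm z < r2}"
  define h where "h = (\<lambda>z. f z / z - (\<Sum>p\<in>K. R p / (z - p)))"
  have "{z :: complex. r1 < norm z \<and> norm z < r2} = ball 0 r2 - cball 0 r1" by auto
  then have S: "open ?S" by (simp add: open_Diff)
  have hol: "h holomorphic_on ?S - K"
    unfolding h_def by (intro holomorphic_intros f) (use r in auto)
  have "\<exists>g. g holomorphic_on ?S \<and> (\<forall>z\<in>?S - K. g z = h z)"
  proof (rule removable_finite[OF K(1) S hol])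
    fix p assume p: "p \<in> K"
    have "((\<lambda>z. (z - p) / z * f z - R p - (z - p) * (\<Sum>p'\<in>K - {p}. R p' / (z - p'))) \<longlongrightarrow> R p - R p - (p - p) * (\<Sum>p'\<in>K - {p}. R p' / (p - p'))) (at p)"
      by (intro tendsto_intros lim p) auto
    moreover have "eventually (\<lambda>z. (z - p) / z * f z - R p - (z - p) * (\<Sum>p'\<in>K - {p}. R p' / (z - p')) = (z - p) * h z) (at p)"
      unfolding eventually_at_filter
    proof (intro always_eventually allI impI)
      fix z assume "z \<noteq> p"
      then show "(z - p) / z * f z - R p - (z - p) * (\<Sum>p'\<in>K - {p}. R p' / (z - p')) = (z - p) * h z"
        unfolding h_def sum.remove[OF K(1) p] by (simp add: right_diff_distrib distrib_left)
    qed
    ultimately show "((\<lambda>z. (z - p) * h z) \<longlongrightarrow> 0) (at p)" by (auto intro: Lim_transform_eventually)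
  qed
  then obtain g where g: "g holomorphic_on ?S" "\<And>z. z \<in> ?S - K \<Longrightarrow> g z = h z" by blast
  have sum: "((\<lambda>z. \<Sum>p\<in>K. R p / (z - p)) has_contour_integral (\<Sum>p\<in>K. R p * c p)) (circlepath 0 \<rho>)"
    if "\<And>p. p \<in> K \<Longrightarrow> ((\<lambda>z. 1 / (z - p)) has_contour_integral c p) (circlepath 0 \<rho>)" for c \<rho>
    using has_contour_integral_sum[OF K(1) has_contour_integral_lmul[OF that], of "\<lambda>p. p" R] by simp
  have ci: "contour_integral (circlepath 0 \<rho>) (\<lambda>z. f z / z) = contour_integral (circlepath 0 \<rho>) g + (\<Sum>p\<in>K. R p * c p)"
    if \<rho>: "r1 < \<rho>" "\<rho> < r2" "\<And>p. p \<in> K \<Longrightarrow> norm p \<noteq> \<rho>" and c: "\<And>p. p \<in> K \<Longrightarrow> ((\<lambda>z. 1 / (z - p)) has_contour_integral c p) (circlepath 0 \<rho>)" for c \<rho>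
  proof -
    have im: "path_image (circlepath 0 \<rho>) \<subseteq> ?S - K" using \<rho> r by auto
    have "g contour_integrable_on circlepath 0 \<rho>"
      by (rule contour_integrable_holomorphic_simple[OF g(1) S]) (use im in auto)
    then have "(g has_contour_integral contour_integral (circlepath 0 \<rho>) g) (circlepath 0 \<rho>)" by (rule has_contour_integral_integral)
    from has_contour_integral_add[OF this sum[OF c]]
    have "((\<lambda>z. g z + (\<Sum>p\<in>K. R p / (z - p))) has_contour_integral contour_integral (circlepath 0 \<rho>) g + (\<Sum>p\<in>K. R p * c p)) (circlepath 0 \<rho>)" .
    then have "((\<lambda>z. f z / z) has_contour_integral contour_integral (circlepath 0 \<rho>) g + (\<Sum>p\<in>K. R p * c p)) (circlepath 0 \<rho>)"
      by (rule has_contour_integral_eq) (use im g(2) in \<open>auto simp: h_def\<close>)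
    then show ?thesis by (rule contour_integral_unique)
  qed
  have 1: "contour_integral (circlepath 0 r) (\<lambda>z. f z / z) = contour_integral (circlepath 0 r) g + (\<Sum>p\<in>K. R p * 0)"
  proof (rule ci)
    fix p assume p: "p \<in> K"
    show "((\<lambda>z. 1 / (z - p)) has_contour_integral 0) (circlepath 0 r)"
      by (rule Cauchy_theorem_convex_simple[of _ "ball 0 (norm p)"]) (use K(2)[OF p] r in \<open>auto intro!: holomorphic_intros\<close>)
  qed (use r K(2) in force)+
  have 2: "contour_integral (circlepath 0 r') (\<lambda>z. f z / z) = contour_integral (circlepath 0 r') g + (\<Sum>p\<in>K. R p * (2 * complex_of_real pi * \<i> * 1))"
  proof (rule ci)
    fix p assume p: "p \<in> K"
    show "((\<lambda>z. 1 / (z - p)) has_contour_integral 2 * complex_of_real pi * \<i> * 1) (circlepath 0 r')"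
      by (rule Cauchy_integral_circlepath_simple[of "\<lambda>_. 1"]) (use K(2)[OF p] in auto)
  qed (use r K(2) in force)+
  have "\<i> * circle_int f r' = \<i> * circle_int f r + (\<Sum>p\<in>K. R p) * (2 * complex_of_real pi * \<i>)"
    using 1 2 annulus_contour[OF g(1) r] circle_int_contour[of r f] circle_int_contour[of r' f] r
    by (simp flip: sum_distrib_right)
  then have "\<i> * circle_int f r' = \<i> * (circle_int f r + 2 * complex_of_real pi * (\<Sum>p\<in>K. R p))" by (simp add: algebra_simps)
  then show ?thesis by simp
qed

context qbase
begin

text \<open>All zeros of the infinite product are simple: c p q^n = 1 can hold for one n only, since
  no positive power of q equals 1.\<close>

lemma Q_simple_zero:
  assumes "c \<noteq> 0" "p \<noteq> 0"
  obtains L where "((\<lambda>x. (x - p) / Q (c * x)) \<longlongrightarrow> L) (at p)"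
proof (cases "Q (c * p) = 0")
  case False
  have "((\<lambda>x. (x - p) / Q (c * x)) \<longlongrightarrow> (p - p) / Q (c * p)) (at p)"
    by (intro tendsto_intros False)
  then show ?thesis by (rule that)
next
  case True
  then obtain n where n: "c * p * q ^ n = 1" by (auto simp: Q_eq_0_iff)
  have Pn: "P n (c * p) \<noteq> 0"
  proof
    assume "P n (c * p) = 0"
    then obtain j where j: "j < n" "c * p * q ^ j = 1" by (auto simp: qpoch_def)
    have "q ^ n = q ^ j * q ^ (n - j)" using j by (simp flip: power_add)
    then have "c * p * q ^ j * q ^ (n - j) = 1" using n by (simp add: mult.assoc)
    then have "q ^ (n - j) = 1" using j(2) by simp
    moreover have "norm (q ^ (n - j)) < 1" using q1 j by (simp add: norm_power power_less_one_iff)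
    ultimately show False by simp
  qed
  have Qn: "Q (c * p * q ^ n * q) \<noteq> 0" unfolding n using Q_nz[OF q1] by simp
  have "((\<lambda>x. - p / (P n (c * x) * Q (c * x * q ^ n * q))) \<longlongrightarrow> - p / (P n (c * p) * Q (c * p * q ^ n * q))) (at p)"
    by (intro tendsto_intros) (use Pn Qn in auto)
  moreover have "eventually (\<lambda>x. - p / (P n (c * x) * Q (c * x * q ^ n * q)) = (x - p) / Q (c * x)) (at p)"
    unfolding eventually_at_filter
  proof (intro always_eventually allI impI)
    fix x assume x: "x \<noteq> p"
    have cq: "c * q ^ n = 1 / p" using n assms by (simp add: field_simps)
    have "1 - c * x * q ^ n = 1 - x * (c * q ^ n)" by (simp add: mult_ac)
    also have "\<dots> = (x - p) * (- 1 / p)" unfolding cq using assms by (simp add: field_simps)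
    finally have e: "1 - c * x * q ^ n = (x - p) * (- 1 / p)" .
    have "Q (c * x) = (x - p) * (- 1 / p) * (P n (c * x) * Q (c * x * q ^ n * q))"
      using Q_shift[of "c * x" n] Q_rec[of "c * x * q ^ n"] unfolding e by (simp add: mult_ac)
    then show "- p / (P n (c * x) * Q (c * x * q ^ n * q)) = (x - p) / Q (c * x)" using x assms by simp
  qed
  ultimately show ?thesis by (intro that) (auto intro: Lim_transform_eventually)
qed

lemma Q_simple_zero':
  assumes "c \<noteq> 0" "p \<noteq> 0"
  obtains L where "((\<lambda>x. (x - p) / Q (c / x)) \<longlongrightarrow> L) (at p)"
proof -
  obtain L where L: "((\<lambda>x. (x - 1 / p) / Q (c * x)) \<longlongrightarrow> L) (at (1 / p))"
    using Q_simple_zero[of c "1 / p"] assms by auto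
  have f: "filterlim (\<lambda>x. 1 / x) (at (1 / p)) (at p)"
    by (rule filterlim_atI) (use assms in \<open>auto intro!: tendsto_eq_intros simp: eventually_at_filter field_simps\<close>)
  have "((\<lambda>x. - (x * p) * ((1 / x - 1 / p) / Q (c * (1 / x)))) \<longlongrightarrow> - (p * p) * L) (at p)"
    by (intro tendsto_intros filterlim_compose[OF L f])
  moreover have "eventually (\<lambda>x. - (x * p) * ((1 / x - 1 / p) / Q (c * (1 / x))) = (x - p) / Q (c / x)) (at p)"
    using tendsto_imp_eventually_ne[OF tendsto_ident_at assms(2), of UNIV]
  proof eventually_elim
    case (elim x)
    have "- (x * p) * (1 / x - 1 / p) = x - p" using elim assms by (simp add: field_simps)
    then show ?case by (metis mult_1_right times_divide_eq_right)
  qed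
  ultimately show ?thesis by (intro that) (auto intro: Lim_transform_eventually)
qed

text \<open>At p = 1 and p = -1 the numerator has a double zero, which absorbs a simple zero of D1
  and one of D2 at the same time.\<close>

lemma double_zero_vanish:
  assumes p: "p\<^sup>2 = 1" and L: "((\<lambda>x. (x - p) / D1 x) \<longlongrightarrow> L1) (at p)" "((\<lambda>x. (x - p) / D2 x) \<longlongrightarrow> L2) (at p)" "(D3 \<longlongrightarrow> l) (at p)" "l \<noteq> 0"
  shows "((\<lambda>x. (x - p) * (Q (x\<^sup>2) * Q (1 / x\<^sup>2) / (D1 x * D2 x * D3 x))) \<longlongrightarrow> 0) (at p)"
proof -
  have p0: "p \<noteq> 0" using p by auto
  have "((\<lambda>x. (x - p) * ((x - p) / D1 x) * ((x - p) / D2 x) * (- (x + p)\<^sup>2 / x\<^sup>2 * Q (x\<^sup>2 * q) * Q (1 / x\<^sup>2 * q) / D3 x))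
     \<longlongrightarrow> (p - p) * L1 * L2 * (- (p + p)\<^sup>2 / p\<^sup>2 * Q (p\<^sup>2 * q) * Q (1 / p\<^sup>2 * q) / l)) (at p)"
    by (intro tendsto_intros L) (use p0 L(4) in auto)
  moreover have "eventually (\<lambda>x. (x - p) * ((x - p) / D1 x) * ((x - p) / D2 x) * (- (x + p)\<^sup>2 / x\<^sup>2 * Q (x\<^sup>2 * q) * Q (1 / x\<^sup>2 * q) / D3 x)
     = (x - p) * (Q (x\<^sup>2) * Q (1 / x\<^sup>2) / (D1 x * D2 x * D3 x))) (at p)"
    using tendsto_imp_eventually_ne[OF tendsto_ident_at p0, of UNIV]
  proof eventually_elim
    case (elim x)
    have e: "1 - x\<^sup>2 = - ((x - p) * (x + p))" "1 - 1 / x\<^sup>2 = (x - p) * (x + p) / x\<^sup>2"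
      using elim p by (simp_all add: field_simps power2_eq_square)
    show ?case using Q_rec[of "x\<^sup>2"] Q_rec[of "1 / x\<^sup>2"] unfolding e
      by (simp add: power2_eq_square mult_ac)
  qed
  ultimately show ?thesis by (auto intro: Lim_transform_eventually)
qed

end

section \<open>The Casoratian of two eigenfunctions\<close>

locale awpair = awp +
  fixes \<gamma> \<gamma>' :: real
  assumes gam: "\<gamma> \<in> AW_dual_S q a b c d t" "\<gamma>' \<in> AW_dual_S q a b c d t"
begin

definition FF :: "real \<Rightarrow> complex \<Rightarrow> complex" where
  "FF g x = aw8 ac bc cc dc sc (complex_of_real g) x"

abbreviation F where "F \<equiv> FF \<gamma>"
abbreviation G where "G \<equiv> FF \<gamma>'"

definition Lam :: "real \<Rightarrow> complex" where
  "Lam g = sc * complex_of_real g + sc / complex_of_real g - 1 - sc ^ 2"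

lemma FF_inverse: "FF g (1 / x) = FF g x"
  unfolding FF_def by (rule aw8_inverse)

lemma FF_holomorphic: "g \<in> AW_dual_S q a b c d t \<Longrightarrow> FF g holomorphic_on - {0}"
  unfolding FF_def[abs_def] by (rule aw8_holomorphic) (use dual_S_z nz in auto)

lemma FF_holomorphic' [holomorphic_intros]:
  assumes "h holomorphic_on S" "\<And>x. x \<in> S \<Longrightarrow> h x \<noteq> 0"
  shows "(\<lambda>x. F (h x)) holomorphic_on S" "(\<lambda>x. G (h x)) holomorphic_on S"
proof -
  have "h ` S \<subseteq> - {0}" using assms(2) by auto
  then show "(\<lambda>x. F (h x)) holomorphic_on S" "(\<lambda>x. G (h x)) holomorphic_on S"
    using holomorphic_on_compose_gen[OF assms(1) FF_holomorphic[OF gam(1)]] holomorphic_on_compose_gen[OF assms(1) FF_holomorphic[OF gam(2)]]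
    by (simp_all add: o_def)
qed

lemma FF_tendsto [tendsto_intros]:
  assumes "(h \<longlongrightarrow> l) T" "l \<noteq> 0"
  shows "((\<lambda>x. F (h x)) \<longlongrightarrow> F l) T" "((\<lambda>x. G (h x)) \<longlongrightarrow> G l) T"
proof -
  have "isCont F l" "isCont G l"
    using FF_holomorphic[OF gam(1)] FF_holomorphic[OF gam(2)] assms(2)
    by (auto dest!: holomorphic_on_imp_continuous_on simp: continuous_on_eq_continuous_at open_Compl)
  then show "((\<lambda>x. F (h x)) \<longlongrightarrow> F l) T" "((\<lambda>x. G (h x)) \<longlongrightarrow> G l) T"
    using isCont_tendsto_compose assms(1) by blast+
qed

text \<open>The q-analogue of the Wronskian of the two numerators. Invariance of these under
  inversion makes it change sign under x -> 1/(qx).\<close>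

definition om :: "complex \<Rightarrow> complex" where
  "om x = F (qc * x) * G x - F x * G (qc * x)"

lemma om_inverse: "om (1 / (qc * x)) = - om x"
proof -
  have "qc * (1 / (qc * x)) = 1 / x" using nz by simp
  then show ?thesis unfolding om_def by (simp add: FF_inverse mult_ac)
qed

text \<open>Multiplication by \<open>Qd\<close> changes the coefficients of the shifted values to
  a1(x) and a1(1/x), whereas the diagonal term keeps A(x) + A(1/x).\<close>

lemma eigen_generic:
  assumes g: "g \<in> AW_dual_S q a b c d t" and x: "x \<noteq> 0" "Q (x / dc) \<noteq> 0" "Q (1 / (dc * x)) \<noteq> 0" "x\<^sup>2 \<noteq> 1" "qc * x\<^sup>2 \<noteq> 1" "x\<^sup>2 \<noteq> qc"
  shows "a1 x * FF g (qc * x) + a1 (1 / x) * FF g (x / qc) = (Lam g + AA ac bc cc dc x + AA ac bc cc dc (1 / x)) * FF g x"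
proof -
  let ?A = "AA ac bc cc dc x" and ?B = "AA ac bc cc dc (1 / x)"
  have dx: "dc * x \<noteq> 1" "x \<noteq> dc"
    using x(2,3) nz by auto
  define W where "W = Q (qc * x / dc) * Q (qc / (dc * x))"
  have 1: "Q (x / dc) = (1 - x / dc) * Q (qc * x / dc)" using Q_rec[of "x / dc"] by (simp add: mult_ac)
  have 2: "Q (1 / (dc * x)) = (1 - 1 / (dc * x)) * Q (qc / (dc * x))" using Q_rec[of "1 / (dc * x)"] by simp
  have 3: "Q (qc * x / dc) = (1 - qc * x / dc) * Q (qc * (qc * x) / dc)" using Q_rec[of "qc * x / dc"] by (simp add: mult_ac)
  have 4: "Q (qc / (dc * x)) = (1 - qc / (dc * x)) * Q (qc / (dc * (x / qc)))" using Q_rec[of "qc / (dc * x)"] by (simp add: mult_ac)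
  have W: "W \<noteq> 0" using x(2,3) unfolding 1 2 W_def by auto
  have n1: "1 - 1 / (dc * x) \<noteq> 0" "1 - x / dc \<noteq> 0" using dx x nz by (auto simp: field_simps)
  have w1: "Q (qc * (qc * x) / dc) * Q (qc / (dc * (qc * x))) * (1 - qc * x / dc) = W * (1 - 1 / (dc * x))"
  proof -
    have "qc / (dc * (qc * x)) = 1 / (dc * x)" using nz by simp
    then show ?thesis unfolding W_def 3 using 2 by simp
  qed
  have w2: "Q (qc * (x / qc) / dc) * Q (qc / (dc * (x / qc))) * (1 - qc / (dc * x)) = W * (1 - x / dc)"
  proof -
    have e: "qc * (x / qc) / dc = x / dc" using nz by simp
    show ?thesis unfolding W_def e 1 4 by algebra
  qed
  have f: "h / w = h * u / (W * v)" if "w * u = W * v" "u \<noteq> 0 \<or> h = 0" "v \<noteq> 0" for h w u v :: complex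
  proof (cases "u = 0")
    case False
    then have "w = W * v / u" using that(1) by (simp add: nonzero_eq_divide_eq)
    then show ?thesis by simp
  qed (use that in auto)
  have L: "?A * (FF g (qc * x) / (Q (qc * (qc * x) / dc) * Q (qc / (dc * (qc * x)))) - FF g x / W) + ?B * (FF g (x / qc) / (Q (qc * (x / qc) / dc) * Q (qc / (dc * (x / qc)))) - FF g x / W)
      = Lam g * (FF g x / W)"
    using awf_eigen[OF g x[folded power2_eq_square]] unfolding Lop_def awf_def FF_def Lam_def W_def .
  have u: "1 - qc * x / dc \<noteq> 0" "1 - qc / (dc * x) \<noteq> 0"
    using W unfolding W_def 3 4 by auto
  have fa: "FF g (qc * x) / (Q (qc * (qc * x) / dc) * Q (qc / (dc * (qc * x)))) = FF g (qc * x) * (1 - qc * x / dc) / (W * (1 - 1 / (dc * x)))"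
    by (rule f[OF w1]) (use u n1 in auto)
  have fb: "FF g (x / qc) / (Q (qc * (x / qc) / dc) * Q (qc / (dc * (x / qc)))) = FF g (x / qc) * (1 - qc / (dc * x)) / (W * (1 - x / dc))"
    by (rule f[OF w2]) (use u n1 in auto)
  have cl: "?A * (fp * u1 / v1) + ?B * (fm * u2 / v2) = (l + ?A + ?B) * f0"
    if "?A * (fp * u1 / (W * v1) - f0 / W) + ?B * (fm * u2 / (W * v2) - f0 / W) = l * (f0 / W)" for fp fm f0 u1 u2 v1 v2 l
  proof -
    have "(?A * (fp * u1 / (W * v1) - f0 / W) + ?B * (fm * u2 / (W * v2) - f0 / W)) * W = l * (f0 / W) * W" using that by simp
    moreover have "fp * u1 / (W * v1) * W = fp * u1 / v1" "fm * u2 / (W * v2) * W = fm * u2 / v2" "f0 / W * W = f0" using W by simp_all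
    ultimately show ?thesis by algebra
  qed
  have aA: "?A * ((1 - qc * x / dc) / (1 - 1 / (dc * x))) = a1 x"
  proof -
    have e: "(1 - dc * x) = - (dc * x) * (1 - 1 / (dc * x))" "(dc - qc * x) = dc * (1 - qc * x / dc)" using nz x by (simp_all add: field_simps)
    have "A1 * A2 * A3 * (- z * v) / D * (u / v) = - (x) * A1 * A2 * A3 * (dc * u) / D" if "v \<noteq> 0" "z = dc * (x)" for A1 A2 A3 z v u D :: complex
      using that by simp
    from this[OF n1(1)] show ?thesis unfolding AA_def a1_def e by simp
  qed
  have aB: "?B * ((1 - qc / (dc * x)) / (1 - x / dc)) = a1 (1 / x)"
  proof -
    have e: "(1 - dc * (1 / x)) = - (dc / x) * (1 - x / dc)" "(dc - qc * (1 / x)) = dc * (1 - qc / (dc * x))" using nz x by (simp_all add: field_simps)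
    have "A1 * A2 * A3 * (- z * v) / D * (u / v) = - (1 / x) * A1 * A2 * A3 * (dc * u) / D" if "v \<noteq> 0" "z = dc * (1 / x)" for A1 A2 A3 z v u D :: complex
      using that by simp
    from this[OF n1(2), of "dc / x"] show ?thesis unfolding AA_def a1_def e by simp
  qed
  from cl[OF L[unfolded fa fb]] show ?thesis unfolding aA[symmetric] aB[symmetric] by (simp add: mult_ac)
qed

lemma AA_tendsto: "p \<noteq> 0 \<Longrightarrow> p\<^sup>2 \<noteq> 1 \<Longrightarrow> qc * p\<^sup>2 \<noteq> 1 \<Longrightarrow> (h \<longlongrightarrow> p) T \<Longrightarrow> ((\<lambda>x. AA ac bc cc dc (h x)) \<longlongrightarrow> AA ac bc cc dc p) T"
  unfolding AA_def by (intro tendsto_intros) auto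

lemma a1_tendsto: "p\<^sup>2 \<noteq> 1 \<Longrightarrow> qc * p\<^sup>2 \<noteq> 1 \<Longrightarrow> (h \<longlongrightarrow> p) T \<Longrightarrow> ((\<lambda>x. a1 (h x)) \<longlongrightarrow> a1 p) T"
  unfolding a1_def by (intro tendsto_intros) auto

lemma ev_Q_nz:
  assumes "p \<noteq> 0"
  shows "eventually (\<lambda>x. Q (x / dc) \<noteq> 0) (at p)" "eventually (\<lambda>x. Q (1 / (dc * x)) \<noteq> 0) (at p)"
proof -
  have c: "connected (- {0 :: complex})" by (rule connected_punctured_universe) simp
  have s: "- (1 / dc) \<noteq> 0" using nz by simp
  have n: "Q (complex_of_real (- 1)) \<noteq> 0" by (rule Q_nz_real) simp
  show "eventually (\<lambda>x. Q (x / dc) \<noteq> 0) (at p)"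
  proof (rule eventually_mono[OF non_zero_neighbour_alt[where f = "\<lambda>x. Q (x / dc)" and S = "- {0}" and \<beta> = "- dc"]])
    show "(\<lambda>x. Q (x / dc)) holomorphic_on - {0}" by (intro holomorphic_intros) (use nz in auto)
  qed (use assms c nz n in auto)
  show "eventually (\<lambda>x. Q (1 / (dc * x)) \<noteq> 0) (at p)"
  proof (rule eventually_mono[OF non_zero_neighbour_alt[where f = "\<lambda>x. Q (1 / (dc * x))" and S = "- {0}" and \<beta> = "- (1 / dc)"]])
    show "(\<lambda>x. Q (1 / (dc * x))) holomorphic_on - {0}" by (intro holomorphic_intros) (use nz in auto)
  qed (use assms c nz n in auto)
qed

text \<open>The numerators are holomorphic off 0 and the zeros of the infinite products are
  isolated, so the equation extends by continuity to the poles of the eigenfunctions.\<close>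

lemma eigen:
  assumes g: "g \<in> AW_dual_S q a b c d t" and x: "x \<noteq> 0" "x\<^sup>2 \<noteq> 1" "qc * x\<^sup>2 \<noteq> 1" "x\<^sup>2 \<noteq> qc"
  shows "a1 x * FF g (qc * x) + a1 (1 / x) * FF g (x / qc) = (Lam g + AA ac bc cc dc x + AA ac bc cc dc (1 / x)) * FF g x"
proof -
  have gt: "((\<lambda>x. FF g (h x)) \<longlongrightarrow> FF g l) T" if "(h \<longlongrightarrow> l) T" "l \<noteq> 0" for h l and T :: "complex filter"
  proof -
    have "isCont (FF g) l" using FF_holomorphic[OF g] that(2)
      by (auto dest!: holomorphic_on_imp_continuous_on simp: continuous_on_eq_continuous_at open_Compl)
    then show ?thesis using isCont_tendsto_compose that(1) by blast
  qed
  have x': "(1 / x)\<^sup>2 \<noteq> 1" "qc * (1 / x)\<^sup>2 \<noteq> 1" "1 / x \<noteq> 0" using x nz by (auto simp: power_divide field_simps)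
  have i: "((\<lambda>y. 1 / y) \<longlongrightarrow> 1 / x) (at x)" by (intro tendsto_intros x)
  have L: "((\<lambda>y. a1 y * FF g (qc * y) + a1 (1 / y) * FF g (y / qc)) \<longlongrightarrow> a1 x * FF g (qc * x) + a1 (1 / x) * FF g (x / qc)) (at x)"
    by (intro tendsto_add tendsto_mult gt a1_tendsto[OF x(2,3)] a1_tendsto[OF x'(1,2)] i tendsto_intros) (use x nz in auto)
  have R: "((\<lambda>y. (Lam g + AA ac bc cc dc y + AA ac bc cc dc (1 / y)) * FF g y) \<longlongrightarrow> (Lam g + AA ac bc cc dc x + AA ac bc cc dc (1 / x)) * FF g x) (at x)"
    by (intro tendsto_add tendsto_mult gt AA_tendsto[OF x(1-3)] AA_tendsto[OF x'(3,1,2)] i tendsto_intros) (use x nz in auto)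
  have ev: "eventually (\<lambda>y. a1 y * FF g (qc * y) + a1 (1 / y) * FF g (y / qc) = (Lam g + AA ac bc cc dc y + AA ac bc cc dc (1 / y)) * FF g y) (at x)"
    using ev_Q_nz[OF x(1)] ev_generic[OF x(1)]
    by eventually_elim (use eigen_generic[OF g] in blast)
  show ?thesis by (rule tendsto_unique[OF _ Lim_transform_eventually[OF L ev] R]) simp
qed

definition del where "del = Lam \<gamma> - Lam \<gamma>'"

text \<open>The diagonal term drops out when the two eigenvalue equations are cross-multiplied; only
  the difference of the eigenvalues survives.\<close>

lemma om_eq:
  assumes "x \<noteq> 0" "x\<^sup>2 \<noteq> 1" "qc * x\<^sup>2 \<noteq> 1" "x\<^sup>2 \<noteq> qc"
  shows "a1 x * om x - a1 (1 / x) * om (x / qc) = del * (F x * G x)"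
proof -
  have q: "qc * (x / qc) = x" using nz by simp
  show ?thesis
    using eigen[OF gam(1) assms] eigen[OF gam(2) assms] unfolding om_def q del_def by algebra
qed

definition H :: "complex \<Rightarrow> complex" where "H x = Bf x * om x"
definition V :: "complex \<Rightarrow> complex" where "V x = Om x * (F x * G x)"

lemma H_diff:
  assumes "x \<noteq> 0" "x\<^sup>2 \<noteq> 1" "qc * x\<^sup>2 \<noteq> 1" "ac * x \<noteq> 1" "bc * x \<noteq> 1" "cc * x \<noteq> 1" "qc * x \<noteq> dc"
     "x\<^sup>2 \<noteq> qc" "ac \<noteq> x" "bc \<noteq> x" "cc \<noteq> x" "dc * x \<noteq> qc"
  shows "H x - H (x / qc) = del * V x"
proof -
  have "H x = Om x * (a1 x * om x)" unfolding H_def Om_a1[OF assms(1-7), symmetric] by simp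
  moreover have "H (x / qc) = Om x * (a1 (1 / x) * om (x / qc))" unfolding H_def Om_a1'[OF assms(1,2,8-12), symmetric] by simp
  ultimately have "H x - H (x / qc) = Om x * (a1 x * om x - a1 (1 / x) * om (x / qc))" by (simp add: right_diff_distrib)
  then show ?thesis unfolding om_eq[OF assms(1-3,8)] V_def by simp
qed

lemma H_inverse: "x \<noteq> 0 \<Longrightarrow> H (1 / (qc * x)) = - H x"
  unfolding H_def by (simp add: Bf_inverse om_inverse del: divide_divide_eq_left mult.commute)

text \<open>Two signs compensate each other: H is odd under x -> 1/(qx), and dx/x changes sign under
  the same map.\<close>

lemma H_residue_inverse:
  assumes L: "((\<lambda>x. (x - p) / x * H x) \<longlongrightarrow> R) (at p)" and p: "p \<noteq> 0"
  shows "((\<lambda>x. (x - 1 / (qc * p)) / x * H x) \<longlongrightarrow> R) (at (1 / (qc * p)))"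
proof -
  let ?p = "1 / (qc * p)"
  have f: "filterlim (\<lambda>x. 1 / (qc * x)) (at p) (at ?p)"
  proof (rule filterlim_atI)
    show "((\<lambda>x. 1 / (qc * x)) \<longlongrightarrow> p) (at ?p)" using p nz by (auto intro!: tendsto_eq_intros)
    have "1 / (qc * x) \<noteq> p" if "x \<noteq> ?p" for x
    proof
      assume "1 / (qc * x) = p"
      then have "x = ?p" using p nz by (cases "x = 0") (auto simp: field_simps)
      with that show False ..
    qed
    then show "eventually (\<lambda>x. 1 / (qc * x) \<noteq> p) (at ?p)" by (simp add: eventually_at_filter)
  qed
  have "((\<lambda>x. (1 / (qc * x) - p) / (1 / (qc * x)) * H (1 / (qc * x)) / (qc * x * p)) \<longlongrightarrow> R / (qc * ?p * p)) (at ?p)"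
    by (intro tendsto_divide filterlim_compose[OF L f] tendsto_intros) (use p nz in auto)
  moreover have "R / (qc * ?p * p) = R" using p nz by simp
  moreover have "eventually (\<lambda>x. (1 / (qc * x) - p) / (1 / (qc * x)) * H (1 / (qc * x)) / (qc * x * p) = (x - ?p) / x * H x) (at ?p)"
  proof -
    have "?p \<noteq> 0" using p nz by simp
    from tendsto_imp_eventually_ne[OF tendsto_ident_at this, of UNIV] show ?thesis
    proof eventually_elim
      case (elim x)
      have "(1 / (qc * x) - p) / (1 / (qc * x)) / (qc * x * p) = - ((x - ?p) / x)" using elim p nz by (simp add: field_simps)
      then have "(1 / (qc * x) - p) / (1 / (qc * x)) / (qc * x * p) * - H x = (x - ?p) / x * H x" by simp
      then show ?case unfolding H_inverse[OF elim] by (simp only: times_divide_eq_left times_divide_eq_right)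
    qed
  qed
  ultimately show ?thesis by (auto intro: Lim_transform_eventually)
qed

end



section \<open>Location of the poles in the annulus\<close>

context awq
begin

lemma powi_less_iff: "q powi i < q powi j \<longleftrightarrow> j < i"
proof -
  have "q powi j < q powi i" if "i < j" for i j :: int
  proof -
    have "q powi j = q powi i * q ^ nat (j - i)"
      using that q_pos by (simp add: power_int_diff flip: power_int_of_nat)
    moreover have "q ^ nat (j - i) < 1" using that q_pos q_less_1 by (simp add: power_less_one_iff)
    moreover have "0 < q powi i" using q_pos by simp
    ultimately show ?thesis using mult_strict_left_mono[of "q ^ nat (j - i)" 1 "q powi i"] by simp
  qed
  then show ?thesis by (metis less_asym linorder_neqE)
qed

lemma ex_powi_between:
  assumes "0 < w"
  obtains k :: int where "1 < w * q powi k" "w * q powi k \<le> 1 / q"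
proof -
  define e where "e = - ln q"
  define k where "k = \<lceil>ln w / e\<rceil> - 1"
  have e0: "0 < e" unfolding e_def using q_pos q_less_1 by simp
  have "ln w / e > of_int k" "ln w / e \<le> of_int k + 1" unfolding k_def by linarith+
  then have l: "of_int k * e < ln w" "ln w \<le> (of_int k + 1) * e"
    using e0 by (simp_all add: pos_less_divide_eq pos_divide_le_eq)
  have e: "ln (w * q powi k) = ln w - of_int k * e"
  proof -
    have "q powi k = q powr of_int k" using q_pos by (simp add: powr_real_of_int')
    then show ?thesis using assms q_pos by (simp add: e_def ln_mult ln_powr)
  qed
  have p: "0 < w * q powi k" using assms q_pos by simp
  have "0 < ln (w * q powi k)" unfolding e using l by simp
  then have 1: "1 < w * q powi k" using p by simp
  have "ln (w * q powi k) \<le> ln (1 / q)" unfolding e using l q_pos by (simp add: e_def ln_div algebra_simps)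
  then have 2: "w * q powi k \<le> 1 / q" using p q_pos by (subst (asm) ln_le_cancel_iff) auto
  show ?thesis by (rule that[OF 1 2])
qed

lemma norm_powi: "norm (qc powi j) = q powi j"
  using q_pos by (simp add: norm_power_int)

context
  fixes y s0 :: real
  assumes y: "1 < \<bar>y\<bar>" "\<bar>y\<bar> \<le> 1 / q" and s0: "1 < s0" "s0 \<le> \<bar>y\<bar>" "q * \<bar>y\<bar> < 1 \<Longrightarrow> s0 \<le> 1 / (q * \<bar>y\<bar>)"
begin

lemma y_cases:
  obtains "q * \<bar>y\<bar> < 1" "s0 * (q * \<bar>y\<bar>) \<le> 1" | "\<bar>y\<bar> = 1 / q"
proof (cases "q * \<bar>y\<bar> < 1")
  case True
  then show ?thesis using that(1) s0(3)[OF True] y q_pos by (simp add: pos_le_divide_eq mult_pos_pos)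
next
  case False
  then have "\<bar>y\<bar> = 1 / q" using y(2) q_pos by (simp add: field_simps)
  then show ?thesis by (rule that(2))
qed

text \<open>The number y represents its lattice in 1 < |y| \<le> 1/q. All other points of y q^Z have
  modulus at most 1 or at least |y|/q, and the latter is at least s0/q.\<close>

lemma lattice_outer:
  fixes x :: complex
  assumes x: "1 < norm x" "norm x < s0 / q" and e: "x = complex_of_real y * qc powi j"
  shows "x = complex_of_real y"
proof -
  have n: "norm x = \<bar>y\<bar> * q powi j" unfolding e by (simp add: norm_mult norm_powi)
  have y0: "0 < \<bar>y\<bar>" using y by linarith
  have "s0 / q \<le> \<bar>y\<bar> / q" using s0(2) q_pos by (intro divide_right_mono) auto
  moreover have "\<bar>y\<bar> / q = \<bar>y\<bar> * q powi (- 1)" by (simp add: power_int_minus divide_inverse)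
  ultimately have "\<bar>y\<bar> * q powi j < \<bar>y\<bar> * q powi (- 1)" using x(2) unfolding n by linarith
  then have "q powi j < q powi (- 1)" by (simp only: mult_less_cancel_left_pos[OF y0])
  then have "- 1 < j" by (simp only: powi_less_iff)
  moreover have "q * \<bar>y\<bar> < \<bar>y\<bar> * q powi j" using x(1) y(2) q_pos unfolding n by (simp add: field_simps)
  then have "\<bar>y\<bar> * q powi 1 < \<bar>y\<bar> * q powi j" by (simp add: mult.commute)
  then have "q powi 1 < q powi j" by (simp only: mult_less_cancel_left_pos[OF y0])
  then have "j < 1" by (simp only: powi_less_iff)
  ultimately have "j = 0" by simp
  then show ?thesis using e by simp
qed

text \<open>The inverse lattice meets the annulus in 1/(qy) only, unless |y| = 1/q. In that case
  1/(qy) has modulus 1, and the next point 1/(q^2 y) coincides with y.\<close>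

lemma lattice_outer':
  fixes x :: complex
  assumes x: "1 < norm x" "norm x < s0 / q" and e: "x * complex_of_real y * qc powi j = 1"
  shows "x = 1 / (qc * complex_of_real y) \<or> x = complex_of_real y"
proof -
  have n: "norm x * (\<bar>y\<bar> * q powi j) = 1" using arg_cong[OF e, of norm] by (simp add: norm_mult norm_powi mult.assoc)
  have pp: "0 < q powi j" using q_pos by simp
  have "q powi j < q powi 0"
  proof -
    have "1 * (1 * q powi j) < norm x * (\<bar>y\<bar> * q powi j)"
      using x(1) y(1) pp by (intro mult_strict_mono mult_strict_right_mono) auto
    then show ?thesis unfolding n by simp
  qed
  then have j: "0 < j" by (simp only: powi_less_iff)
  have "norm x * (\<bar>y\<bar> * q powi j) < s0 / q * (\<bar>y\<bar> * q powi j)"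
    using x(2) y(1) pp by (intro mult_strict_right_mono) auto
  then have u: "1 < s0 / q * (\<bar>y\<bar> * q powi j)" unfolding n .
  show ?thesis
  proof (cases rule: y_cases)
    case 1
    have "s0 / q * (\<bar>y\<bar> * q powi j) = s0 * (q * \<bar>y\<bar>) * q powi (j - 2)"
      using q_pos by (simp add: power_int_diff power2_eq_square)
    also have "\<dots> \<le> 1 * q powi (j - 2)" using 1(2) q_pos by (intro mult_right_mono) auto
    finally have "q powi 0 < q powi (j - 2)" using u by simp
    then have "j = 1" using j by (simp only: powi_less_iff)
    then show ?thesis using e y q_pos by (auto simp: field_simps)
  next
    case 2
    have "s0 / q * (\<bar>y\<bar> * q powi j) \<le> \<bar>y\<bar> / q * (\<bar>y\<bar> * q powi j)"
      using s0(2) q_pos pp by (intro mult_right_mono divide_right_mono) auto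
    also have "\<dots> = q powi (j - 3)" unfolding 2 using q_pos by (simp add: power_int_diff power3_eq_cube)
    finally have "q powi 0 < q powi (j - 3)" using u by simp
    then have "j < 3" by (simp only: powi_less_iff)
    moreover have "j \<noteq> 1"
    proof
      assume "j = 1"
      then have "norm x = 1" using n q_pos unfolding 2 by simp
      then show False using x by simp
    qed
    ultimately have j2: "j = 2" using j by linarith
    have "y * y * (q * q) = 1" using 2 q_pos by (metis abs_mult_self_eq divide_self_if less_irrefl mult.commute mult.left_commute times_divide_eq_right mult_1_right)
    then have "complex_of_real (y * y * (q * q)) = 1" by simp
    then have yy: "complex_of_real y * complex_of_real y * (qc * qc) = 1" by simp
    have "x * complex_of_real y * (qc * qc) = 1" using e unfolding j2 by (simp add: power2_eq_square mult.assoc)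
    then have "x = complex_of_real y" using yy by algebra
    then show ?thesis ..
  qed
qed

text \<open>A lattice point this close to the unit circle exists only if |y| = 1/q. It is then q y,
  a real number of modulus 1.\<close>

lemma lattice_inner:
  fixes x :: complex
  assumes x: "1 / s0 < norm x" "norm x < s0" and e: "x = complex_of_real y * qc powi j"
  shows "x\<^sup>2 = 1"
proof -
  have n: "norm x = \<bar>y\<bar> * q powi j" unfolding e by (simp add: norm_mult norm_powi)
  have y0: "0 < \<bar>y\<bar>" using y by linarith
  have "\<bar>y\<bar> * q powi j < \<bar>y\<bar> * q powi 0" using x(2) s0(2) unfolding n by simp
  then have j: "0 < j" by (simp only: mult_less_cancel_left_pos[OF y0] powi_less_iff)
  have l: "1 < s0 * (\<bar>y\<bar> * q powi j)" using x(1) s0(1) unfolding n by (simp add: pos_divide_less_eq mult.commute)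
  show ?thesis
  proof (cases rule: y_cases)
    case 1
    have "s0 * (\<bar>y\<bar> * q powi j) = s0 * (q * \<bar>y\<bar>) * q powi (j - 1)"
      using q_pos by (simp add: power_int_diff)
    also have "\<dots> \<le> 1 * q powi (j - 1)" using 1(2) q_pos by (intro mult_right_mono) auto
    finally have "q powi 0 < q powi (j - 1)" using l by simp
    then have False using j by (simp only: powi_less_iff)
    then show ?thesis ..
  next
    case 2
    have "s0 * (\<bar>y\<bar> * q powi j) \<le> \<bar>y\<bar> * (\<bar>y\<bar> * q powi j)"
      using s0(2) q_pos by (intro mult_right_mono) auto
    also have "\<dots> = q powi (j - 2)" unfolding 2 using q_pos by (simp add: power_int_diff power2_eq_square)
    finally have "q powi 0 < q powi (j - 2)" using l by simp
    then have "j = 1" using j by (simp only: powi_less_iff)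
    then have "x = complex_of_real (y * q)" using e by simp
    moreover have "(y * q)\<^sup>2 = (\<bar>y\<bar> * q)\<^sup>2" by (simp add: power_mult_distrib)
    then have "(y * q)\<^sup>2 = 1" unfolding 2 using q_pos by simp
    ultimately show ?thesis by (metis of_real_1 of_real_power)
  qed
qed

lemma lattice_inner':
  fixes x :: complex
  assumes x: "1 / s0 < norm x" "norm x < s0" and e: "x * complex_of_real y * qc powi j = 1"
  shows "x\<^sup>2 = 1"
proof -
  have x0: "x \<noteq> 0" using e by auto
  have "(1 / x)\<^sup>2 = 1"
  proof (rule lattice_inner)
    show "1 / s0 < norm (1 / x)" "norm (1 / x) < s0"
      using x x0 s0(1) by (simp_all add: norm_divide field_simps)
    show "1 / x = complex_of_real y * qc powi j" using e x0 by (simp add: field_simps)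
  qed
  then show ?thesis by (simp add: power_divide)
qed

text \<open>Both points lie outside the unit circle unless |y| = 1/q, when only y does; they
  coincide if q y^2 = 1. In these two situations, and only there, y^2 lies in q^Z. The doubled
  residue thus makes up for the missing pole.\<close>

lemma card_eps:
  "of_nat (card {p \<in> {complex_of_real y, 1 / (qc * complex_of_real y)}. 1 < norm p}) * complex_of_real (eps y) = 2"
proof -
  have n: "norm (complex_of_real y) = \<bar>y\<bar>" "norm (1 / (qc * complex_of_real y)) = 1 / (q * \<bar>y\<bar>)"
    using q_pos by (simp_all add: norm_divide norm_mult)
  have eq: "complex_of_real y = 1 / (qc * complex_of_real y) \<longleftrightarrow> y\<^sup>2 = q powi (- 1)"
  proof -
    have "complex_of_real y = 1 / (qc * complex_of_real y) \<longleftrightarrow> complex_of_real y = complex_of_real (1 / (q * y))" by simp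
    also have "\<dots> \<longleftrightarrow> y = 1 / (q * y)" by (simp only: of_real_eq_iff)
    also have "\<dots> \<longleftrightarrow> y\<^sup>2 = q powi (- 1)"
      using y q_pos by (auto simp: power_int_minus field_simps power2_eq_square)
    finally show ?thesis .
  qed
  show ?thesis
  proof (cases rule: y_cases)
    case 2
    have "y\<^sup>2 = \<bar>y\<bar>\<^sup>2" by simp
    also have "\<dots> = q powi (- 2)" unfolding 2 by (simp add: power_int_minus power_divide divide_inverse power_inverse)
    finally have "eps y = 2" unfolding eps_def by auto
    moreover have "{p \<in> {complex_of_real y, 1 / (qc * complex_of_real y)}. 1 < norm p} = {complex_of_real y}"
      using n y 2 q_pos by auto
    ultimately show ?thesis by simp
  next
    case 1
    then have g: "1 < 1 / (q * \<bar>y\<bar>)" using y q_pos by (simp add: field_simps)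
    then have s: "{p \<in> {complex_of_real y, 1 / (qc * complex_of_real y)}. 1 < norm p} = {complex_of_real y, 1 / (qc * complex_of_real y)}"
      using n y by auto
    show ?thesis
    proof (cases "y\<^sup>2 = q powi (- 1)")
      case True
      then have "eps y = 2" unfolding eps_def by metis
      then show ?thesis unfolding s using True eq by (simp del: of_real_mult)
    next
      case False
      have "y\<^sup>2 \<noteq> q powi j" for j
      proof
        assume j: "y\<^sup>2 = q powi j"
        have "1 < \<bar>y\<bar> * \<bar>y\<bar>" by (rule less_1_mult[OF y(1) y(1)])
        then have "q powi 0 < q powi j" unfolding j[symmetric] by (simp add: power2_eq_square)
        then have "j < 0" by (simp only: powi_less_iff)
        have "\<bar>y\<bar> < 1 / q" using 1 q_pos by (simp add: field_simps)
        then have "\<bar>y\<bar> * \<bar>y\<bar> < (1 / q) * (1 / q)" using y q_pos by (intro mult_strict_mono) auto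
        then have "q powi j < q powi (- 2)" unfolding j[symmetric] by (simp add: power2_eq_square power_int_minus divide_inverse)
        then have "- 2 < j" by (simp only: powi_less_iff)
        with \<open>j < 0\<close> have "j = - 1" by simp
        then show False using False j by simp
      qed
      then have "eps y = 1" unfolding eps_def by auto
      then show ?thesis unfolding s using False eq by simp
    qed
  qed
qed

end

lemma theta_zero:
  assumes "theta y = 0"
  obtains j :: int where "y * qc powi j = 1"
proof -
  from assms consider n where "y * qc ^ n = 1" | n where "qc / y * qc ^ n = 1"
    unfolding theta_def by (auto simp: Q_eq_0_iff)
  then show ?thesis
  proof cases
    case 1
    then show ?thesis using that[of "int n"] by simp
  next
    case 2
    then have "y \<noteq> 0" by auto
    then have "y = qc ^ Suc n" using 2 by (simp add: field_simps)
    then have "y * qc powi (- int (Suc n)) = 1" using q0 by (simp add: power_int_minus del: power_Suc of_nat_Suc)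
    then show ?thesis by (rule that)
  qed
qed

end

text \<open>The numbers \<open>yp\<close> and \<open>ym\<close> represent the lattices of a and of d
  t in 1 < |x| \<le> 1/q. The margin s0 > 1 is so small that V is singular at most at 1 and -1 in
  1/s0 < |x| < s0, and H at most at the representatives and their mirror images in 1 < |x| < s0/q.
  The lattice of a matters for a \<ge> 1; the value a = 1 is included since the lattice then meets
  the unit circle.\<close>

locale awsetup = awpair +
  fixes yp ym s0 :: real and kp km :: int
  assumes ym: "ym = d * t * q powi km" "ym < - 1" "- ym \<le> 1 / q"
    and yp: "1 \<le> a \<Longrightarrow> yp = a * q powi kp" "1 \<le> a \<Longrightarrow> 1 < yp" "1 \<le> a \<Longrightarrow> yp \<le> 1 / q"
    and s0: "1 < s0" "s0 \<le> d / q" "s0 \<le> 1 / b" "s0 \<le> 1 / c" "s0 * s0 \<le> 1 / q" "a < 1 \<Longrightarrow> s0 \<le> 1 / a"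
    and s0p: "1 \<le> a \<Longrightarrow> s0 \<le> yp" "1 \<le> a \<Longrightarrow> q * yp < 1 \<Longrightarrow> s0 \<le> 1 / (q * yp)"
    and s0m: "s0 \<le> - ym" "q * (- ym) < 1 \<Longrightarrow> s0 \<le> 1 / (q * (- ym))"
begin

lemma Th_zero:
  assumes "Th x = 0" "x \<noteq> 0"
  obtains j where "x = complex_of_real ym * qc powi j" | j where "x * complex_of_real ym * qc powi j = 1"
proof -
  have yc: "complex_of_real ym = dc * tc * qc powi km" unfolding ym(1) by simp
  from assms(1) consider "theta (dc * tc * x) = 0" | "theta (dc * tc / x) = 0" unfolding Th_def by auto
  then show ?thesis
  proof cases
    case 1
    from theta_zero[OF this] obtain j where j: "dc * tc * x * qc powi j = 1" by blast
    have "x * complex_of_real ym * qc powi (j - km) = 1" unfolding yc using j nz by (simp add: power_int_diff mult_ac)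
    then show ?thesis by (rule that(2))
  next
    case 2
    from theta_zero[OF this] obtain j where j: "dc * tc / x * qc powi j = 1" by blast
    have "x = dc * tc * qc powi j" using j assms(2) by (simp add: field_simps)
    then have "x = complex_of_real ym * qc powi (j - km)" unfolding yc using nz by (simp add: power_int_diff)
    then show ?thesis by (rule that(1))
  qed
qed

lemma Q_a_zero:
  assumes "1 \<le> a"
  shows "Q (ac * qc ^ i * x) = 0 \<Longrightarrow> \<exists>j. x * complex_of_real yp * qc powi j = 1"
    "Q (ac / x) = 0 \<Longrightarrow> x \<noteq> 0 \<Longrightarrow> \<exists>j. x = complex_of_real yp * qc powi j"
proof -
  have yc: "complex_of_real yp = ac * qc powi kp" unfolding yp(1)[OF assms] by simp
  assume "Q (ac * qc ^ i * x) = 0"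
  then obtain n where n: "ac * qc ^ i * x * qc ^ n = 1" by (auto simp: Q_eq_0_iff)
  have "x * complex_of_real yp * qc powi (int i + int n - kp) = 1" unfolding yc using n nz by (simp add: power_int_diff power_int_add mult_ac)
  then show "\<exists>j. x * complex_of_real yp * qc powi j = 1" ..
next
  have yc: "complex_of_real yp = ac * qc powi kp" unfolding yp(1)[OF assms] by simp
  assume "Q (ac / x) = 0" "x \<noteq> 0"
  then obtain n where n: "ac / x * qc ^ n = 1" by (auto simp: Q_eq_0_iff)
  then have "x = ac * qc ^ n" using \<open>x \<noteq> 0\<close> by (simp add: field_simps)
  then have "x = complex_of_real yp * qc powi (int n - kp)" unfolding yc using nz by (simp add: power_int_diff)
  then show "\<exists>j. x = complex_of_real yp * qc powi j" ..
qed

lemma ym': "1 < \<bar>ym\<bar>" "\<bar>ym\<bar> \<le> 1 / q" "s0 \<le> \<bar>ym\<bar>" "q * \<bar>ym\<bar> < 1 \<Longrightarrow> s0 \<le> 1 / (q * \<bar>ym\<bar>)"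
  using ym s0m by auto

lemma yp': "1 \<le> a \<Longrightarrow> 1 < \<bar>yp\<bar>" "1 \<le> a \<Longrightarrow> \<bar>yp\<bar> \<le> 1 / q" "1 \<le> a \<Longrightarrow> s0 \<le> \<bar>yp\<bar>" "1 \<le> a \<Longrightarrow> q * \<bar>yp\<bar> < 1 \<Longrightarrow> s0 \<le> 1 / (q * \<bar>yp\<bar>)"
  using yp s0p by force+

lemma Q_nz_norm: "norm x < 1 / u \<Longrightarrow> 0 < u \<Longrightarrow> Q (complex_of_real u * x) \<noteq> 0"
  by (rule Q_nz) (simp add: norm_mult field_simps)

lemma Q_nz_norm':
  assumes "u < norm x" "0 < u"
  shows "Q (complex_of_real u / x) \<noteq> 0"
proof (rule Q_nz)
  have "0 < norm x" using assms by linarith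
  then show "norm (complex_of_real u / x) < 1" using assms by (simp add: norm_divide)
qed

lemma Om_den_nz:
  assumes x: "1 / s0 < norm x" "norm x < s0" "x\<^sup>2 \<noteq> 1"
  shows "Qd x * Dn x * Th x \<noteq> 0"
proof -
  have x0: "x \<noteq> 0" using x(1) s0(1) by auto
  have s: "1 / s0 < 1" using s0(1) by simp
  have inv: "u \<le> 1 / s0" if "s0 \<le> 1 / u" "0 < u" for u using that s0(1) by (simp add: field_simps)
  have 1: "Qd x \<noteq> 0"
  proof -
    have "q / d \<le> 1 / s0" by (rule inv) (use s0(2) q_pos d_pos in auto)
    then have "Q (complex_of_real (q / d) * x) \<noteq> 0" "Q (complex_of_real (q / d) / x) \<noteq> 0"
      using x s0(2) q_pos d_pos by (intro Q_nz_norm Q_nz_norm'; simp)+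
    then show ?thesis unfolding Qd_def by (simp add: mult_ac)
  qed
  have 2: "Q (bc * x) \<noteq> 0" "Q (bc / x) \<noteq> 0" "Q (cc * x) \<noteq> 0" "Q (cc / x) \<noteq> 0"
    using inv[OF s0(3)] inv[OF s0(4)] x s0 par' by (intro Q_nz_norm Q_nz_norm'; simp)+
  have 3: "Q (ac * x) \<noteq> 0" "Q (ac / x) \<noteq> 0"
  proof -
    have "Q (ac * x) \<noteq> 0 \<and> Q (ac / x) \<noteq> 0"
    proof (cases "1 \<le> a")
      case True
      then show ?thesis
        using lattice_inner[OF yp'(1)[OF True] yp'(2)[OF True] s0(1) yp'(3)[OF True] yp'(4)[OF True] x(1,2)]
          lattice_inner'[OF yp'(1)[OF True] yp'(2)[OF True] s0(1) yp'(3)[OF True] yp'(4)[OF True] x(1,2)]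
          Q_a_zero(1)[OF True, of 0 x] Q_a_zero(2)[OF True, of x] x(3) x0 by auto
    next
      case False
      then show ?thesis using inv[OF s0(6)] x s0 a_pos by (intro conjI Q_nz_norm Q_nz_norm') auto
    qed
    then show "Q (ac * x) \<noteq> 0" "Q (ac / x) \<noteq> 0" by auto
  qed
  have 4: "Th x \<noteq> 0"
  proof
    assume "Th x = 0"
    from Th_zero[OF this x0] have "(\<exists>j. x = complex_of_real ym * qc powi j) \<or> (\<exists>j. x * complex_of_real ym * qc powi j = 1)" by metis
    then show False using lattice_inner[OF ym'(1,2) s0(1) ym'(3,4) x(1,2)] lattice_inner'[OF ym'(1,2) s0(1) ym'(3,4) x(1,2)] x(3)
      by blast
  qed
  show ?thesis unfolding Dn_def using 1 2 3 4 by simp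
qed

abbreviation PP where "PP \<equiv> (if 1 \<le> a then {complex_of_real yp, 1 / (qc * complex_of_real yp)} else {})"
abbreviation PM where "PM \<equiv> {complex_of_real ym, 1 / (qc * complex_of_real ym)}"

lemma Bf_den_nz:
  assumes x: "1 < norm x" "norm x < s0 / q" "x \<notin> PP \<union> PM"
  shows "Q (qc\<^sup>2 * x / dc) * Q (qc / (dc * x)) * (Q (qc * ac * x) * Q (ac / x) * Q (qc * bc * x) * Q (bc / x) * Q (qc * cc * x) * Q (cc / x)) * Th x \<noteq> 0"
proof -
  have x0: "x \<noteq> 0" using x(1) by auto
  have up: "norm x < 1 / (q * u)" if "s0 \<le> 1 / u" "0 < u" for u
  proof -
    have "q * norm x * u < s0 * u" using x(2) q_pos that(2) by (intro mult_strict_right_mono) (simp_all add: field_simps)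
    moreover have "s0 * u \<le> 1" using that by (simp add: field_simps)
    ultimately have "norm x * (q * u) < 1" by (simp add: mult_ac)
    then show ?thesis using q_pos that(2) by (simp add: pos_less_divide_eq)
  qed
  have 1: "Q (qc\<^sup>2 * x / dc) \<noteq> 0" "Q (qc / (dc * x)) \<noteq> 0"
  proof -
    have "Q (complex_of_real (q * (q / d)) * x) \<noteq> 0"
      by (rule Q_nz_norm[OF up]) (use s0(2) q_pos d_pos in auto)
    then show "Q (qc\<^sup>2 * x / dc) \<noteq> 0" by (simp add: power2_eq_square mult_ac)
    have "Q (complex_of_real (q / d) / x) \<noteq> 0"
      by (rule Q_nz_norm') (use x(1) d_gt_q q_pos d_pos in \<open>auto intro: order.strict_trans[of _ 1]\<close>)
    then show "Q (qc / (dc * x)) \<noteq> 0" by simp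
  qed
  have 2: "Q (qc * bc * x) \<noteq> 0" "Q (bc / x) \<noteq> 0" "Q (qc * cc * x) \<noteq> 0" "Q (cc / x) \<noteq> 0"
    using Q_nz_norm[OF up[OF s0(3)]] Q_nz_norm[OF up[OF s0(4)]] Q_nz_norm'[of b x] Q_nz_norm'[of c x] x(1) bc_less_1 par' q_pos by auto
  have 3: "Q (qc * ac * x) \<noteq> 0 \<and> Q (ac / x) \<noteq> 0"
  proof (cases "1 \<le> a")
    case True
    then show ?thesis
      using lattice_outer[OF yp'(1)[OF True] yp'(2)[OF True] s0(1) yp'(3)[OF True] yp'(4)[OF True] x(1,2)]
        lattice_outer'[OF yp'(1)[OF True] yp'(2)[OF True] s0(1) yp'(3)[OF True] yp'(4)[OF True] x(1,2)]
        Q_a_zero(1)[OF True, of 1 x] Q_a_zero(2)[OF True, of x] x(3) x0 by (auto simp: mult.commute[of qc])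
  next
    case False
    then show ?thesis using Q_nz_norm[OF up[OF s0(6)]] Q_nz_norm'[of a x] x(1) a_pos q_pos by auto
  qed
  have 4: "Th x \<noteq> 0"
  proof
    assume "Th x = 0"
    from Th_zero[OF this x0] have "(\<exists>j. x = complex_of_real ym * qc powi j) \<or> (\<exists>j. x * complex_of_real ym * qc powi j = 1)" by metis
    then show False using lattice_outer[OF ym'(1,2) s0(1) ym'(3,4) x(1,2)] lattice_outer'[OF ym'(1,2) s0(1) ym'(3,4) x(1,2)] x(3)
      by blast
  qed
  show ?thesis using 1 2 3 4 by simp
qed

lemma theta_holomorphic: "f holomorphic_on S \<Longrightarrow> (\<And>x. x \<in> S \<Longrightarrow> f x \<noteq> 0) \<Longrightarrow> (\<lambda>x. theta (f x)) holomorphic_on S"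
  unfolding theta_def by (intro holomorphic_intros) auto

lemma V_holomorphic: "V holomorphic_on {z. 1 / s0 < norm z \<and> norm z < s0} - {1, - 1}"
proof -
  let ?S = "{z. 1 / s0 < norm z \<and> norm z < s0} - {1, - 1 :: complex}"
  have S: "x \<noteq> 0" "x\<^sup>2 \<noteq> 1" if "x \<in> ?S" for x
    using that s0(1) by (auto simp: power2_eq_1_iff)
  have den: "Qd x * Dn x * Th x \<noteq> 0" if "x \<in> ?S" for x
    using Om_den_nz[of x] S[OF that] that by auto
  show ?thesis
    unfolding V_def[abs_def] Om_def[abs_def]
  proof (intro holomorphic_intros)
    show "Qd holomorphic_on ?S" "Dn holomorphic_on ?S" unfolding Qd_def[abs_def] Dn_def[abs_def]
      by (intro holomorphic_intros; use S nz in auto)+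
    show "Th holomorphic_on ?S" unfolding Th_def[abs_def]
      by (intro holomorphic_intros theta_holomorphic; use S nz in auto)
  qed (use S den in auto)
qed

lemma H_holomorphic: "H holomorphic_on {z. 1 < norm z \<and> norm z < s0 / q} - (PP \<union> PM)"
proof -
  let ?S = "{z. 1 < norm z \<and> norm z < s0 / q} - (PP \<union> PM)"
  have S: "x \<noteq> 0" if "x \<in> ?S" for x using that by auto
  have den: "Q (qc\<^sup>2 * x / dc) * Q (qc / (dc * x)) * (Q (qc * ac * x) * Q (ac / x) * Q (qc * bc * x) * Q (bc / x) * Q (qc * cc * x) * Q (cc / x)) * Th x \<noteq> 0"
    if "x \<in> ?S" for x using Bf_den_nz[of x] that by auto
  have Th: "Th holomorphic_on ?S" unfolding Th_def[abs_def]
    by (intro holomorphic_intros theta_holomorphic; use S nz in auto)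
  have "Bf holomorphic_on ?S" unfolding Bf_def[abs_def]
    by (intro holomorphic_intros Th) (use S den nz in auto)
  moreover have "om holomorphic_on ?S" unfolding om_def[abs_def]
    by (intro holomorphic_intros) (use S nz in auto)
  ultimately show ?thesis unfolding H_def[abs_def] by (rule holomorphic_on_mult)
qed

end



section \<open>Residues of H and the contour identity\<close>

lemma (in awq) pair_bounds:
  fixes y s0 :: real
  assumes y: "1 < \<bar>y\<bar>" "\<bar>y\<bar> \<le> 1 / q" and s0: "s0 \<le> \<bar>y\<bar>" "q * \<bar>y\<bar> < 1 \<Longrightarrow> s0 \<le> 1 / (q * \<bar>y\<bar>)"
    and p: "p \<in> {complex_of_real y, 1 / (qc * complex_of_real y)}" "1 < norm p"
  shows "s0 \<le> norm p" "norm p \<le> 1 / q"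
proof -
  have n: "norm (1 / (qc * complex_of_real y)) = 1 / (q * \<bar>y\<bar>)" using q_pos by (simp add: norm_divide norm_mult)
  have qy: "0 < q * \<bar>y\<bar>" "q \<le> q * \<bar>y\<bar>" using y q_pos by auto
  have "1 / (q * \<bar>y\<bar>) \<le> 1 / q" using qy q_pos by (intro divide_left_mono) auto
  moreover have "1 < 1 / (q * \<bar>y\<bar>) \<Longrightarrow> q * \<bar>y\<bar> < 1" using qy by (simp add: less_divide_eq_1_pos)
  ultimately show "s0 \<le> norm p" "norm p \<le> 1 / q" using p y s0 n by auto
qed

context awpair
begin

text \<open>Equals a1 x * om x by \<open>om_eq\<close>, but stays regular at q x^2 = 1. There
  \<open>a1\<close> has a pole, and such a point may belong to a lattice.\<close>

definition D0 :: "complex \<Rightarrow> complex" where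
  "D0 x = del * (F x * G x) + a1 (1 / x) * om (x / qc)"

lemma om_tendsto: "(h \<longlongrightarrow> l) T \<Longrightarrow> l \<noteq> 0 \<Longrightarrow> ((\<lambda>x. om (h x)) \<longlongrightarrow> om l) T"
  unfolding om_def by (intro tendsto_intros) (use nz in auto)

lemma H_residue:
  assumes L: "((\<lambda>x. (x - y) / x * Om x) \<longlongrightarrow> R) (at y)" and y: "y \<noteq> 0" "(1 / y)\<^sup>2 \<noteq> 1" "qc * (1 / y)\<^sup>2 \<noteq> 1"
  shows "((\<lambda>x. (x - y) / x * H x) \<longlongrightarrow> R * D0 y) (at y)"
proof -
  have i: "((\<lambda>x. 1 / x) \<longlongrightarrow> 1 / y) (at y)" "((\<lambda>x. x / qc) \<longlongrightarrow> y / qc) (at y)" by (intro tendsto_intros y nz)+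
  have "((\<lambda>x. (x - y) / x * Om x * D0 x) \<longlongrightarrow> R * D0 y) (at y)"
    unfolding D0_def using y nz by (intro tendsto_mult[OF L] tendsto_intros a1_tendsto[OF y(2,3) i(1)] om_tendsto[OF i(2)]) auto
  moreover have "eventually (\<lambda>x. (x - y) / x * Om x * D0 x = (x - y) / x * H x) (at y)"
    using ev_generic[OF y(1)]
  proof eventually_elim
    case (elim x)
    have "D0 x = a1 x * om x" unfolding D0_def using om_eq[of x] elim by (simp add: algebra_simps)
    moreover have "Om x * a1 x = Bf x" by (rule Om_a1) (use elim in auto)
    ultimately show ?case unfolding H_def by (simp add: mult.assoc)
  qed
  ultimately show ?thesis by (rule Lim_transform_eventually)
qed

text \<open>The relation of \<open>rho_step\<close> for two limits already known to exist,
  multiplied out so that a zero of \<open>a1\<close> does no harm.\<close>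

lemma rho_rel:
  assumes L: "((\<lambda>x. (x - p) / x * Om x) \<longlongrightarrow> R) (at p)" and L': "((\<lambda>x. (x - qc * p) / x * Om x) \<longlongrightarrow> R') (at (qc * p))"
    and p: "p \<noteq> 0" "p\<^sup>2 \<noteq> 1" "qc * p\<^sup>2 \<noteq> 1" "qc\<^sup>2 * p\<^sup>2 \<noteq> 1"
  shows "R' * a1 (1 / (qc * p)) = R * a1 p"
proof -
  have qp: "qc * p \<noteq> 0" using p nz by simp
  have "filterlim (\<lambda>x. x / qc) (at p) (at (qc * p))"
    by (rule filterlim_atI) (use nz in \<open>auto intro!: tendsto_eq_intros simp: eventually_at_filter field_simps\<close>)
  from filterlim_compose[OF rho_Bf[OF L p(1-3)] this]
  have 1: "((\<lambda>x. (x / qc - p) / (x / qc) * Bf (x / qc)) \<longlongrightarrow> R * a1 p) (at (qc * p))" .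
  have 2: "((\<lambda>x. a1 (1 / x)) \<longlongrightarrow> a1 (1 / (qc * p))) (at (qc * p))"
    by (rule a1_tendsto) (use p nz qp in \<open>auto intro!: tendsto_intros simp: power_divide power_mult_distrib field_simps power2_eq_square\<close>)
  have "eventually (\<lambda>x. (x - qc * p) / x * Om x * a1 (1 / x) = (x / qc - p) / (x / qc) * Bf (x / qc)) (at (qc * p))"
    using ev_generic[OF qp]
  proof eventually_elim
    case (elim x)
    have "x / qc - p = (x - qc * p) / qc" using nz by (simp add: diff_divide_distrib)
    then have "(x / qc - p) / (x / qc) = (x - qc * p) / x" using nz by simp
    then show ?case using Om_a1'[of x] elim by (simp add: mult.assoc)
  qed
  from Lim_transform_eventually[OF tendsto_mult[OF L' 2] this] 1 show ?thesis
    by (rule tendsto_unique[rotated]) simp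
qed

text \<open>The identity H(x) - H(x/q) = del V(x) on the level of residues: the contribution of the
  point q p is the difference of two consecutive values of R * D0.\<close>

lemma telescope_step:
  assumes L: "((\<lambda>x. (x - p) / x * Om x) \<longlongrightarrow> R) (at p)" and L': "((\<lambda>x. (x - qc * p) / x * Om x) \<longlongrightarrow> R') (at (qc * p))"
    and p: "p = complex_of_real y" "1 < \<bar>q * y\<bar>"
  shows "R' * D0 (qc * p) = R' * (del * (F (qc * p) * G (qc * p))) + R * D0 p"
proof -
  have "\<bar>y\<bar> > \<bar>q * y\<bar>" using p(2) q_pos q_less_1 by (simp add: abs_mult) (metis abs_ge_zero less_le_trans less_numeral_extra(1) mult.commute mult_less_cancel_left2 mult_zero_right not_le zero_le_one)
  then have y1: "1 < \<bar>y\<bar>" using p(2) by linarith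
  have y2: "1 < y\<^sup>2" "1 < q * y\<^sup>2" "1 < q\<^sup>2 * y\<^sup>2"
  proof -
    show "1 < y\<^sup>2" using one_less_power[OF y1, of 2] by simp
    show "1 < q\<^sup>2 * y\<^sup>2" using one_less_power[OF p(2), of 2] by (simp add: power_mult_distrib)
    have "1 < \<bar>q * y\<bar> * \<bar>y\<bar>" by (rule less_1_mult[OF p(2) y1])
    also have "\<dots> = q * y\<^sup>2" using q_pos by (simp add: abs_mult power2_eq_square)
    finally show "1 < q * y\<^sup>2" .
  qed
  have "p \<noteq> 0" using y1 p by auto
  have "complex_of_real (y\<^sup>2) \<noteq> complex_of_real 1" "complex_of_real (q * y\<^sup>2) \<noteq> complex_of_real 1" "complex_of_real (q\<^sup>2 * y\<^sup>2) \<noteq> complex_of_real 1" "complex_of_real (y\<^sup>2) \<noteq> complex_of_real q"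
    unfolding of_real_eq_iff using y2 q_less_1 by linarith+
  then have c: "p\<^sup>2 \<noteq> 1" "qc * p\<^sup>2 \<noteq> 1" "qc\<^sup>2 * p\<^sup>2 \<noteq> 1" "p\<^sup>2 \<noteq> qc" unfolding p by simp_all
  have D: "D0 p = a1 p * om p" unfolding D0_def using om_eq[OF \<open>p \<noteq> 0\<close> c(1,2,4)] by (simp add: algebra_simps)
  have "qc * p / qc = p" using nz by simp
  then show ?thesis using rho_rel[OF L L' \<open>p \<noteq> 0\<close> c(1-3)] unfolding D0_def[of "qc * p"] D by (simp add: distrib_left)
qed

lemma Q_neg_real: "r < 0 \<Longrightarrow> Q (complex_of_real r) \<noteq> 0" by (rule Q_nz_real) simp

lemma Th_1: "Th 1 \<noteq> 0"
proof -
  have "theta (complex_of_real (d * t)) \<noteq> 0" by (rule theta_neg) (rule d_neg)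
  then show ?thesis unfolding Th_def by simp
qed

lemma theta_tendsto [tendsto_intros]: "(h \<longlongrightarrow> l) T \<Longrightarrow> l \<noteq> 0 \<Longrightarrow> ((\<lambda>x. theta (h x)) \<longlongrightarrow> theta l) T"
  unfolding theta_def by (intro tendsto_intros)

lemma Th_tendsto: "l \<noteq> 0 \<Longrightarrow> (Th \<longlongrightarrow> Th l) (at l)"
  unfolding Th_def by (intro tendsto_intros) (use nz in auto)

lemma Q_at_1: "Q (qc / dc) \<noteq> 0" "Q (qc * qc / dc) \<noteq> 0" "Q qc \<noteq> 0" "Q bc \<noteq> 0" "Q cc \<noteq> 0" "Q (qc * bc) \<noteq> 0" "Q (qc * cc) \<noteq> 0"
proof -
  have "q / d < 1" using d_gt_q d_pos by simp
  moreover have "q * q / d < 1" using \<open>q / d < 1\<close> mult_strict_mono[of q 1 "q / d" 1] q_pos q_less_1 d_pos by simp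
  moreover have "q * b < 1" "q * c < 1" using bc_less_1 par' q_pos q_less_1 mult_strict_mono[of q 1 b 1] mult_strict_mono[of q 1 c 1] by simp_all
  ultimately have r: "q / d < 1" "q * q / d < 1" "q < 1" "b < 1" "c < 1" "q * b < 1" "q * c < 1" using q_less_1 bc_less_1 by auto
  show "Q (qc / dc) \<noteq> 0" "Q (qc * qc / dc) \<noteq> 0" "Q qc \<noteq> 0" "Q bc \<noteq> 0" "Q cc \<noteq> 0" "Q (qc * bc) \<noteq> 0" "Q (qc * cc) \<noteq> 0"
    using r[THEN Q_nz_real] by simp_all
qed

text \<open>The double zero of the numerator of \<open>Om\<close> faces at most two simple zeros: at
  x = 1 those of (ax, a/x; q)_infinity, at x = -1 one from each of the two theta functions.\<close>

lemma V_lim: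
  assumes p: "p = 1 \<or> p = - 1"
  shows "((\<lambda>x. (x - p) * V x) \<longlongrightarrow> 0) (at p)"
proof -
  have p0: "p \<noteq> 0" "p\<^sup>2 = 1" using p by auto
  have goal: "((\<lambda>x. (x - p) * V x) \<longlongrightarrow> 0) (at p)"
    if D: "((\<lambda>x. (x - p) / D1 x) \<longlongrightarrow> L1) (at p)" "((\<lambda>x. (x - p) / D2 x) \<longlongrightarrow> L2) (at p)" "(D3 \<longlongrightarrow> l) (at p)" "l \<noteq> 0"
      and e: "\<And>x. Qd x * Dn x * Th x = D1 x * D2 x * D3 x" for D1 D2 D3 L1 L2 l
  proof -
    have "((\<lambda>x. (x - p) * Om x * (F x * G x)) \<longlongrightarrow> 0 * (F p * G p)) (at p)"
      unfolding Om_def e by (intro tendsto_mult double_zero_vanish[OF p0(2) D] tendsto_intros p0(1))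
    then show ?thesis unfolding V_def by (simp add: mult.assoc)
  qed
  show ?thesis
  proof (cases "p = 1")
    case True
    obtain L1 where L1: "((\<lambda>x. (x - p) / Q (ac * x)) \<longlongrightarrow> L1) (at p)" using Q_simple_zero[OF nz(1) p0(1)] by blast
    obtain L2 where L2: "((\<lambda>x. (x - p) / Q (ac / x)) \<longlongrightarrow> L2) (at p)" using Q_simple_zero'[OF nz(1) p0(1)] by blast
    define D3 where "D3 = (\<lambda>x. Q (qc * x / dc) * Q (qc / (dc * x)) * (Q (bc * x) * Q (bc / x) * Q (cc * x) * Q (cc / x)) * Th x)"
    have l: "(D3 \<longlongrightarrow> D3 1) (at p)" unfolding D3_def True by (intro tendsto_mult Th_tendsto tendsto_intros) (use nz in auto)
    have l0: "D3 1 \<noteq> 0" unfolding D3_def using Q_at_1 Th_1 by simp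
    show ?thesis
      by (rule goal[OF L1 L2 l l0]) (simp add: D3_def Qd_def Dn_def mult_ac)
  next
    case False
    then have pm: "p = - 1" using p by simp
    define w where "w = - (d * t)"
    have w: "0 < w" "complex_of_real w = - (dc * tc)" using d_neg by (simp_all add: w_def)
    define N where "N = (\<lambda>x. Q (qc * x / dc) * Q (qc / (dc * x)) * (Q (ac * x) * Q (ac / x) * Q (bc * x) * Q (bc / x) * Q (cc * x) * Q (cc / x)))"
    have lN: "(N \<longlongrightarrow> N (- 1)) (at p)" unfolding N_def pm by (intro tendsto_intros) (use nz in auto)
    have neg: "- (q / d) < 0" "- a < 0" "- b < 0" "- c < 0" using q_pos d_pos a_pos par' by auto
    have N0: "N (- 1) \<noteq> 0" unfolding N_def using neg[THEN Q_neg_real] by simp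
    have dt: "dc * tc \<noteq> 0" using nz by simp
    have th: "Th x = Q (dc * tc * x) * Q (dc * tc / x) * (Q ((qc / (dc * tc)) / x) * Q ((qc / (dc * tc)) * x))" for x
      unfolding Th_def theta_def using nz by (simp add: mult_ac)
    \<comment> \<open>At x = -1 each theta function is (w, q/w; q)_infinity with w > 0. The first
      factor can vanish only for w \<ge> 1, the second only for w \<le> q, so never both.\<close>
    show ?thesis
    proof (cases "1 \<le> w")
      case True
      have "q / w < 1" using True q_pos q_less_1 by simp
      then have "Q (- (qc / (dc * tc))) \<noteq> 0" using Q_nz_real[of "q / w"] w by simp
      then have z: "Q ((qc / (dc * tc)) / - 1) * Q ((qc / (dc * tc)) * - 1) \<noteq> 0" by simp
      obtain L1 where L1: "((\<lambda>x. (x - p) / Q (dc * tc * x)) \<longlongrightarrow> L1) (at p)" using Q_simple_zero[OF dt p0(1)] by blast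
      obtain L2 where L2: "((\<lambda>x. (x - p) / Q (dc * tc / x)) \<longlongrightarrow> L2) (at p)" using Q_simple_zero'[OF dt p0(1)] by blast
      have l: "((\<lambda>x. N x * (Q ((qc / (dc * tc)) / x) * Q ((qc / (dc * tc)) * x))) \<longlongrightarrow> N (- 1) * (Q ((qc / (dc * tc)) / - 1) * Q ((qc / (dc * tc)) * - 1))) (at p)"
        unfolding pm by (intro tendsto_mult lN[unfolded pm] tendsto_intros) auto
      have l0: "N (- 1) * (Q ((qc / (dc * tc)) / - 1) * Q ((qc / (dc * tc)) * - 1)) \<noteq> 0" using N0 z by (rule no_zero_divisors)
      show ?thesis
        by (rule goal[OF L1 L2 l l0]) (simp add: th Qd_def Dn_def N_def mult_ac)
    next
      case False
      then have "Q (- (dc * tc)) \<noteq> 0" using Q_nz_real[of w] w by simp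
      then have z: "Q (dc * tc * - 1) * Q (dc * tc / - 1) \<noteq> 0" by simp
      have dt': "qc / (dc * tc) \<noteq> 0" using nz by simp
      obtain L1 where L1: "((\<lambda>x. (x - p) / Q (qc / (dc * tc) * x)) \<longlongrightarrow> L1) (at p)" using Q_simple_zero[OF dt' p0(1)] by blast
      obtain L2 where L2: "((\<lambda>x. (x - p) / Q (qc / (dc * tc) / x)) \<longlongrightarrow> L2) (at p)" using Q_simple_zero'[OF dt' p0(1)] by blast
      have l: "((\<lambda>x. N x * (Q (dc * tc * x) * Q (dc * tc / x))) \<longlongrightarrow> N (- 1) * (Q (dc * tc * - 1) * Q (dc * tc / - 1))) (at p)"
        unfolding pm by (intro tendsto_mult lN[unfolded pm] tendsto_intros) auto
      have l0: "N (- 1) * (Q (dc * tc * - 1) * Q (dc * tc / - 1)) \<noteq> 0" using N0 z by (rule no_zero_divisors)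
      show ?thesis
        by (rule goal[OF L1 L2 l l0]) (simp add: th Qd_def Dn_def N_def mult_ac)
    qed
  qed
qed

text \<open>For a = 1 there are no masses at a q^k, yet the representative 1/q is a possible pole of
  H. Its mirror image is x = 1, where the zero of \<open>Q (1 / x^2)\<close> compensates that of
  \<open>Q (a / x)\<close>.\<close>

lemma H_residue_a1:
  assumes a: "a = 1"
  shows "((\<lambda>x. (x - 1 / qc) / x * H x) \<longlongrightarrow> 0) (at (1 / qc))"
proof -
  obtain L where L: "((\<lambda>x. (x - 1) / Q (ac / x)) \<longlongrightarrow> L) (at 1)" using Q_simple_zero'[OF nz(1), of 1] by auto
  define N where "N = (\<lambda>x. - (dc * x) * Q (qc\<^sup>2 * x\<^sup>2) / (Q (qc\<^sup>2 * x / dc) * Q (qc / (dc * x)) * (Q (qc * ac * x) * Q (qc * bc * x) * Q (bc / x) * Q (qc * cc * x) * Q (cc / x)) * Th x) / x)"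
  have "(N \<longlongrightarrow> N 1) (at 1)" unfolding N_def
    by (intro tendsto_divide tendsto_mult Th_tendsto tendsto_intros) (use nz Q_at_1 Th_1 a in \<open>auto simp: power2_eq_square\<close>)
  then have "((\<lambda>x. (x - 1) / Q (ac / x) * Q (1 / x\<^sup>2) * N x * om x) \<longlongrightarrow> L * Q (1 / 1\<^sup>2) * N 1 * om 1) (at 1)"
    by (intro tendsto_mult L om_tendsto tendsto_intros) auto
  moreover have "(x - 1) / Q (ac / x) * Q (1 / x\<^sup>2) * N x * om x = (x - 1) / x * H x" for x
    unfolding N_def H_def Bf_def by (simp only: divide_inverse inverse_mult_distrib mult_ac)
  ultimately have "((\<lambda>x. (x - 1) / x * H x) \<longlongrightarrow> 0) (at 1)" by simp
  from H_residue_inverse[OF this] show ?thesis by simp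
qed

end

context awsetup
begin

text \<open>Every pole of H with 1 < |p| \<le> 1/q has modulus at least s0 and therefore lies in r0
  < |x| < r0/q. Poles on the unit circle, such as 1/(qy) for |y| = 1/q, stay outside this
  annulus.\<close>

definition r0 where "r0 = (1 + s0) / 2"

lemma r0: "1 < r0" "r0 < s0" using s0(1) by (simp_all add: r0_def)

lemma V_extension:
  obtains g where "g holomorphic_on {z. 1 / s0 < norm z \<and> norm z < s0}" "\<forall>z. 1 / s0 < norm z \<longrightarrow> norm z < s0 \<longrightarrow> z\<^sup>2 \<noteq> 1 \<longrightarrow> g z = V z"
proof -
  let ?S = "{z :: complex. 1 / s0 < norm z \<and> norm z < s0}"
  have "?S = ball 0 s0 - cball 0 (1 / s0)" by auto
  then have S: "open ?S" by (simp add: open_Diff)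
  have "\<exists>g. g holomorphic_on ?S \<and> (\<forall>z\<in>?S - {1, - 1}. g z = V z)"
    by (rule removable_finite[OF _ S V_holomorphic]) (use V_lim in auto)
  then obtain g where g: "g holomorphic_on ?S" "\<And>z. z \<in> ?S - {1, - 1} \<Longrightarrow> g z = V z" by blast
  show ?thesis by (rule that[OF g(1)]) (use g(2) in \<open>auto simp: power2_eq_1_iff\<close>)
qed

lemma circle_V: "circle_int V 1 = circle_int V r0"
proof -
  obtain g where g: "g holomorphic_on {z. 1 / s0 < norm z \<and> norm z < s0}" "\<And>z. 1 / s0 < norm z \<Longrightarrow> norm z < s0 \<Longrightarrow> z\<^sup>2 \<noteq> 1 \<Longrightarrow> g z = V z"
    using V_extension by blast
  have s1: "1 / s0 < 1" using s0(1) by simp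
  have "circle_int g r0 = circle_int g 1"
    using annulus_residues[of g "1 / s0" s0 "{}" 1 r0 "\<lambda>_. 0"] g(1) r0 s1 s0(1) by simp
  moreover have "circle_int V r0 = circle_int g r0"
  proof (rule circle_int_cong)
    fix z :: complex assume z: "norm z = r0"
    have "z\<^sup>2 \<noteq> 1"
    proof
      assume "z\<^sup>2 = 1"
      then have "z = 1 \<or> z = - 1" by (simp add: power2_eq_1_iff)
      then show False using z r0 by auto
    qed
    then show "V z = g z" using g(2)[of z] z r0 s1 by simp
  qed (use r0 in simp)
  moreover have "circle_int V 1 = circle_int g 1"
    unfolding circle_int_def
  proof (rule integral_spike[where S = "range (\<lambda>i :: int. of_int i * pi)"])
    show "negligible (range (\<lambda>i :: int. of_int i * pi))" 
    proof -
      have "negligible (\<Union> (range (\<lambda>i :: int. {of_int i * pi})))" by (rule negligible_countable_Union) auto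
      moreover have "\<Union> (range (\<lambda>i :: int. {of_int i * pi})) = range (\<lambda>i :: int. of_int i * pi)" by auto
      ultimately show ?thesis by simp
    qed
    fix s assume s: "s \<in> {0..2 * pi} - range (\<lambda>i :: int. of_int i * pi)"
    have "(cis s)\<^sup>2 \<noteq> 1"
    proof
      assume "(cis s)\<^sup>2 = 1"
      then have "cis s = 1 \<or> cis s = - 1" by (simp add: power2_eq_1_iff)
      then have "sin s = 0" by (auto simp: complex_eq_iff)
      then show False using s unfolding sin_zero_iff_int2 by auto
    qed
    then show "g (complex_of_real 1 * cis s) = V (complex_of_real 1 * cis s)" using g(2)[of "cis s"] s0(1) by simp
  qed
  ultimately show ?thesis by simp
qed

text \<open>The bounds imposed on s0 exclude every exceptional value of \<open>H_diff\<close> on the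
  circle. The delicate one is x = a for a \<ge> 1: a point of that lattice with modulus r0 would
  have to be \<open>yp\<close>, whose modulus is at least s0.\<close>

lemma H_diff_circle:
  assumes x: "norm x = r0"
  shows "H x - H (x / qc) = del * V x"
proof -
  have r: "1 < norm x" "norm x < s0" using r0 x by auto
  have x0: "x \<noteq> 0" using r by auto
  have ne: "z \<noteq> w" if "norm z \<noteq> norm w" for z w :: complex using that by auto
  have sq: "1 < norm (x\<^sup>2)" "q * norm (x\<^sup>2) < 1"
  proof -
    show "1 < norm (x\<^sup>2)" using one_less_power[OF r(1), of 2] by (simp add: norm_power)
    have "norm x * norm x < s0 * s0" using r by (intro mult_strict_mono) auto
    then have "norm x * norm x < 1 / q" using s0(5) by linarith
    then show "q * norm (x\<^sup>2) < 1" using q_pos by (simp add: norm_power norm_mult power2_eq_square field_simps)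
  qed
  have ub: "u * norm x < 1" if "s0 \<le> 1 / u" "0 < u" for u
    using that r(2) mult_strict_left_mono[of "norm x" "1 / u" u] by simp
  have ax: "a * norm x \<noteq> 1" "a \<noteq> norm x"
  proof -
    have "a * norm x \<noteq> 1 \<and> a \<noteq> norm x"
    proof (cases "1 \<le> a")
      case True
      have "1 < a * norm x" using r(1) True mult_mono[of 1 a "norm x" "norm x"] by simp
      moreover have "a \<noteq> norm x"
      proof
        assume an: "a = norm x"
        have "s0 < s0 / q" using s0(1) q_pos q_less_1 by (simp add: field_simps)
        then have "ac = complex_of_real yp"
          by (intro lattice_outer[OF yp'(1)[OF True] yp'(2)[OF True] s0(1) yp'(3)[OF True] yp'(4)[OF True], where j = "- kp"])
             (use an r a_pos yp(1)[OF True] q_pos in \<open>auto simp: power_int_minus\<close>)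
        then have "a = yp" by simp
        then show False using s0p(1)[OF True] r an by simp
      qed
      ultimately show ?thesis by simp
    next
      case False
      then show ?thesis using ub[OF s0(6)] r a_pos by auto
    qed
    then show "a * norm x \<noteq> 1" "a \<noteq> norm x" by auto
  qed
  have dx: "q * norm x < d" using r(2) s0(2) q_pos by (simp add: pos_le_divide_eq) (smt (verit) mult.commute mult_strict_left_mono)
  have dx': "q < d * norm x" using d_gt_q mult_strict_left_mono[OF r(1) d_pos] by simp
  show ?thesis
    by (rule H_diff; (rule x0 | rule ne); use sq ub[OF s0(3)] ub[OF s0(4)] ax dx dx' r bc_less_1 par' a_pos d_pos q_pos q_less_1 in \<open>auto simp: norm_mult\<close>)
qed

lemma sum_two_families:
  assumes "finite A" "finite B" "A \<inter> B = {}"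
  shows "(\<Sum>p\<in>A \<union> B. if p \<in> A then x else (y :: complex)) = of_nat (card A) * x + of_nat (card B) * y"
proof -
  have "(\<Sum>p\<in>B. if p \<in> A then x else y) = (\<Sum>p\<in>B. y)" by (rule sum.cong) (use assms(3) in auto)
  then show ?thesis using assms by (simp add: sum.union_disjoint)
qed

text \<open>Mirror poles have equal residues by \<open>H_residue_inverse\<close>, so each lattice
  contributes one residue times the number of its poles outside the unit circle. The poles of the
  two lattices are separated by the sign of their real part.\<close>

lemma contour_identity:
  assumes RP: "1 \<le> a \<Longrightarrow> ((\<lambda>x. (x - complex_of_real yp) / x * H x) \<longlongrightarrow> RP) (at (complex_of_real yp))"
    and RM: "((\<lambda>x. (x - complex_of_real ym) / x * H x) \<longlongrightarrow> RM) (at (complex_of_real ym))"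
  shows "del * circle_int V 1 = - (2 * complex_of_real pi * (of_nat (card {p \<in> PP. 1 < norm p}) * RP + of_nat (card {p \<in> PM. 1 < norm p}) * RM))"
proof -
  define A where "A = {p \<in> PP. 1 < norm p}"
  define B where "B = {p \<in> PM. 1 < norm p}"
  have fin: "finite A" "finite B" unfolding A_def B_def by auto
  have disj: "A \<inter> B = {}"
  proof -
    have "0 < Re p" if "p \<in> PP" for p
    proof -
      have a: "1 \<le> a" using that by (simp split: if_splits)
      have "1 / (qc * complex_of_real yp) = complex_of_real (1 / (q * yp))" by simp
      moreover have "0 < 1 / (q * yp)" "0 < yp" using yp(2)[OF a] q_pos by auto
      moreover have "p = complex_of_real yp \<or> p = 1 / (qc * complex_of_real yp)" using that a by simp
      ultimately show ?thesis by (metis Re_complex_of_real)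
    qed
    moreover have "Re p < 0" if "p \<in> PM" for p
    proof -
      have "1 / (qc * complex_of_real ym) = complex_of_real (1 / (q * ym))" by simp
      moreover have "1 / (q * ym) < 0" "ym < 0" using ym(2) q_pos by (auto simp: divide_pos_neg mult_pos_neg)
      moreover have "p = complex_of_real ym \<or> p = 1 / (qc * complex_of_real ym)" using that by simp
      ultimately show ?thesis by (metis Re_complex_of_real)
    qed
    ultimately show ?thesis unfolding A_def B_def by fastforce
  qed
  have bd: "r0 < norm p \<and> norm p < r0 / q" if "p \<in> A \<union> B" for p
  proof -
    have "s0 \<le> norm p \<and> norm p \<le> 1 / q"
    proof (cases "p \<in> A")
      case True
      then have a: "1 \<le> a" and p: "p \<in> {complex_of_real yp, 1 / (qc * complex_of_real yp)}" "1 < norm p" unfolding A_def by (auto split: if_splits)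
      show ?thesis using pair_bounds[OF yp'(1)[OF a] yp'(2)[OF a] yp'(3)[OF a] yp'(4)[OF a] p] by blast
    next
      case False
      then have p: "p \<in> PM" "1 < norm p" using that unfolding B_def by auto
      show ?thesis using pair_bounds[OF ym' p] by blast
    qed
    moreover have "1 / q < r0 / q" using r0 q_pos by (simp add: divide_strict_right_mono)
    ultimately show ?thesis using r0 by linarith
  qed
  have off: "z \<notin> PP \<union> PM" if "norm z = r0 \<or> norm z = r0 / q" for z
  proof
    assume z: "z \<in> PP \<union> PM"
    have "1 < r0 / q" using r0 q_pos q_less_1 by (simp add: field_simps)
    then have "1 < norm z" using that r0 by auto
    then have "z \<in> A \<union> B" using z unfolding A_def B_def by auto
    from bd[OF this] show False using that by auto
  qed
  have rq: "1 < r0 / q" "r0 / q < s0 / q" "r0 \<le> r0 / q" "r0 < s0 / q"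
  proof -
    show "1 < r0 / q" using r0 q_pos q_less_1 by (simp add: field_simps)
    show "r0 / q < s0 / q" using r0 q_pos by (simp add: divide_strict_right_mono)
    show "r0 \<le> r0 / q" using r0 q_pos q_less_1 by (simp add: field_simps)
    show "r0 < s0 / q" using \<open>r0 / q < s0 / q\<close> \<open>r0 \<le> r0 / q\<close> by linarith
  qed
  have hol: "H holomorphic_on {z. 1 < norm z \<and> norm z < s0 / q} - (A \<union> B)"
    by (rule holomorphic_on_subset[OF H_holomorphic]) (auto simp: A_def B_def)
  have "circle_int H (r0 / q) = circle_int H r0 + 2 * complex_of_real pi * (\<Sum>p\<in>A \<union> B. if p \<in> A then RP else RM)"
  proof (rule annulus_residues[OF hol])
    fix p assume p: "p \<in> A \<union> B"
    show "r0 < norm p \<and> norm p < r0 / q" by (rule bd[OF p])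
    show "((\<lambda>z. (z - p) / z * H z) \<longlongrightarrow> (if p \<in> A then RP else RM)) (at p)"
    proof (cases "p \<in> A")
      case True
      then have a: "1 \<le> a" and pp: "p = complex_of_real yp \<or> p = 1 / (qc * complex_of_real yp)" unfolding A_def by (auto split: if_splits)
      have "complex_of_real yp \<noteq> 0" using yp(2)[OF a] by simp
      then show ?thesis using pp True RP[OF a] H_residue_inverse[OF RP[OF a]] by auto
    next
      case False
      then have pp: "p = complex_of_real ym \<or> p = 1 / (qc * complex_of_real ym)" using p unfolding B_def by auto
      have "complex_of_real ym \<noteq> 0" using ym(2) by simp
      then show ?thesis using pp False RM H_residue_inverse[OF RM] by auto
    qed
  qed (use fin r0 rq in auto)
  then have 1: "circle_int H (r0 / q) = circle_int H r0 + 2 * complex_of_real pi * (of_nat (card A) * RP + of_nat (card B) * RM)"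
    unfolding sum_two_families[OF fin disj] .
  have cH: "continuous_on (sphere 0 \<rho>) H" if "\<rho> = r0 \<or> \<rho> = r0 / q" for \<rho>
  proof (rule holomorphic_on_imp_continuous_on[OF holomorphic_on_subset[OF H_holomorphic]], rule subsetI)
    fix z :: complex assume "z \<in> sphere 0 \<rho>"
    then have z: "norm z = r0 \<or> norm z = r0 / q" using that by auto
    then have "1 < norm z" "norm z < s0 / q" using rq r0 by auto
    then show "z \<in> {z. 1 < norm z \<and> norm z < s0 / q} - (PP \<union> PM)" using off[OF z] by simp
  qed
  have c2: "continuous_on (sphere 0 r0) (\<lambda>x. H (x / qc))"
    by (rule continuous_on_compose2[OF cH[of "r0 / q"]]) (use nz q_pos in \<open>auto intro!: continuous_intros simp: norm_divide\<close>)
  have "del * circle_int V r0 = circle_int (\<lambda>x. H x - H (x / qc)) r0"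
    unfolding circle_int_cmult[symmetric] by (rule circle_int_cong) (use r0 H_diff_circle in auto)
  also have "\<dots> = circle_int H r0 - circle_int (\<lambda>x. H (x / qc)) r0"
    by (rule circle_int_diff) (use r0 cH c2 in auto)
  also have "\<dots> = - (2 * complex_of_real pi * (of_nat (card A) * RP + of_nat (card B) * RM))"
    unfolding circle_int_scale 1 by simp
  finally show ?thesis unfolding circle_V A_def B_def .
qed

end



section \<open>Telescoping over the point masses and growth estimates\<close>

context awsetup
begin

abbreviation xp where "xp k \<equiv> complex_of_real (a * q ^ k)"
abbreviation xm where "xm k \<equiv> complex_of_real (d * t * q powi k)"

definition rhop :: "nat \<Rightarrow> complex" where
  "rhop k = complex_of_real (eps a * (2 * AW_mass_plus q a b c d t k / Kc)) / (Qd (xp k))\<^sup>2"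

definition rhom :: "int \<Rightarrow> complex" where
  "rhom k = complex_of_real (eps (d * t) * (2 * AW_mass_minus q a b c d t k / Kc)) / (Qd (xm k))\<^sup>2"

lemma kp_nonneg: "1 < a \<Longrightarrow> 0 \<le> kp"
proof (rule ccontr)
  assume a: "1 < a" and "\<not> 0 \<le> kp"
  then have "\<not> - 1 < kp" by simp
  then have "q powi (- 1) \<le> q powi kp" using powi_less_iff[of kp "- 1"] by simp
  then have "1 * q powi (- 1) < a * q powi kp"
    using a q_pos by (intro mult_less_le_imp_less) auto
  then show False using yp a by (simp add: power_int_minus divide_inverse)
qed

lemma yp_nat:
  assumes "1 < a"
  shows "yp = a * q ^ nat kp"
  using yp(1) kp_nonneg[OF assms] assms by (simp add: power_int_def)

lemma index_plus:
  assumes "1 < a"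
  shows "{k. 1 < a * q ^ k} = {..nat kp}"
proof (intro set_eqI iffI)
  fix k assume k: "k \<in> {..nat kp}"
  have "q ^ nat kp \<le> q ^ k" using k q_pos q_less_1 by (intro power_decreasing) auto
  then have "yp \<le> a * q ^ k" unfolding yp_nat[OF assms] using a_pos by simp
  then show "k \<in> {k. 1 < a * q ^ k}" using yp(2) assms by simp
next
  fix k assume "k \<in> {k. 1 < a * q ^ k}"
  then have k: "1 < a * q ^ k" by simp
  show "k \<in> {..nat kp}"
  proof (rule ccontr)
    assume "k \<notin> {..nat kp}"
    then have "q ^ k \<le> q ^ Suc (nat kp)" using q_pos q_less_1 by (intro power_decreasing) auto
    then have "a * q ^ k \<le> yp * q" unfolding yp_nat[OF assms] using a_pos by (simp add: mult_ac)
    also have "\<dots> \<le> 1" using yp(3) assms q_pos by (simp add: pos_le_divide_eq)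
    finally show False using k by simp
  qed
qed

lemma index_plus_empty:
  assumes "\<not> 1 < a"
  shows "{k. 1 < a * q ^ k} = {}"
proof -
  have "a * q ^ k \<le> 1" for k
    using mult_mono[of a 1 "q ^ k" 1] assms a_pos q_pos q_less_1 by (simp add: power_le_one)
  then show ?thesis by (auto simp: not_less)
qed

lemma xm_less: "k \<le> km \<Longrightarrow> d * t * q powi k \<le> ym"
  unfolding ym(1) using d_neg(1) powi_less_iff[of k km] by (intro mult_left_mono_neg) auto

lemma index_minus: "{k. d * t * q powi k < - 1} = {..km}"
proof (intro set_eqI iffI)
  fix k assume "k \<in> {..km}"
  then show "k \<in> {k. d * t * q powi k < - 1}" using xm_less[of k] ym(2) by simp
next
  fix k assume k: "k \<in> {k. d * t * q powi k < - 1}"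
  show "k \<in> {..km}"
  proof (rule ccontr)
    assume "k \<notin> {..km}"
    then have "q powi k \<le> q powi (km + 1)" using powi_less_iff[of "km + 1" k] by simp
    then have "d * t * q powi (km + 1) \<le> d * t * q powi k" using d_neg(1) by (intro mult_left_mono_neg) auto
    moreover have "d * t * q powi (km + 1) = ym * q" unfolding ym(1) using q_pos by (simp add: power_int_add)
    moreover have "- 1 \<le> ym * q" using ym(3) q_pos by (simp add: pos_le_divide_eq)
    ultimately show False using k by simp
  qed
qed

text \<open>At the largest point x = a the coefficient a1(1/a) vanishes, so \<open>D0\<close>
  consists of the product F G alone and the telescoping has no initial boundary term.\<close>

lemma sum_plus:
  assumes "1 < a" "m \<le> nat kp"
  shows "(\<Sum>k\<le>m. rhop k * (del * (F (xp k) * G (xp k)))) = rhop m * D0 (xp m)"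
  using assms(2)
proof (induction m)
  case 0
  have "a1 (1 / ac) = 0" unfolding a1_def using nz by simp
  then show ?case by (simp add: D0_def)
next
  case (Suc m)
  have l: "1 < a * q ^ m" "1 < a * q ^ Suc m" using Suc.prems index_plus[OF assms(1)] by (auto simp del: power_Suc)
  have e: "qc * xp m = xp (Suc m)" by (simp add: mult_ac)
  have "rhop (Suc m) * D0 (qc * xp m) = rhop (Suc m) * (del * (F (qc * xp m) * G (qc * xp m))) + rhop m * D0 (xp m)"
  proof (rule telescope_step)
    show "((\<lambda>x. (x - xp m) / x * Om x) \<longlongrightarrow> rhop m) (at (xp m))"
      unfolding rhop_def by (rule rho_plus[OF l(1)])
    show "((\<lambda>x. (x - qc * xp m) / x * Om x) \<longlongrightarrow> rhop (Suc m)) (at (qc * xp m))"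
      unfolding rhop_def e by (rule rho_plus[OF l(2)])
    show "1 < \<bar>q * (a * q ^ m)\<bar>" using l(2) by (simp add: mult_ac)
  qed (rule refl)
  then show ?case using Suc unfolding e by simp
qed

text \<open>The summation runs outwards from \<open>ym\<close>, the lattice point nearest to the
  unit circle. The subtracted term is the boundary contribution at the far end.\<close>

lemma sum_minus:
  "(\<Sum>j\<le>N. rhom (km - int j) * (del * (F (xm (km - int j)) * G (xm (km - int j)))))
    = rhom km * D0 (xm km) - rhom (km - int N) * (a1 (1 / xm (km - int N)) * om (xm (km - int N) / qc))"
proof (induction N)
  case 0
  show ?case by (simp add: D0_def distrib_left)
next
  case (Suc N)
  let ?k = "km - int N"
  have k1: "km - int (Suc N) = ?k - 1" by simp
  have l: "d * t * q powi (?k - 1) < - 1" "d * t * q powi ?k < - 1"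
    using xm_less[of ?k] xm_less[of "?k - 1"] ym(2) by auto
  have e': "q * (d * t * q powi (?k - 1)) = d * t * q powi ?k" using q_pos by (simp add: power_int_diff)
  have e: "qc * xm (?k - 1) = xm ?k" using arg_cong[OF e', of complex_of_real] by simp
  have "rhom ?k * D0 (qc * xm (?k - 1)) = rhom ?k * (del * (F (qc * xm (?k - 1)) * G (qc * xm (?k - 1)))) + rhom (?k - 1) * D0 (xm (?k - 1))"
  proof (rule telescope_step)
    show "((\<lambda>x. (x - xm (?k - 1)) / x * Om x) \<longlongrightarrow> rhom (?k - 1)) (at (xm (?k - 1)))"
      unfolding rhom_def by (rule rho_minus[OF refl l(1)])
    show "((\<lambda>x. (x - qc * xm (?k - 1)) / x * Om x) \<longlongrightarrow> rhom ?k) (at (qc * xm (?k - 1)))"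
      unfolding rhom_def e by (rule rho_minus[OF refl l(2)])
    show "1 < \<bar>q * (d * t * q powi (?k - 1))\<bar>" unfolding e' using l(2) by simp
  qed (rule refl)
  then have "rhom ?k * (a1 (1 / xm ?k) * om (xm ?k / qc)) = rhom (?k - 1) * D0 (xm (?k - 1))"
    unfolding e D0_def[of "xm ?k"] by (simp add: distrib_left)
  moreover have "rhom (?k - 1) * D0 (xm (?k - 1)) = rhom (?k - 1) * (del * (F (xm (?k - 1)) * G (xm (?k - 1))))
      + rhom (?k - 1) * (a1 (1 / xm (?k - 1)) * om (xm (?k - 1) / qc))"
    unfolding D0_def by (simp add: distrib_left)
  ultimately show ?case using Suc.IH unfolding sum.atMost_Suc k1 by simp
qed

lemma phi0_FF: "phi0 g x = FF g x / Qd x"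
  unfolding awf_def FF_def Qd_def ..

lemma Qd_minus: "k \<le> km \<Longrightarrow> Qd (xm k) \<noteq> 0"
  using Q_d_neg[of "d * t * q powi k"] xm_less[of k] ym(2) unfolding Qd_def by simp

lemma xm_seq: "1 / xm (km - int N) = qc ^ N / complex_of_real ym"
  unfolding ym(1) using q_pos by (simp add: power_int_diff)

lemma inv_xm_tendsto: "(\<lambda>N. 1 / xm (km - int N)) \<longlonglongrightarrow> 0"
  unfolding xm_seq using q_pow_tendsto_0[of "1 / complex_of_real ym"] by simp

text \<open>By \<open>mass_minus_eq\<close> the mass divided by s^(2k) is a function of 1/x that is
  continuous at 0, hence bounded along the lattice.\<close>

lemma mass_minus_bound:
  obtains C where "\<And>N. norm (complex_of_real (2 * AW_mass_minus q a b c d t (km - int N) / Kc)) \<le> C * s powi (2 * (km - int N))"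
proof -
  define N1 where "N1 = (\<lambda>w. (Q (qc / ac * w) * Q (qc / bc * w) * Q (qc / cc * w) * Q (qc / dc * w)) / (Q (dc * w) * Q (ac * w) * Q (bc * w) * Q (cc * w)) * (1 - w\<^sup>2))"
  define C0 where "C0 = theta (qc * tc) / ((Q qc)\<^sup>2 * (theta (ac * dc * tc) * theta (bc * dc * tc) * theta (cc * dc * tc)))"
  have "(\<lambda>N. C0 * N1 (1 / xm (km - int N))) \<longlonglongrightarrow> C0 * N1 0"
    unfolding N1_def by (intro tendsto_intros inv_xm_tendsto) auto
  then have "Bseq (\<lambda>N. C0 * N1 (1 / xm (km - int N)))" by (intro convergent_imp_Bseq convergentI)
  then obtain C where C: "\<And>N. norm (C0 * N1 (1 / xm (km - int N))) \<le> C" unfolding Bseq_def by auto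
  show ?thesis
  proof (rule that)
    fix N
    have "complex_of_real (2 * AW_mass_minus q a b c d t (km - int N) / Kc) = C0 * N1 (1 / xm (km - int N)) * sc powi (2 * (km - int N))"
      unfolding mass_minus_eq[OF refl] C0_def N1_def by (simp add: power_divide)
    then have "norm (complex_of_real (2 * AW_mass_minus q a b c d t (km - int N) / Kc)) = norm (C0 * N1 (1 / xm (km - int N))) * s powi (2 * (km - int N))"
      using s_pos by (simp only: norm_mult norm_power_int norm_of_real abs_of_pos)
    also have "\<dots> \<le> C * s powi (2 * (km - int N))" using C s_pos by (intro mult_right_mono) auto
    finally show "norm (complex_of_real (2 * AW_mass_minus q a b c d t (km - int N) / Kc)) \<le> C * s powi (2 * (km - int N))" .
  qed
qed

text \<open>The growth s^(2k) of the masses is shared evenly by the two eigenfunctions; each one,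
  normalised by s^k, decays geometrically with ratio 1/|g|.\<close>

lemma decay_seq:
  assumes g: "g \<in> AW_dual_S q a b c d t"
  obtains C where "0 \<le> C" "\<And>N. norm (phi0 g (xm (km - int N))) * s powi (km - int N) \<le> C * (1 / \<bar>g\<bar>) ^ N"
proof -
  have g1: "1 < \<bar>g\<bar>" by (rule dual_S_abs[OF g])
  obtain C k0 where C: "\<And>k. k \<le> k0 \<Longrightarrow> norm (phi0 g (xm k)) \<le> C * (\<bar>g\<bar> / s) powi k"
    using decay[OF g] by blast
  define u where "u = (\<lambda>N. norm (phi0 g (xm (km - int N))) * s powi (km - int N) * \<bar>g\<bar> ^ N)"
  have u0: "0 \<le> u N" for N unfolding u_def using s_pos by simp
  \<comment> \<open>The estimate \<open>decay\<close> starts at some k0; the finitely many N before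
    that are absorbed by a finite sum.\<close>
  have "u N \<le> \<bar>C\<bar> * \<bar>g\<bar> powi km + (\<Sum>j\<le>nat (km - k0). u j)" for N
  proof (cases "km - int N \<le> k0")
    case True
    have "u N \<le> C * (\<bar>g\<bar> / s) powi (km - int N) * s powi (km - int N) * \<bar>g\<bar> ^ N"
      unfolding u_def using C[OF True] s_pos by (intro mult_right_mono) auto
    also have "\<dots> = C * (\<bar>g\<bar> powi (km - int N) * \<bar>g\<bar> ^ N)" using s_pos by (simp add: power_int_divide_distrib)
    also have "\<bar>g\<bar> powi (km - int N) * \<bar>g\<bar> ^ N = \<bar>g\<bar> powi km"
    proof -
      have "g \<noteq> 0" using g1 by auto
      then show ?thesis by (simp add: power_int_diff)
    qed
    also have "C * \<bar>g\<bar> powi km \<le> \<bar>C\<bar> * \<bar>g\<bar> powi km" by (intro mult_right_mono) auto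
    finally show ?thesis using sum_nonneg[of "{..nat (km - k0)}" u] u0 by (simp add: add_increasing2)
  next
    case False
    then have "u N \<le> (\<Sum>j\<le>nat (km - k0). u j)" using u0 by (intro member_le_sum) auto
    moreover have "0 \<le> \<bar>C\<bar> * \<bar>g\<bar> powi km" by simp
    ultimately show ?thesis by linarith
  qed
  note bd = this
  show ?thesis
  proof (rule that)
    show "0 \<le> \<bar>C\<bar> * \<bar>g\<bar> powi km + (\<Sum>j\<le>nat (km - k0). u j)" using u0 by (intro add_nonneg_nonneg sum_nonneg) auto
    fix N
    have "norm (phi0 g (xm (km - int N))) * s powi (km - int N) = u N * (1 / \<bar>g\<bar>) ^ N"
      unfolding u_def using g1 by (simp add: power_divide)
    also have "\<dots> \<le> (\<bar>C\<bar> * \<bar>g\<bar> powi km + (\<Sum>j\<le>nat (km - k0). u j)) * (1 / \<bar>g\<bar>) ^ N"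
      using bd by (intro mult_right_mono) auto
    finally show "norm (phi0 g (xm (km - int N))) * s powi (km - int N) \<le> (\<bar>C\<bar> * \<bar>g\<bar> powi km + (\<Sum>j\<le>nat (km - k0). u j)) * (1 / \<bar>g\<bar>) ^ N" .
  qed
qed

text \<open>The diagonal bound gives absolute summability of the point masses against the product;
  the two mixed bounds control the Casoratian, which involves neighbouring points. The rate is that
  of the first function, the second one being merely bounded.\<close>

lemma mass_phi_bound:
  "\<exists>C \<theta>. 0 \<le> \<theta> \<and> \<theta> < 1 \<and>
    (\<forall>N. norm (complex_of_real (2 * AW_mass_minus q a b c d t (km - int N) / Kc)) * (norm (phi0 \<gamma> (xm (km - int N))) * norm (phi0 \<gamma>' (xm (km - int N)))) \<le> C * \<theta> ^ N) \<and>
    (\<forall>N. norm (complex_of_real (2 * AW_mass_minus q a b c d t (km - int N) / Kc)) * (norm (phi0 \<gamma> (xm (km - int N))) * norm (phi0 \<gamma>' (xm (km - int (Suc N))))) \<le> C * \<theta> ^ N) \<and>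
    (\<forall>N. norm (complex_of_real (2 * AW_mass_minus q a b c d t (km - int N) / Kc)) * (norm (phi0 \<gamma> (xm (km - int (Suc N)))) * norm (phi0 \<gamma>' (xm (km - int N)))) \<le> C * \<theta> ^ N)"
proof -
  obtain M where M: "\<And>N. norm (complex_of_real (2 * AW_mass_minus q a b c d t (km - int N) / Kc)) \<le> M * s powi (2 * (km - int N))"
    using mass_minus_bound by blast
  obtain C1 where C1: "0 \<le> C1" "\<And>N. norm (phi0 \<gamma> (xm (km - int N))) * s powi (km - int N) \<le> C1 * (1 / \<bar>\<gamma>\<bar>) ^ N"
    using decay_seq[OF gam(1)] by blast
  obtain C2 where C2: "0 \<le> C2" "\<And>N. norm (phi0 \<gamma>' (xm (km - int N))) * s powi (km - int N) \<le> C2 * (1 / \<bar>\<gamma>'\<bar>) ^ N"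
    using decay_seq[OF gam(2)] by blast
  have g1: "1 < \<bar>\<gamma>\<bar>" "1 < \<bar>\<gamma>'\<bar>" using dual_S_abs gam by auto
  define \<theta> where "\<theta> = 1 / \<bar>\<gamma>\<bar>"
  define C where "C = \<bar>M\<bar> * (C1 * C2) * (1 + s)"
  have th: "0 \<le> \<theta>" "\<theta> < 1" unfolding \<theta>_def using g1 by auto
  have D1: "norm (phi0 \<gamma> (xm (km - int N))) * s powi (km - int N) \<le> C1 * \<theta> ^ N" for N using C1(2) unfolding \<theta>_def .
  have D2: "norm (phi0 \<gamma>' (xm (km - int N))) * s powi (km - int N) \<le> C2" for N
  proof -
    have "C2 * (1 / \<bar>\<gamma>'\<bar>) ^ N \<le> C2 * 1" using g1 C2(1) by (intro mult_left_mono power_le_one) auto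
    then show ?thesis using C2(2)[of N] by linarith
  qed
  have D1': "norm (phi0 \<gamma> (xm (km - int (Suc N)))) * s powi (km - int (Suc N)) \<le> C1 * \<theta> ^ N" for N
  proof -
    have "C1 * \<theta> ^ Suc N \<le> C1 * \<theta> ^ N" using C1(1) th by (intro mult_left_mono power_decreasing) auto
    then show ?thesis using D1[of "Suc N"] by linarith
  qed
  have pw: "s powi (2 * (km - int N)) = s powi (km - int N) * s powi (km - int N)" for N
  proof -
    have "s \<noteq> 0 \<or> (km - int N) + (km - int N) \<noteq> 0" using s_pos by simp
    then show ?thesis unfolding mult_2 by (rule power_int_add)
  qed
  have ps: "s powi (km - int N) = s * s powi (km - int (Suc N))" for N
  proof -
    have "s powi (1 + (km - int (Suc N))) = s * s powi (km - int (Suc N))"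
      by (subst power_int_add) (use s_pos in simp_all)
    moreover have "1 + (km - int (Suc N)) = km - int N" by simp
    ultimately show ?thesis by (simp only:)
  qed
  have gen: "norm (complex_of_real (2 * AW_mass_minus q a b c d t (km - int N) / Kc)) * (p1 * p2) \<le> C * \<theta> ^ N"
    if p: "0 \<le> p1" "0 \<le> p2" "(p1 * e1) * (p2 * e2) \<le> (C1 * \<theta> ^ N) * C2" "s powi (2 * (km - int N)) = l * (e1 * e2)" "0 \<le> l" "l \<le> 1 + s" for p1 p2 e1 e2 l N
  proof -
    have "norm (complex_of_real (2 * AW_mass_minus q a b c d t (km - int N) / Kc)) * (p1 * p2) \<le> M * s powi (2 * (km - int N)) * (p1 * p2)"
      by (intro mult_right_mono M) (use p in auto)
    also have "\<dots> \<le> \<bar>M\<bar> * s powi (2 * (km - int N)) * (p1 * p2)"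
      using p(1,2) s_pos by (intro mult_right_mono) auto
    also have "\<dots> = \<bar>M\<bar> * l * ((p1 * e1) * (p2 * e2))" unfolding p(4) by (simp add: mult_ac)
    also have "\<dots> \<le> \<bar>M\<bar> * l * ((C1 * \<theta> ^ N) * C2)" using p by (intro mult_left_mono) auto
    also have "\<dots> \<le> \<bar>M\<bar> * (1 + s) * ((C1 * \<theta> ^ N) * C2)"
      using p C1(1) C2(1) th by (intro mult_right_mono mult_left_mono) auto
    also have "\<dots> = C * \<theta> ^ N" unfolding C_def by (simp add: mult_ac)
    finally show ?thesis .
  qed
  have nn: "0 \<le> norm (phi0 g (xm k)) * s powi j" for g k j using s_pos by simp
  show ?thesis
  proof (rule exI[of _ C], rule exI[of _ \<theta>], intro conjI allI th)
    fix N
    show "norm (complex_of_real (2 * AW_mass_minus q a b c d t (km - int N) / Kc)) * (norm (phi0 \<gamma> (xm (km - int N))) * norm (phi0 \<gamma>' (xm (km - int N)))) \<le> C * \<theta> ^ N"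
      by (rule gen[where l = 1, OF norm_ge_zero norm_ge_zero mult_mono[OF D1 D2]]) (use pw s_pos C1(1) th nn in auto)
    show "norm (complex_of_real (2 * AW_mass_minus q a b c d t (km - int N) / Kc)) * (norm (phi0 \<gamma> (xm (km - int N))) * norm (phi0 \<gamma>' (xm (km - int (Suc N))))) \<le> C * \<theta> ^ N"
      by (rule gen[where l = s, OF norm_ge_zero norm_ge_zero mult_mono[OF D1 D2]]) (use pw[of N] ps[of N] s_pos C1(1) th nn in \<open>auto simp: mult_ac\<close>)
    show "norm (complex_of_real (2 * AW_mass_minus q a b c d t (km - int N) / Kc)) * (norm (phi0 \<gamma> (xm (km - int (Suc N)))) * norm (phi0 \<gamma>' (xm (km - int N)))) \<le> C * \<theta> ^ N"
      by (rule gen[where l = s, OF norm_ge_zero norm_ge_zero mult_mono[OF D1' D2]]) (use pw[of N] ps[of N] s_pos C1(1) th nn in \<open>auto simp: mult_ac\<close>)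
  qed
qed

end



section \<open>The boundary term, and the circle integral against the point masses\<close>

context awsetup
begin

text \<open>In w = 1/x the quotient Qd(x/q)/Qd(x) is the rational function (w - 1/d) / (w (1 - q w /
  d)). The zero of a1(w) at w = 0 cancels its pole, and the limit is (-d)(-1/d) = 1.\<close>

lemma bracket_tendsto:
  "(\<lambda>N. a1 (1 / xm (km - int N)) * (Qd (xm (km - int N) / qc) / Qd (xm (km - int N)))) \<longlonglongrightarrow> 1"
proof -
  define br where "br = (\<lambda>w. - (1 - ac * w) * (1 - bc * w) * (1 - cc * w) * (dc - qc * w) * (w - 1 / dc) / ((1 - w\<^sup>2) * (1 - qc * w\<^sup>2) * (1 - qc * w / dc)))"
  have "(\<lambda>N. br (1 / xm (km - int N))) \<longlonglongrightarrow> br 0"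
    unfolding br_def by (intro tendsto_intros inv_xm_tendsto) (use d_pos in auto)
  moreover have "br 0 = 1"
  proof -
    have "dc * (1 / dc) = 1" using d_pos by simp
    then show ?thesis unfolding br_def by simp
  qed
  moreover have "br (1 / xm (km - int N)) = a1 (1 / xm (km - int N)) * (Qd (xm (km - int N) / qc) / Qd (xm (km - int N)))" for N
  proof -
    let ?x = "xm (km - int N)"
    have Qn: "Qd ?x \<noteq> 0" by (rule Qd_minus) simp
    have x0: "?x \<noteq> 0"
    proof -
      have "d * t * q powi (km - int N) \<le> ym" by (rule xm_less) simp
      then have "d * t * q powi (km - int N) \<noteq> 0" using ym(2) by linarith
      then show ?thesis unfolding of_real_eq_0_iff .
    qed
    have 1: "Q (?x / dc) = (1 - ?x / dc) * Q (qc * ?x / dc)" using Q_rec[of "?x / dc"] by (simp add: mult_ac)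
    have 4: "Q (qc / (dc * ?x)) = (1 - qc / (dc * ?x)) * Q (qc / (dc * (?x / qc)))" using Q_rec[of "qc / (dc * ?x)"] by (simp add: mult_ac)
    have e: "qc * (?x / qc) / dc = ?x / dc" using nz by simp
    have "Qd (?x / qc) * (1 - qc / (dc * ?x)) = Qd ?x * (1 - ?x / dc)"
      unfolding Qd_def e 1 4 by algebra
    moreover have u: "1 - qc / (dc * ?x) \<noteq> 0" using Qn unfolding Qd_def 4 by auto
    ultimately have "Qd (?x / qc) / Qd ?x = (1 - ?x / dc) / (1 - qc / (dc * ?x))" by (intro frac_eq_eq[THEN iffD2, OF Qn u]) (simp only: mult.commute)
    moreover have "1 - ?x / dc = (1 / ?x - 1 / dc) * ?x" using x0 by (simp add: field_simps)
    moreover have "br w = a1 w * ((w - 1 / dc) * (1 / w) / (1 - qc * w / dc))" if "w \<noteq> 0" for w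
    proof -
      have "- A * B * C * D * E / (M1 * M2 * U) = - w * A * B * C * D / (M1 * M2) * (E * (1 / w) / U)" for A B C D E M1 M2 U
        using that by (simp add: mult_ac)
      then show ?thesis unfolding br_def a1_def by blast
    qed
    from this[of "1 / ?x"] have "br (1 / ?x) = a1 (1 / ?x) * ((1 / ?x - 1 / dc) * ?x / (1 - qc / (dc * ?x)))" using x0 by (simp add: mult.commute)
    ultimately show ?thesis by simp
  qed
  ultimately show ?thesis by simp
qed

lemma Qd_minus_int: "Qd (xm (km - int N)) \<noteq> 0"
  by (rule Qd_minus) linarith

lemma FF_phi0: "Qd x \<noteq> 0 \<Longrightarrow> FF g x = phi0 g x * Qd x"
  unfolding phi0_FF by (rule nonzero_divide_eq_eq[THEN iffD1, OF _ refl])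

lemma om_minus:
  "om (xm (km - int N) / qc) = Qd (xm (km - int N)) * Qd (xm (km - int N) / qc)
     * (phi0 \<gamma> (xm (km - int N)) * phi0 \<gamma>' (xm (km - int (Suc N))) - phi0 \<gamma> (xm (km - int (Suc N))) * phi0 \<gamma>' (xm (km - int N)))"
proof -
  have alg: "F1 * G2 - F2 * G1 = A * B * (p1 * p2 - p3 * p4)" if "F1 = p1 * A" "G2 = p2 * B" "F2 = p3 * B" "G1 = p4 * A" for F1 G2 F2 G1 p1 p2 p3 p4 A B :: complex
    unfolding that by (simp add: algebra_simps)
  have "km - int N = 1 + (km - int (Suc N))" by simp
  then have e: "q powi (km - int N) = q * q powi (km - int (Suc N))"
  proof -
    have "q powi (1 + (km - int (Suc N))) = q * q powi (km - int (Suc N))"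
      by (subst power_int_add) (use q_pos in simp_all)
    then show ?thesis unfolding \<open>km - int N = 1 + (km - int (Suc N))\<close> .
  qed
  have xq: "xm (km - int N) / qc = xm (km - int (Suc N))" unfolding e using nz(6) by simp
  have q1: "qc * (x / qc) = x" for x using nz(6) by simp
  have "om (xm (km - int N) / qc) = F (xm (km - int N)) * G (xm (km - int N) / qc) - F (xm (km - int N) / qc) * G (xm (km - int N))"
    unfolding om_def q1 ..
  also have "\<dots> = Qd (xm (km - int N)) * Qd (xm (km - int N) / qc)
     * (phi0 \<gamma> (xm (km - int N)) * phi0 \<gamma>' (xm (km - int (Suc N))) - phi0 \<gamma> (xm (km - int (Suc N))) * phi0 \<gamma>' (xm (km - int N)))"
    unfolding xq by (rule alg; rule FF_phi0; rule Qd_minus_int)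
  finally show ?thesis .
qed

lemma boundary_tendsto:
  "(\<lambda>N. rhom (km - int N) * (a1 (1 / xm (km - int N)) * om (xm (km - int N) / qc))) \<longlonglongrightarrow> 0"
proof -
  define m where "m = (\<lambda>N. complex_of_real (2 * AW_mass_minus q a b c d t (km - int N) / Kc))"
  define f where "f = (\<lambda>N. phi0 \<gamma> (xm (km - int N)))"
  define f' where "f' = (\<lambda>N. phi0 \<gamma>' (xm (km - int N)))"
  obtain C \<theta> where ex: "0 \<le> \<theta> \<and> \<theta> < 1 \<and>
    (\<forall>N. norm (complex_of_real (2 * AW_mass_minus q a b c d t (km - int N) / Kc)) * (norm (phi0 \<gamma> (xm (km - int N))) * norm (phi0 \<gamma>' (xm (km - int N)))) \<le> C * \<theta> ^ N) \<and>
    (\<forall>N. norm (complex_of_real (2 * AW_mass_minus q a b c d t (km - int N) / Kc)) * (norm (phi0 \<gamma> (xm (km - int N))) * norm (phi0 \<gamma>' (xm (km - int (Suc N))))) \<le> C * \<theta> ^ N) \<and>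
    (\<forall>N. norm (complex_of_real (2 * AW_mass_minus q a b c d t (km - int N) / Kc)) * (norm (phi0 \<gamma> (xm (km - int (Suc N)))) * norm (phi0 \<gamma>' (xm (km - int N)))) \<le> C * \<theta> ^ N)"
    by (rule exE[OF mass_phi_bound], erule exE, rule that)
  have th: "0 \<le> \<theta>" "\<theta> < 1" by (rule conjunct1[OF ex], rule conjunct1[OF conjunct2[OF ex]])
  have C: "norm (m N) * (norm (f N) * norm (f' (Suc N))) \<le> C * \<theta> ^ N" "norm (m N) * (norm (f (Suc N)) * norm (f' N)) \<le> C * \<theta> ^ N" for N
    unfolding m_def f_def f'_def
    by (rule spec[OF conjunct1[OF conjunct2[OF conjunct2[OF conjunct2[OF ex]]]]], rule spec[OF conjunct2[OF conjunct2[OF conjunct2[OF conjunct2[OF ex]]]]])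
  define br where "br = (\<lambda>N. a1 (1 / xm (km - int N)) * (Qd (xm (km - int N) / qc) / Qd (xm (km - int N))))"
  have alg: "E * mm / A\<^sup>2 * (al * (A * B * (u - v))) = E * (al * (B / A)) * (mm * u - mm * v)" if "A \<noteq> 0" for E mm A al B u v :: complex
    using that by (simp add: power2_eq_square right_diff_distrib diff_divide_distrib mult_ac)
  have eq: "rhom (km - int N) * (a1 (1 / xm (km - int N)) * om (xm (km - int N) / qc))
     = complex_of_real (eps (d * t)) * br N * (m N * (f N * f' (Suc N)) - m N * (f (Suc N) * f' N))" for N
    unfolding om_minus[of N] rhom_def br_def m_def f_def f'_def of_real_mult[of "eps (d * t)"]
    by (rule alg[OF Qd_minus_int])
  have z: "(\<lambda>N. C * \<theta> ^ N) \<longlonglongrightarrow> 0" using LIMSEQ_realpow_zero[OF th] tendsto_mult_right_zero by blast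
  have 1: "(\<lambda>N. m N * (f N * f' (Suc N))) \<longlonglongrightarrow> 0"
    by (rule Lim_null_comparison[OF _ z]) (use C(1) in \<open>simp add: norm_mult\<close>)
  have 2: "(\<lambda>N. m N * (f (Suc N) * f' N)) \<longlonglongrightarrow> 0"
    by (rule Lim_null_comparison[OF _ z]) (use C(2) in \<open>simp add: norm_mult\<close>)
  have "(\<lambda>N. complex_of_real (eps (d * t)) * br N * (m N * (f N * f' (Suc N)) - m N * (f (Suc N) * f' N))) \<longlonglongrightarrow> complex_of_real (eps (d * t)) * 1 * (0 - 0)"
    unfolding br_def by (intro tendsto_mult tendsto_diff tendsto_const bracket_tendsto 1 2)
  then show ?thesis unfolding eq by simp
qed

abbreviation termp where "termp k \<equiv> complex_of_real (AW_mass_plus q a b c d t k) * (phi0 \<gamma> (xp k) * phi0 \<gamma>' (xp k))"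
abbreviation termm where "termm k \<equiv> complex_of_real (AW_mass_minus q a b c d t k) * (phi0 \<gamma> (xm k) * phi0 \<gamma>' (xm k))"

lemma conds:
  assumes "1 < \<bar>y\<bar>"
  shows "complex_of_real y \<noteq> 0" "(1 / complex_of_real y)\<^sup>2 \<noteq> 1" "qc * (1 / complex_of_real y)\<^sup>2 \<noteq> 1"
proof -
  have y2: "1 < y\<^sup>2" using one_less_power[OF assms, of 2] by simp
  show "complex_of_real y \<noteq> 0" using assms by auto
  have "0 < y\<^sup>2" "q < y\<^sup>2" using y2 q_less_1 by linarith+
  then have "1 / y\<^sup>2 < 1" "q * (1 / y\<^sup>2) < 1" using y2 by (simp_all add: pos_divide_less_eq)
  then have "complex_of_real (1 / y\<^sup>2) \<noteq> complex_of_real 1" "complex_of_real (q * (1 / y\<^sup>2)) \<noteq> complex_of_real 1"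
    unfolding of_real_eq_iff by linarith+
  then show "(1 / complex_of_real y)\<^sup>2 \<noteq> 1" "qc * (1 / complex_of_real y)\<^sup>2 \<noteq> 1"
    by (simp_all add: power_divide)
qed

text \<open>The multiplicities fit: a residue carries the factor \<open>eps\<close>, and the number
  of poles is 2/eps by \<open>card_eps\<close>. Both lattices therefore enter with the uniform
  factor 2, which is the factor for a point and its inverse in the measure.\<close>

lemma circle_identity:
  assumes del: "del \<noteq> 0"
  obtains SM where "(\<lambda>N. termm (km - int N)) sums SM"
    "complex_of_real (Kc / (4 * pi)) * circle_int V 1 + 2 * (\<Sum>k | 1 < a * q ^ k. termp k) + 2 * SM = 0"
proof -
  have K: "complex_of_real Kc \<noteq> 0" using K_pos by simp
  have e0: "complex_of_real (eps y) \<noteq> 0" for y unfolding eps_def by auto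
  have rm: "rhom k * (del * (F (xm k) * G (xm k))) = complex_of_real (eps (d * t)) * (2 * del / complex_of_real Kc) * termm k" for k
    unfolding rhom_def phi0_FF of_real_mult[of "eps (d * t)"] by (simp add: power2_eq_square)
  have rp: "rhop k * (del * (F (xp k) * G (xp k))) = complex_of_real (eps a) * (2 * del / complex_of_real Kc) * termp k" for k
    unfolding rhop_def phi0_FF of_real_mult[of "eps a"] by (simp add: power2_eq_square)
  have ymc: "xm km = complex_of_real ym" unfolding ym(1) ..
  define cm where "cm = complex_of_real (eps (d * t)) * (2 * del / complex_of_real Kc)"
  define cp where "cp = complex_of_real (eps a) * (2 * del / complex_of_real Kc)"
  have c0: "cm \<noteq> 0" "cp \<noteq> 0" unfolding cm_def cp_def using e0 K del by auto
  define RM where "RM = rhom km * D0 (xm km)"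
  have "(\<lambda>N. \<Sum>j\<le>N. rhom (km - int j) * (del * (F (xm (km - int j)) * G (xm (km - int j))))) \<longlonglongrightarrow> RM - 0"
    unfolding sum_minus RM_def by (intro tendsto_diff tendsto_const boundary_tendsto)
  then have "(\<lambda>N. rhom (km - int N) * (del * (F (xm (km - int N)) * G (xm (km - int N))))) sums RM"
    by (simp add: sums_def_le)
  then have "(\<lambda>N. cm * termm (km - int N)) sums RM" unfolding rm cm_def .
  from sums_divide[OF this, of cm] have sm: "(\<lambda>N. termm (km - int N)) sums (RM / cm)" using c0 by simp
  have LM: "((\<lambda>x. (x - complex_of_real ym) / x * H x) \<longlongrightarrow> RM) (at (complex_of_real ym))"
    unfolding RM_def ymc
  proof (rule H_residue)
    show "((\<lambda>x. (x - complex_of_real ym) / x * Om x) \<longlongrightarrow> rhom km) (at (complex_of_real ym))"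
      unfolding rhom_def ymc[symmetric] by (rule rho_minus[OF refl]) (use ym in simp)
  qed (use conds[of ym] ym'(1) in auto)
  define SP where "SP = (\<Sum>k | 1 < a * q ^ k. termp k)"
  define RP where "RP = cp * SP"
  have LP: "((\<lambda>x. (x - complex_of_real yp) / x * H x) \<longlongrightarrow> RP) (at (complex_of_real yp))" if a: "1 \<le> a"
  proof (cases "1 < a")
    case True
    have yc: "complex_of_real yp = xp (nat kp)" unfolding yp_nat[OF True] ..
    have "RP = rhop (nat kp) * D0 (xp (nat kp))"
      unfolding RP_def SP_def index_plus[OF True] sum_distrib_left cp_def rp[symmetric] by (rule sum_plus[OF True order_refl])
    moreover have "((\<lambda>x. (x - complex_of_real yp) / x * H x) \<longlongrightarrow> rhop (nat kp) * D0 (complex_of_real yp)) (at (complex_of_real yp))"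
    proof (rule H_residue)
      show "((\<lambda>x. (x - complex_of_real yp) / x * Om x) \<longlongrightarrow> rhop (nat kp)) (at (complex_of_real yp))"
        unfolding rhop_def yc by (rule rho_plus) (use yp(2)[OF a] yp_nat[OF True] in simp)
    qed (use conds[of yp] yp'(1)[OF a] in auto)
    ultimately show ?thesis unfolding yc by simp
  next
    case False
    then have a1: "a = 1" using a by simp
    have "SP = 0" unfolding SP_def index_plus_empty[OF False] by simp
    then have R0: "RP = 0" unfolding RP_def by simp
    \<comment> \<open>For a = 1 the representative in (1, 1/q] is 1/q. Its index kp = -1 is not an
      index of a mass.\<close>
    have "q powi 0 < q powi kp \<and> \<not> q powi (- 1) < q powi kp" using yp a1 by (simp add: power_int_minus divide_inverse)
    then have "kp = - 1" unfolding powi_less_iff by linarith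
    then have "complex_of_real yp = 1 / qc" using yp(1)[OF a] a1 by (simp add: power_int_minus divide_inverse)
    then show ?thesis using H_residue_a1[OF a1] R0 by simp
  qed
  have cardM: "of_nat (card {p \<in> PM. 1 < norm p}) * complex_of_real (eps (d * t)) = 2"
    using card_eps[OF ym'(1,2) s0(1) ym'(3,4)] eps_shift[of "d * t" km] unfolding ym(1)[symmetric] by simp
  have cardP: "of_nat (card {p \<in> PP. 1 < norm p}) * RP = 2 * (2 * del / complex_of_real Kc) * SP"
  proof (cases "1 \<le> a")
    case True
    have "of_nat (card {p \<in> {complex_of_real yp, 1 / (qc * complex_of_real yp)}. 1 < norm p}) * complex_of_real (eps a) = 2"
      using card_eps[OF yp'(1)[OF True] yp'(2)[OF True] s0(1) yp'(3)[OF True] yp'(4)[OF True]] eps_shift[of a kp] yp(1)[OF True] by simp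
    then show ?thesis using True unfolding RP_def cp_def by (simp add: mult.assoc[symmetric])
  next
    case False
    then have "SP = 0" unfolding SP_def using index_plus_empty by simp
    then show ?thesis unfolding RP_def by simp
  qed
  have cardM': "of_nat (card {p \<in> PM. 1 < norm p}) * RM = 2 * (2 * del / complex_of_real Kc) * (RM / cm)"
  proof -
    have "of_nat (card {p \<in> PM. 1 < norm p}) * RM = of_nat (card {p \<in> PM. 1 < norm p}) * (cm * (RM / cm))" using c0 by simp
    also have "\<dots> = (of_nat (card {p \<in> PM. 1 < norm p}) * complex_of_real (eps (d * t))) * (2 * del / complex_of_real Kc) * (RM / cm)"
      unfolding cm_def by (simp only: mult_ac)
    finally show ?thesis unfolding cardM .
  qed
  have ci: "del * circle_int V 1 = - (2 * complex_of_real pi * (2 * (2 * del / complex_of_real Kc) * SP + 2 * (2 * del / complex_of_real Kc) * (RM / cm)))"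
    using contour_identity[OF LP LM] unfolding cardP cardM' by simp
  have fin: "K0 / (4 * P0) * J + 2 * S1 + 2 * S2 = 0"
    if "D * J = - (2 * P0 * (2 * (2 * D / K0) * S1 + 2 * (2 * D / K0) * S2))" "D \<noteq> 0" "K0 \<noteq> 0" "P0 \<noteq> 0" for D J P0 K0 S1 S2 :: complex
  proof -
    have "D * J = D * (- (8 * P0 / K0) * (S1 + S2))" unfolding that(1) by (simp add: algebra_simps add_divide_distrib)
    then have J: "J = - (8 * P0 / K0) * (S1 + S2)" by (rule mult_left_cancel[THEN iffD1, OF that(2)])
    have "K0 / (4 * P0) * J = - 2 * (S1 + S2)" unfolding J using that(3,4) by (simp add: field_simps)
    then show ?thesis by (simp add: algebra_simps)
  qed
  show ?thesis
  proof (rule that[OF sm])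
    show "complex_of_real (Kc / (4 * pi)) * circle_int V 1 + 2 * (\<Sum>k | 1 < a * q ^ k. termp k) + 2 * (RM / cm) = 0"
      using fin[OF ci del K] unfolding SP_def by simp
  qed
qed

end



section \<open>Positive masses, real values on the support, integration against the measure\<close>

context awp
begin

lemma qfac1_neg: "y < 0 \<Longrightarrow> 0 < qfac1 q k y"
proof -
  assume y: "y < 0"
  have "0 < 1 - y * q ^ i" "0 < 1 - y / q ^ i" for i
  proof -
    have "y * q ^ i < 0" "y / q ^ i < 0" using y q_pos by (simp_all add: mult_neg_pos divide_neg_pos)
    then show "0 < 1 - y * q ^ i" "0 < 1 - y / q ^ i" by linarith+
  qed
  then show ?thesis unfolding qfac1_def by (simp add: prod_pos)
qed

text \<open>Apart from (q; q)_infinity all products have negative arguments and are positive; 1 -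
  1/z^2 is positive because |z| > 1.\<close>

lemma mass_minus_nonneg:
  assumes "d * t * q powi k < - 1"
  shows "0 \<le> AW_mass_minus q a b c d t k"
proof -
  have pos: "0 < a" "0 < b" "0 < c" "0 < d" using a_pos par' d_pos by auto
  have q1: "0 < qinf1 q y" if "y < 0" for y using qinf1_pos[of y] that by simp
  have n: "q * t < 0" "q / (d\<^sup>2 * t) < 0" "a / (d * t) < 0" "b / (d * t) < 0" "c / (d * t) < 0" "a * d * t < 0" "b * d * t < 0" "c * d * t < 0"
    "1 / t < 0" "q / (a * d * t) < 0" "q / (b * d * t) < 0" "q / (c * d * t) < 0"
    using d_neg pos q_pos par'(1) by (simp_all add: divide_pos_neg mult_pos_neg)
  have qq: "0 < qinf1 q q" by (rule qinf1_pos) (rule q_less_1)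
  define z where "z = d * t * q powi k"
  have "1 < \<bar>z\<bar>" using assms unfolding z_def by simp
  then have z2: "1 < z\<^sup>2" using one_less_power[of "\<bar>z\<bar>" 2] by simp
  have "q \<noteq> 0 \<or> k + k \<noteq> 0" using q_pos by simp
  then have "q powi (2 * k) = q powi k * q powi k" unfolding mult_2 by (rule power_int_add)
  then have zz: "d\<^sup>2 * t\<^sup>2 * q powi (2 * k) = z\<^sup>2" unfolding z_def by (simp add: power2_eq_square mult_ac)
  have "0 < z\<^sup>2" using z2 by linarith
  then have "1 / z\<^sup>2 < 1" by (rule divide_less_eq_1_pos[THEN iffD2, OF _ z2])
  then have "0 \<le> 1 - 1 / z\<^sup>2" by linarith
  then show ?thesis unfolding AW_mass_minus_def qinf_def qfac_def zz
    using q1[OF n(1)] q1[OF n(2)] q1[OF n(3)] q1[OF n(4)] q1[OF n(5)] q1[OF n(6)] q1[OF n(7)] q1[OF n(8)] qq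
      qfac1_neg[OF n(9), of "- k"] qfac1_neg[OF n(3), of "- k"] qfac1_neg[OF n(4), of "- k"] qfac1_neg[OF n(5), of "- k"]
      qfac1_neg[OF n(10), of "- k"] qfac1_neg[OF n(11), of "- k"] qfac1_neg[OF n(12), of "- k"] qfac1_neg[OF n(2), of "- k"] K_pos[unfolded Kc_def] s_pos
    by (intro mult_nonneg_nonneg divide_nonneg_nonneg) simp_all
qed

text \<open>With x = a q^k and y = q x, the ratio of consecutive masses has the negative factors 1 -
  a x and 1 - d x above, 1 - y/b and 1 - y/c below, and two more in the quotient of 1 - y^2 by 1 -
  x^2: signs cancel in pairs.\<close>

lemma mass_plus_nonneg:
  assumes "1 < a * q ^ k"
  shows "0 \<le> AW_mass_plus q a b c d t k"
  using assms
proof (induction k)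
  case 0
  then have a: "1 < a" by simp
  have lt: "q * a / d < 1" "q / (a * d) < 1" "1 / a\<^sup>2 < 1" "b / a < 1" "c / a < 1"
  proof -
    have a2: "1 < a\<^sup>2" using a by (simp add: power2_eq_square less_1_mult)
    have "1 * q < a * d" using a d_gt_q q_pos by (intro mult_strict_mono) auto
    then show "q * a / d < 1" "q / (a * d) < 1" "1 / a\<^sup>2 < 1" "b / a < 1" "c / a < 1"
      using a a2 qa_less_d d_pos a_pos bc_less_1 q_pos by (simp_all add: pos_divide_less_eq)
  qed
  have th: "0 < qtheta q (a * d * t)" "0 < qtheta q (d * t / a)"
    using d_neg a_pos by (auto intro!: qtheta_neg simp: divide_neg_pos)
  have "a\<^sup>2 \<noteq> 1" using a by (simp add: power2_eq_square) (metis less_1_mult less_irrefl)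
  then show ?case unfolding AW_mass_plus_def qinf_def qfac_def qfac1_def
    using lt[THEN qinf1_pos] th qinf1_pos[OF q_less_1] qinf1_pos[OF par'(9)] qinf1_pos[OF par'(10)] K_pos[unfolded Kc_def]
    by (simp add: divide_nonneg_nonneg)
next
  case (Suc k)
  define x where "x = a * q ^ k"
  define y where "y = q * x"
  have y1: "1 < y" using Suc.prems unfolding y_def x_def by (simp add: mult_ac)
  have x0: "0 < x" unfolding x_def using a_pos q_pos by simp
  have yx: "y < x" unfolding y_def using q_less_1 x0 by simp
  then have x1: "1 < x" using y1 by linarith
  have IH: "0 \<le> AW_mass_plus q a b c d t k" using Suc.IH x1 unfolding x_def by simp
  have xa: "x \<le> a" unfolding x_def using a_pos q_pos q_less_1 by (simp add: power_le_one)
  have ya: "y < a" using yx xa by linarith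
  have "q * x \<le> q * a" using xa q_pos by (intro mult_left_mono) auto
  then have yd: "y < d" unfolding y_def using qa_less_d by linarith
  have dx: "1 < d * x"
  proof -
    have "y / q = x" unfolding y_def using q_pos by simp
    moreover have "1 / q < y / q" using y1 q_pos by (simp add: divide_strict_right_mono)
    ultimately have "q * (1 / q) < d * x" using d_gt_q q_pos d_pos by (intro mult_strict_mono) auto
    then show ?thesis using q_pos by simp
  qed
  have e1: "a\<^sup>2 * q ^ (2 * k) = x\<^sup>2" "a\<^sup>2 * q ^ (2 * Suc k) = y\<^sup>2"
  proof -
    have "q ^ (2 * k) = q ^ k * q ^ k" "q ^ (2 * Suc k) = (q * q ^ k) * (q * q ^ k)" by (simp_all only: mult_2 power_add power_Suc)
    then show "a\<^sup>2 * q ^ (2 * k) = x\<^sup>2" "a\<^sup>2 * q ^ (2 * Suc k) = y\<^sup>2" by (simp_all only: x_def y_def power2_eq_square mult_ac)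
  qed
  have e2: "a\<^sup>2 * q ^ k = a * x" "a * b * q ^ k = b * x" "a * c * q ^ k = c * x" "a * d * q ^ k = d * x" "q * q ^ k = y / a" "q * a / b * q ^ k = y / b"
    "q * a / c * q ^ k = y / c" "q * a / d * q ^ k = y / d"
    unfolding y_def x_def using a_pos by (simp_all add: power2_eq_square)
  have sg: "1 - a * x < 0" "0 < 1 - b * x" "0 < 1 - c * x" "1 - d * x < 0" "0 < 1 - y / a" "1 - y / b < 0" "1 - y / c < 0" "0 < 1 - y / d" "1 - y\<^sup>2 < 0" "1 - x\<^sup>2 < 0"
  proof -
    have "1 < a" using ya y1 by linarith
    from less_1_mult[OF this x1] show "1 - a * x < 0" by linarith
    have "b * x \<le> b * a" "c * x \<le> c * a" using xa par' by (auto intro: mult_left_mono)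
    moreover have "b * a < 1" "c * a < 1" using par'(9,10) by (simp_all add: mult.commute)
    ultimately show "0 < 1 - b * x" "0 < 1 - c * x" by linarith+
    show "1 - d * x < 0" using dx by simp
    show "0 < 1 - y / a" "0 < 1 - y / d" using ya yd a_pos d_pos by simp_all
    show "1 - y / b < 0" "1 - y / c < 0" using y1 bc_less_1 par' by (simp_all add: pos_less_divide_eq)
    show "1 - y\<^sup>2 < 0" "1 - x\<^sup>2 < 0" using x1 y1 by (simp_all add: power2_eq_square less_1_mult)
  qed
  have nz2: "1 - a\<^sup>2 * q ^ (2 * k) \<noteq> 0" unfolding e1 using sg by linarith
  have N: "0 \<le> (1 - a * x) * ((1 - b * x) * ((1 - c * x) * (1 - d * x)))"
  proof -
    have "(1 - a * x) * ((1 - b * x) * ((1 - c * x) * (1 - d * x))) = ((1 - a * x) * (1 - d * x)) * ((1 - b * x) * (1 - c * x))" by (simp only: mult_ac)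
    moreover have "0 \<le> \<dots>"
      by (rule mult_nonneg_nonneg[OF mult_nonpos_nonpos mult_nonneg_nonneg]) (use sg in linarith)+
    ultimately show ?thesis by (simp only:)
  qed
  have D: "0 \<le> (1 - y / a) * ((1 - y / b) * ((1 - y / c) * (1 - y / d)))"
  proof -
    have "(1 - y / a) * ((1 - y / b) * ((1 - y / c) * (1 - y / d))) = ((1 - y / b) * (1 - y / c)) * ((1 - y / a) * (1 - y / d))" by (simp only: mult_ac)
    moreover have "0 \<le> \<dots>"
      by (rule mult_nonneg_nonneg[OF mult_nonpos_nonpos mult_nonneg_nonneg]) (use sg in linarith)+
    ultimately show ?thesis by (simp only:)
  qed
  have XY: "0 \<le> (1 - y\<^sup>2) / (1 - x\<^sup>2)" by (rule divide_nonpos_nonpos) (use sg in linarith)+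
  show ?case
    unfolding mass_plus_Suc[OF nz2] unfolding e1 e2
    by (rule divide_nonneg_nonneg[OF mult_nonneg_nonneg[OF mult_nonneg_nonneg[OF IH divide_nonneg_nonneg[OF N D]] XY]]) simp
qed

lemma supp_nz:
  assumes "x \<in> AW_supp q a d t"
  shows "x \<noteq> 0" "Q (qc * x / dc) \<noteq> 0" "Q (qc / (dc * x)) \<noteq> 0"
proof -
  have qd: "q / d < 1" using d_gt_q d_pos by simp
  have real: "complex_of_real y \<noteq> 0 \<and> Q (qc * complex_of_real y / dc) \<noteq> 0 \<and> Q (qc / (dc * complex_of_real y)) \<noteq> 0" if y: "y \<in> AW_S q a d t" for y
  proof -
    from y consider k where "y = a * q ^ k" "1 < y" | k where "y = d * t * q powi k" "y < - 1"
      unfolding AW_S_def AW_S_plus_def AW_S_minus_def by blast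
    then show ?thesis
    proof cases
      case 1
      have "y \<le> a" unfolding 1(1) using a_pos q_pos q_less_1 by (simp add: power_le_one)
      then have "q * y \<le> q * a" using q_pos by (intro mult_left_mono) auto
      then have "q * y < d" using qa_less_d by linarith
      then have u: "q * y / d < 1" by (rule divide_less_eq_1_pos[THEN iffD2, OF d_pos])
      have "1 * q < y * d" using 1(2) d_gt_q q_pos by (intro mult_strict_mono) auto
      then have "q < d * y" by (simp add: mult.commute)
      moreover have "0 < d * y" using d_pos 1(2) by simp
      ultimately have v: "q / (d * y) < 1" by (metis divide_less_eq_1_pos)
      have "y \<noteq> 0" using 1(2) by linarith
      then show ?thesis using Q_nz_real[OF u] Q_nz_real[OF v] by simp
    next
      case 2
      then have "y < 0" by linarith
      from Q_d_neg[OF this] this show ?thesis by simp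
    qed
  qed
  from assms consider "norm x = 1" | y where "y \<in> AW_S q a d t" "x = complex_of_real y" | y where "y \<in> AW_S q a d t" "x = inverse (complex_of_real y)"
    unfolding AW_supp_def by auto
  then have C: "x \<noteq> 0 \<and> Q (qc * x / dc) \<noteq> 0 \<and> Q (qc / (dc * x)) \<noteq> 0"
  proof cases
    case 1
    have "norm (qc * x / dc) < 1" "norm (qc / (dc * x)) < 1" using 1 qd q_pos d_pos by (simp_all add: norm_mult norm_divide)
    then show ?thesis using Q_nz 1 by auto
  next
    case 2
    show ?thesis unfolding 2(2) by (rule real[OF 2(1)])
  next
    case 3
    have e: "qc * x / dc = qc / (dc * complex_of_real y)" "qc / (dc * x) = qc * complex_of_real y / dc"
      unfolding 3(2) by (simp_all only: divide_inverse inverse_mult_distrib inverse_inverse_eq mult_ac)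
    note r = real[OF 3(1)]
    have x0: "x \<noteq> 0" unfolding 3(2) by (rule nonzero_imp_inverse_nonzero[OF conjunct1[OF r]])
    show ?thesis unfolding e by (rule conjI[OF x0 conjI[OF conjunct2[OF conjunct2[OF r]] conjunct1[OF conjunct2[OF r]]]])
  qed
  show "x \<noteq> 0" "Q (qc * x / dc) \<noteq> 0" "Q (qc / (dc * x)) \<noteq> 0"
    by (rule conjunct1[OF C], rule conjunct1[OF conjunct2[OF C]], rule conjunct2[OF conjunct2[OF C]])
qed

lemma supp_inverse:
  assumes "x \<in> AW_supp q a d t"
  shows "inverse x \<in> AW_supp q a d t"
proof -
  from assms consider "norm x = 1" | y where "y \<in> AW_S q a d t" "x = complex_of_real y" | y where "y \<in> AW_S q a d t" "x = inverse (complex_of_real y)"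
    unfolding AW_supp_def by auto
  then show ?thesis
  proof cases
    case 1
    then have "norm (inverse x) = 1" by (simp add: norm_inverse)
    then show ?thesis unfolding AW_supp_def by simp
  next
    case 2
    then show ?thesis unfolding AW_supp_def by blast
  next
    case 3
    have "inverse x = complex_of_real y" unfolding 3(2) by (rule inverse_inverse_eq)
    then show ?thesis unfolding AW_supp_def using 3(1) by blast
  qed
qed

text \<open>Points of the support are real or lie on the unit circle, where conjugation is
  inversion. Combined with the inversion symmetry and the real parameters this makes the
  eigenfunctions real on the support.\<close>

lemma supp_cnj:
  assumes "x \<in> AW_supp q a d t"
  shows "cnj x = x \<or> cnj x = 1 / x"
proof -
  from assms consider "norm x = 1" | y where "x = complex_of_real y" | y where "x = inverse (complex_of_real y)"
    unfolding AW_supp_def by auto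
  then show ?thesis
  proof cases
    case 1
    have "x * cnj x = 1" using complex_norm_square[of x] 1 by simp
    then show ?thesis by (metis nonzero_mult_div_cancel_left mult_zero_left zero_neq_one)
  qed simp_all
qed

definition phi :: "real \<Rightarrow> complex \<Rightarrow> complex" where
  "phi g = AW_phi q a b c d (complex_of_real g)"

definition cst :: "real \<Rightarrow> complex" where
  "cst g = aw_const ac bc cc dc sc (complex_of_real g)"

lemma phi_eq:
  assumes "g \<in> AW_dual_S q a b c d t" "x \<in> AW_supp q a d t"
  shows "phi g x = cst g * phi0 g x"
  using AW_phi_eq[OF assms(1) supp_nz[OF assms(2)]] unfolding phi_def cst_def .

lemma phi0_inverse: "phi0 g (inverse x) = phi0 g x"
proof -
  have i: "inverse x = 1 / x" by (rule inverse_eq_divide)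
  have e: "qc * (1 / x) / dc = qc / (dc * x)" "qc / (dc * (1 / x)) = qc * x / dc" by (simp_all add: mult.commute)
  show ?thesis unfolding awf_def i e aw8_inverse by (simp only: mult.commute)
qed

lemma cnj_Q: "cnj (Q x) = Q (cnj x)"
  by (rule cnj_qinf1[OF q_pos q_less_1])

lemma cnj_aw8:
  assumes g: "g \<in> AW_dual_S q a b c d t"
  shows "cnj (aw8 ac bc cc dc sc (complex_of_real g) x) = aw8 ac bc cc dc sc (complex_of_real g) (cnj x)"
proof -
  let ?g = "complex_of_real g"
  let ?w = "\<lambda>x. w8 (qc / (ac * dc)) (ac * x) (ac / x) (sc * ?g) (sc / ?g) (ac * bc * ?g / sc) (ac * cc * ?g / sc)"
  have sm: "summable (?w x)"
  proof -
    define R where "R = 1 + norm (qc / (ac * dc)) + norm (ac * x) + norm (ac / x) + norm (sc * ?g) + norm (sc / ?g) + norm (ac * bc * ?g / sc) + norm (ac * cc * ?g / sc)"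
    have R1: "1 \<le> R" unfolding R_def by (simp add: add_nonneg_nonneg)
    have le: "norm (qc / (ac * dc)) \<le> R" "norm (ac * x) \<le> R" "norm (ac / x) \<le> R" "norm (sc * ?g) \<le> R" "norm (sc / ?g) \<le> R" "norm (ac * bc * ?g / sc) \<le> R" "norm (ac * cc * ?g / sc) \<le> R"
      unfolding R_def using norm_ge_zero[of "qc / (ac * dc)"] norm_ge_zero[of "ac * x"] norm_ge_zero[of "ac / x"] norm_ge_zero[of "sc * ?g"] norm_ge_zero[of "sc / ?g"]
        norm_ge_zero[of "ac * bc * ?g / sc"] norm_ge_zero[of "ac * cc * ?g / sc"] by linarith+
    have e: "qc / (ac * dc) * (sc / ?g) = qc * sc / (ac * dc * ?g)" by simp
    have le8: "norm (qc / (ac * dc) * (sc / ?g)) \<le> norm (qc * sc / (ac * dc * ?g))" unfolding e by (rule order_refl)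
    show ?thesis
    proof (rule w8_bound[OF R1])
      fix K assume K: "\<And>\<alpha> e f g h C D r k. norm \<alpha> \<le> R \<Longrightarrow> norm e \<le> R \<Longrightarrow> norm f \<le> R \<Longrightarrow>
        norm g \<le> R \<Longrightarrow> norm h \<le> R \<Longrightarrow> norm C \<le> R \<Longrightarrow> norm D \<le> R \<Longrightarrow> norm (\<alpha> * h) \<le> r \<Longrightarrow>
        norm (w8 \<alpha> e f g h C D k) \<le> K * r ^ k"
      have "norm (?w x k) \<le> K * norm (qc * sc / (ac * dc * ?g)) ^ k" for k
        by (rule K[OF le le8])
      then show ?thesis by (rule summable_geo_bound[OF _ norm_ge_zero dual_S_z[OF g]])
    qed
  qed
  have e: "?w (cnj x) k = cnj (?w x k)" for k
    unfolding w8_def wcoef_def qpoch_def vwp_def by (simp add: cnj_Q split: nat.split)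
  have "(\<lambda>k. ?w (cnj x) k) sums cnj (suminf (?w x))"
    unfolding e sums_cnj by (rule summable_sums[OF sm])
  then show ?thesis unfolding aw8_def by (rule sums_unique)
qed

lemma cnj_phi:
  assumes g: "g \<in> AW_dual_S q a b c d t" and x: "x \<in> AW_supp q a d t"
  shows "cnj (phi g x) = phi g x"
proof -
  have "cnj (phi0 g x) = phi0 g (cnj x)" unfolding awf_def by (simp add: cnj_aw8[OF g] cnj_Q)
  also have "\<dots> = phi0 g x" using supp_cnj[OF x] phi0_inverse[of g x] by (auto simp: inverse_eq_divide)
  finally have "cnj (phi0 g x) = phi0 g x" .
  moreover have "cnj (cst g) = cst g" unfolding cst_def aw_const_def by (simp add: cnj_Q)
  ultimately show ?thesis unfolding phi_eq[OF assms] by simp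
qed

lemma phi_measurable:
  assumes g: "g \<in> AW_dual_S q a b c d t"
  shows "phi g \<in> borel_measurable (AW_measure q a b c d t)"
proof -
  have c: "continuous_on (AW_supp q a d t) (\<lambda>x. cst g * phi0 g x)"
  proof -
    have "aw8 ac bc cc dc sc (complex_of_real g) holomorphic_on - {0}"
      by (rule aw8_holomorphic) (use dual_S_z[OF g] nz in auto)
    then have "continuous_on (AW_supp q a d t) (aw8 ac bc cc dc sc (complex_of_real g))"
      by (rule continuous_on_subset[OF holomorphic_on_imp_continuous_on]) (use supp_nz in auto)
    then show ?thesis unfolding awf_def
      by (intro continuous_intros) (use supp_nz nz in auto)
  qed
  have "(\<lambda>x. cst g * phi0 g x) \<in> borel_measurable (AW_measure q a b c d t)"
    using borel_measurable_continuous_on_restrict[OF c] unfolding measurable_cong_sets[OF sets_AW_measure[of q a b c d t] refl] .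
  then show ?thesis
    by (rule measurable_cong[THEN iffD2, rotated]) (use phi_eq[OF g] space_AW_measure in auto)
qed


text \<open>The functional describing the measure accepts nonnegative functions only. It is applied
  to the positive and the negative part of h, that is with e = 1 and e = -1, and the two are
  recombined; \<open>ennreal\<close> cuts off the sign of e h, while weight and masses are
  nonnegative.\<close>

lemma LINT_AW:
  fixes h :: "complex \<Rightarrow> real"
  defines "M \<equiv> AW_measure q a b c d t"
  defines "w \<equiv> \<lambda>s. AW_K q a b c d t / (4 * pi) * Re (AW_weight q a b c d t (cis s))"
  defines "f1 \<equiv> \<lambda>s. indicator {0..2 * pi} s * (h (cis s) * w s)"
    and "f2 \<equiv> \<lambda>k. 2 * h (complex_of_real (a * q ^ k)) * AW_mass_plus q a b c d t k"
    and "f3 \<equiv> \<lambda>k. 2 * h (complex_of_real (d * t * q powi k)) * AW_mass_minus q a b c d t k"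
  assumes h: "h \<in> borel_measurable M" and sym: "\<And>x. x \<in> AW_supp q a d t \<Longrightarrow> h (inverse x) = h x"
    and I: "integrable lborel f1" "integrable (count_space {k. 1 < a * q ^ k}) f2" "integrable (count_space {k. d * t * q powi k < - 1}) f3"
  shows "integrable M h" "(LINT x|M. h x) = (LINT s|lborel. f1 s) + (LINT k|count_space {k. 1 < a * q ^ k}. f2 k) + (LINT k|count_space {k. d * t * q powi k < - 1}. f3 k)"
proof -
  have w0: "0 \<le> w s" for s
  proof -
    obtain r where "0 \<le> r" "AW_weight q a b c d t (cis s) = complex_of_real r"
      using AW_weight_circle[OF q_pos q_less_1, of "cis s" a b c d t] by auto
    then show ?thesis unfolding w_def using K_pos[unfolded Kc_def] by simp
  qed
  have key: "(\<integral>\<^sup>+ x. ennreal (e * h x) \<partial>M) = (\<integral>\<^sup>+ s. ennreal (e * f1 s) \<partial>lborel)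
     + (\<integral>\<^sup>+ k. ennreal (e * f2 k) \<partial>count_space {k. 1 < a * q ^ k}) + (\<integral>\<^sup>+ k. ennreal (e * f3 k) \<partial>count_space {k. d * t * q powi k < - 1})" for e :: real
  proof -
    have m: "(\<lambda>x. ennreal (e * h x)) \<in> borel_measurable (AW_measure q a b c d t)"
      using h unfolding M_def by measurable
    have two: "(ennreal u + ennreal u) * ennreal m = ennreal (2 * u * m)" if "0 \<le> m" for u m :: real
    proof -
      have "ennreal u + ennreal u = ennreal (2 * u)"
      proof (cases "0 \<le> u")
        case True
        then show ?thesis by (simp flip: ennreal_plus)
      next
        case False
        then show ?thesis by (simp add: ennreal_neg)
      qed
      then show ?thesis using that by (simp add: ennreal_mult'')
    qed
    have A: "ennreal (e * h (cis s)) * ennreal (w s) * indicator {0..2 * pi} s = ennreal (e * f1 s)" for s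
      unfolding f1_def using w0[of s] by (cases "s \<in> {0..2 * pi}") (simp_all add: ennreal_mult''[symmetric] mult.assoc)
    have B: "(ennreal (e * h (complex_of_real (a * q ^ k))) + ennreal (e * h (inverse (complex_of_real (a * q ^ k))))) * ennreal (AW_mass_plus q a b c d t k)
       = ennreal (e * f2 k)" if "1 < a * q ^ k" for k
      unfolding f2_def sym[OF AW_points_in_supp(2)[OF that]] two[OF mass_plus_nonneg[OF that]] by (simp only: mult_ac)
    have C: "(ennreal (e * h (complex_of_real (d * t * q powi k))) + ennreal (e * h (inverse (complex_of_real (d * t * q powi k))))) * ennreal (AW_mass_minus q a b c d t k)
       = ennreal (e * f3 k)" if "d * t * q powi k < - 1" for k
      unfolding f3_def sym[OF AW_points_in_supp(4)[OF that]] two[OF mass_minus_nonneg[OF that]] by (simp only: mult_ac)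
    show ?thesis
      unfolding M_def nn_integral_AW_measure[OF q_pos q_less_1 m] AW_functional_def
      by (intro arg_cong2[of _ _ _ _ "(+)"] nn_integral_cong) (simp_all only: A[unfolded w_def] B C space_count_space mem_Collect_eq)
  qed
  note kp = key[of 1, simplified mult_1] and kn = key[of "- 1", simplified mult_minus1]
  note J = I[unfolded real_integrable_def]
  show int: "integrable M h"
    unfolding real_integrable_def kp kn using h J by simp
  show "(LINT x|M. h x) = (LINT s|lborel. f1 s) + (LINT k|count_space {k. 1 < a * q ^ k}. f2 k) + (LINT k|count_space {k. d * t * q powi k < - 1}. f3 k)"
    unfolding real_lebesgue_integral_def[OF int] real_lebesgue_integral_def[OF I(1)] real_lebesgue_integral_def[OF I(2)] real_lebesgue_integral_def[OF I(3)] kp kn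
    using J by (simp add: enn2real_plus less_top)
qed

end

section \<open>Integrability and vanishing of the integral for a pair of eigenfunctions\<close>

context awsetup
begin

lemma V_circle:
  shows "(\<lambda>s. V (cis s)) integrable_on {0..2 * pi}" "\<exists>B. \<forall>s. norm (V (cis s)) \<le> B"
proof -
  obtain g where g: "g holomorphic_on {z. 1 / s0 < norm z \<and> norm z < s0}" "\<And>z. 1 / s0 < norm z \<Longrightarrow> norm z < s0 \<Longrightarrow> z\<^sup>2 \<noteq> 1 \<Longrightarrow> g z = V z"
    using V_extension by blast
  have s1: "1 / s0 < 1" using s0(1) by simp
  have cont: "continuous_on (sphere 0 1) g"
    by (rule continuous_on_subset[OF holomorphic_on_imp_continuous_on[OF g(1)]]) (use s1 s0(1) in auto)
  have "continuous_on {0..2 * pi} (\<lambda>s. g (cis s))"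
    by (rule continuous_on_compose2[OF cont]) (auto intro!: continuous_intros)
  then have gi: "(\<lambda>s. g (cis s)) integrable_on {0..2 * pi}" by (rule integrable_continuous_interval)
  have neg: "negligible (range (\<lambda>i :: int. of_int i * pi))"
  proof -
    have "negligible (\<Union> (range (\<lambda>i :: int. {of_int i * pi})))" by (rule negligible_countable_Union) auto
    moreover have "\<Union> (range (\<lambda>i :: int. {of_int i * pi})) = range (\<lambda>i :: int. of_int i * pi)" by auto
    ultimately show ?thesis by simp
  qed
  show "(\<lambda>s. V (cis s)) integrable_on {0..2 * pi}"
  proof (rule integrable_spike[OF gi neg])
    fix s assume s: "s \<in> {0..2 * pi} - range (\<lambda>i :: int. of_int i * pi)"
    have "(cis s)\<^sup>2 \<noteq> 1"
    proof
      assume "(cis s)\<^sup>2 = 1"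
      then have "cis s = 1 \<or> cis s = - 1" by (simp add: power2_eq_1_iff)
      then have "sin s = 0" by (auto simp: complex_eq_iff)
      then show False using s unfolding sin_zero_iff_int2 by auto
    qed
    then show "V (cis s) = g (cis s)" using g(2)[of "cis s"] s0(1) by simp
  qed
  have "bounded (g ` sphere 0 1)" by (intro compact_imp_bounded compact_continuous_image cont) simp
  then obtain B where B: "\<And>z. z \<in> sphere 0 1 \<Longrightarrow> norm (g z) \<le> B" unfolding bounded_iff by blast
  have "norm (V (cis s)) \<le> \<bar>B\<bar>" for s
  proof (cases "(cis s)\<^sup>2 = 1")
    case True
    \<comment> \<open>At x^2 = 1 the numerator contains \<open>Q 1\<close> = 0, so V is 0 there
      whatever its denominator is.\<close>
    then show ?thesis unfolding V_def Om_def by simp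
  next
    case False
    then have "V (cis s) = g (cis s)" using g(2)[of "cis s"] s0(1) by simp
    moreover have "norm (g (cis s)) \<le> B" by (rule B) simp
    ultimately show ?thesis by simp
  qed
  then show "\<exists>B. \<forall>s. norm (V (cis s)) \<le> B" by blast
qed

text \<open>A real-valued function that agrees with the product of the two eigenfunctions on the
  support, so that the splitting into positive and negative parts applies.\<close>

definition hh :: "complex \<Rightarrow> real" where "hh x = Re (phi \<gamma> x * phi \<gamma>' x)"

lemma phi_phi:
  "x \<in> AW_supp q a d t \<Longrightarrow> phi \<gamma> x * phi \<gamma>' x = complex_of_real (hh x)"
  unfolding hh_def using cnj_phi[OF gam(1)] cnj_phi[OF gam(2)] by (simp add: complex_eq_iff)

lemma phi_phi0: "x \<in> AW_supp q a d t \<Longrightarrow> complex_of_real (hh x) = cst \<gamma> * cst \<gamma>' * (phi0 \<gamma> x * phi0 \<gamma>' x)"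
  by (simp add: phi_phi[symmetric] phi_eq[OF gam(1)] phi_eq[OF gam(2)] mult_ac)

text \<open>Integrability is a statement about any two indices, also equal ones; that case yields
  square integrability. The vanishing is \<open>circle_identity\<close> multiplied by the two
  normalising constants.\<close>

lemma pair_integral:
  shows "integrable (AW_measure q a b c d t) hh" "del \<noteq> 0 \<Longrightarrow> (LINT x|AW_measure q a b c d t. hh x) = 0"
proof -
  let ?M = "AW_measure q a b c d t"
  let ?w = "\<lambda>s. AW_K q a b c d t / (4 * pi) * Re (AW_weight q a b c d t (cis s))"
  define CC where "CC = cst \<gamma> * cst \<gamma>'"
  define C1 where "C1 = CC * complex_of_real (Kc / (4 * pi))"
  have h: "hh \<in> borel_measurable ?M"
    using phi_measurable[OF gam(1)] phi_measurable[OF gam(2)] unfolding hh_def[abs_def] by measurable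
  have sym: "hh (inverse x) = hh x" if "x \<in> AW_supp q a d t" for x
    unfolding hh_def using that by (simp add: phi_eq[OF gam(1)] phi_eq[OF gam(2)] supp_inverse phi0_inverse)
  have circ: "hh (cis s) * ?w s = Re (C1 * V (cis s))" for s
  proof -
    let ?x = "cis s"
    have xs: "?x \<in> AW_supp q a d t" by (rule AW_points_in_supp(1))
    obtain r where r: "AW_weight q a b c d t ?x = complex_of_real r"
      using AW_weight_circle[OF q_pos q_less_1, of ?x a b c d t] by auto
    have Qn: "Qd ?x \<noteq> 0" unfolding Qd_def using supp_nz[OF xs] by simp
    have "complex_of_real (hh ?x) * AW_weight q a b c d t ?x = CC * V ?x"
      unfolding phi_phi0[OF xs] AW_weight_eq phi0_FF V_def CC_def using Qn by (simp add: power2_eq_square mult_ac)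
    then have "complex_of_real (hh ?x * r) = CC * V ?x" unfolding r by simp
    then have e: "C1 * V ?x = complex_of_real (hh ?x * r) * complex_of_real (Kc / (4 * pi))" unfolding C1_def by (simp add: mult_ac)
    show ?thesis unfolding e r Kc_def[symmetric] by simp
  qed
  obtain B where B: "\<And>s. norm (V (cis s)) \<le> B" using V_circle(2) by blast
  have wm: "(\<lambda>s. hh (cis s) * ?w s) \<in> borel_measurable lborel"
  proof -
    have [measurable]: "cis \<in> borel_measurable borel"
      by (intro borel_measurable_continuous_onI continuous_intros)
    have h': "hh \<in> borel_measurable (restrict_space borel (AW_supp q a d t))"
      using h unfolding measurable_cong_sets[OF sets_AW_measure[of q a b c d t] refl] .
    note [measurable] = AW_weight_measurable[OF q_pos q_less_1, of a b c d t] measurable_compose[OF cis_measurable_supp[OF q_pos q_less_1] h']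
    show ?thesis by measurable
  qed
  have I1': "integrable lborel (\<lambda>s. indicator {0..2 * pi} s *\<^sub>R (hh (cis s) * ?w s))"
  proof (rule integrableI_bounded_set_indicator[where B = "norm C1 * B"])
    show "AE s in lborel. s \<in> {0..2 * pi} \<longrightarrow> norm (hh (cis s) * ?w s) \<le> norm C1 * B"
    proof (intro AE_I2 impI)
      fix s
      have "norm (Re (C1 * V (cis s))) \<le> norm (C1 * V (cis s))" unfolding real_norm_def by (rule abs_Re_le_cmod)
      also have "\<dots> \<le> norm C1 * B" unfolding norm_mult using B by (intro mult_left_mono) auto
      finally show "norm (hh (cis s) * ?w s) \<le> norm C1 * B" unfolding circ .
    qed
  qed (use wm in auto)
  then have I1: "integrable lborel (\<lambda>s. indicator {0..2 * pi} s * (hh (cis s) * ?w s))" by simp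
  have fin: "finite {k. 1 < a * q ^ k}"
    by (cases "1 < a") (simp_all add: index_plus index_plus_empty)
  have I2: "integrable (count_space {k. 1 < a * q ^ k}) (\<lambda>k. 2 * hh (xp k) * AW_mass_plus q a b c d t k)"
    by (rule integrable_count_space[OF fin])
  \<comment> \<open>The negative lattice is counted outwards, j = 0 being the point nearest to the
    unit circle.\<close>
  have bij: "bij_betw (\<lambda>j. km - int j) UNIV {k. d * t * q powi k < - 1}"
    unfolding index_minus by (rule bij_betwI[where g = "\<lambda>k. nat (km - k)"]) auto
  have xms: "xm (km - int j) \<in> AW_supp q a d t" for j
  proof (rule AW_points_in_supp(4))
    have "km - int j \<in> {k. d * t * q powi k < - 1}" unfolding index_minus by simp
    then show "d * t * q powi (km - int j) < - 1" by simp
  qed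
  have f3: "complex_of_real (2 * hh (xm (km - int j)) * AW_mass_minus q a b c d t (km - int j)) = CC * (2 * termm (km - int j))" for j
  proof -
    have "complex_of_real (2 * u * m) = 2 * complex_of_real u * complex_of_real m" for u m by simp
    from this[of "hh (xm (km - int j))" "AW_mass_minus q a b c d t (km - int j)"]
    show ?thesis unfolding phi_phi0[OF xms] CC_def by (rule trans) (simp only: mult_ac)
  qed
  have I3': "summable (\<lambda>j. norm (2 * hh (xm (km - int j)) * AW_mass_minus q a b c d t (km - int j)))"
  proof -
    have wk: "\<exists>C \<theta>. 0 \<le> \<theta> \<and> \<theta> < 1 \<and> (\<forall>N. norm (complex_of_real (2 * AW_mass_minus q a b c d t (km - int N) / Kc)) * (norm (phi0 \<gamma> (xm (km - int N))) * norm (phi0 \<gamma>' (xm (km - int N)))) \<le> C * \<theta> ^ N)"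
      by (rule exE[OF mass_phi_bound], erule exE, (erule conjE)+, rule exI, rule exI, rule conjI, assumption, rule conjI, assumption, assumption)
    obtain C \<theta> where ex: "0 \<le> \<theta> \<and> \<theta> < 1 \<and> (\<forall>N. norm (complex_of_real (2 * AW_mass_minus q a b c d t (km - int N) / Kc)) * (norm (phi0 \<gamma> (xm (km - int N))) * norm (phi0 \<gamma>' (xm (km - int N)))) \<le> C * \<theta> ^ N)"
      by (rule exE[OF wk], erule exE, rule that)
    have "norm (norm (2 * hh (xm (km - int j)) * AW_mass_minus q a b c d t (km - int j))) \<le> norm CC * Kc * C * \<theta> ^ j" for j
    proof -
      have K: "0 < Kc" by (rule K_pos)
      let ?m = "AW_mass_minus q a b c d t (km - int j)" and ?p = "norm (phi0 \<gamma> (xm (km - int j))) * norm (phi0 \<gamma>' (xm (km - int j)))"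
      have "norm (2 * hh (xm (km - int j)) * ?m) = norm (complex_of_real (2 * hh (xm (km - int j)) * ?m))" by (simp only: norm_of_real real_norm_def)
      also have "\<dots> = norm CC * (2 * (\<bar>?m\<bar> * ?p))" unfolding f3 by (simp add: norm_mult mult.assoc)
      also have "2 * (\<bar>?m\<bar> * ?p) = Kc * (norm (complex_of_real (2 * ?m / Kc)) * ?p)" using K by (simp only: norm_of_real) (simp add: abs_mult)
      also have "\<dots> \<le> Kc * (C * \<theta> ^ j)" using ex K by (intro mult_left_mono) auto
      finally show ?thesis by (simp add: mult_left_mono mult.assoc)
    qed
    then show ?thesis by (rule summable_geo_bound) (use ex in auto)
  qed
  have I3n: "integrable (count_space UNIV) (\<lambda>j. 2 * hh (xm (km - int j)) * AW_mass_minus q a b c d t (km - int j))"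
    unfolding integrable_count_space_nat_iff by (rule I3')
  have I3: "integrable (count_space {k. d * t * q powi k < - 1}) (\<lambda>k. 2 * hh (xm k) * AW_mass_minus q a b c d t k)"
    using I3n unfolding integrable_bij_count_space[OF bij, of "\<lambda>k. 2 * hh (xm k) * AW_mass_minus q a b c d t k", symmetric] .
  note L = LINT_AW[OF h sym I1 I2 I3]
  show "integrable ?M hh" by (rule L(1))
  assume del: "del \<noteq> 0"
  obtain SM where SM: "(\<lambda>N. termm (km - int N)) sums SM"
    "complex_of_real (Kc / (4 * pi)) * circle_int V 1 + 2 * (\<Sum>k | 1 < a * q ^ k. termp k) + 2 * SM = 0"
    using circle_identity[OF del] by blast
  have T1: "(LINT s|lborel. indicator {0..2 * pi} s * (hh (cis s) * ?w s)) = Re (C1 * circle_int V 1)"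
  proof -
    have "set_integrable lborel {0..2 * pi} (\<lambda>s. hh (cis s) * ?w s)" unfolding set_integrable_def by (rule I1')
    from set_borel_integral_eq_integral(2)[OF this]
    have "(LINT s|lborel. indicator {0..2 * pi} s * (hh (cis s) * ?w s)) = integral {0..2 * pi} (\<lambda>s. Re (C1 * V (cis s)))"
      unfolding set_lebesgue_integral_def circ by simp
    also have "\<dots> = Re (C1 * integral {0..2 * pi} (\<lambda>s. V (cis s)))"
      using integral_linear[OF V_circle(1) bounded_linear_compose[OF bounded_linear_Re bounded_linear_mult_right[of C1]]] by (simp add: o_def)
    also have "\<dots> = Re (C1 * circle_int V 1)" unfolding circle_int_def by simp
    finally show ?thesis .
  qed
  have T2: "(LINT k|count_space {k. 1 < a * q ^ k}. 2 * hh (xp k) * AW_mass_plus q a b c d t k) = Re (CC * (2 * (\<Sum>k | 1 < a * q ^ k. termp k)))"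
  proof -
    have "complex_of_real (2 * hh (xp k) * AW_mass_plus q a b c d t k) = CC * (2 * termp k)" if "1 < a * q ^ k" for k
      by (simp only: of_real_mult phi_phi0[OF AW_points_in_supp(2)[OF that], unfolded of_real_mult] CC_def) (simp add: mult_ac)
    then have "complex_of_real (\<Sum>k | 1 < a * q ^ k. 2 * hh (xp k) * AW_mass_plus q a b c d t k) = (\<Sum>k | 1 < a * q ^ k. CC * (2 * termp k))"
      unfolding of_real_sum by (intro sum.cong) auto
    also have "\<dots> = CC * (2 * (\<Sum>k | 1 < a * q ^ k. termp k))" by (simp add: sum_distrib_left)
    finally show ?thesis unfolding lebesgue_integral_count_space_finite[OF fin] by (metis Re_complex_of_real)
  qed
  have T3: "(LINT k|count_space {k. d * t * q powi k < - 1}. 2 * hh (xm k) * AW_mass_minus q a b c d t k) = Re (CC * (2 * SM))"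
  proof -
    have "(\<lambda>j. CC * (2 * termm (km - int j))) sums (CC * (2 * SM))" by (intro sums_mult SM(1))
    then have "(\<lambda>j. complex_of_real (2 * hh (xm (km - int j)) * AW_mass_minus q a b c d t (km - int j))) sums (CC * (2 * SM))" unfolding f3 .
    from sums_Re[OF this] have "(\<lambda>j. 2 * hh (xm (km - int j)) * AW_mass_minus q a b c d t (km - int j)) sums Re (CC * (2 * SM))" by (simp only: Re_complex_of_real)
    then show ?thesis
      unfolding integral_bij_count_space[OF bij, of "\<lambda>k. 2 * hh (xm k) * AW_mass_minus q a b c d t k", symmetric] integral_count_space_nat[OF I3n]
      by (rule sums_unique[symmetric])
  qed
  have L2: "(LINT x|?M. hh x) = (LINT s|lborel. indicator {0..2 * pi} s * (hh (cis s) * ?w s))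
     + (LINT k|count_space {k. 1 < a * q ^ k}. 2 * hh (xp k) * AW_mass_plus q a b c d t k)
     + (LINT k|count_space {k. d * t * q powi k < - 1}. 2 * hh (xm k) * AW_mass_minus q a b c d t k)"
    by (rule L(2))
  have "(LINT x|?M. hh x) = Re (CC * (complex_of_real (Kc / (4 * pi)) * circle_int V 1 + 2 * (\<Sum>k | 1 < a * q ^ k. termp k) + 2 * SM))"
    unfolding L2 T1 T2 T3 by (simp only: C1_def distrib_left mult.assoc plus_complex.sel)
  then show "(LINT x|?M. hh x) = 0" unfolding SM(2) by simp
qed

end

section \<open>Choice of the radii and conclusion\<close>

context awp
begin

lemma ex_setup:
  assumes g: "g \<in> AW_dual_S q a b c d t" "g' \<in> AW_dual_S q a b c d t"
  shows "\<exists>yp ym s0 kp km. awsetup q a b c d t g g' yp ym s0 kp km"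
proof -
  obtain km where km: "1 < - (d * t) * q powi km" "- (d * t) * q powi km \<le> 1 / q"
    using ex_powi_between[of "- (d * t)"] d_neg(1) by auto
  obtain kp where kp: "1 < a * q powi kp" "a * q powi kp \<le> 1 / q"
    using ex_powi_between[OF a_pos] by blast
  define ym where "ym = d * t * q powi km"
  define yp where "yp = a * q powi kp"
  define yn where "yn = - ym"
  \<comment> \<open>One entry greater than 1 for each bound that s0 has to satisfy; the value 2
    stands in where a conditional bound does not apply.\<close>
  define A where "A = {d / q, 1 / b, 1 / c, sqrt (1 / q), (if a < 1 then 1 / a else 2), yp, (if q * yp < 1 then 1 / (q * yp) else 2), yn, (if q * yn < 1 then 1 / (q * yn) else 2)}"
  have ym1: "1 < - ym" "- ym \<le> 1 / q" and yp1: "1 < yp" "yp \<le> 1 / q" using km kp unfolding ym_def yp_def by simp_all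
  have yn1: "1 < yn" "yn \<le> 1 / q" using ym1 unfolding yn_def by simp_all
  have A1: "\<forall>x\<in>A. 1 < x"
  proof -
    have "1 < d / q" "1 < 1 / b" "1 < 1 / c" "1 < sqrt (1 / q)"
      using d_gt_q bc_less_1 par' q_pos q_less_1 by simp_all
    moreover have "1 < 1 / u" if "u < 1" "0 < u" for u :: real using that by simp
    moreover have "0 < q * yp" "0 < q * yn" using yp1 yn1 q_pos by simp_all
    ultimately show ?thesis unfolding A_def using a_pos yp1 yn1 by auto
  qed
  define s0 where "s0 = Min A"
  have fA: "finite A" "A \<noteq> {}" unfolding A_def by auto
  have s01: "1 < s0" unfolding s0_def using A1 Min_in[OF fA] by blast
  have le: "s0 \<le> x" if "x \<in> A" for x unfolding s0_def using Min_le[OF fA(1) that] .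
  have l: "s0 \<le> d / q" "s0 \<le> 1 / b" "s0 \<le> 1 / c" "s0 \<le> sqrt (1 / q)" "s0 \<le> (if a < 1 then 1 / a else 2)" "s0 \<le> yp"
    "s0 \<le> (if q * yp < 1 then 1 / (q * yp) else 2)" "s0 \<le> yn" "s0 \<le> (if q * yn < 1 then 1 / (q * yn) else 2)"
    by (rule le, simp add: A_def)+
  have "s0 * s0 \<le> sqrt (1 / q) * sqrt (1 / q)" by (intro mult_mono) (use l(4) s01 q_pos in auto)
  then have sq: "s0 * s0 \<le> 1 / q" using q_pos by simp
  have "awsetup q a b c d t g g' yp ym s0 kp km"
  proof unfold_locales
    show "a < 1 \<Longrightarrow> s0 \<le> 1 / a" using l(5) by simp
    show "q * yp < 1 \<Longrightarrow> s0 \<le> 1 / (q * yp)" using l(7) by simp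
    show "q * (- ym) < 1 \<Longrightarrow> s0 \<le> 1 / (q * (- ym))" using l(9) unfolding yn_def by simp
    show "ym = d * t * q powi km" "yp = a * q powi kp" by (fact ym_def yp_def)+
  qed (use g l(1-3,6) l(8)[unfolded yn_def] sq s01 ym1 yp1 in linarith | use g in simp)+
  then show ?thesis by blast
qed

lemma pair_result:
  assumes g: "g \<in> AW_dual_S q a b c d t" "g' \<in> AW_dual_S q a b c d t"
  shows "integrable (AW_measure q a b c d t) (\<lambda>x. Re (phi g x * phi g' x))"
    "g \<noteq> g' \<Longrightarrow> (LINT x|AW_measure q a b c d t. Re (phi g x * phi g' x)) = 0"
proof -
  obtain yp ym s0 kp km where "awsetup q a b c d t g g' yp ym s0 kp km" using ex_setup[OF g] by blast
  then interpret S: awsetup q a b c d t g g' yp ym s0 kp km .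
  show "integrable (AW_measure q a b c d t) (\<lambda>x. Re (phi g x * phi g' x))"
    using S.pair_integral(1) unfolding S.hh_def[abs_def] .
  assume ne: "g \<noteq> g'"
  \<comment> \<open>The eigenvalue is an affine function of \<gamma> + 1/\<gamma>, and this
    expression is injective on |\<gamma>| > 1: two distinct arguments with the same value have
    product 1.\<close>
  have "S.del \<noteq> 0"
  proof
    assume "S.del = 0"
    then have "S.Lam g = S.Lam g'" unfolding S.del_def by (rule right_minus_eq[THEN iffD1])
    moreover have "u = u'" if "u - 1 - v = u' - 1 - v" for u u' v :: complex using that by simp
    ultimately have "sc * complex_of_real g + sc / complex_of_real g = sc * complex_of_real g' + sc / complex_of_real g'"
      unfolding S.Lam_def by blast
    then have "complex_of_real (s * g + s / g) = complex_of_real (s * g' + s / g')"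
      unfolding of_real_add of_real_mult of_real_divide .
    then have "s * (g + 1 / g) = s * (g' + 1 / g')" unfolding of_real_eq_iff by (simp add: distrib_left)
    then have e: "g + 1 / g = g' + 1 / g'" using s_pos by simp
    have g1: "1 < \<bar>g\<bar>" "1 < \<bar>g'\<bar>" using dual_S_abs g by auto
    then have g0: "g \<noteq> 0" "g' \<noteq> 0" by auto
    have "(g - g') * (g * g' - 1) = 0" using e g0 by (simp add: field_simps)
    then have "g * g' = 1" using ne by simp
    then have "\<bar>g\<bar> * \<bar>g'\<bar> = 1" by (simp flip: abs_mult)
    then show False using less_1_mult[OF g1] by simp
  qed
  from S.pair_integral(2)[OF this] show "(LINT x|AW_measure q a b c d t. Re (phi g x * phi g' x)) = 0"
    unfolding S.hh_def[abs_def] .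
qed

text \<open>On the support the eigenfunction is real, so the square of its modulus is the product
  for a pair of equal indices.\<close>

lemma phi_Hilbert:
  assumes g: "g \<in> AW_dual_S q a b c d t"
  shows "phi g \<in> AW_Hilbert q a b c d t"
proof -
  have sq: "(cmod (phi g x))\<^sup>2 = Re (phi g x * phi g x)" if "x \<in> AW_supp q a d t" for x
  proof -
    have "phi g x * phi g x = phi g x * cnj (phi g x)" using cnj_phi[OF g that] by simp
    then show ?thesis by (simp add: complex_norm_square[symmetric] del: of_real_power)
  qed
  have "integrable (AW_measure q a b c d t) (\<lambda>x. (cmod (phi g x))\<^sup>2)"
    by (rule Bochner_Integration.integrable_cong[OF refl, THEN iffD2, OF _ pair_result(1)[OF g g]])
       (use sq space_AW_measure in auto)
  moreover have "AE x in AW_measure q a b c d t. phi g x = phi g (inverse x)"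
    by (rule AE_I2) (use space_AW_measure in \<open>simp add: phi_eq[OF g] supp_inverse phi0_inverse\<close>)
  ultimately show ?thesis unfolding AW_Hilbert_def using phi_measurable[OF g] by simp
qed

lemma phi_orthogonal:
  assumes g: "g \<in> AW_dual_S q a b c d t" "g' \<in> AW_dual_S q a b c d t" "g \<noteq> g'"
  shows "(LINT x|AW_measure q a b c d t. phi g x * cnj (phi g' x)) = 0"
proof -
  have "phi g x * cnj (phi g' x) = complex_of_real (Re (phi g x * phi g' x))" if "x \<in> AW_supp q a d t" for x
    using cnj_phi[OF g(1) that] cnj_phi[OF g(2) that] by (simp add: complex_eq_iff)
  then have "(LINT x|AW_measure q a b c d t. phi g x * cnj (phi g' x)) = (LINT x|AW_measure q a b c d t. complex_of_real (Re (phi g x * phi g' x)))"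
    by (intro Bochner_Integration.integral_cong[OF refl]) (simp add: space_AW_measure)
  then show ?thesis by (simp only: integral_complex_of_real pair_result(2)[OF g] of_real_0)
qed

end

theorem lemma3:
  fixes q a b c d t :: real
  assumes "0 < q" "q < 1"
    and "(a, b, c, d, t) \<in> AW_params q"
  shows "(\<forall>\<gamma>\<in>AW_dual_S q a b c d t.
            AW_phi q a b c d (complex_of_real \<gamma>) \<in> AW_Hilbert q a b c d t) \<and>
         (\<forall>\<gamma>\<in>AW_dual_S q a b c d t. \<forall>\<gamma>'\<in>AW_dual_S q a b c d t. \<gamma> \<noteq> \<gamma>' \<longrightarrow>
            (LINT x|AW_measure q a b c d t.
               AW_phi q a b c d (complex_of_real \<gamma>) x
               * cnj (AW_phi q a b c d (complex_of_real \<gamma>') x)) = 0)"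
proof -
  interpret awp q a b c d t by unfold_locales (use assms in auto)
  show ?thesis using phi_Hilbert phi_orthogonal unfolding phi_def by blast
qed

end
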